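(* Let $\tau$ be the twisted full toroidal Lie algebra described in the context, let $V$ be an irreducible $\tau$-module in the category $\mathcal{B}_\psi$ such that $K_0$ acts on $V$ by a non-zero scalar $C_0$, and let $S=\{v\in V:\tau_+v=0\}$ and $T=\{v\in V:\tau^{+}v=0\}$. Let $W_1$ (a finite dimensional irreducible $\mathfrak{gl}_n$-module), $W_2=\bigoplus_{\overline{k}\in\Lambda}W_{2,\overline{k}}$ (a finite dimensional $\Lambda$-graded irreducible $\overset{\circ}{\mathfrak{g}}$-module), $\underline{\alpha}\in\mathbb{C}^n$ and $d\in\mathbb{C}$ be data such that $T\cong T'$ as $\tau^0$-modules, where $T'=\bigoplus_{\underline{k}\in\mathbb{Z}^n}W_1\otimes W_{2,\overline{k}}\otimes\mathbb{C}t^{\underline{k}}$ is the $\tau^0$-module defined in the context from these data. Let $S'=\bigoplus_{\underline{k}\in\mathbb{Z}^n}W_1\otimes W_2(\sigma_0)_{\overline{k}}\otimes\mathbb{C}t^{\underline{k}}$ be the $\tau_0$-module defined in the context. Then $S\cong S'$ as $\tau_0$-modules.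
   Context: Everything is over $\mathbb{C}$. The algebra $\tau$. Let $\mathfrak{g}$ be a finite dimensional simple Lie algebra with a non-degenerate invariant symmetric bilinear form $(\cdot,\cdot)$; fix $n\ge 1$ and commuting automorphisms $\sigma_0,\dots,\sigma_n$ of $\mathfrak{g}$ of finite orders $m_0,\dots,m_n$. Put $\underline{m}=(m_1,\dots,m_n)$, $\Gamma=m_1\mathbb{Z}\oplus\cdots\oplus m_n\mathbb{Z}$, $\Gamma_0=m_0\mathbb{Z}$, $\Lambda=\mathbb{Z}^n/\Gamma$, $\Lambda_0=\mathbb{Z}/\Gamma_0$; bars denote images in $\Lambda$ or $\Lambda_0$. For $\underline{k}=(k_1,\dots,k_n)\in\mathbb{Z}^n$ write $t^{\underline{k}}=t_1^{k_1}\cdots t_n^{k_n}$. Let $\xi_i$ be a primitive $m_i$-th root of unity, and $\mathfrak{g}(\overline{k_0},\overline{k})=\{x\in\mathfrak{g}:\sigma_i x=\xi_i^{k_i}x,\ 0\le i\le n\}$. The multiloop algebra is $L(\mathfrak{g},\sigma)=\bigoplus_{(k_0,\underline{k})\in\mathbb{Z}^{n+1}}\mathfrak{g}(\overline{k_0},\overline{k})\otimes\mathbb{C}t_0^{k_0}t^{\underline{k}}$. Let $A(\underline{m})=\mathbb{C}[t_1^{\pm m_1},\dots,t_n^{\pm m_n}]$ and $A(m_0,\underline{m})=\mathbb{C}[t_0^{\pm m_0},\dots,t_n^{\pm m_n}]$. Let $Z(m_0,\underline{m})$ be the space spanned by symbols $t_0^{r_0}t^{\underline{r}}K_i$ ($r_0\in\Gamma_0$,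 $\underline{r}\in\Gamma$, $0\le i\le n$) modulo the relations $\sum_{i=0}^n r_i t_0^{r_0}t^{\underline{r}}K_i=0$. Let $D(m_0,\underline{m})$ be the derivation algebra of $A(m_0,\underline{m})$, with basis $t_0^{r_0}t^{\underline{r}}d_i$, $d_i=t_i\frac{d}{dt_i}$ ($r_0\in\Gamma_0$, $\underline{r}\in\Gamma$, $0\le i\le n$). The twisted full toroidal Lie algebra is $\tau=L(\mathfrak{g},\sigma)\oplus Z(m_0,\underline{m})\oplus D(m_0,\underline{m})$ with brackets, for $X(k_0,\underline{k})=X\otimes t_0^{k_0}t^{\underline{k}}$ and $r_0,s_0\in\Gamma_0$, $\underline{r},\underline{s}\in\Gamma$, $0\le a,b\le n$: $[X(k_0,\underline{k}),Y(l_0,\underline{l})]=[X,Y](k_0+l_0,\underline{k}+\underline{l})+(X,Y)\sum_{i=0}^n k_i t_0^{k_0+l_0}t^{\underline{k}+\underline{l}}K_i$; $[L(\mathfrak{g},\sigma)\oplus Z(m_0,\underline{m}),Z(m_0,\underline{m})]=0$; $[t_0^{r_0}t^{\underline{r}}d_a,X(k_0,\underline{k})]=k_aX(k_0+r_0,\underline{k}+\underline{r})$; $[t_0^{r_0}t^{\underline{r}}d_a,t_0^{s_0}t^{\underline{s}}K_b]=s_at_0^{r_0+s_0}t^{\underline{r}+\underline{s}}K_b+\delta_{ab}\sum_{p=0}^n r_pt_0^{r_0+s_0}t^{\underline{r}+\underline{s}}K_p$; $[t_0^{r_0}t^{\underline{r}}d_a,t_0^{s_0}t^{\underline{s}}d_b]=s_at_0^{r_0+s_0}t^{\underline{r}+\underline{s}}d_b-r_bt_0^{r_0+s_0}t^{\underline{r}+\underline{s}}d_a+\phi(t_0^{r_0}t^{\underline{r}}d_a,t_0^{s_0}t^{\underline{s}}d_b)$,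 where $\phi$ is a fixed arbitrary linear combination of the cocycles $\phi_1(t_0^{r_0}t^{\underline{r}}d_a,t_0^{s_0}t^{\underline{s}}d_b)=-s_ar_b\sum_{p=0}^n r_pt_0^{r_0+s_0}t^{\underline{r}+\underline{s}}K_p$ and $\phi_2(t_0^{r_0}t^{\underline{r}}d_a,t_0^{s_0}t^{\underline{s}}d_b)=r_as_b\sum_{p=0}^n r_pt_0^{r_0+s_0}t^{\underline{r}+\underline{s}}K_p$. The centre $Z(\tau)$ is spanned by $K_0,\dots,K_n$. Standing assumptions. (i) $\mathfrak{g}(\overline{0},\overline{0})$ is a simple Lie algebra. (ii) Cartan subalgebras $\mathfrak{h}(\overline{0})$ of $\mathfrak{g}(\overline{0},\overline{0})$ and $\mathfrak{h}$ of $\mathfrak{g}$ are chosen with $\mathfrak{h}(\overline{0})\subseteq\mathfrak{h}$. (iii) Let $\Delta_0^\times$ be the set of non-zero roots of $\mathfrak{g}(\overline{0},\overline{0})$ with respect to $\mathfrak{h}(\overline{0})$ and $\Delta_{0,sh}^\times$ its short roots; let $\Delta_{0,en}^\times=\Delta_0^\times\cup 2\Delta_{0,sh}^\times$ if $\Delta_0^\times$ is of type $B_l$, and $\Delta_{0,en}^\times=\Delta_0^\times$ otherwise; $\Delta_{0,en}=\Delta_{0,en}^\times\cup\{0\}$. It is assumed that the set of weights (including $0$) of $\mathfrak{h}(\overline{0})$ on $\mathfrak{g}$ equals $\Delta_{0,en}$. Fix a choice of positive roots in $\Delta_{0,en}$. Write $\mathfrak{g}(\overline{k_0},\overline{k},\alpha)$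 for the $\alpha$-weight space of $\mathfrak{h}(\overline{0})$ in $\mathfrak{g}(\overline{k_0},\overline{k})$. Triangular decompositions. (a) $\tau_q=\{X\in\tau:[d_0,X]=qX\}$, $\tau_\pm=\bigoplus_{\pm q>0}\tau_q$, so $\tau=\tau_-\oplus\tau_0\oplus\tau_+$, where $\tau_0$ is the $q=0$ part. (b) $\tau_0=\tau_0(-)\oplus\tau^0\oplus\tau_0(+)$, with $\tau_0(\pm)=\bigoplus_{\pm\alpha>0,\ \underline{k}\in\mathbb{Z}^n}\mathfrak{g}(\overline{0},\overline{k},\alpha)\otimes\mathbb{C}t^{\underline{k}}$ and $\tau^0$ the $\mathfrak{h}(\overline{0})$-weight $0$ part of $\tau_0$. (c) $\tau=\tau^-\oplus\tau^0\oplus\tau^+$, with $\tau^{\pm}$ the sum of root spaces for roots $\alpha+k_0\delta_0+\delta_{\underline{k}}$ (i.e. $\mathfrak{h}(\overline{0})$-weight $\alpha$, $d_0$-weight $k_0$, $(d_1,\dots,d_n)$-weight $\underline{k}$) with $\pm(\alpha+k_0\delta_0)>0$ in the affine root system $\{\alpha+k_0\delta_0\}$ (positive means $k_0>0$, or $k_0=0$ and $\alpha>0$); thus $\tau^\pm=\tau_\pm\oplus\tau_0(\pm)$. Category $\mathcal{B}_\psi$. For a linear map $\psi:Z(\tau)\to\mathbb{C}$, a $\tau$-module $V$ is in $\mathcal{B}_\psi$ if: $V=\bigoplus_{\underline{\lambda}\in\mathbb{C}^{n+1}}V_{\underline{\lambda}}$ with $V_{\underline{\lambda}}=\{v:d_iv=\lambda_iv,\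 0\le i\le n\}$; all $V_{\underline{\lambda}}$ are finite dimensional; $K_iv=\psi(K_i)v$ for all $v\in V$ and $0\le i\le n$; the real parts of the eigenvalues of $d_0$ on $V$ are bounded above. The modules. Let $\mathfrak{g}(\sigma_0)=\{X\in\mathfrak{g}:\sigma_0X=X\}$ and $\overset{\circ}{\mathfrak{g}}=\{X\in\mathfrak{g}(\sigma_0):[\mathfrak{h}(\overline{0}),X]=0\}$; both are $\Lambda$-graded by the eigenspaces of $\sigma_1,\dots,\sigma_n$. One has $\tau_0=\bigoplus_{\underline{k}\in\mathbb{Z}^n}\mathfrak{g}(\sigma_0)_{\overline{k}}\otimes\mathbb{C}t^{\underline{k}}\oplus\mathrm{Der}(A(\underline{m}))\oplus\bigoplus_{\underline{r}\in\Gamma}\mathbb{C}t^{\underline{r}}d_0\oplus\sum_{\underline{r}\in\Gamma,\,0\le p\le n}\mathbb{C}t^{\underline{r}}K_p$, and $\tau^0$ is given by the same formula with $\overset{\circ}{\mathfrak{g}}$ in place of $\mathfrak{g}(\sigma_0)$. "$\Lambda$-graded irreducible" means non-zero, $\Lambda$-graded, with no proper non-zero graded submodule. Let $\{E_{ij}\}$ be the standard basis of $\mathfrak{gl}_n$ and for $\underline{u}\in\mathbb{C}^n$, $\underline{r}=(r_1,\dots,r_n)\in\Gamma$ put $D(\underline{u},\underline{r})=\sum_{i=1}^n u_it^{\underline{r}}d_i$. Given $W_1,W_2,\underline{\alpha},d$ as in the claim, $\tau^0$ acts on $T'$, for $v_1\in W_1$, $v_2\in W_{2,\overline{k}}$,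 $X\in\overset{\circ}{\mathfrak{g}}_{\overline{l}}$, $\underline{r}\in\Gamma$, by $D(\underline{u},\underline{r})(v_1\otimes v_2\otimes t^{\underline{k}})=\big(\sum_i u_i(k_i+\alpha_i)\big)v_1\otimes v_2\otimes t^{\underline{k}+\underline{r}}+\sum_{i,j}u_ir_j(E_{ji}v_1)\otimes v_2\otimes t^{\underline{k}+\underline{r}}$; $X\otimes t^{\underline{l}}(v_1\otimes v_2\otimes t^{\underline{k}})=v_1\otimes Xv_2\otimes t^{\underline{k}+\underline{l}}$; $t^{\underline{r}}d_0(v_1\otimes v_2\otimes t^{\underline{k}})=d\,v_1\otimes v_2\otimes t^{\underline{k}+\underline{r}}$; $t^{\underline{r}}K_0(v_1\otimes v_2\otimes t^{\underline{k}})=C_0\,v_1\otimes v_2\otimes t^{\underline{k}+\underline{r}}$; $t^{\underline{r}}K_p(v_1\otimes v_2\otimes t^{\underline{k}})=0$ for $1\le p\le n$. It is known (a result from the literature on which the setting relies) that data with $T\cong T'$ exist. Decompose $\mathfrak{g}(\sigma_0)=\mathfrak{g}(\sigma_0)_-\oplus\overset{\circ}{\mathfrak{g}}\oplus\mathfrak{g}(\sigma_0)_+$ by negative, zero, positive $\mathfrak{h}(\overline{0})$-weights. $W_2(\sigma_0)=\bigoplus_{\overline{k}\in\Lambda}W_2(\sigma_0)_{\overline{k}}$ denotes the unique $\Lambda$-graded irreducible quotient of the induced module $U(\mathfrak{g}(\sigma_0))\otimes_{U(\overset{\circ}{\mathfrak{g}}\oplus\mathfrak{g}(\sigma_0)_+)}W_2$,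 where $\mathfrak{g}(\sigma_0)_+$ acts trivially on $W_2$. The action of $\tau_0$ on $S'$ is given by the same five formulas, now with $v_2\in W_2(\sigma_0)_{\overline{k}}$ and $X\in\mathfrak{g}(\sigma_0)_{\overline{l}}$. *)

theory Defs
  imports
    "HOL-Analysis.Analysis"
    "HOL-Library.Poly_Mapping"
    "HOL-Library.Function_Algebras"
begin

text \<open>The library hides these constants.\<close>

abbreviation "lookup \<equiv> Poly_Mapping.lookup"
abbreviation "keys \<equiv> Poly_Mapping.keys"
abbreviation "single \<equiv> Poly_Mapping.single"

section \<open>Complex vector spaces\<close>

class scaleC =
  fixes scaleC :: "complex \<Rightarrow> 'a \<Rightarrow> 'a" (infixr \<open>*\<^sub>C\<close> 75)

class complex_vector = ab_group_add + scaleC +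
  assumes scaleC_right_distrib: "a *\<^sub>C (x + y) = a *\<^sub>C x + a *\<^sub>C y"
    and scaleC_left_distrib: "(a + b) *\<^sub>C x = a *\<^sub>C x + b *\<^sub>C x"
    and scaleC_scaleC: "a *\<^sub>C (b *\<^sub>C x) = (a * b) *\<^sub>C x"
    and scaleC_one: "1 *\<^sub>C x = x"

interpretation cv: vector_space "scaleC :: complex \<Rightarrow> 'a \<Rightarrow> 'a::complex_vector"
  by standard (rule scaleC_right_distrib scaleC_left_distrib scaleC_scaleC scaleC_one)+

instantiation complex :: complex_vector
begin
definition scaleC_complex :: "complex \<Rightarrow> complex \<Rightarrow> complex" where
  "scaleC_complex c x = c * x"
instance by standard (simp_all add: scaleC_complex_def algebra_simps)
end

instantiation vec :: (complex_vector, finite) complex_vector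
begin
definition scaleC_vec :: "complex \<Rightarrow> 'a ^ 'b \<Rightarrow> 'a ^ 'b" where
  "scaleC_vec c x = (\<chi> i. c *\<^sub>C (x $ i))"
instance
  by standard (simp_all add: scaleC_vec_def vec_eq_iff cv.scale_right_distrib cv.scale_left_distrib)
end

instantiation prod :: (complex_vector, complex_vector) complex_vector
begin
definition scaleC_prod :: "complex \<Rightarrow> 'a \<times> 'b \<Rightarrow> 'a \<times> 'b" where
  "scaleC_prod c x = (c *\<^sub>C fst x, c *\<^sub>C snd x)"
instance
  by standard (simp_all add: scaleC_prod_def prod_eq_iff cv.scale_right_distrib cv.scale_left_distrib)
end

instantiation "fun" :: (type, complex_vector) complex_vector
begin
definition scaleC_fun :: "complex \<Rightarrow> ('a \<Rightarrow> 'b) \<Rightarrow> 'a \<Rightarrow> 'b" where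
  "scaleC_fun c f = (\<lambda>x. c *\<^sub>C f x)"
instance
  by standard (simp_all add: scaleC_fun_def fun_eq_iff cv.scale_right_distrib cv.scale_left_distrib)
end

instantiation poly_mapping :: (type, complex_vector) complex_vector
begin
definition scaleC_poly_mapping :: "complex \<Rightarrow> ('a \<Rightarrow>\<^sub>0 'b) \<Rightarrow> 'a \<Rightarrow>\<^sub>0 'b" where
  "scaleC_poly_mapping c f = Poly_Mapping.map (\<lambda>x. c *\<^sub>C x) f"
lemma lookup_scaleC: "lookup (c *\<^sub>C f) k = c *\<^sub>C lookup f k"
  by (cases "lookup f k = 0") (simp_all add: scaleC_poly_mapping_def Poly_Mapping.map.rep_eq)
instance
  by standard (simp_all add: poly_mapping_eq_iff fun_eq_iff lookup_scaleC lookup_add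
      cv.scale_right_distrib cv.scale_left_distrib)
end

lemma scaleC_single: "c *\<^sub>C single k x = single k (c *\<^sub>C x)"
  by (simp add: poly_mapping_eq_iff fun_eq_iff lookup_scaleC lookup_single when_def)

definition fin_dim :: "'a::complex_vector set \<Rightarrow> bool" where
  "fin_dim S \<longleftrightarrow> (\<exists>B. finite B \<and> S \<subseteq> cv.span B)"

definition clinear_on :: "'a::complex_vector set \<Rightarrow> ('a \<Rightarrow> 'b::complex_vector) \<Rightarrow> bool" where
  "clinear_on S f \<longleftrightarrow> (\<forall>x\<in>S. \<forall>y\<in>S. f (x + y) = f x + f y) \<and> (\<forall>c. \<forall>x\<in>S. f (c *\<^sub>C x) = c *\<^sub>C f x)"

definition direct_sum_on :: "'i set \<Rightarrow> 'a::complex_vector set \<Rightarrow> ('i \<Rightarrow> 'a set) \<Rightarrow> bool" where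
  "direct_sum_on I M U \<longleftrightarrow>
     (\<forall>i\<in>I. cv.subspace (U i) \<and> U i \<subseteq> M) \<and>
     (\<forall>x\<in>M. \<exists>!f. {i. f i \<noteq> 0} \<subseteq> I \<and> finite {i. f i \<noteq> 0} \<and> (\<forall>i\<in>I. f i \<in> U i) \<and>
        x = (\<Sum>i | f i \<noteq> 0. f i))"

text \<open>Bilinear extension from monomials. The coefficient map \<open>B k l\<close> may depend on the exponents.\<close>

definition pm_sum2 :: "('k \<Rightarrow> 'l \<Rightarrow> 'a \<Rightarrow> 'b \<Rightarrow> 'c) \<Rightarrow> ('k \<Rightarrow>\<^sub>0 'a::zero) \<Rightarrow> ('l \<Rightarrow>\<^sub>0 'b::zero)
    \<Rightarrow> 'c::comm_monoid_add" where
  "pm_sum2 B f g = (\<Sum>k\<in>keys f. \<Sum>l\<in>keys g. B k l (lookup f k) (lookup g l))"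

lemma pm_sum2_single:
  assumes "\<And>b. B k l 0 b = 0" "\<And>a. B k l a 0 = 0"
  shows "pm_sum2 B (single k a) (single l b) = B k l a b"
  using assms by (simp add: pm_sum2_def)

lemma pm_sum2_zero [simp]: "pm_sum2 B 0 g = 0" "pm_sum2 B f 0 = 0"
  by (simp_all add: pm_sum2_def)

lemma pm_sum2_right:
  assumes "\<And>k l a. B k l a 0 = 0" "finite S" "keys g \<subseteq> S"
  shows "pm_sum2 B f g = (\<Sum>k\<in>keys f. \<Sum>l\<in>S. B k l (lookup f k) (lookup g l))"
  unfolding pm_sum2_def using assms
  by (intro sum.cong refl sum.mono_neutral_left) (auto simp: in_keys_iff)

lemma pm_sum2_add_right:
  fixes g h :: "'l \<Rightarrow>\<^sub>0 'b::monoid_add"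
  assumes B0: "\<And>k l a. B k l a 0 = 0" and B: "\<And>k l a b c. B k l a (b + c) = B k l a b + B k l a c"
  shows "pm_sum2 B f (g + h) = pm_sum2 B f g + pm_sum2 B f h"
proof -
  let ?S = "keys g \<union> keys h"
  have "keys (g + h) \<subseteq> ?S" by (rule keys_add)
  then show ?thesis
    using pm_sum2_right[of B, OF B0, of ?S "g + h" f] pm_sum2_right[of B, OF B0, of ?S g f]
      pm_sum2_right[of B, OF B0, of ?S h f]
    by (simp add: lookup_add B sum.distrib)
qed

lemma pm_sum2_scale_right:
  fixes g :: "'l \<Rightarrow>\<^sub>0 'b::complex_vector" and B :: "'k \<Rightarrow> 'l \<Rightarrow> 'a::zero \<Rightarrow> 'b \<Rightarrow> 'c::complex_vector"
  assumes B0: "\<And>k l a. B k l a 0 = 0" and B: "\<And>k l a b c. B k l a (c *\<^sub>C b) = c *\<^sub>C B k l a b"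
  shows "pm_sum2 B f (c *\<^sub>C g) = c *\<^sub>C pm_sum2 B f g"
proof -
  have "keys (c *\<^sub>C g) \<subseteq> keys g" by (auto simp: in_keys_iff lookup_scaleC)
  then show ?thesis
    using pm_sum2_right[of B, OF B0, of "keys g" "c *\<^sub>C g" f] pm_sum2_right[of B, OF B0, of "keys g" g f]
    by (simp add: lookup_scaleC B cv.scale_sum_right)
qed


section \<open>Tensor products\<close>

definition tensor_relations :: "(('a::complex_vector \<times> 'b::complex_vector) \<Rightarrow>\<^sub>0 complex) set" where
  "tensor_relations = cv.span (
     {single (x + x', y) 1 - single (x, y) 1 - single (x', y) 1 | x x' y. True} \<union>
     {single (x, y + y') 1 - single (x, y) 1 - single (x, y') 1 | x y y'. True} \<union>
     {single (c *\<^sub>C x, y) 1 - single (x, y) c | c x y. True} \<union>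
     {single (x, c *\<^sub>C y) 1 - single (x, y) c | c x y. True})"

lemma equivp_subspace:
  assumes "cv.subspace S"
  shows "equivp (\<lambda>x y. x - y \<in> S)"
proof (rule equivpI)
  show "reflp (\<lambda>x y. x - y \<in> S)" using cv.subspace_0[OF assms] by (simp add: reflp_def)
  show "symp (\<lambda>x y. x - y \<in> S)"
  proof (rule sympI)
    fix x y assume "x - y \<in> S"
    from cv.subspace_neg[OF assms this] show "y - x \<in> S" by simp
  qed
  show "transp (\<lambda>x y. x - y \<in> S)"
  proof (rule transpI)
    fix x y z assume "x - y \<in> S" "y - z \<in> S"
    from cv.subspace_add[OF assms this] show "x - z \<in> S" by simp
  qed
qed

lemma subspace_cong:
  assumes "cv.subspace S"
  shows "x - x' \<in> S \<Longrightarrow> y - y' \<in> S \<Longrightarrow> (x + y) - (x' + y') \<in> S"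
    and "x - x' \<in> S \<Longrightarrow> y - y' \<in> S \<Longrightarrow> (x - y) - (x' - y') \<in> S"
    and "x - x' \<in> S \<Longrightarrow> - x - - x' \<in> S"
    and "x - x' \<in> S \<Longrightarrow> c *\<^sub>C x - c *\<^sub>C x' \<in> S"
    and "x = y \<Longrightarrow> x - y \<in> S"
proof -
  show "(x + y) - (x' + y') \<in> S" if "x - x' \<in> S" "y - y' \<in> S"
    using cv.subspace_add[OF assms that] by (simp add: add_diff_add)
  show "(x - y) - (x' - y') \<in> S" if "x - x' \<in> S" "y - y' \<in> S"
    using cv.subspace_diff[OF assms that] by (simp add: algebra_simps)
  show "- x - - x' \<in> S" if "x - x' \<in> S"
    using cv.subspace_neg[OF assms that] by simp
  show "c *\<^sub>C x - c *\<^sub>C x' \<in> S" if "x - x' \<in> S"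
    using cv.subspace_scale[OF assms that, of c] by (simp add: cv.scale_right_diff_distrib)
  show "x - y \<in> S" if "x = y"
    using that cv.subspace_0[OF assms] by simp
qed

quotient_type (overloaded) ('a, 'b) tensor = "(('a::complex_vector \<times> 'b::complex_vector) \<Rightarrow>\<^sub>0 complex)" /
    "\<lambda>f g. f - g \<in> tensor_relations"
  by (rule equivp_subspace) (simp add: tensor_relations_def)

lemma tensor_relations_subspace: "cv.subspace tensor_relations"
  by (simp add: tensor_relations_def)

instantiation tensor :: (complex_vector, complex_vector) complex_vector
begin
lift_definition zero_tensor :: "('a, 'b) tensor" is 0 .
lift_definition plus_tensor :: "('a, 'b) tensor \<Rightarrow> ('a, 'b) tensor \<Rightarrow> ('a, 'b) tensor" is "(+)"
  by (rule subspace_cong(1)[OF tensor_relations_subspace])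
lift_definition uminus_tensor :: "('a, 'b) tensor \<Rightarrow> ('a, 'b) tensor" is uminus
  by (rule subspace_cong(3)[OF tensor_relations_subspace])
lift_definition minus_tensor :: "('a, 'b) tensor \<Rightarrow> ('a, 'b) tensor \<Rightarrow> ('a, 'b) tensor" is "(-)"
  by (rule subspace_cong(2)[OF tensor_relations_subspace])
lift_definition scaleC_tensor :: "complex \<Rightarrow> ('a, 'b) tensor \<Rightarrow> ('a, 'b) tensor" is "(*\<^sub>C)"
  by (rule subspace_cong(4)[OF tensor_relations_subspace])
instance
proof
  fix x y z :: "('a, 'b) tensor" and a b :: complex
  note eq = subspace_cong(5)[OF tensor_relations_subspace]
  show "x + y + z = x + (y + z)" by transfer (rule eq, rule add.assoc)
  show "x + y = y + x" by transfer (rule eq, rule add.commute)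
  show "0 + x = x" by transfer (rule eq, rule add_0)
  show "- x + x = 0" by transfer (rule eq, rule left_minus)
  show "x - y = x + - y" by transfer (rule eq, rule diff_conv_add_uminus)
  show "a *\<^sub>C (x + y) = a *\<^sub>C x + a *\<^sub>C y" by transfer (rule eq, rule scaleC_right_distrib)
  show "(a + b) *\<^sub>C x = a *\<^sub>C x + b *\<^sub>C x" by transfer (rule eq, rule scaleC_left_distrib)
  show "a *\<^sub>C b *\<^sub>C x = (a * b) *\<^sub>C x" by transfer (rule eq, rule scaleC_scaleC)
  show "1 *\<^sub>C x = x" by transfer (rule eq, rule scaleC_one)
qed
end

lift_definition tensor :: "'a::complex_vector \<Rightarrow> 'b::complex_vector \<Rightarrow> ('a, 'b) tensor" (infixr \<open>\<otimes>\<^sub>t\<close> 70)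
  is "\<lambda>x y. single (x, y) 1" .

text \<open>The linear map on the tensor product induced by a bilinear map \<open>B\<close>; for bilinear \<open>B\<close> the
  choice of the representative is immaterial, see \<open>tensor_lift_tensor\<close> below.\<close>

definition tensor_lift :: "('a \<Rightarrow> 'b \<Rightarrow> 'c) \<Rightarrow> ('a::complex_vector, 'b::complex_vector) tensor
    \<Rightarrow> 'c::complex_vector" where
  "tensor_lift B t = (\<Sum>p\<in>keys (rep_tensor t). lookup (rep_tensor t) p *\<^sub>C B (fst p) (snd p))"

definition free_lift :: "('p \<Rightarrow> 'c) \<Rightarrow> ('p \<Rightarrow>\<^sub>0 complex) \<Rightarrow> 'c::complex_vector" where
  "free_lift b f = (\<Sum>p\<in>keys f. lookup f p *\<^sub>C b p)"

lemma free_lift_superset: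
  assumes "finite S" "keys f \<subseteq> S"
  shows "free_lift b f = (\<Sum>p\<in>S. lookup f p *\<^sub>C b p)"
  unfolding free_lift_def using assms
  by (intro sum.mono_neutral_left) (auto simp: in_keys_iff)

lemma free_lift_single [simp]: "free_lift b (single p c) = c *\<^sub>C b p"
  by (simp add: free_lift_def)

lemma free_lift_add: "free_lift b (f + g) = free_lift b f + free_lift b g"
  using free_lift_superset[of "keys f \<union> keys g" "f + g" b] free_lift_superset[of "keys f \<union> keys g" f b]
    free_lift_superset[of "keys f \<union> keys g" g b] keys_add[of f g]
  by (simp add: lookup_add cv.scale_left_distrib sum.distrib)

lemma free_lift_scale: "free_lift b (c *\<^sub>C f) = c *\<^sub>C free_lift b f"
proof -
  have "keys (c *\<^sub>C f) \<subseteq> keys f" by (auto simp: in_keys_iff lookup_scaleC)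
  then show ?thesis
    using free_lift_superset[of "keys f" "c *\<^sub>C f" b] free_lift_superset[of "keys f" f b]
    by (simp add: lookup_scaleC scaleC_complex_def cv.scale_sum_right)
qed

lemma free_lift_diff: "free_lift b (f - g) = free_lift b f - free_lift b g"
proof -
  have "free_lift b f = free_lift b (f - g) + free_lift b g"
    by (simp flip: free_lift_add)
  then show ?thesis by simp
qed

definition bilinear_map :: "('a::complex_vector \<Rightarrow> 'b::complex_vector \<Rightarrow> 'c::complex_vector) \<Rightarrow> bool" where
  "bilinear_map B \<longleftrightarrow> (\<forall>x. clinear_on UNIV (B x)) \<and> (\<forall>y. clinear_on UNIV (\<lambda>x. B x y))"

lemma free_lift_tensor_relations:
  assumes "bilinear_map B" "f \<in> tensor_relations"
  shows "free_lift (\<lambda>p. B (fst p) (snd p)) f = 0"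
  using assms(2) unfolding tensor_relations_def
proof (induction rule: cv.span_induct_alt)
  case base show ?case by (simp add: free_lift_def)
next
  case (step c x y)
  then have "free_lift (\<lambda>p. B (fst p) (snd p)) x = 0"
    using assms(1) by (auto simp: free_lift_diff bilinear_map_def clinear_on_def scaleC_one)
  with step show ?case by (simp add: free_lift_add free_lift_scale)
qed

lemma tensor_lift_abs:
  assumes "bilinear_map B"
  shows "tensor_lift B (abs_tensor f) = free_lift (\<lambda>p. B (fst p) (snd p)) f"
proof -
  have "rep_tensor (abs_tensor f) - f \<in> tensor_relations"
    by (metis (mono_tags, lifting) Quotient3_abs_rep Quotient3_tensor tensor.abs_eq_iff)
  from free_lift_tensor_relations[OF assms this]
  show ?thesis by (simp add: tensor_lift_def free_lift_diff flip: free_lift_def)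
qed

lemma tensor_lift_tensor:
  assumes "bilinear_map B"
  shows "tensor_lift B (x \<otimes>\<^sub>t y) = B x y"
  using tensor_lift_abs[OF assms] by (simp add: tensor.abs_eq scaleC_one)

lemma tensor_lift_linear:
  assumes "bilinear_map B"
  shows "clinear_on UNIV (tensor_lift B)"
proof -
  have "tensor_lift B (s + t) = tensor_lift B s + tensor_lift B t" for s t
  proof (induction s, induction t)
    fix f g show "tensor_lift B (abs_tensor g + abs_tensor f) = tensor_lift B (abs_tensor g) + tensor_lift B (abs_tensor f)"
      by (simp add: plus_tensor.abs_eq tensor_lift_abs[OF assms] free_lift_add)
  qed
  moreover have "tensor_lift B (c *\<^sub>C t) = c *\<^sub>C tensor_lift B t" for c t
  proof (induction t)
    fix f show "tensor_lift B (c *\<^sub>C abs_tensor f) = c *\<^sub>C tensor_lift B (abs_tensor f)"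
      by (simp add: scaleC_tensor.abs_eq tensor_lift_abs[OF assms] free_lift_scale)
  qed
  ultimately show ?thesis by (simp add: clinear_on_def)
qed

lemma bilinear_tensor:
  "bilinear_map (\<lambda>(x::'a::complex_vector) (y::'b::complex_vector). x \<otimes>\<^sub>t y)"
  unfolding bilinear_map_def clinear_on_def
proof (intro conjI allI ballI)
  show "x \<otimes>\<^sub>t (y + y') = x \<otimes>\<^sub>t y + x \<otimes>\<^sub>t y'" for x :: 'a and y y' :: 'b
    by transfer (unfold tensor_relations_def, rule cv.span_base, simp only: diff_diff_eq [symmetric], blast)
  show "(x + x') \<otimes>\<^sub>t y = x \<otimes>\<^sub>t y + x' \<otimes>\<^sub>t y" for x x' :: 'a and y :: 'b
    by transfer (unfold tensor_relations_def, rule cv.span_base, simp only: diff_diff_eq [symmetric], blast)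
  show "x \<otimes>\<^sub>t (c *\<^sub>C y) = c *\<^sub>C (x \<otimes>\<^sub>t y)" for x :: 'a and y :: 'b and c
    by transfer (unfold tensor_relations_def, rule cv.span_base,
        simp only: scaleC_single scaleC_complex_def mult_1_right, blast)
  show "(c *\<^sub>C x) \<otimes>\<^sub>t y = c *\<^sub>C (x \<otimes>\<^sub>t y)" for x :: 'a and y :: 'b and c
    by transfer (unfold tensor_relations_def, rule cv.span_base,
        simp only: scaleC_single scaleC_complex_def mult_1_right, blast)
qed

section \<open>Lie algebras and their modules\<close>

text \<open>Lie algebras, ideals and modules are given by carrier subspaces of ambient vector spaces.\<close>

definition lie_algebra_on :: "('l \<Rightarrow> 'l \<Rightarrow> 'l) \<Rightarrow> 'l::complex_vector set \<Rightarrow> bool" where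
  "lie_algebra_on br L \<longleftrightarrow> cv.subspace L \<and> (\<forall>x\<in>L. \<forall>y\<in>L. br x y \<in> L) \<and>
     (\<forall>x\<in>L. clinear_on L (br x)) \<and> (\<forall>y\<in>L. clinear_on L (\<lambda>x. br x y)) \<and>
     (\<forall>x\<in>L. br x x = 0) \<and>
     (\<forall>x\<in>L. \<forall>y\<in>L. \<forall>z\<in>L. br x (br y z) + br y (br z x) + br z (br x y) = 0)"

definition simple_lie_algebra_on :: "('l \<Rightarrow> 'l \<Rightarrow> 'l) \<Rightarrow> 'l::complex_vector set \<Rightarrow> bool" where
  "simple_lie_algebra_on br L \<longleftrightarrow> lie_algebra_on br L \<and> (\<exists>x\<in>L. \<exists>y\<in>L. br x y \<noteq> 0) \<and>
     (\<forall>I. cv.subspace I \<and> I \<subseteq> L \<and> (\<forall>x\<in>L. \<forall>y\<in>I. br x y \<in> I) \<longrightarrow> I = {0} \<or> I = L)"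

fun lower_central_series :: "('l \<Rightarrow> 'l \<Rightarrow> 'l) \<Rightarrow> 'l::complex_vector set \<Rightarrow> nat \<Rightarrow> 'l set" where
  "lower_central_series br L 0 = L"
| "lower_central_series br L (Suc n) = cv.span {br x y | x y. x \<in> L \<and> y \<in> lower_central_series br L n}"

definition cartan_subalgebra_of :: "('l \<Rightarrow> 'l \<Rightarrow> 'l) \<Rightarrow> 'l::complex_vector set \<Rightarrow> 'l set \<Rightarrow> bool" where
  "cartan_subalgebra_of br L H \<longleftrightarrow> H \<subseteq> L \<and> lie_algebra_on br H \<and>
     (\<exists>n. lower_central_series br H n = {0}) \<and>
     {x\<in>L. \<forall>h\<in>H. br x h \<in> H} = H"

definition lie_module_on :: "('l \<Rightarrow> 'l \<Rightarrow> 'l) \<Rightarrow> 'l::complex_vector set \<Rightarrow>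
    ('l \<Rightarrow> 'v \<Rightarrow> 'v) \<Rightarrow> 'v::complex_vector set \<Rightarrow> bool" where
  "lie_module_on br L act M \<longleftrightarrow> cv.subspace M \<and> (\<forall>x\<in>L. \<forall>v\<in>M. act x v \<in> M) \<and>
     (\<forall>x\<in>L. clinear_on M (act x)) \<and> (\<forall>v\<in>M. clinear_on L (\<lambda>x. act x v)) \<and>
     (\<forall>x\<in>L. \<forall>y\<in>L. \<forall>v\<in>M. act (br x y) v = act x (act y v) - act y (act x v))"

definition lie_submodule :: "'l set \<Rightarrow> ('l \<Rightarrow> 'v \<Rightarrow> 'v) \<Rightarrow> 'v::complex_vector set \<Rightarrow> 'v set \<Rightarrow> bool" where
  "lie_submodule L act M N \<longleftrightarrow> cv.subspace N \<and> N \<subseteq> M \<and> (\<forall>x\<in>L. \<forall>v\<in>N. act x v \<in> N)"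

definition irreducible_lie_module_on :: "('l \<Rightarrow> 'l \<Rightarrow> 'l) \<Rightarrow> 'l::complex_vector set \<Rightarrow>
    ('l \<Rightarrow> 'v \<Rightarrow> 'v) \<Rightarrow> 'v::complex_vector set \<Rightarrow> bool" where
  "irreducible_lie_module_on br L act M \<longleftrightarrow> lie_module_on br L act M \<and> M \<noteq> {0} \<and>
     (\<forall>N. lie_submodule L act M N \<longrightarrow> N = {0} \<or> N = M)"

definition lie_module_iso :: "('l \<Rightarrow> 'l \<Rightarrow> 'l) \<Rightarrow> 'l::complex_vector set \<Rightarrow>
    ('l \<Rightarrow> 'v \<Rightarrow> 'v) \<Rightarrow> 'v::complex_vector set \<Rightarrow> ('l \<Rightarrow> 'w \<Rightarrow> 'w) \<Rightarrow> 'w::complex_vector set \<Rightarrow> bool" where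
  "lie_module_iso br L act M act' M' \<longleftrightarrow> lie_module_on br L act M \<and> lie_module_on br L act' M' \<and>
     (\<exists>f. bij_betw f M M' \<and> clinear_on M f \<and> (\<forall>x\<in>L. \<forall>v\<in>M. f (act x v) = act' x (f v)))"

definition gl_bracket :: "complex ^ 'n ^ 'n \<Rightarrow> complex ^ 'n ^ 'n \<Rightarrow> complex ^ 'n ^ 'n" where
  "gl_bracket X Y = X ** Y - Y ** X"

definition gl_unit :: "'n \<Rightarrow> 'n \<Rightarrow> complex ^ 'n ^ 'n" where
  "gl_unit i j = (\<chi> a b. if a = i \<and> b = j then 1 else 0)"


section \<open>The twisted full toroidal Lie algebra\<close>

text \<open>
  The type \<open>'n\<close> is the index set \<open>{1, \<dots>, n}\<close>, and \<open>'n option\<close> is \<open>{0, \<dots>, n}\<close> with \<open>None\<close> as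
  the index \<open>0\<close>. Exponents \<open>(k\<^sub>0, k)\<close> are vectors in \<open>int ^ 'n option\<close>.

  \<open>root1\<close> holds the roots of unity \<open>\<xi>\<^sub>i\<close>, \<open>cart0\<close> and \<open>cart\<close> are the two Cartan subalgebras, \<open>positive\<close> the chosen positive roots, and
  \<open>mu1\<close>, \<open>mu2\<close> the coefficients of the two cocycles in \<open>\<phi>\<close>.
\<close>

record ('g, 'n) toroidal_data =
  lie :: "'g \<Rightarrow> 'g \<Rightarrow> 'g"
  form :: "'g \<Rightarrow> 'g \<Rightarrow> complex"
  aut :: "'n option \<Rightarrow> 'g \<Rightarrow> 'g"
  ord :: "'n option \<Rightarrow> nat"
  root1 :: "'n option \<Rightarrow> complex"
  cart0 :: "'g set"
  cart :: "'g set"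
  positive :: "('g \<Rightarrow> complex) set"
  mu1 :: complex
  mu2 :: complex

definition emb :: "int ^ 'n::finite \<Rightarrow> int ^ 'n option" where
  "emb k = (\<chi> i. case i of None \<Rightarrow> 0 | Some j \<Rightarrow> k $ j)"

definition rest :: "int ^ ('n::finite) option \<Rightarrow> int ^ 'n" where
  "rest k = (\<chi> j. k $ Some j)"

definition cvec :: "int ^ 'i \<Rightarrow> complex ^ 'i" where
  "cvec k = (\<chi> i. of_int (k $ i))"

definition cdot :: "complex ^ 'i \<Rightarrow> complex ^ 'i \<Rightarrow> complex" where
  "cdot u v = (\<Sum>i\<in>UNIV. u $ i * v $ i)"

text \<open>The space of the symbols \<open>t\<^sup>r K\<^sub>i\<close> for all \<open>r\<close>, where \<open>single r c\<close> stands for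
  \<open>\<Sum>i. c\<^sub>i t\<^sup>r K\<^sub>i\<close>. The relations are homogeneous in \<open>r\<close>, so \<open>Z(m\<^sub>0, m)\<close> is the subspace
  \<open>K_part\<close> below of classes supported on \<open>\<Gamma>\<^sub>0 \<oplus> \<Gamma>\<close>.\<close>

definition K_relations :: "((int ^ ('n::finite) option) \<Rightarrow>\<^sub>0 (complex ^ 'n option)) set" where
  "K_relations = cv.span (range (\<lambda>r. single r (cvec r)))"

lemma K_relations_subspace: "cv.subspace K_relations"
  by (simp add: K_relations_def)

quotient_type 'n K_space = "(int ^ ('n::finite) option) \<Rightarrow>\<^sub>0 (complex ^ 'n option)" /
    "\<lambda>z z'. z - z' \<in> K_relations"
  by (rule equivp_subspace[OF K_relations_subspace])

instantiation K_space :: (finite) complex_vector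
begin
lift_definition zero_K_space :: "'a K_space" is 0 .
lift_definition plus_K_space :: "'a K_space \<Rightarrow> 'a K_space \<Rightarrow> 'a K_space" is "(+)"
  by (rule subspace_cong(1)[OF K_relations_subspace])
lift_definition uminus_K_space :: "'a K_space \<Rightarrow> 'a K_space" is uminus
  by (rule subspace_cong(3)[OF K_relations_subspace])
lift_definition minus_K_space :: "'a K_space \<Rightarrow> 'a K_space \<Rightarrow> 'a K_space" is "(-)"
  by (rule subspace_cong(2)[OF K_relations_subspace])
lift_definition scaleC_K_space :: "complex \<Rightarrow> 'a K_space \<Rightarrow> 'a K_space" is "(*\<^sub>C)"
  by (rule subspace_cong(4)[OF K_relations_subspace])
instance
proof
  fix x y z :: "'a K_space" and a b :: complex
  note eq = subspace_cong(5)[OF K_relations_subspace]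
  show "x + y + z = x + (y + z)" by transfer (rule eq, rule add.assoc)
  show "x + y = y + x" by transfer (rule eq, rule add.commute)
  show "0 + x = x" by transfer (rule eq, rule add_0)
  show "- x + x = 0" by transfer (rule eq, rule left_minus)
  show "x - y = x + - y" by transfer (rule eq, rule diff_conv_add_uminus)
  show "a *\<^sub>C (x + y) = a *\<^sub>C x + a *\<^sub>C y" by transfer (rule eq, rule scaleC_right_distrib)
  show "(a + b) *\<^sub>C x = a *\<^sub>C x + b *\<^sub>C x" by transfer (rule eq, rule scaleC_left_distrib)
  show "a *\<^sub>C b *\<^sub>C x = (a * b) *\<^sub>C x" by transfer (rule eq, rule scaleC_scaleC)
  show "1 *\<^sub>C x = x" by transfer (rule eq, rule scaleC_one)
qed
end

lift_definition Kmono :: "int ^ ('n::finite) option \<Rightarrow> complex ^ 'n option \<Rightarrow> 'n K_space"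
  is single .

text \<open>The ambient algebra \<open>L(\<gg>) \<oplus> Z \<oplus> D\<close> with all exponents allowed; \<open>\<tau>\<close> is a subalgebra.
  In the last component \<open>single r c\<close> stands for \<open>\<Sum>a. c\<^sub>a t\<^sup>r d\<^sub>a\<close>.\<close>

type_synonym ('g, 'n) toroidal =
  "((int ^ 'n option) \<Rightarrow>\<^sub>0 'g) \<times> 'n K_space \<times> ((int ^ 'n option) \<Rightarrow>\<^sub>0 (complex ^ 'n option))"

definition loop_elt :: "'g \<Rightarrow> int ^ 'n option \<Rightarrow> ('g::complex_vector, 'n::finite) toroidal" where
  "loop_elt X k = (single k X, 0, 0)"

definition K_elt :: "int ^ 'n option \<Rightarrow> 'n option \<Rightarrow> ('g::complex_vector, 'n::finite) toroidal" where
  "K_elt r i = (0, Kmono r (axis i 1), 0)"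

definition d_elt :: "int ^ 'n option \<Rightarrow> 'n option \<Rightarrow> ('g::complex_vector, 'n::finite) toroidal" where
  "d_elt r a = (0, 0, single r (axis a 1))"

definition loop_bracket :: "('g, 'n) toroidal_data \<Rightarrow> ((int ^ 'n option) \<Rightarrow>\<^sub>0 'g) \<Rightarrow>
    ((int ^ 'n option) \<Rightarrow>\<^sub>0 'g) \<Rightarrow> ((int ^ ('n::finite) option) \<Rightarrow>\<^sub>0 'g::complex_vector)" where
  "loop_bracket A = pm_sum2 (\<lambda>k l X Y. single (k + l) (lie A X Y))"

definition loop_cocycle :: "('g, 'n) toroidal_data \<Rightarrow> ((int ^ 'n option) \<Rightarrow>\<^sub>0 'g) \<Rightarrow>
    ((int ^ 'n option) \<Rightarrow>\<^sub>0 'g::complex_vector) \<Rightarrow> 'n::finite K_space" where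
  "loop_cocycle A = pm_sum2 (\<lambda>k l X Y. Kmono (k + l) (form A X Y *\<^sub>C cvec k))"

definition der_loop :: "((int ^ 'n option) \<Rightarrow>\<^sub>0 (complex ^ 'n option)) \<Rightarrow> ((int ^ 'n option) \<Rightarrow>\<^sub>0 'g) \<Rightarrow>
    ((int ^ ('n::finite) option) \<Rightarrow>\<^sub>0 'g::complex_vector)" where
  "der_loop = pm_sum2 (\<lambda>r k c X. single (k + r) (cdot c (cvec k) *\<^sub>C X))"

definition der_K_raw :: "((int ^ 'n option) \<Rightarrow>\<^sub>0 (complex ^ 'n option)) \<Rightarrow>
    ((int ^ 'n option) \<Rightarrow>\<^sub>0 (complex ^ 'n option)) \<Rightarrow> ((int ^ ('n::finite) option) \<Rightarrow>\<^sub>0 (complex ^ 'n option))" where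
  "der_K_raw = pm_sum2 (\<lambda>r s c e. single (r + s) (cdot c (cvec s) *\<^sub>C e + cdot c e *\<^sub>C cvec r))"

lemma cdot_zero [simp]: "cdot 0 v = 0" "cdot u 0 = 0"
  by (simp_all add: cdot_def)

lemma cdot_right:
  "cdot u (v + w) = cdot u v + cdot u w" "cdot u (v - w) = cdot u v - cdot u w"
  "cdot u (c *\<^sub>C v) = c * cdot u v"
  by (simp_all add: cdot_def algebra_simps sum.distrib sum_subtractf sum_distrib_left
      scaleC_vec_def scaleC_complex_def)

lemma cdot_axis [simp]: "cdot (axis a 1) v = v $ a"
  by (simp add: cdot_def axis_def if_distrib[where f = "\<lambda>x. x * _"] cong: if_cong)

lemma cvec_nth [simp]: "cvec k $ i = of_int (k $ i)"
  by (simp add: cvec_def)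

lemma cvec_zero [simp]: "cvec 0 = 0"
  by (simp add: vec_eq_iff)

lemma cvec_add: "cvec (k + l) = cvec k + cvec l"
  by (simp add: vec_eq_iff)

lemma der_K_raw_add: "der_K_raw D (z + z') = der_K_raw D z + der_K_raw D z'"
  unfolding der_K_raw_def
  by (rule pm_sum2_add_right)
    (simp_all add: cdot_right cv.scale_right_distrib cv.scale_left_distrib add_ac flip: single_add)

lemma der_K_raw_diff: "der_K_raw D (z - z') = der_K_raw D z - der_K_raw D z'"
proof -
  have "der_K_raw D z = der_K_raw D (z - z') + der_K_raw D z'"
    by (simp flip: der_K_raw_add)
  then show ?thesis by simp
qed

lemma der_K_raw_relations:
  assumes "z \<in> K_relations"
  shows "der_K_raw D z \<in> K_relations"
  using assms unfolding K_relations_def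
proof (induction rule: cv.span_induct_alt)
  case base show ?case by (simp add: der_K_raw_def cv.span_zero)
next
  case (step c x y)
  then obtain s where x: "x = single s (cvec s)" by blast
  have "der_K_raw D (c *\<^sub>C x) = (\<Sum>r\<in>keys D. \<Sum>l\<in>keys (c *\<^sub>C x). single (r + l)
      (cdot (lookup D r) (cvec l) *\<^sub>C lookup (c *\<^sub>C x) l + cdot (lookup D r) (lookup (c *\<^sub>C x) l) *\<^sub>C cvec r))"
    by (simp add: der_K_raw_def pm_sum2_def)
  also have "\<dots> \<in> cv.span (range (\<lambda>r. single r (cvec r)))"
  proof (intro cv.span_sum)
    fix r l assume "l \<in> keys (c *\<^sub>C x)"
    then have "l = s" by (simp add: x scaleC_single split: if_splits)
    then have "single (r + l) (cdot (lookup D r) (cvec l) *\<^sub>C lookup (c *\<^sub>C x) l + cdot (lookup D r) (lookup (c *\<^sub>C x) l) *\<^sub>C cvec r)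
      = (c * cdot (lookup D r) (cvec s)) *\<^sub>C single (r + s) (cvec (r + s))"
      by (simp add: x scaleC_single cdot_right cvec_add cv.scale_right_distrib mult.commute add.commute)
    then show "single (r + l) (cdot (lookup D r) (cvec l) *\<^sub>C lookup (c *\<^sub>C x) l + cdot (lookup D r) (lookup (c *\<^sub>C x) l) *\<^sub>C cvec r)
      \<in> cv.span (range (\<lambda>r. single r (cvec r)))"
      by (simp add: cv.span_base cv.span_scale)
  qed
  finally show ?case using step.IH by (simp add: der_K_raw_add cv.span_add)
qed

lift_definition der_K :: "((int ^ 'n option) \<Rightarrow>\<^sub>0 (complex ^ 'n option)) \<Rightarrow> 'n K_space \<Rightarrow> 'n::finite K_space"
  is der_K_raw
  using der_K_raw_diff der_K_raw_relations by metis

definition der_bracket :: "((int ^ 'n option) \<Rightarrow>\<^sub>0 (complex ^ 'n option)) \<Rightarrow>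
    ((int ^ 'n option) \<Rightarrow>\<^sub>0 (complex ^ 'n option)) \<Rightarrow> ((int ^ ('n::finite) option) \<Rightarrow>\<^sub>0 (complex ^ 'n option))" where
  "der_bracket = pm_sum2 (\<lambda>r s c e. single (r + s) (cdot c (cvec s) *\<^sub>C e - cdot e (cvec r) *\<^sub>C c))"

definition phi1 :: "((int ^ 'n option) \<Rightarrow>\<^sub>0 (complex ^ 'n option)) \<Rightarrow>
    ((int ^ 'n option) \<Rightarrow>\<^sub>0 (complex ^ 'n option)) \<Rightarrow> 'n::finite K_space" where
  "phi1 = pm_sum2 (\<lambda>r s c e. - (cdot c (cvec s) * cdot e (cvec r)) *\<^sub>C Kmono (r + s) (cvec r))"

definition phi2 :: "((int ^ 'n option) \<Rightarrow>\<^sub>0 (complex ^ 'n option)) \<Rightarrow>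
    ((int ^ 'n option) \<Rightarrow>\<^sub>0 (complex ^ 'n option)) \<Rightarrow> 'n::finite K_space" where
  "phi2 = pm_sum2 (\<lambda>r s c e. (cdot c (cvec r) * cdot e (cvec s)) *\<^sub>C Kmono (r + s) (cvec r))"

fun bracket :: "('g, 'n) toroidal_data \<Rightarrow> ('g, 'n) toroidal \<Rightarrow> ('g, 'n) toroidal \<Rightarrow>
    ('g::complex_vector, 'n::finite) toroidal" where
  "bracket A (x, z, D) (x', z', D') =
     (loop_bracket A x x' + der_loop D x' - der_loop D' x,
      loop_cocycle A x x' + der_K D z' - der_K D' z + mu1 A *\<^sub>C phi1 D D' + mu2 A *\<^sub>C phi2 D D',
      der_bracket D D')"

text \<open>On monomials \<open>bracket\<close> reduces to the defining formulas, proved in \<open>K_relation\<close> and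
  \<open>bracket_loop_loop\<close> to \<open>bracket_d_d\<close>.\<close>

lemma Kmono_add: "Kmono r (c + e) = Kmono r c + Kmono r e"
  by transfer (simp add: single_add cv.subspace_0[OF K_relations_subspace])

lemma Kmono_scale: "Kmono r (a *\<^sub>C c) = a *\<^sub>C Kmono r c"
  by transfer (simp add: scaleC_single cv.subspace_0[OF K_relations_subspace])

lemma Kmono_zero [simp]: "Kmono r 0 = 0"
  by transfer (simp add: cv.subspace_0[OF K_relations_subspace])

lemma der_zero [simp]:
  "loop_bracket A 0 y = 0" "loop_bracket A y 0 = 0" "loop_cocycle A 0 y = 0" "loop_cocycle A y 0 = 0"
  "der_loop 0 y = 0" "der_loop D 0 = 0" "der_bracket 0 D = 0" "der_bracket D 0 = 0"
  "phi1 0 D = 0" "phi1 D 0 = 0" "phi2 0 D = 0" "phi2 D 0 = 0"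
  by (simp_all add: loop_bracket_def loop_cocycle_def der_loop_def der_bracket_def phi1_def phi2_def)

lemma der_K_zero_left [simp]: "der_K 0 z = 0"
  by transfer (simp add: der_K_raw_def cv.subspace_0[OF K_relations_subspace])

lemma der_K_zero_right [simp]: "der_K D 0 = 0"
  by transfer (simp add: der_K_raw_def cv.subspace_0[OF K_relations_subspace])

lemma toroidal_scale: "c *\<^sub>C (x, z, D) = (c *\<^sub>C x, c *\<^sub>C z, c *\<^sub>C D)"
  by (simp add: scaleC_prod_def)

lemma K_sum:
  "(\<Sum>p\<in>UNIV. c $ p *\<^sub>C (K_elt q p :: ('g::complex_vector, 'n::finite) toroidal)) = (0, Kmono q c, 0)"
proof -
  have "(\<Sum>p\<in>S. c $ p *\<^sub>C (K_elt q p :: ('g, 'n) toroidal)) = (0, Kmono q (\<Sum>p\<in>S. c $ p *\<^sub>C axis p 1), 0)" for S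
    by (induction S rule: infinite_finite_induct)
      (simp_all add: K_elt_def toroidal_scale Kmono_add Kmono_scale zero_prod_def)
  moreover have "(\<Sum>p\<in>UNIV. c $ p *\<^sub>C axis p 1) = c"
    by (simp add: vec_eq_iff scaleC_vec_def scaleC_complex_def axis_def if_distrib cong: if_cong)
  ultimately show ?thesis by simp
qed

lemma K_sum_int: "(\<Sum>p\<in>UNIV. of_int (k $ p) *\<^sub>C K_elt q p) = (0, Kmono q (cvec k), 0)"
  using K_sum[of "cvec k" q] by simp

lemma K_relation: "(\<Sum>i\<in>UNIV. of_int (r $ i) *\<^sub>C K_elt r i) = 0"
proof -
  have "Kmono r (cvec r) = 0"
    by transfer (simp add: K_relations_def cv.span_base)
  then show ?thesis by (simp add: K_sum_int zero_prod_def)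
qed

lemma bracket_loop_loop:
  assumes "lie A 0 Y = 0" "lie A X 0 = 0" "form A 0 Y = 0" "form A X 0 = 0"
  shows "bracket A (loop_elt X k) (loop_elt Y l) =
    loop_elt (lie A X Y) (k + l) + form A X Y *\<^sub>C (\<Sum>i\<in>UNIV. of_int (k $ i) *\<^sub>C K_elt (k + l) i)"
  using assms unfolding K_sum_int
  by (simp add: loop_elt_def loop_bracket_def loop_cocycle_def pm_sum2_def Kmono_scale toroidal_scale)

lemma bracket_d_loop:
  "bracket A (d_elt r a) (loop_elt X k) = of_int (k $ a) *\<^sub>C loop_elt X (k + r)"
  by (simp add: loop_elt_def d_elt_def der_loop_def pm_sum2_def scaleC_single toroidal_scale)

lemma bracket_K:
  "bracket A (x, z, 0) (0, z', 0) = 0"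
  by (simp add: zero_prod_def)

lemma bracket_d_K:
  "bracket A (d_elt r a) (K_elt s b) = of_int (s $ a) *\<^sub>C K_elt (r + s) b +
     (if a = b then \<Sum>p\<in>UNIV. of_int (r $ p) *\<^sub>C K_elt (r + s) p else 0)"
proof -
  have "der_K (single r (axis a 1)) (Kmono s (axis b 1)) =
    Kmono (r + s) (of_int (s $ a) *\<^sub>C axis b 1 + (if a = b then 1 else 0) *\<^sub>C cvec r)"
  proof -
    have axis: "axis b (1::complex) $ a = (if a = b then 1 else 0)" by (simp add: axis_def)
    have "der_K_raw (single r (axis a 1)) (single s (axis b 1)) =
      single (r + s) (cdot (axis a 1) (cvec s) *\<^sub>C axis b 1 + cdot (axis a 1) (axis b 1) *\<^sub>C cvec r)"
      unfolding der_K_raw_def by (rule pm_sum2_single) simp_all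
    then show ?thesis
      by (simp only: Kmono.abs_eq der_K.abs_eq cdot_axis axis cvec_nth)
  qed
  then show ?thesis unfolding K_sum_int
    by (simp add: d_elt_def K_elt_def toroidal_scale Kmono_add Kmono_scale scaleC_one zero_prod_def)
qed

lemma phi1_d:
  "phi1 (single r (axis a 1)) (single s (axis b 1)) = - (of_int (s $ a) * of_int (r $ b)) *\<^sub>C Kmono (r + s) (cvec r)"
  by (simp add: phi1_def pm_sum2_def)

lemma phi2_d:
  "phi2 (single r (axis a 1)) (single s (axis b 1)) = (of_int (r $ a) * of_int (s $ b)) *\<^sub>C Kmono (r + s) (cvec r)"
  by (simp add: phi2_def pm_sum2_def)

lemma bracket_d_d:
  "bracket A (d_elt r a) (d_elt s b) = of_int (s $ a) *\<^sub>C d_elt (r + s) b - of_int (r $ b) *\<^sub>C d_elt (r + s) a +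
     (mu2 A * of_int (r $ a) * of_int (s $ b) - mu1 A * of_int (s $ a) * of_int (r $ b)) *\<^sub>C
       (\<Sum>p\<in>UNIV. of_int (r $ p) *\<^sub>C K_elt (r + s) p)"
  unfolding K_sum_int
  by (simp add: d_elt_def toroidal_scale phi1_d phi2_d der_bracket_def pm_sum2_def scaleC_single single_diff
      cv.scale_left_diff_distrib mult.assoc)

definition Gam :: "('g, 'n) toroidal_data \<Rightarrow> (int ^ ('n::finite) option) set" where
  "Gam A = {r. \<forall>i. int (ord A i) dvd r $ i}"

text \<open>The eigenspace of the automorphisms belonging to the class of the exponent \<open>k\<close>.\<close>

definition eig :: "('g::complex_vector, 'n) toroidal_data \<Rightarrow> int ^ ('n::finite) option \<Rightarrow> 'g set" where
  "eig A k = {x. \<forall>i. aut A i x = (root1 A i powi (k $ i)) *\<^sub>C x}"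

definition K_part :: "('g, 'n::finite) toroidal_data \<Rightarrow> 'n K_space set" where
  "K_part A = abs_K_space ` {z. keys z \<subseteq> Gam A}"

definition tau :: "('g, 'n) toroidal_data \<Rightarrow> ('g::complex_vector, 'n::finite) toroidal set" where
  "tau A = {(x, z, D). (\<forall>k. lookup x k \<in> eig A k) \<and> z \<in> K_part A \<and> keys D \<subseteq> Gam A}"

definition tau_centre :: "('g, 'n) toroidal_data \<Rightarrow> ('g::complex_vector, 'n::finite) toroidal set" where
  "tau_centre A = cv.span (range (K_elt 0))"


section \<open>Roots and the standing assumptions\<close>

text \<open>Linear forms on \<open>cart0\<close> are extended by \<open>0\<close> outside \<open>cart0\<close>, which makes them unique as
  functions on the whole of \<open>\<gg>\<close>.\<close>

definition cart0_dual :: "('g::complex_vector, 'n) toroidal_data \<Rightarrow> ('g \<Rightarrow> complex) set" where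
  "cart0_dual A = {\<alpha>. clinear_on (cart0 A) \<alpha> \<and> (\<forall>x. x \<notin> cart0 A \<longrightarrow> \<alpha> x = 0)}"

definition weight_space :: "('g::complex_vector, 'n) toroidal_data \<Rightarrow> 'g set \<Rightarrow> ('g \<Rightarrow> complex) \<Rightarrow> 'g set" where
  "weight_space A S \<alpha> = {x\<in>S. \<forall>h\<in>cart0 A. lie A h x = \<alpha> h *\<^sub>C x}"

definition weights :: "('g::complex_vector, 'n) toroidal_data \<Rightarrow> 'g set \<Rightarrow> ('g \<Rightarrow> complex) set" where
  "weights A S = {\<alpha>\<in>cart0_dual A. weight_space A S \<alpha> \<noteq> {0}}"

definition Delta0_nz :: "('g::complex_vector, 'n::finite) toroidal_data \<Rightarrow> ('g \<Rightarrow> complex) set" where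
  "Delta0_nz A = weights A (eig A 0) - {0}"

definition dual_vec :: "('g::complex_vector, 'n) toroidal_data \<Rightarrow> ('g \<Rightarrow> complex) \<Rightarrow> 'g" where
  "dual_vec A \<alpha> = (THE t. t \<in> cart0 A \<and> (\<forall>h\<in>cart0 A. form A t h = \<alpha> h))"

definition dual_form :: "('g::complex_vector, 'n) toroidal_data \<Rightarrow> ('g \<Rightarrow> complex) \<Rightarrow> ('g \<Rightarrow> complex) \<Rightarrow> complex" where
  "dual_form A \<alpha> \<beta> = form A (dual_vec A \<alpha>) (dual_vec A \<beta>)"

text \<open>The form on \<open>\<gg>\<close> is any nonzero multiple of the Killing form, possibly a non-real one, so only
  ratios of squared lengths of roots are positive numbers. If all roots have the same length, all
  of them count as short.\<close>

definition short_roots :: "('g::complex_vector, 'n::finite) toroidal_data \<Rightarrow> ('g \<Rightarrow> complex) set" where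
  "short_roots A = {\<alpha>\<in>Delta0_nz A. \<forall>\<beta>\<in>Delta0_nz A. Re (dual_form A \<alpha> \<alpha> / dual_form A \<beta> \<beta>) \<le> 1}"

text \<open>An isomorphism of root systems is a linear bijection of the spanned spaces that maps one set of
  roots onto the other; here the other one is \<open>{\<plusminus>\<epsilon>\<^sub>i} \<union> {\<plusminus>\<epsilon>\<^sub>i \<plusminus> \<epsilon>\<^sub>j | i \<noteq> j}\<close>.\<close>

definition type_B :: "nat \<Rightarrow> ('g \<Rightarrow> complex) set \<Rightarrow> bool" where
  "type_B l R \<longleftrightarrow> (\<exists>\<epsilon>. inj_on \<epsilon> {..<l} \<and> cv.independent (\<epsilon> ` {..<l}) \<and>
     R = {\<epsilon> i | i. i < l} \<union> {- \<epsilon> i | i. i < l} \<union>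
       (\<Union>(i, j)\<in>{(i, j). i < l \<and> j < l \<and> i \<noteq> j}. {\<epsilon> i + \<epsilon> j, \<epsilon> i - \<epsilon> j, - \<epsilon> i - \<epsilon> j}))"

text \<open>\<open>lmin\<close> is the smallest rank for which the name \<open>B\<^sub>l\<close> is used: with \<open>lmin = 1\<close> the type
  \<open>A\<^sub>1\<close> also counts as \<open>B\<^sub>1\<close>, with \<open>lmin = 2\<close> it does not.\<close>

definition Delta_en_nz :: "nat \<Rightarrow> ('g::complex_vector, 'n::finite) toroidal_data \<Rightarrow> ('g \<Rightarrow> complex) set" where
  "Delta_en_nz lmin A =
     (if \<exists>l\<ge>lmin. type_B l (Delta0_nz A) then Delta0_nz A \<union> (\<lambda>\<alpha>. 2 *\<^sub>C \<alpha>) ` short_roots A else Delta0_nz A)"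

definition positive_system :: "('g \<Rightarrow> complex) set \<Rightarrow> ('g \<Rightarrow> complex) set \<Rightarrow> bool" where
  "positive_system R P \<longleftrightarrow> R = P \<union> uminus ` P \<and> P \<inter> uminus ` P = {} \<and>
     (\<forall>\<alpha>\<in>P. \<forall>\<beta>\<in>P. \<alpha> + \<beta> \<in> R \<longrightarrow> \<alpha> + \<beta> \<in> P)"

definition multiloop_data :: "('g::complex_vector, 'n::finite) toroidal_data \<Rightarrow> bool" where
  "multiloop_data A \<longleftrightarrow>
     fin_dim (UNIV :: 'g set) \<and> simple_lie_algebra_on (lie A) UNIV \<and>
     bilinear_map (form A) \<and> (\<forall>x y. form A x y = form A y x) \<and>
     (\<forall>x y z. form A (lie A x y) z = form A x (lie A y z)) \<and>
     (\<forall>x. (\<forall>y. form A x y = 0) \<longrightarrow> x = 0) \<and>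
     (\<forall>i. clinear_on UNIV (aut A i) \<and> bij (aut A i) \<and>
        (\<forall>x y. aut A i (lie A x y) = lie A (aut A i x) (aut A i y))) \<and>
     (\<forall>i j. aut A i \<circ> aut A j = aut A j \<circ> aut A i) \<and>
     (\<forall>i. ord A i > 0 \<and> aut A i ^^ ord A i = id \<and> (\<forall>q. 0 < q \<and> q < ord A i \<longrightarrow> aut A i ^^ q \<noteq> id)) \<and>
     (\<forall>i. root1 A i ^ ord A i = 1 \<and> (\<forall>q. 0 < q \<and> q < ord A i \<longrightarrow> root1 A i ^ q \<noteq> 1))"

definition standing_assumptions :: "nat \<Rightarrow> ('g::complex_vector, 'n::finite) toroidal_data \<Rightarrow> bool" where
  "standing_assumptions lmin A \<longleftrightarrow>
     simple_lie_algebra_on (lie A) (eig A 0) \<and>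
     cartan_subalgebra_of (lie A) (eig A 0) (cart0 A) \<and>
     cartan_subalgebra_of (lie A) UNIV (cart A) \<and> cart0 A \<subseteq> cart A \<and>
     weights A UNIV \<union> {0} = Delta_en_nz lmin A \<union> {0} \<and>
     positive_system (Delta_en_nz lmin A) (positive A)"


section \<open>Triangular decompositions\<close>

definition tau_deg :: "('g, 'n) toroidal_data \<Rightarrow> int \<Rightarrow> ('g::complex_vector, 'n::finite) toroidal set" where
  "tau_deg A q = {X\<in>tau A. bracket A (d_elt 0 None) X = of_int q *\<^sub>C X}"

definition tau_plus :: "('g, 'n) toroidal_data \<Rightarrow> ('g::complex_vector, 'n::finite) toroidal set" where
  "tau_plus A = cv.span (\<Union>q\<in>{0<..}. tau_deg A q)"

definition tau_zero :: "('g, 'n) toroidal_data \<Rightarrow> ('g::complex_vector, 'n::finite) toroidal set" where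
  "tau_zero A = tau_deg A 0"

definition tau_upper_zero :: "('g, 'n) toroidal_data \<Rightarrow> ('g::complex_vector, 'n::finite) toroidal set" where
  "tau_upper_zero A = {X\<in>tau_zero A. \<forall>h\<in>cart0 A. bracket A (loop_elt h 0) X = 0}"

definition root_space :: "('g, 'n) toroidal_data \<Rightarrow> ('g \<Rightarrow> complex) \<Rightarrow> int ^ 'n option \<Rightarrow>
    ('g::complex_vector, 'n::finite) toroidal set" where
  "root_space A \<alpha> k = {X\<in>tau A. (\<forall>h\<in>cart0 A. bracket A (loop_elt h 0) X = \<alpha> h *\<^sub>C X) \<and>
     (\<forall>i. bracket A (d_elt 0 i) X = of_int (k $ i) *\<^sub>C X)}"

definition tau_upper_plus :: "('g, 'n) toroidal_data \<Rightarrow> ('g::complex_vector, 'n::finite) toroidal set" where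
  "tau_upper_plus A = cv.span (\<Union>{root_space A \<alpha> k | \<alpha> k.
     \<alpha> \<in> cart0_dual A \<and> (k $ None > 0 \<or> k $ None = 0 \<and> \<alpha> \<in> positive A)})"


section \<open>The category of modules\<close>

definition in_category_B :: "('g, 'n) toroidal_data \<Rightarrow> (('g::complex_vector, 'n::finite) toroidal \<Rightarrow> complex) \<Rightarrow>
    (('g, 'n) toroidal \<Rightarrow> 'v \<Rightarrow> 'v::complex_vector) \<Rightarrow> bool" where
  "in_category_B A \<psi> act \<longleftrightarrow>
     (let V = \<lambda>\<mu> :: complex ^ 'n option. {v. \<forall>i. act (d_elt 0 i) v = (\<mu> $ i) *\<^sub>C v} in
       lie_module_on (bracket A) (tau A) act UNIV \<and>
       direct_sum_on UNIV UNIV V \<and> (\<forall>\<mu>. fin_dim (V \<mu>)) \<and>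
       (\<forall>i v. act (K_elt 0 i) v = \<psi> (K_elt 0 i) *\<^sub>C v) \<and>
       (\<exists>b. \<forall>e v. v \<noteq> 0 \<and> act (d_elt 0 None) v = e *\<^sub>C v \<longrightarrow> Re e \<le> b))"


section \<open>Graded modules\<close>

text \<open>The class of \<open>k\<close> in \<open>\<Lambda> = \<int>\<^sup>n / \<Gamma>\<close>, as a coset.\<close>

definition lam :: "('g, 'n) toroidal_data \<Rightarrow> int ^ 'n \<Rightarrow> (int ^ 'n::finite) set" where
  "lam A k = {l. \<forall>i. int (ord A (Some i)) dvd l $ i - k $ i}"

definition g_sigma0 :: "('g, 'n) toroidal_data \<Rightarrow> 'g set" where
  "g_sigma0 A = {x. aut A None x = x}"

definition g_circ :: "('g::complex_vector, 'n) toroidal_data \<Rightarrow> 'g set" where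
  "g_circ A = {x\<in>g_sigma0 A. \<forall>h\<in>cart0 A. lie A h x = 0}"

definition g_sigma0_plus :: "('g::complex_vector, 'n) toroidal_data \<Rightarrow> 'g set" where
  "g_sigma0_plus A = cv.span (\<Union>\<alpha>\<in>positive A. weight_space A (g_sigma0 A) \<alpha>)"

definition homog :: "('g::complex_vector, 'n) toroidal_data \<Rightarrow> 'g set \<Rightarrow> int ^ 'n::finite \<Rightarrow> 'g set" where
  "homog A L k = {x\<in>L. \<forall>i. aut A (Some i) x = (root1 A (Some i) powi (k $ i)) *\<^sub>C x}"

definition graded_module :: "('g::complex_vector, 'n::finite) toroidal_data \<Rightarrow> 'g set \<Rightarrow> ('g \<Rightarrow> 'w \<Rightarrow> 'w) \<Rightarrow>
    ((int ^ 'n) set \<Rightarrow> 'w::complex_vector set) \<Rightarrow> bool" where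
  "graded_module A L act gr \<longleftrightarrow> lie_module_on (lie A) L act UNIV \<and> direct_sum_on (range (lam A)) UNIV gr \<and>
     (\<forall>k l. \<forall>x\<in>homog A L k. \<forall>w\<in>gr (lam A l). act x w \<in> gr (lam A (k + l)))"

definition graded_irreducible :: "('g::complex_vector, 'n::finite) toroidal_data \<Rightarrow> 'g set \<Rightarrow> ('g \<Rightarrow> 'w \<Rightarrow> 'w) \<Rightarrow>
    ((int ^ 'n) set \<Rightarrow> 'w::complex_vector set) \<Rightarrow> bool" where
  "graded_irreducible A L act gr \<longleftrightarrow> graded_module A L act gr \<and> (UNIV :: 'w set) \<noteq> {0} \<and>
     (\<forall>N. lie_submodule L act UNIV N \<and> direct_sum_on (range (lam A)) N (\<lambda>\<mu>. N \<inter> gr \<mu>) \<longrightarrow> N = {0} \<or> N = UNIV)"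

text \<open>
  The induced module \<open>U(\<gg>(\<sigma>\<^sub>0)) \<otimes> W\<close> over \<open>U(\<gg>\<^sup>\<circ> \<oplus> \<gg>(\<sigma>\<^sub>0)\<^sub>+)\<close> is \<open>induced_free A / induced_relations A act\<close>,
  where \<open>single [x\<^sub>1, \<dots>, x\<^sub>p] w\<close> represents \<open>x\<^sub>1 \<cdots> x\<^sub>p \<otimes> w\<close>. The first three sets of relations are those
  of the enveloping algebra as a quotient of the tensor algebra; the last two balance the tensor
  product, with \<open>\<gg>(\<sigma>\<^sub>0)\<^sub>+\<close> acting trivially on \<open>W\<close>.
\<close>

definition induced_free :: "('g, 'n) toroidal_data \<Rightarrow> ('g list \<Rightarrow>\<^sub>0 'w::zero) set" where
  "induced_free A = {f. keys f \<subseteq> lists (g_sigma0 A)}"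

definition induced_relations :: "('g::complex_vector, 'n) toroidal_data \<Rightarrow> ('g \<Rightarrow> 'w \<Rightarrow> 'w) \<Rightarrow>
    ('g list \<Rightarrow>\<^sub>0 'w::complex_vector) set" where
  "induced_relations A act = cv.span (
     {single (p @ [x + y] @ q) w - single (p @ [x] @ q) w - single (p @ [y] @ q) w | p q x y w.
        p \<in> lists (g_sigma0 A) \<and> q \<in> lists (g_sigma0 A) \<and> x \<in> g_sigma0 A \<and> y \<in> g_sigma0 A} \<union>
     {single (p @ [c *\<^sub>C x] @ q) w - single (p @ [x] @ q) (c *\<^sub>C w) | p q c x w.
        p \<in> lists (g_sigma0 A) \<and> q \<in> lists (g_sigma0 A) \<and> x \<in> g_sigma0 A} \<union>
     {single (p @ [x, y] @ q) w - single (p @ [y, x] @ q) w - single (p @ [lie A x y] @ q) w | p q x y w.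
        p \<in> lists (g_sigma0 A) \<and> q \<in> lists (g_sigma0 A) \<and> x \<in> g_sigma0 A \<and> y \<in> g_sigma0 A} \<union>
     {single (p @ [x]) w - single p (act x w) | p x w. p \<in> lists (g_sigma0 A) \<and> x \<in> g_circ A} \<union>
     {single (p @ [x]) w | p x w. p \<in> lists (g_sigma0 A) \<and> x \<in> g_sigma0_plus A})"

text \<open>
  \<open>(actM, grM)\<close> is a graded irreducible quotient of the module induced from \<open>(act, gr)\<close>: \<open>\<pi>\<close> is the
  quotient map, composed with the projection \<open>induced_free A \<rightarrow> induced_free A / induced_relations A act\<close>.
\<close>

definition graded_irreducible_quotient :: "('g::complex_vector, 'n::finite) toroidal_data \<Rightarrow>
    ('g \<Rightarrow> 'w \<Rightarrow> 'w) \<Rightarrow> ((int ^ 'n) set \<Rightarrow> 'w::complex_vector set) \<Rightarrow>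
    ('g \<Rightarrow> 'm \<Rightarrow> 'm) \<Rightarrow> ((int ^ 'n) set \<Rightarrow> 'm::complex_vector set) \<Rightarrow> bool" where
  "graded_irreducible_quotient A act gr actM grM \<longleftrightarrow> graded_irreducible A (g_sigma0 A) actM grM \<and>
     (\<exists>\<pi>. clinear_on (induced_free A) \<pi> \<and> (\<forall>f\<in>induced_relations A act. \<pi> f = 0) \<and>
        \<pi> ` induced_free A = UNIV \<and>
        (\<forall>x\<in>g_sigma0 A. \<forall>p\<in>lists (g_sigma0 A). \<forall>w. \<pi> (single (x # p) w) = actM x (\<pi> (single p w))) \<and>
        (\<forall>ks p l w. list_all2 (\<lambda>k x. x \<in> homog A (g_sigma0 A) k) ks p \<and> w \<in> gr (lam A l) \<longrightarrow>
           \<pi> (single p w) \<in> grM (lam A (sum_list ks + l))))"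


section \<open>The tensor modules\<close>

text \<open>\<open>\<Oplus>\<^sub>k W\<^sub>1 \<otimes> W\<^sub>2\<^sub>,\<^sub>k \<otimes> \<complex>t\<^sup>k\<close>, with \<open>single k (v\<^sub>1 \<otimes>\<^sub>t v\<^sub>2)\<close> for \<open>v\<^sub>1 \<otimes> v\<^sub>2 \<otimes> t\<^sup>k\<close>.\<close>

definition tensor_space :: "('g, 'n::finite) toroidal_data \<Rightarrow> ((int ^ 'n) set \<Rightarrow> 'w::complex_vector set) \<Rightarrow>
    ((int ^ 'n) \<Rightarrow>\<^sub>0 ('w1::complex_vector, 'w) tensor) set" where
  "tensor_space A gr = {f. \<forall>k. lookup f k \<in> cv.span {v1 \<otimes>\<^sub>t v2 | v1 v2. v2 \<in> gr (lam A k)}}"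

text \<open>The coefficients of the \<open>t\<^sup>r K\<^sub>0\<close> with \<open>r\<^sub>0 = 0\<close>, which the relations do not involve.\<close>

lemma K_relations_None:
  assumes "z \<in> K_relations" "r $ None = 0"
  shows "lookup z r $ None = 0"
  using assms(1) unfolding K_relations_def
proof (induction rule: cv.span_induct_alt)
  case base show ?case by simp
next
  case (step c x y)
  then obtain s where "x = single s (cvec s)" by blast
  with step.IH assms(2) show ?case
    by (simp add: lookup_add lookup_scaleC lookup_single when_def scaleC_vec_def scaleC_complex_def)
qed

lift_definition K0_part :: "('n::finite) K_space \<Rightarrow> ((int ^ 'n option) \<Rightarrow>\<^sub>0 complex)" is
  "\<lambda>z. Poly_Mapping.mapp (\<lambda>r e. if r $ None = 0 then e $ None else 0) z"
proof -
  fix z z' :: "(int ^ 'n option) \<Rightarrow>\<^sub>0 (complex ^ 'n option)"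
  assume "z - z' \<in> K_relations"
  from K_relations_None[OF this] have *: "lookup z r $ None = lookup z' r $ None" if "r $ None = 0" for r
    using that by (simp add: lookup_minus)
  show "Poly_Mapping.mapp (\<lambda>r e. if r $ None = 0 then e $ None else 0) z =
      Poly_Mapping.mapp (\<lambda>r e. if r $ None = 0 then e $ None else 0) z'"
  proof (intro poly_mapping_eqI)
    fix r
    have "lookup (Poly_Mapping.mapp (\<lambda>r e. if r $ None = 0 then e $ None else 0) w) r =
        (if r $ None = 0 then lookup w r $ None else 0)" for w :: "(int ^ 'n option) \<Rightarrow>\<^sub>0 (complex ^ 'n option)"
      by (simp add: Poly_Mapping.mapp.rep_eq in_keys_iff when_def)
    with * show "lookup (Poly_Mapping.mapp (\<lambda>r e. if r $ None = 0 then e $ None else 0) z) r =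
        lookup (Poly_Mapping.mapp (\<lambda>r e. if r $ None = 0 then e $ None else 0) z') r"
      by simp
  qed
qed

text \<open>The action of \<open>\<tau>\<^sub>0\<close>, and by restriction of \<open>\<tau>\<^sup>0\<close>, written for arbitrary elements; the
  defining formulas on monomials are \<open>tensor_act_loop\<close> to \<open>tensor_act_K\<close> below.\<close>

fun tensor_act :: "(complex ^ 'n ^ 'n \<Rightarrow> 'w1 \<Rightarrow> 'w1) \<Rightarrow> ('g \<Rightarrow> 'w \<Rightarrow> 'w) \<Rightarrow> complex ^ 'n \<Rightarrow> complex \<Rightarrow> complex \<Rightarrow>
    ('g::complex_vector, 'n::finite) toroidal \<Rightarrow> ((int ^ 'n) \<Rightarrow>\<^sub>0 ('w1::complex_vector, 'w::complex_vector) tensor) \<Rightarrow>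
    ((int ^ 'n) \<Rightarrow>\<^sub>0 ('w1, 'w) tensor)" where
  "tensor_act act1 act2 \<alpha> d C0 (x, z, D) f =
     pm_sum2 (\<lambda>l k X v. single (k + rest l) (tensor_lift (\<lambda>v1 v2. v1 \<otimes>\<^sub>t act2 X v2) v)) x f +
     pm_sum2 (\<lambda>r k u v. single (k + rest r)
       ((\<Sum>i\<in>UNIV. u $ Some i * (of_int (k $ i) + \<alpha> $ i)) *\<^sub>C v +
        (\<Sum>i\<in>UNIV. \<Sum>j\<in>UNIV. (u $ Some i * of_int (r $ Some j)) *\<^sub>C
           tensor_lift (\<lambda>v1 v2. act1 (gl_unit j i) v1 \<otimes>\<^sub>t v2) v) +
        (u $ None * d) *\<^sub>C v)) D f +
     pm_sum2 (\<lambda>r k c v. single (k + rest r) ((C0 * c) *\<^sub>C v)) (K0_part z) f"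

lemma rest_emb [simp]: "rest (emb r) = r"
  by (simp add: rest_def emb_def vec_eq_iff)

lemma rest_zero [simp]: "rest 0 = 0"
  by (simp add: rest_def vec_eq_iff)

lemma emb_nth [simp]: "emb r $ None = 0" "emb r $ Some j = r $ j"
  by (simp_all add: emb_def)

lemma clinear_zero:
  assumes "clinear_on S f" "0 \<in> S"
  shows "f 0 = 0"
  using assms unfolding clinear_on_def by (metis cv.scale_zero_left)

lemma tensor_lift_zero:
  assumes "bilinear_map B"
  shows "tensor_lift B 0 = 0"
  by (rule clinear_zero[OF tensor_lift_linear[OF assms]]) simp

lemma tensor_linear:
  "(x + x') \<otimes>\<^sub>t y = x \<otimes>\<^sub>t y + x' \<otimes>\<^sub>t y" "x \<otimes>\<^sub>t (y + y') = x \<otimes>\<^sub>t y + x \<otimes>\<^sub>t y'"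
  "(c *\<^sub>C x) \<otimes>\<^sub>t y = c *\<^sub>C (x \<otimes>\<^sub>t y)" "x \<otimes>\<^sub>t (c *\<^sub>C y) = c *\<^sub>C (x \<otimes>\<^sub>t y)"
  by (rule bilinear_tensor[unfolded bilinear_map_def clinear_on_def, THEN conjunct2, rule_format, THEN conjunct1, rule_format]
        bilinear_tensor[unfolded bilinear_map_def clinear_on_def, THEN conjunct1, rule_format, THEN conjunct1, rule_format]
        bilinear_tensor[unfolded bilinear_map_def clinear_on_def, THEN conjunct2, rule_format, THEN conjunct2, rule_format]
        bilinear_tensor[unfolded bilinear_map_def clinear_on_def, THEN conjunct1, rule_format, THEN conjunct2, rule_format]; simp)+

lemma tensor_zero_left [simp]: "0 \<otimes>\<^sub>t y = 0"
  using tensor_linear(3)[of 0 0 y] by simp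

lemma tensor_zero_right [simp]: "x \<otimes>\<^sub>t 0 = 0"
  using tensor_linear(4)[of x 0 0] by simp

lemma bilinear_tensor_map:
  assumes "clinear_on UNIV f" "clinear_on UNIV g"
  shows "bilinear_map (\<lambda>v1 v2. f v1 \<otimes>\<^sub>t g v2)"
  using assms by (simp add: bilinear_map_def clinear_on_def tensor_linear)

lemma clinear_id: "clinear_on UNIV (\<lambda>x. x)"
  by (simp add: clinear_on_def)

lemma K0_part_zero [simp]: "K0_part 0 = 0"
  by transfer (rule poly_mapping_eqI, simp add: Poly_Mapping.mapp.rep_eq)

lemma K0_part_emb: "K0_part (Kmono (emb r) c) = single (emb r) (c $ None)"
  by transfer (rule poly_mapping_eqI, auto simp: Poly_Mapping.mapp.rep_eq lookup_single when_def)

definition D_elt :: "complex ^ 'n \<Rightarrow> int ^ 'n \<Rightarrow> ('g::complex_vector, 'n::finite) toroidal" where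
  "D_elt u r = (\<Sum>i\<in>UNIV. u $ i *\<^sub>C d_elt (emb r) (Some i))"

lemma D_elt_eq:
  "(D_elt u r :: ('g::complex_vector, 'n::finite) toroidal) = (0, 0, single (emb r) (\<chi> i. case i of None \<Rightarrow> 0 | Some j \<Rightarrow> u $ j))"
proof -
  have "(\<Sum>i\<in>S. u $ i *\<^sub>C (d_elt (emb r) (Some i) :: ('g, 'n) toroidal)) =
      (0, 0, single (emb r) (\<Sum>i\<in>S. u $ i *\<^sub>C axis (Some i) 1))" for S
    by (induction S rule: infinite_finite_induct)
      (simp_all add: d_elt_def toroidal_scale zero_prod_def scaleC_single single_add)
  moreover have "(\<Sum>i\<in>UNIV. u $ i *\<^sub>C axis (Some i) 1) = (\<chi> i. case i of None \<Rightarrow> 0 | Some j \<Rightarrow> u $ j)"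
    by (auto simp: vec_eq_iff scaleC_vec_def scaleC_complex_def axis_def if_distrib split: option.split cong: if_cong)
  ultimately show ?thesis by (simp add: D_elt_def)
qed

lemma tensor_act_loop:
  assumes "clinear_on UNIV (act2 X)" "\<And>v. act2 0 v = 0"
  shows "tensor_act act1 act2 \<alpha> d C0 (loop_elt X (emb l)) (single k (v1 \<otimes>\<^sub>t v2)) =
    single (k + l) (v1 \<otimes>\<^sub>t act2 X v2)"
proof -
  have b: "bilinear_map (\<lambda>v1 v2. v1 \<otimes>\<^sub>t act2 X v2)"
    by (rule bilinear_tensor_map[OF clinear_id assms(1)])
  show ?thesis
  proof (cases "v1 \<otimes>\<^sub>t v2 = 0")
    case True
    then have "v1 \<otimes>\<^sub>t act2 X v2 = 0"
      by (metis b tensor_lift_tensor tensor_lift_zero)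
    with True show ?thesis by (simp add: loop_elt_def)
  next
    case False
    with b show ?thesis
      by (cases "X = 0") (simp_all add: loop_elt_def pm_sum2_def tensor_lift_tensor[OF b] assms(2))
  qed
qed

lemma tensor_act_D:
  assumes "\<And>Y. clinear_on UNIV (act1 Y)"
  shows "tensor_act act1 act2 \<alpha> d C0 (D_elt u r) (single k (v1 \<otimes>\<^sub>t v2)) =
    (\<Sum>i\<in>UNIV. u $ i * (of_int (k $ i) + \<alpha> $ i)) *\<^sub>C single (k + r) (v1 \<otimes>\<^sub>t v2) +
    (\<Sum>i\<in>UNIV. \<Sum>j\<in>UNIV. (u $ i * of_int (r $ j)) *\<^sub>C single (k + r) (act1 (gl_unit j i) v1 \<otimes>\<^sub>t v2))"
proof -
  have b: "bilinear_map (\<lambda>v1 v2. act1 Y v1 \<otimes>\<^sub>t v2)" for Y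
    by (rule bilinear_tensor_map[OF assms clinear_id])
  note z = tensor_lift_zero[OF b]
  have sum: "(\<Sum>i\<in>S. single q (f i)) = single q (\<Sum>i\<in>S. f i)" for S :: "'x set" and q :: "int ^ 'n" and f :: "'x \<Rightarrow> ('b, 'c) tensor"
    by (induction S rule: infinite_finite_induct) (simp_all add: single_add)
  show ?thesis
    unfolding D_elt_eq tensor_act.simps pm_sum2_zero K0_part_zero add_0_left add_0_right
    by (subst pm_sum2_single)
      (simp_all add: z tensor_lift_tensor[OF b] scaleC_single sum flip: single_add)
qed

lemma tensor_act_d0:
  fixes \<alpha> :: "complex ^ ('n::finite)"
  assumes "\<And>Y. clinear_on UNIV (act1 Y)"
  shows "tensor_act act1 act2 \<alpha> d C0 (d_elt (emb r) None) (single k (v1 \<otimes>\<^sub>t v2)) = d *\<^sub>C single (k + r) (v1 \<otimes>\<^sub>t v2)"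
proof -
  have b: "bilinear_map (\<lambda>v1 v2. act1 Y v1 \<otimes>\<^sub>t v2)" for Y
    by (rule bilinear_tensor_map[OF assms clinear_id])
  have [simp]: "axis (None :: 'n option) (1::complex) $ Some i = 0" "axis (None :: 'n option) (1::complex) $ None = 1" for i
    by (simp_all add: axis_def)
  show ?thesis
    unfolding d_elt_def tensor_act.simps pm_sum2_zero K0_part_zero add_0_left add_0_right
    by (subst pm_sum2_single) (simp_all add: tensor_lift_zero[OF b] scaleC_single)
qed

lemma tensor_act_K:
  "tensor_act act1 act2 \<alpha> d C0 (K_elt (emb r) p) (single k (v1 \<otimes>\<^sub>t v2)) =
     (if p = None then C0 *\<^sub>C single (k + r) (v1 \<otimes>\<^sub>t v2) else 0)"
proof -
  have [simp]: "axis p (1::complex) $ None = (if p = None then 1 else 0)"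
    by (simp add: axis_def)
  show ?thesis
    unfolding K_elt_def tensor_act.simps K0_part_emb pm_sum2_zero K0_part_zero add_0_left add_0_right
    by (subst pm_sum2_single) (simp_all add: scaleC_single)
qed

end

theory Submission
  imports Defs "HOL-Computational_Algebra.Fundamental_Theorem_Algebra"
begin

text \<open>
  The isomorphism is constructed as a graph. Let \<open>f : T \<rightarrow> T'\<close> be the given isomorphism and let
  \<open>J : T' \<rightarrow> S'\<close> be induced by the embedding of \<open>W\<^sub>2\<close> into \<open>W\<^sub>2(\<sigma>\<^sub>0)\<close>. The pairs \<open>(t, J (f t))\<close> form a
  \<open>\<tau>\<^sup>0\<close>-submodule of \<open>S \<times> S'\<close> that is killed by the raising operators. So they generate a \<open>\<tau>\<^sub>0\<close>-submodule \<open>G\<close>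
  by lowering operators alone (\<open>lowered_submodule\<close>). Let \<open>h0\<close> be an element of the Cartan subalgebra on
  which all positive roots are positive real numbers. It acts on the pairs by a scalar and lowering
  operators strictly decrease its eigenvalue, so the pairs are the full top eigenspace of \<open>h0\<close> in \<open>G\<close>
  (\<open>lowered_top\<close>). This turns statements about \<open>G\<close> into statements about the pairs, and it remains to see that
  \<open>G\<close> projects bijectively onto \<open>S\<close> and onto \<open>S'\<close>.

  The module \<open>S\<close> is irreducible over \<open>\<tau>\<^sub>0\<close> (\<open>S_irreducible\<close>): as \<open>V\<close> is irreducible, it is generated from any
  eigenvector of \<open>d\<^sub>0\<close> in \<open>S\<close> by \<open>\<tau>\<^sub>0\<close> followed by operators that lower the eigenvalue of \<open>d\<^sub>0\<close>, and \<open>d\<^sub>0\<close> turns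
  out to be a scalar on \<open>S\<close>. So \<open>G\<close> projects onto \<open>S\<close>, and it contains no \<open>(v, 0)\<close> with \<open>v \<noteq> 0\<close>, since
  otherwise it would contain all \<open>(t, 0)\<close>, which have the top eigenvalue. The module \<open>S'\<close> is generated by the
  image of \<open>J\<close>, because \<open>W\<^sub>2(\<sigma>\<^sub>0)\<close> is generated by \<open>W\<^sub>2\<close>. Finally, if \<open>(0, p) \<in> G\<close> with \<open>p \<noteq> 0\<close>, then a contraction
  of \<open>p\<close> over \<open>W\<^sub>1\<close> is a nonzero vector of \<open>W\<^sub>2(\<sigma>\<^sub>0)\<close>. By graded irreducibility, homogeneous elements of
  \<open>\<gg>(\<sigma>\<^sub>0)\<close> move it to a vector with nonzero component in the top eigenspace (\<open>reaches_top\<close>). Hence \<open>G\<close> would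
  contain a pair \<open>(0, p')\<close> of the top eigenvalue with \<open>p' \<noteq> 0\<close>, which is not one of the generating pairs.

  The structure theory that this needs is derived from traces on the generalised weight spaces of the
  Cartan subalgebra \<open>H\<close>. Let \<open>e\<close> and \<open>f\<close> be vectors of opposite weights \<open>\<alpha>\<close> and \<open>-\<alpha>\<close>. Averaging \<open>[e, f]\<close>
  over the automorphisms gives an element of \<open>H\<close> with the same traces on the weight spaces, and these traces
  telescope along \<open>\<alpha>\<close>-strings. Hence the Killing form is non-degenerate (\<open>killing_nondeg\<close>), derivations are
  inner, \<open>H\<close> acts diagonalisably (\<open>H_diagonal\<close>), and the element dual to the sum of the positive roots (with multiplicities) can serve
  as \<open>h0\<close> (\<open>positive_element_exists\<close>). Moreover the invariant form is a multiple of the Killing form, so it is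
  preserved by the automorphisms, and the toroidal algebra is closed under its bracket.
\<close>

section \<open>Linear algebra\<close>

interpretation cvp: vector_space_pair "scaleC :: complex \<Rightarrow> 'a \<Rightarrow> 'a::complex_vector"
  "scaleC :: complex \<Rightarrow> 'b \<Rightarrow> 'b::complex_vector"
  by unfold_locales

abbreviation clinear :: "('a::complex_vector \<Rightarrow> 'b::complex_vector) \<Rightarrow> bool" where
  "clinear \<equiv> Vector_Spaces.linear scaleC scaleC"

lemma clinear_iff: "clinear f \<longleftrightarrow> (\<forall>x y. f (x + y) = f x + f y) \<and> (\<forall>c x. f (c *\<^sub>C x) = c *\<^sub>C f x)"
  by (simp add: Vector_Spaces.linear_iff cv.vector_space_axioms)

lemma clinear_on_UNIV: "clinear_on UNIV f \<longleftrightarrow> clinear f"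
  by (simp add: clinear_on_def clinear_iff)

lemma clinearI:
  assumes "\<And>x y. f (x + y) = f x + f y" "\<And>c x. f (c *\<^sub>C x) = c *\<^sub>C f x"
  shows "clinear f"
  using assms by (simp add: clinear_iff)

lemmas clinear_add = cvp.linear_add
lemmas clinear_scale = cvp.linear_scale
lemmas clinear_diff = cvp.linear_diff
lemmas clinear_neg = cvp.linear_neg
lemmas clinear_0 = cvp.linear_0
lemmas clinear_sum = cvp.linear_sum

lemma clinear_ident: "clinear (\<lambda>x. x)"
  by (simp add: clinear_iff)

lemma clinear_zero_map: "clinear (\<lambda>x. 0)"
  by (simp add: clinear_iff)

lemma clinear_plus: "clinear f \<Longrightarrow> clinear g \<Longrightarrow> clinear (\<lambda>x. f x + g x)"
  by (simp add: clinear_iff scaleC_right_distrib)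

lemma clinear_minus: "clinear f \<Longrightarrow> clinear g \<Longrightarrow> clinear (\<lambda>x. f x - g x)"
  by (rule cvp.module_hom_sub)

lemma clinear_scaled: "clinear f \<Longrightarrow> clinear (\<lambda>x. c *\<^sub>C f x)"
  by (rule cvp.module_hom_scale)

lemma clinear_comp: "clinear f \<Longrightarrow> clinear g \<Longrightarrow> clinear (\<lambda>x. f (g x))"
  by (simp add: clinear_iff)

lemma clinear_sum_map: "(\<And>i. i \<in> I \<Longrightarrow> clinear (f i)) \<Longrightarrow> clinear (\<lambda>x. \<Sum>i\<in>I. f i x)"
  by (rule cvp.linear_compose_sum) blast

lemma clinear_fun: "clinear c \<Longrightarrow> clinear (\<lambda>x. c x *\<^sub>C v)" for c :: "'a::complex_vector \<Rightarrow> complex"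
  by (simp add: clinear_iff scaleC_complex_def scaleC_left_distrib scaleC_scaleC)

lemma clinear_funpow: "clinear f \<Longrightarrow> clinear (f ^^ m)" for f :: "'a::complex_vector \<Rightarrow> 'a"
  by (induction m) (simp_all add: clinear_iff)

lemmas clinear_intros = clinear_ident clinear_zero_map clinear_plus clinear_minus clinear_scaled clinear_sum_map

lemma span_map_into:
  assumes "clinear f" "cv.subspace U" "\<And>s. s \<in> S \<Longrightarrow> f s \<in> U" "x \<in> cv.span S"
  shows "f x \<in> U"
  using assms(4)
proof (induction rule: cv.span_induct)
  case base
  show ?case using assms(1,2)
    by (auto simp: cv.subspace_def clinear_add clinear_scale clinear_0)
qed (use assms(3) in simp)

lemma subspace_Collect_linear:
  assumes "clinear f" "cv.subspace U"
  shows "cv.subspace {x. f x \<in> U}"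
  using assms by (rule cvp.linear_subspace_linear_preimage)

lemma subspace_kernel: "clinear f \<Longrightarrow> cv.subspace {x. f x = 0}"
  by (rule cvp.linear_subspace_kernel)

lemma clinear_eq_on_span:
  assumes "clinear f" "clinear g" "\<And>s. s \<in> S \<Longrightarrow> f s = g s" "x \<in> cv.span S"
  shows "f x = g x"
proof -
  have "f x - g x \<in> {0}"
    by (rule span_map_into[OF clinear_minus[OF assms(1,2)] cv.subspace_single_0 _ assms(4)]) (simp add: assms(3))
  then show ?thesis by simp
qed

lemma span_UN_decomposition:
  assumes "x \<in> cv.span (\<Union>i\<in>I. U i)" "\<And>i. i \<in> I \<Longrightarrow> cv.subspace (U i)"
  obtains F y where "finite F" "F \<subseteq> I" "\<And>i. i \<in> F \<Longrightarrow> y i \<in> U i" "x = (\<Sum>i\<in>F. y i)"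
proof -
  have "\<exists>F y. finite F \<and> F \<subseteq> I \<and> (\<forall>i\<in>F. y i \<in> U i) \<and> x = (\<Sum>i\<in>F. y i)"
    using assms(1)
  proof (induction rule: cv.span_induct_alt)
    case base
    show ?case by (rule exI[of _ "{}"]) simp
  next
    case (step c u v)
    from step.IH obtain F y where Fy: "finite F" "F \<subseteq> I" "\<forall>i\<in>F. y i \<in> U i" "v = (\<Sum>i\<in>F. y i)" by blast
    from step.hyps obtain j where j: "j \<in> I" "u \<in> U j" by blast
    let ?y = "\<lambda>i. (if i \<in> F then y i else 0) + (if i = j then c *\<^sub>C u else 0)"
    have "(\<Sum>i\<in>insert j F. ?y i) = (\<Sum>i\<in>insert j F. if i \<in> F then y i else 0) + (\<Sum>i\<in>insert j F. if i = j then c *\<^sub>C u else 0)"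
      by (rule sum.distrib)
    also have "(\<Sum>i\<in>insert j F. if i \<in> F then y i else 0) = (\<Sum>i\<in>F. y i)"
      using Fy(1) by (intro sum.mono_neutral_cong_right) auto
    also have "(\<Sum>i\<in>insert j F. if i = j then c *\<^sub>C u else 0) = c *\<^sub>C u"
      using Fy(1) by simp
    finally have "c *\<^sub>C u + v = (\<Sum>i\<in>insert j F. ?y i)" using Fy(4) by simp
    moreover have "\<forall>i\<in>insert j F. ?y i \<in> U i"
      using Fy(2,3) j assms(2) by (auto intro!: cv.subspace_add cv.subspace_scale cv.subspace_0)
    ultimately show ?case using Fy(1,2) j(1)
      by (intro exI[of _ "insert j F"] exI[of _ ?y]) blast
  qed
  then show ?thesis using that by blast
qed

lemma subspace_eigenspace: "clinear f \<Longrightarrow> cv.subspace {v. f v = c *\<^sub>C v}"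
  by (auto simp: cv.subspace_def clinear_add clinear_scale clinear_0 scaleC_right_distrib scaleC_scaleC mult.commute)

text \<open>Applying \<open>f - c\<close> removes the component of eigenvalue \<open>c\<close> and rescales the others by nonzero
  factors.\<close>

lemma eigencomponents_in_invariant_subspace:
  assumes "clinear f" "cv.subspace U" "\<And>u. u \<in> U \<Longrightarrow> f u \<in> U"
    and "finite F" "\<And>d. d \<in> F \<Longrightarrow> f (y d) = d *\<^sub>C y d" "(\<Sum>d\<in>F. y d) \<in> U"
  shows "d \<in> F \<Longrightarrow> y d \<in> U"
  using assms(4-6)
proof (induction F arbitrary: y d rule: finite_induct)
  case (insert c F)
  have "f (\<Sum>d\<in>insert c F. y d) - c *\<^sub>C (\<Sum>d\<in>insert c F. y d) \<in> U"
    using insert.prems(3) assms(2,3) by (intro cv.subspace_diff cv.subspace_scale) auto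
  also have "f (\<Sum>d\<in>insert c F. y d) - c *\<^sub>C (\<Sum>d\<in>insert c F. y d) = (\<Sum>d\<in>F. (d - c) *\<^sub>C y d)"
    using insert.hyps insert.prems(2)
    by (simp add: clinear_sum[OF assms(1)] clinear_add[OF assms(1)] cv.scale_sum_right scaleC_right_distrib
        cv.scale_left_diff_distrib sum_subtractf)
  finally have "(d - c) *\<^sub>C y d \<in> U" if "d \<in> F" for d
    using insert.IH[of d "\<lambda>d. (d - c) *\<^sub>C y d"] insert.prems(2) that
    by (simp add: clinear_scale[OF assms(1)] scaleC_scaleC mult.commute)
  then have in_U: "y d \<in> U" if "d \<in> F" for d
    using cv.subspace_scale[OF assms(2), of "(d - c) *\<^sub>C y d" "inverse (d - c)"] that insert.hyps(2)
    by (cases "d = c") (auto simp: scaleC_scaleC scaleC_one)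
  have "y c = (\<Sum>d\<in>insert c F. y d) - (\<Sum>d\<in>F. y d)" using insert.hyps by simp
  then have "y c \<in> U"
    using insert.prems(3) in_U assms(2) by (metis cv.subspace_diff cv.subspace_sum)
  with in_U insert.prems(1) show ?case by blast
qed simp

lemma span_eigenvectors_decomposition:
  assumes "clinear f" "x \<in> cv.span {v. \<exists>d\<in>D. f v = d *\<^sub>C v}"
  obtains F y where "finite F" "F \<subseteq> D" "\<And>d. d \<in> F \<Longrightarrow> f (y d) = d *\<^sub>C y d" "x = (\<Sum>d\<in>F. y d)"
proof -
  have "{v. \<exists>d\<in>D. f v = d *\<^sub>C v} = (\<Union>d\<in>D. {v. f v = d *\<^sub>C v})" by blast
  with assms(2) have x: "x \<in> cv.span (\<Union>d\<in>D. {v. f v = d *\<^sub>C v})" by simp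
  obtain F y where Fy: "finite F" "F \<subseteq> D" "\<And>d. d \<in> F \<Longrightarrow> y d \<in> {v. f v = d *\<^sub>C v}" "x = (\<Sum>d\<in>F. y d)"
    by (rule span_UN_decomposition[OF x subspace_eigenspace[OF assms(1)]]) blast
  show ?thesis by (rule that[OF Fy(1,2) _ Fy(4)]) (use Fy(3) in blast)
qed

text \<open>A component of an eigenvector outside its own eigenvalue vanishes.\<close>

lemma eigenvector_in_span_eigenvectors:
  assumes "clinear f" "x \<in> cv.span {v. \<exists>d\<in>D. f v = d *\<^sub>C v}" "f x = c *\<^sub>C x" "c \<notin> D"
  shows "x = 0"
proof -
  obtain F y where Fy: "finite F" "F \<subseteq> D" "\<And>d. d \<in> F \<Longrightarrow> f (y d) = d *\<^sub>C y d" "x = (\<Sum>d\<in>F. y d)"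
    by (rule span_eigenvectors_decomposition[OF assms(1,2)]) blast
  have "c \<notin> F" using Fy(2) assms(4) by blast
  let ?y = "y(c := - x)"
  have "?y c \<in> {0}"
  proof (rule eigencomponents_in_invariant_subspace[OF assms(1) cv.subspace_single_0, where F = "insert c F" and y = ?y and d = c])
    show "f u \<in> {0}" if "u \<in> {0}" for u using that clinear_0[OF assms(1)] by simp
    show "f (?y d) = d *\<^sub>C ?y d" if "d \<in> insert c F" for d
      using that Fy(3) assms(3) clinear_neg[OF assms(1)] by (auto simp: cv.scale_minus_right)
    have "(\<Sum>d\<in>F. ?y d) = x" using \<open>c \<notin> F\<close> Fy(4) by (metis (mono_tags, lifting) fun_upd_other sum.cong)
    then show "(\<Sum>d\<in>insert c F. ?y d) \<in> {0}" using \<open>c \<notin> F\<close> Fy(1) by simp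
  qed (use Fy(1) in auto)
  then show ?thesis by simp
qed

text \<open>On a space spanned by eigenvectors, \<open>f - c\<close> maps onto the sum of the eigenspaces of the other
  eigenvalues.\<close>

lemma range_shift_of_eigenvectors:
  assumes "clinear f" "finite F" "\<And>d. d \<in> F \<Longrightarrow> f (y d) = d *\<^sub>C y d" "c \<in> F \<Longrightarrow> y c = 0"
  shows "\<exists>w. (\<Sum>d\<in>F. y d) = f w - c *\<^sub>C w"
proof
  let ?w = "\<Sum>d\<in>F. inverse (d - c) *\<^sub>C y d"
  have "inverse (d - c) *\<^sub>C (d *\<^sub>C y d) - c *\<^sub>C (inverse (d - c) *\<^sub>C y d) = y d" if "d \<in> F" for d
  proof (cases "d = c")
    case False
    have "inverse (d - c) *\<^sub>C (d *\<^sub>C y d) - c *\<^sub>C (inverse (d - c) *\<^sub>C y d) = ((d - c) * inverse (d - c)) *\<^sub>C y d"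
      by (simp only: scaleC_scaleC left_diff_distrib cv.scale_left_diff_distrib mult.commute)
    with False show ?thesis by (simp add: scaleC_one)
  qed (use that assms(4) in simp)
  then show "(\<Sum>d\<in>F. y d) = f ?w - c *\<^sub>C ?w"
    using assms(3) by (simp add: clinear_sum[OF assms(1)] clinear_scale[OF assms(1)] cv.scale_sum_right flip: sum_subtractf)
qed

subsection \<open>Generalised eigenspaces\<close>

definition generalised_eigenspace :: "('a::complex_vector \<Rightarrow> 'a) \<Rightarrow> complex \<Rightarrow> 'a set" where
  "generalised_eigenspace f c = {x. \<exists>m. ((\<lambda>y. f y - c *\<^sub>C y) ^^ m) x = 0}"

lemma clinear_shift: "clinear f \<Longrightarrow> clinear (\<lambda>y. f y - c *\<^sub>C y)"
  by (intro clinear_intros)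

lemma funpow_zero_mono:
  fixes f :: "'a::complex_vector \<Rightarrow> 'a"
  assumes "clinear f" "(f ^^ m) x = 0" "m \<le> n"
  shows "(f ^^ n) x = 0"
proof -
  have "f ^^ n = (f ^^ (n - m)) \<circ> (f ^^ m)" using assms(3) by (simp flip: funpow_add)
  then show ?thesis using assms(2) clinear_0[OF clinear_funpow[OF assms(1)]] by simp
qed

lemma subspace_generalised_eigenspace:
  assumes "clinear f"
  shows "cv.subspace (generalised_eigenspace f c)"
proof -
  let ?g = "\<lambda>y. f y - c *\<^sub>C y"
  note lin = clinear_shift[OF assms, of c]
  have "x + y \<in> generalised_eigenspace f c" if xy: "x \<in> generalised_eigenspace f c" "y \<in> generalised_eigenspace f c" for x y
  proof -
    from xy obtain m n where "(?g ^^ m) x = 0" "(?g ^^ n) y = 0" by (auto simp: generalised_eigenspace_def)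
    then have "(?g ^^ max m n) x = 0" "(?g ^^ max m n) y = 0"
      by (auto intro: funpow_zero_mono[OF lin])
    then have "(?g ^^ max m n) (x + y) = 0"
      by (simp add: clinear_add[OF clinear_funpow[OF lin]])
    then show ?thesis by (auto simp: generalised_eigenspace_def)
  qed
  moreover have "a *\<^sub>C x \<in> generalised_eigenspace f c" if "x \<in> generalised_eigenspace f c" for a x
    using that by (auto simp: generalised_eigenspace_def clinear_scale[OF clinear_funpow[OF lin]] intro!: exI)
  moreover have "0 \<in> generalised_eigenspace f c"
    by (auto simp: generalised_eigenspace_def intro!: exI[of _ 0])
  ultimately show ?thesis by (auto simp: cv.subspace_def)
qed

lemma generalised_eigenspace_shift_iff:
  "f x - c *\<^sub>C x \<in> generalised_eigenspace f c \<longleftrightarrow> x \<in> generalised_eigenspace f c" if "clinear f"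
proof
  assume "f x - c *\<^sub>C x \<in> generalised_eigenspace f c"
  then obtain m where "((\<lambda>y. f y - c *\<^sub>C y) ^^ m) (f x - c *\<^sub>C x) = 0" by (auto simp: generalised_eigenspace_def)
  then have "((\<lambda>y. f y - c *\<^sub>C y) ^^ Suc m) x = 0" by (simp only: funpow_Suc_right o_apply)
  then show "x \<in> generalised_eigenspace f c" unfolding generalised_eigenspace_def by blast
next
  assume "x \<in> generalised_eigenspace f c"
  then obtain m where "((\<lambda>y. f y - c *\<^sub>C y) ^^ m) x = 0" by (auto simp: generalised_eigenspace_def)
  then have "((\<lambda>y. f y - c *\<^sub>C y) ^^ Suc m) x = 0" by (rule funpow_zero_mono[OF clinear_shift[OF that]]) simp
  then have "((\<lambda>y. f y - c *\<^sub>C y) ^^ m) (f x - c *\<^sub>C x) = 0" by (simp only: funpow_Suc_right o_apply)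
  then show "f x - c *\<^sub>C x \<in> generalised_eigenspace f c" unfolding generalised_eigenspace_def by blast
qed

text \<open>On the generalised eigenspace of \<open>a \<noteq> c\<close> the operator \<open>f - c\<close> is the sum of the nonzero scalar
  \<open>a - c\<close> and a nilpotent operator, hence invertible.\<close>

lemma shift_surj_generalised_eigenspace:
  assumes "clinear f" "cv.subspace M" "\<And>x. x \<in> M \<Longrightarrow> f x \<in> M" "a \<noteq> c"
    and "v \<in> generalised_eigenspace f a" "v \<in> M"
  shows "\<exists>w. w \<in> generalised_eigenspace f a \<and> w \<in> M \<and> f w - c *\<^sub>C w = v"
proof -
  from assms(5) obtain m where "((\<lambda>y. f y - a *\<^sub>C y) ^^ m) v = 0" by (auto simp: generalised_eigenspace_def)
  then show ?thesis using assms(6)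
  proof (induction m arbitrary: v)
    case 0
    then show ?case using assms(2) clinear_0[OF assms(1)]
      by (intro exI[of _ 0]) (auto simp: generalised_eigenspace_def intro: cv.subspace_0 exI[of _ 0])
  next
    case (Suc m)
    let ?G = "generalised_eigenspace f a"
    note sub = subspace_generalised_eigenspace[OF assms(1), of a]
    define u where "u = inverse (a - c) *\<^sub>C (f v - a *\<^sub>C v)"
    have v: "v \<in> ?G" using Suc.prems(1) unfolding generalised_eigenspace_def by blast
    have "((\<lambda>y. f y - a *\<^sub>C y) ^^ m) (f v - a *\<^sub>C v) = 0"
      using Suc.prems(1) by (simp only: funpow_Suc_right o_apply)
    then have "((\<lambda>y. f y - a *\<^sub>C y) ^^ m) u = 0"
      by (simp add: u_def clinear_scale[OF clinear_funpow[OF clinear_shift[OF assms(1)]]])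
    moreover have "u \<in> M"
      using Suc.prems(2) assms(2,3) by (auto simp: u_def intro!: cv.subspace_scale cv.subspace_diff)
    ultimately obtain w where w: "w \<in> ?G" "w \<in> M" "f w - c *\<^sub>C w = u" using Suc.IH by blast
    let ?w = "inverse (a - c) *\<^sub>C v - w"
    have "f ?w - c *\<^sub>C ?w = inverse (a - c) *\<^sub>C (f v - c *\<^sub>C v) - (f w - c *\<^sub>C w)"
      by (simp add: clinear_diff[OF assms(1)] clinear_scale[OF assms(1)] cv.scale_right_diff_distrib scaleC_scaleC mult.commute)
    also have "\<dots> = inverse (a - c) *\<^sub>C ((f v - c *\<^sub>C v) - (f v - a *\<^sub>C v))"
      by (simp only: w(3) u_def cv.scale_right_diff_distrib)
    also have "(f v - c *\<^sub>C v) - (f v - a *\<^sub>C v) = (a - c) *\<^sub>C v"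
      by (simp add: cv.scale_left_diff_distrib)
    also have "inverse (a - c) *\<^sub>C (a - c) *\<^sub>C v = ((a - c) * inverse (a - c)) *\<^sub>C v"
      by (simp only: scaleC_scaleC mult.commute)
    finally have "f ?w - c *\<^sub>C ?w = v" using assms(4) by (simp add: scaleC_one)
    moreover have "?w \<in> ?G" using sub v w(1) by (intro cv.subspace_diff cv.subspace_scale)
    moreover have "?w \<in> M" using assms(2) Suc.prems(2) w(2) by (intro cv.subspace_diff cv.subspace_scale)
    ultimately show ?case by blast
  qed
qed

text \<open>As \<open>f - a\<close> and \<open>f - c\<close> commute, induction on the power of \<open>f - a\<close> that kills \<open>v\<close> reduces this to an
  eigenvector of eigenvalue \<open>a\<close>, which \<open>(f - c)\<^sup>n\<close> multiplies by \<open>(a - c)\<^sup>n\<close>.\<close>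

lemma shift_inj_generalised_eigenspace:
  assumes "clinear f" "a \<noteq> c" "v \<in> generalised_eigenspace f a" "v \<in> generalised_eigenspace f c"
  shows "v = 0"
proof -
  have "v = 0" if "((\<lambda>y. f y - a *\<^sub>C y) ^^ m) v = 0" "((\<lambda>y. f y - c *\<^sub>C y) ^^ n) v = 0" for m n v
    using that
  proof (induction m arbitrary: n v)
    case (Suc m)
    let ?u = "f v - a *\<^sub>C v"
    have comm: "((\<lambda>y. f y - c *\<^sub>C y) ^^ n) ?u = f (((\<lambda>y. f y - c *\<^sub>C y) ^^ n) v) - a *\<^sub>C ((\<lambda>y. f y - c *\<^sub>C y) ^^ n) v" for n
      by (induction n) (simp_all add: clinear_diff[OF assms(1)] clinear_scale[OF assms(1)] cv.scale_right_diff_distrib scaleC_scaleC mult.commute)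
    have "?u = 0"
    proof (rule Suc.IH)
      show "((\<lambda>y. f y - a *\<^sub>C y) ^^ m) ?u = 0"
        using Suc.prems(1) by (simp only: funpow_Suc_right o_apply)
      show "((\<lambda>y. f y - c *\<^sub>C y) ^^ n) ?u = 0"
        using comm Suc.prems(2) clinear_0[OF assms(1)] by simp
    qed
    then have fv: "f v = a *\<^sub>C v" by simp
    have "((\<lambda>y. f y - c *\<^sub>C y) ^^ n) v = (a - c) ^ n *\<^sub>C v" for n
      by (induction n) (simp_all add: fv clinear_scale[OF assms(1)] scaleC_one scaleC_scaleC left_diff_distrib mult.commute flip: cv.scale_left_diff_distrib)
    with Suc.prems(2) assms(2) show ?case by simp
  qed simp
  with assms(3,4) show ?thesis by (auto simp: generalised_eigenspace_def)
qed

definition poly_apply :: "('a::complex_vector \<Rightarrow> 'a) \<Rightarrow> complex poly \<Rightarrow> 'a \<Rightarrow> 'a" where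
  "poly_apply f p x = (\<Sum>i\<le>degree p. coeff p i *\<^sub>C (f ^^ i) x)"

lemma poly_apply_eq:
  assumes "degree p \<le> n"
  shows "poly_apply f p x = (\<Sum>i\<le>n. coeff p i *\<^sub>C (f ^^ i) x)"
  unfolding poly_apply_def using assms
  by (intro sum.mono_neutral_left) (auto simp: coeff_eq_0)

lemma poly_apply_linear_factor:
  assumes "clinear f"
  shows "poly_apply f ([:- c, 1:] * q) x = poly_apply f q (f x - c *\<^sub>C x)"
proof -
  let ?n = "Suc (degree q)"
  have deg: "degree ([:- c, 1:] * q) \<le> ?n"
    using degree_mult_le[of "[:- c, 1:]" q] by simp
  have coeff: "coeff ([:- c, 1:] * q) i = (case i of 0 \<Rightarrow> 0 | Suc j \<Rightarrow> coeff q j) - c * coeff q i" for i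
    by (simp add: coeff_pCons algebra_simps split: nat.split)
  have pow: "(f ^^ i) (f x) = f ((f ^^ i) x)" for i
    by (metis funpow_swap1)
  have "poly_apply f ([:- c, 1:] * q) x = (\<Sum>i\<le>?n. coeff ([:- c, 1:] * q) i *\<^sub>C (f ^^ i) x)"
    by (rule poly_apply_eq[OF deg])
  also have "\<dots> = (\<Sum>i\<le>?n. (case i of 0 \<Rightarrow> 0 | Suc j \<Rightarrow> coeff q j) *\<^sub>C (f ^^ i) x) - (\<Sum>i\<le>?n. (c * coeff q i) *\<^sub>C (f ^^ i) x)"
    unfolding coeff by (simp only: cv.scale_left_diff_distrib sum_subtractf)
  also have "(\<Sum>i\<le>?n. (case i of 0 \<Rightarrow> 0 | Suc j \<Rightarrow> coeff q j) *\<^sub>C (f ^^ i) x) = (\<Sum>i\<le>degree q. coeff q i *\<^sub>C f ((f ^^ i) x))"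
    by (subst sum.atMost_Suc_shift) simp
  also have "(\<Sum>i\<le>?n. (c * coeff q i) *\<^sub>C (f ^^ i) x) = (\<Sum>i\<le>degree q. coeff q i *\<^sub>C (c *\<^sub>C (f ^^ i) x))"
    by (simp add: coeff_eq_0 scaleC_scaleC mult.commute)
  finally show ?thesis
    by (simp add: poly_apply_def clinear_diff[OF clinear_funpow[OF assms]] clinear_scale[OF clinear_funpow[OF assms]] pow
        cv.scale_right_diff_distrib sum_subtractf)
qed

lemma annihilating_polynomial:
  assumes "fin_dim (UNIV :: 'a::complex_vector set)"
  shows "\<exists>p. p \<noteq> 0 \<and> poly_apply f p (x :: 'a) = 0"
proof -
  obtain B :: "'a set" where B: "finite B" "cv.span B = UNIV" using assms by (auto simp: fin_dim_def)
  define e where "e i = (f ^^ i) x" for i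
  show ?thesis
  proof (cases "inj_on e {..card B}")
    case False
    then obtain i j where ij: "e i = e j" "i < j"
      by (metis (no_types, lifting) inj_on_def linorder_neqE_nat)
    let ?p = "monom 1 j - monom 1 i :: complex poly"
    have "degree ?p \<le> j" using ij(2) by (intro degree_diff_le) (simp_all add: degree_monom_eq)
    then have "poly_apply f ?p x = (\<Sum>k\<le>j. coeff ?p k *\<^sub>C e k)" by (simp add: poly_apply_eq e_def)
    also have "\<dots> = (\<Sum>k\<le>j. if k = j then e k else 0) - (\<Sum>k\<le>j. if k = i then e k else 0)"
      unfolding sum_subtractf[symmetric]
      by (rule sum.cong) (auto simp: cv.scale_left_diff_distrib scaleC_one)
    also have "\<dots> = 0" using ij by simp
    finally have "poly_apply f ?p x = 0" .
    moreover have "?p \<noteq> 0"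
      using ij(2) by (metis coeff_diff coeff_monom coeff_0 diff_zero less_irrefl zero_neq_one)
    ultimately show ?thesis by blast
  next
    case True
    then have card: "card (e ` {..card B}) = Suc (card B)" by (simp add: card_image)
    have "cv.dependent (e ` {..card B})"
      using cv.independent_span_bound[OF B(1), of "e ` {..card B}"] B(2) card by auto
    then obtain u where u: "(\<Sum>v\<in>e ` {..card B}. u v *\<^sub>C v) = 0" "\<exists>v\<in>e ` {..card B}. u v \<noteq> 0"
      using cv.dependent_finite[of "e ` {..card B}"] by auto
    define p where "p = (\<Sum>i\<le>card B. monom (u (e i)) i)"
    have coeff: "coeff p i = (if i \<le> card B then u (e i) else 0)" for i
      by (simp add: p_def coeff_sum)
    then have "degree p \<le> card B" by (intro degree_le) auto
    then have "poly_apply f p x = (\<Sum>i\<le>card B. u (e i) *\<^sub>C e i)"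
      by (simp add: poly_apply_eq coeff e_def)
    also have "\<dots> = 0" using u(1) True by (simp add: sum.reindex)
    finally have "poly_apply f p x = 0" .
    moreover have "p \<noteq> 0"
    proof -
      from u(2) obtain i where "i \<le> card B" "u (e i) \<noteq> 0" by auto
      with coeff[of i] show ?thesis by auto
    qed
    ultimately show ?thesis by blast
  qed
qed

text \<open>Induction on the degree of a polynomial that annihilates \<open>x\<close>. If \<open>c\<close> is a root of it, then \<open>f x - c x\<close>
  is annihilated by a polynomial of smaller degree and decomposes. Since \<open>f - c\<close> maps the generalised
  eigenspaces of the other eigenvalues onto themselves, their components lift, and what remains of \<open>x\<close> lies
  in the generalised eigenspace of \<open>c\<close>.\<close>

lemma generalised_eigenspaces_span:
  fixes f :: "'a::complex_vector \<Rightarrow> 'a"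
  assumes "fin_dim (UNIV :: 'a set)" "clinear f" "cv.subspace M" "\<And>x. x \<in> M \<Longrightarrow> f x \<in> M" "x \<in> M"
  shows "x \<in> cv.span (\<Union>c. generalised_eigenspace f c \<inter> M)"
proof -
  let ?G = "\<lambda>c. generalised_eigenspace f c \<inter> M"
  have sub: "cv.subspace (?G c)" for c
    using subspace_generalised_eigenspace[OF assms(2)] assms(3) by (rule cv.subspace_inter)
  have lift: "x \<in> cv.span (\<Union>c. ?G c)" if x: "x \<in> M" "f x - c *\<^sub>C x \<in> cv.span (\<Union>c. ?G c)" for x c
  proof -
    obtain F y where Fy: "finite F" "\<And>a. a \<in> F \<Longrightarrow> y a \<in> ?G a" "f x - c *\<^sub>C x = (\<Sum>a\<in>F. y a)"
      by (rule span_UN_decomposition[OF x(2) sub]) blast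
    have "\<forall>a\<in>F - {c}. \<exists>w. w \<in> ?G a \<and> f w - c *\<^sub>C w = y a"
      using Fy(2) shift_surj_generalised_eigenspace[OF assms(2-4)] by blast
    then obtain w where w: "\<And>a. a \<in> F - {c} \<Longrightarrow> w a \<in> ?G a" "\<And>a. a \<in> F - {c} \<Longrightarrow> f (w a) - c *\<^sub>C w a = y a"
      by metis
    define u where "u = x - (\<Sum>a\<in>F - {c}. w a)"
    have "f u - c *\<^sub>C u = (f x - c *\<^sub>C x) - (\<Sum>a\<in>F - {c}. f (w a) - c *\<^sub>C w a)"
      by (simp add: u_def clinear_diff[OF assms(2)] clinear_sum[OF assms(2)] cv.scale_right_diff_distrib cv.scale_sum_right sum_subtractf)
    also have "\<dots> = (\<Sum>a\<in>F. y a) - (\<Sum>a\<in>F - {c}. y a)" using w(2) Fy(3) by simp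
    also have "\<dots> = (if c \<in> F then y c else 0)"
      using Fy(1) by (simp add: sum.remove)
    also have "\<dots> \<in> ?G c" using Fy(2) cv.subspace_0[OF sub] by simp
    finally have "u \<in> generalised_eigenspace f c" using generalised_eigenspace_shift_iff[OF assms(2)] by blast
    moreover have "u \<in> M" using x(1) w(1) assms(3) by (auto simp: u_def intro!: cv.subspace_diff cv.subspace_sum)
    ultimately have "u \<in> cv.span (\<Union>c. ?G c)" by (intro cv.span_base) blast
    moreover have "(\<Sum>a\<in>F - {c}. w a) \<in> cv.span (\<Union>c. ?G c)" using w(1) by (intro cv.span_sum cv.span_base) blast
    ultimately have "u + (\<Sum>a\<in>F - {c}. w a) \<in> cv.span (\<Union>c. ?G c)" by (rule cv.span_add)
    then show ?thesis by (simp add: u_def)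
  qed
  have "x \<in> cv.span (\<Union>c. ?G c)" if "p \<noteq> 0" "poly_apply f p x = 0" "x \<in> M" "degree p = n" for p n x
    using that
  proof (induction n arbitrary: p x)
    case 0
    then have "coeff p 0 *\<^sub>C x = 0" by (simp add: poly_apply_def)
    with 0 have "x = 0" by (metis cv.scale_eq_0_iff leading_coeff_0_iff)
    then show ?case by (simp add: cv.span_zero)
  next
    case (Suc n)
    then have "\<not> constant (poly p)" by (simp add: constant_degree)
    then obtain c where "poly p c = 0" using fundamental_theorem_of_algebra by blast
    then obtain q where q: "p = [:- c, 1:] * q" by (metis poly_eq_0_iff_dvd dvdE)
    have "q \<noteq> 0" using Suc.prems(1) q by auto
    then have "degree q = n" using Suc.prems(4) degree_mult_eq[of "[:- c, 1:]" q] unfolding q by (simp del: mult_pCons_left)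
    moreover have "poly_apply f q (f x - c *\<^sub>C x) = 0"
      using Suc.prems(2) q poly_apply_linear_factor[OF assms(2)] by simp
    moreover have "f x - c *\<^sub>C x \<in> M" using Suc.prems(3) assms(3,4) by (intro cv.subspace_diff cv.subspace_scale)
    ultimately have "f x - c *\<^sub>C x \<in> cv.span (\<Union>c. ?G c)" using Suc.IH \<open>q \<noteq> 0\<close> by blast
    then show ?case using lift Suc.prems(3) by blast
  qed
  then show ?thesis using annihilating_polynomial[OF assms(1)] assms(5) by blast
qed

lemma eigenvector_exists:
  fixes f :: "'a::complex_vector \<Rightarrow> 'a"
  assumes "fin_dim (UNIV :: 'a set)" "clinear f" "(UNIV :: 'a set) \<noteq> {0}"
  obtains c v where "v \<noteq> 0" "f v = c *\<^sub>C v"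
proof -
  obtain x :: 'a where "x \<noteq> 0" using assms(3) by blast
  have "\<exists>c. generalised_eigenspace f c \<noteq> {0}"
  proof (rule ccontr)
    assume "\<nexists>c. generalised_eigenspace f c \<noteq> {0}"
    then have "x \<in> cv.span {0}"
      using generalised_eigenspaces_span[OF assms(1,2), of UNIV x] by simp
    with \<open>x \<noteq> 0\<close> show False by simp
  qed
  then obtain c y where y: "y \<in> generalised_eigenspace f c" "y \<noteq> 0"
    using cv.subspace_0[OF subspace_generalised_eigenspace[OF assms(2)]] by blast
  let ?g = "\<lambda>y. f y - c *\<^sub>C y"
  define m where "m = (LEAST m. (?g ^^ m) y = 0)"
  have m: "(?g ^^ m) y = 0" using y(1) unfolding m_def generalised_eigenspace_def by (auto intro: LeastI)
  then have "m \<noteq> 0" using y(2) by (cases m) auto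
  then obtain k where k: "m = Suc k" by (cases m) auto
  have "(?g ^^ k) y \<noteq> 0" using not_less_Least[of k "\<lambda>m. (?g ^^ m) y = 0"] k m_def by auto
  moreover have "f ((?g ^^ k) y) = c *\<^sub>C (?g ^^ k) y" using m k by simp
  ultimately show ?thesis using that by blast
qed

subsection \<open>The trace\<close>

definition std_basis :: "'a::complex_vector set" where
  "std_basis = cv.extend_basis {}"

text \<open>The basis is fixed for the whole type; \<open>trace_comp\<close> makes the choice immaterial.\<close>

definition trace :: "('a::complex_vector \<Rightarrow> 'a) \<Rightarrow> complex" where
  "trace f = (\<Sum>b\<in>std_basis. cv.representation std_basis (f b) b)"

lemma std_basis: "cv.independent std_basis" "cv.span std_basis = UNIV"
  unfolding std_basis_def
  by (rule cv.independent_extend_basis[OF cv.independent_empty], rule cv.span_extend_basis[OF cv.independent_empty])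

lemma finite_independent:
  assumes "fin_dim (UNIV :: 'a::complex_vector set)" "cv.independent (B :: 'a set)"
  shows "finite B"
proof -
  obtain C :: "'a set" where "finite C" "UNIV \<subseteq> cv.span C" using assms(1) by (auto simp: fin_dim_def)
  then show ?thesis using cv.independent_span_bound[OF _ assms(2)] by blast
qed

lemma clinear_coordinate: "clinear (\<lambda>v. cv.representation std_basis v b)"
  by (rule clinearI) (simp_all add: cv.representation_add[OF std_basis(1)] cv.representation_scale[OF std_basis(1)] std_basis(2) scaleC_complex_def)

lemma trace_add: "trace (\<lambda>x. f x + g x) = trace f + trace g"
  by (simp add: trace_def clinear_add[OF clinear_coordinate] sum.distrib)

lemma trace_diff: "trace (\<lambda>x. f x - g x) = trace f - trace g"
  by (simp add: trace_def clinear_diff[OF clinear_coordinate] sum_subtractf)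

lemma trace_scale: "trace (\<lambda>x. c *\<^sub>C f x) = c * trace f"
  by (simp add: trace_def clinear_scale[OF clinear_coordinate] sum_distrib_left scaleC_complex_def)

lemma trace_0 [simp]: "trace (\<lambda>x. 0) = 0"
  by (simp add: trace_def clinear_0[OF clinear_coordinate])

lemma trace_sum: "trace (\<lambda>x. \<Sum>i\<in>I. f i x) = (\<Sum>i\<in>I. trace (f i))"
  by (simp add: trace_def clinear_sum[OF clinear_coordinate] sum.swap[of _ I])

lemma coordinate_expansion:
  assumes "fin_dim (UNIV :: 'a::complex_vector set)"
  shows "(\<Sum>b\<in>std_basis. cv.representation std_basis v b *\<^sub>C b) = (v :: 'a)"
  using cv.sum_representation_eq[OF std_basis(1) _ finite_independent[OF assms std_basis(1)]] std_basis(2) by auto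

lemma trace_comp:
  fixes f g :: "'a::complex_vector \<Rightarrow> 'a"
  assumes fin: "fin_dim (UNIV :: 'a set)" and f: "clinear f" and g: "clinear g"
  shows "trace (\<lambda>x. f (g x)) = trace (\<lambda>x. g (f x))"
proof -
  let ?r = "cv.representation (std_basis :: 'a set)"
  have expand: "?r (h v) b = (\<Sum>b'\<in>std_basis. ?r v b' * ?r (h b') b)" if "clinear h" for h :: "'a \<Rightarrow> 'a" and v b
  proof -
    have "?r (h v) b = ?r (h (\<Sum>b'\<in>std_basis. ?r v b' *\<^sub>C b')) b" by (simp add: coordinate_expansion[OF fin])
    also have "\<dots> = (\<Sum>b'\<in>std_basis. ?r v b' * ?r (h b') b)"
      by (simp add: clinear_sum[OF that] clinear_scale[OF that] clinear_sum[OF clinear_coordinate]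
          clinear_scale[OF clinear_coordinate] scaleC_complex_def)
    finally show ?thesis .
  qed
  have "trace (\<lambda>x. f (g x)) = (\<Sum>b\<in>std_basis. \<Sum>b'\<in>std_basis. ?r (g b) b' * ?r (f b') b)"
    unfolding trace_def by (intro sum.cong refl expand[OF f])
  also have "\<dots> = (\<Sum>b\<in>std_basis. \<Sum>b'\<in>std_basis. ?r (f b) b' * ?r (g b') b)"
    by (subst sum.swap) (simp add: mult.commute)
  also have "\<dots> = trace (\<lambda>x. g (f x))"
    unfolding trace_def by (intro sum.cong refl expand[OF g, symmetric])
  finally show ?thesis .
qed

lemma trace_rank_one:
  fixes v :: "'a::complex_vector"
  assumes "fin_dim (UNIV :: 'a set)" "clinear c"
  shows "trace (\<lambda>x. c x *\<^sub>C v) = c v"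
proof -
  have "trace (\<lambda>x. c x *\<^sub>C v) = (\<Sum>b\<in>std_basis. cv.representation std_basis v b * c b)"
    by (simp add: trace_def clinear_scale[OF clinear_coordinate] scaleC_complex_def mult.commute)
  also have "\<dots> = c (\<Sum>b\<in>std_basis. cv.representation std_basis v b *\<^sub>C b)"
    by (simp add: clinear_sum[OF assms(2)] clinear_scale[OF assms(2)] scaleC_complex_def)
  finally show ?thesis by (simp add: coordinate_expansion[OF assms(1)])
qed

lemma projection_exists:
  fixes W :: "'a::complex_vector set"
  assumes "cv.subspace W"
  obtains p where "clinear p" "\<And>x. p x \<in> W" "\<And>x. x \<in> W \<Longrightarrow> p x = x"
proof -
  obtain B where B: "B \<subseteq> W" "cv.independent B" "W \<subseteq> cv.span B" using cv.basis_exists by metis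
  let ?p = "cvp.construct B (\<lambda>b. b)"
  have lin: "clinear ?p" by (rule cvp.linear_construct[OF B(2)])
  moreover have "?p x \<in> W" for x
    using cvp.construct_in_span[OF B(2), of "\<lambda>b. b" x] cv.span_minimal[OF B(1) assms] by auto
  moreover have "?p x = x" if "x \<in> W" for x
    by (rule clinear_eq_on_span[OF lin clinear_ident, of B]) (use cvp.construct_basis[OF B(2)] B(3) that in auto)
  ultimately show ?thesis using that by blast
qed

text \<open>A nilpotent \<open>N\<close> has the same trace as \<open>N p\<close> for a projection \<open>p\<close> onto the range of \<open>N\<close>, and
  \<open>N p\<close> has a smaller order of nilpotency.\<close>

lemma trace_nilpotent:
  fixes f :: "'a::complex_vector \<Rightarrow> 'a"
  assumes fin: "fin_dim (UNIV :: 'a set)" and "clinear f" "\<And>x. (f ^^ m) x = 0"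
  shows "trace f = 0"
  using assms(2,3)
proof (induction m arbitrary: f)
  case 0
  then have "f = (\<lambda>x. 0)" by (metis funpow_0)
  then show ?case by simp
next
  case (Suc m)
  show ?case
  proof (cases m)
    case 0
    with Suc.prems(2) have "f = (\<lambda>x. 0)" by (simp add: fun_eq_iff)
    then show ?thesis by simp
  next
    case m: (Suc k)
    have "cv.subspace (range f)" using cvp.linear_subspace_image[OF Suc.prems(1) cv.subspace_UNIV] .
    then obtain p where p: "clinear p" "\<And>x. p x \<in> range f" "\<And>x. x \<in> range f \<Longrightarrow> p x = x"
      by (rule projection_exists) blast
    have pf: "p (f x) = f x" for x using p(3) by blast
    have pow: "((\<lambda>x. f (p x)) ^^ Suc k) x = (f ^^ Suc k) (p x)" for k x
      by (induction k) (simp_all add: pf)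
    have "trace f = trace (\<lambda>x. p (f x))" by (simp add: pf)
    also have "\<dots> = trace (\<lambda>x. f (p x))" by (rule trace_comp[OF fin p(1) Suc.prems(1)])
    also have "\<dots> = 0"
    proof (rule Suc.IH[OF clinear_comp[OF Suc.prems(1) p(1)]])
      fix x
      obtain y where "p x = f y" using p(2) by blast
      then have "((\<lambda>x. f (p x)) ^^ m) x = (f ^^ Suc m) y"
        unfolding m pow by (simp add: funpow_swap1)
      then show "((\<lambda>x. f (p x)) ^^ m) x = 0" using Suc.prems(2) by simp
    qed
    finally show ?thesis .
  qed
qed

lemma trace_locally_nilpotent:
  fixes f :: "'a::complex_vector \<Rightarrow> 'a"
  assumes fin: "fin_dim (UNIV :: 'a set)" and f: "clinear f" and nil: "\<And>x. \<exists>m. (f ^^ m) x = 0"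
  shows "trace f = 0"
proof -
  obtain m where m: "\<And>x. (f ^^ m x) x = 0" using nil by metis
  note finB = finite_independent[OF fin std_basis(1)]
  define n where "n = Max (insert 0 (m ` std_basis))"
  show ?thesis
  proof (rule trace_nilpotent[OF fin f])
    fix x
    have "(f ^^ n) b = 0" if "b \<in> std_basis" for b
      by (rule funpow_zero_mono[OF f m]) (use finB that in \<open>simp add: n_def\<close>)
    then show "(f ^^ n) x = 0"
      by (rule clinear_eq_on_span[OF clinear_funpow[OF f] clinear_zero_map, of std_basis]) (auto simp: std_basis(2))
  qed
qed

text \<open>In a basis that extends a basis of the range of \<open>p\<close>, the trace counts the basis vectors of the range.\<close>

lemma trace_idempotent:
  fixes p :: "'a::complex_vector \<Rightarrow> 'a"
  assumes fin: "fin_dim (UNIV :: 'a set)" and p: "clinear p" and idem: "\<And>x. p (p x) = p x"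
  obtains n where "trace p = of_nat n" "n = 0 \<Longrightarrow> p = (\<lambda>x. 0)"
proof -
  obtain B where B: "B \<subseteq> range p" "cv.independent B" "range p \<subseteq> cv.span B" using cv.basis_exists by metis
  let ?E = "cv.extend_basis B"
  note E = cv.independent_extend_basis[OF B(2)] cv.span_extend_basis[OF B(2)] cv.extend_basis_superset[OF B(2)]
  let ?c = "\<lambda>b v. cv.representation ?E v b"
  have c: "clinear (?c b)" for b
    by (rule clinearI) (simp_all add: cv.representation_add[OF E(1)] cv.representation_scale[OF E(1)] E(2) scaleC_complex_def)
  have finB: "finite B" by (rule finite_independent[OF fin B(2)])
  have "p x = (\<Sum>b\<in>B. ?c b (p x) *\<^sub>C b)" for x
  proof -
    have "p x \<in> cv.span B" using B(3) by blast
    then have "cv.representation ?E (p x) = cv.representation B (p x)"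
      by (rule cv.representation_extend[OF E(1) _ E(3)])
    then show ?thesis
      using cv.sum_representation_eq[OF B(2) \<open>p x \<in> cv.span B\<close> finB] by simp
  qed
  then have "trace p = trace (\<lambda>x. \<Sum>b\<in>B. ?c b (p x) *\<^sub>C b)"
    by (intro arg_cong[where f = trace] ext)
  also have "\<dots> = (\<Sum>b\<in>B. ?c b (p b))"
    by (simp add: trace_sum trace_rank_one[OF fin clinear_comp[OF c p]])
  also have "\<dots> = (\<Sum>b\<in>B. 1)"
  proof (rule sum.cong[OF refl])
    fix b assume "b \<in> B"
    then have "p b = b" "b \<in> ?E" using B(1) idem E(3) by auto
    then show "?c b (p b) = 1" by (simp add: cv.representation_basis[OF E(1)])
  qed
  finally have tr: "trace p = of_nat (card B)" by simp
  have zero: "p = (\<lambda>x. 0)" if "card B = 0"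
  proof -
    have "range p \<subseteq> {0}" using that finB B(3) by simp
    then show ?thesis by (intro ext) blast
  qed
  show ?thesis by (rule that[OF tr zero])
qed

lemma trace_projection_nilpotent:
  fixes g :: "'a::complex_vector \<Rightarrow> 'a"
  assumes fin: "fin_dim (UNIV :: 'a set)" and "clinear g" "clinear p"
    and idem: "\<And>x. p (p x) = p x" and comm: "\<And>x. p (g x) = g (p x)"
    and nil: "\<And>x. \<exists>m. (g ^^ m) (p x) = 0"
  shows "trace (\<lambda>x. p (g x)) = 0"
proof (rule trace_locally_nilpotent[OF fin clinear_comp[OF assms(3,2)]])
  fix x
  have pow: "((\<lambda>x. p (g x)) ^^ Suc k) x = (g ^^ Suc k) (p x)" for k
  proof (induction k)
    case (Suc k)
    have gp: "p ((g ^^ j) y) = (g ^^ j) (p y)" for j y by (induction j) (simp_all add: comm)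
    have "((\<lambda>x. p (g x)) ^^ Suc (Suc k)) x = p (g ((g ^^ Suc k) (p x)))" using Suc by simp
    also have "\<dots> = p ((g ^^ Suc (Suc k)) (p x))" by simp
    also have "\<dots> = (g ^^ Suc (Suc k)) (p x)" unfolding gp idem ..
    finally show ?case .
  qed (simp only: comm funpow.simps o_apply id_apply)
  obtain m where "(g ^^ m) (p x) = 0" using nil by blast
  then have "(g ^^ Suc m) (p x) = 0" by (simp add: clinear_0[OF assms(2)])
  then show "\<exists>m. ((\<lambda>x. p (g x)) ^^ m) x = 0" using pow by metis
qed

text \<open>On the range of the projection \<open>p\<close>, both \<open>f - c\<close> and its square are nilpotent and have trace zero.\<close>

lemma trace_generalised_eigenspace:
  fixes f :: "'a::complex_vector \<Rightarrow> 'a"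
  assumes fin: "fin_dim (UNIV :: 'a set)" and f: "clinear f" and p: "clinear p"
    and idem: "\<And>x. p (p x) = p x" and comm: "\<And>x. p (f x) = f (p x)"
    and gen: "\<And>x. p x \<in> generalised_eigenspace f c"
  shows "trace (\<lambda>x. p (f x)) = c * trace p" and "trace (\<lambda>x. p (f (f x))) = c\<^sup>2 * trace p"
proof -
  let ?g = "\<lambda>y. f y - c *\<^sub>C y"
  note g = clinear_shift[OF f, of c]
  have gcomm: "p (?g x) = ?g (p x)" for x
    by (simp add: clinear_diff[OF p] clinear_scale[OF p] comm)
  have nil: "\<exists>m. (?g ^^ m) (p x) = 0" for x using gen[of x] by (simp add: generalised_eigenspace_def)
  have "trace (\<lambda>x. p (?g x)) = 0"
  proof (rule trace_projection_nilpotent[OF fin g p idem])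
    show "p (?g x) = ?g (p x)" for x by (rule gcomm)
    show "\<exists>m. (?g ^^ m) (p x) = 0" for x by (rule nil)
  qed
  then have t1: "trace (\<lambda>x. p (f x)) - c * trace p = 0"
    by (simp add: clinear_diff[OF p] clinear_scale[OF p] trace_diff trace_scale)
  then show "trace (\<lambda>x. p (f x)) = c * trace p" by simp
  have "trace (\<lambda>x. p (?g (?g x))) = 0"
  proof (rule trace_projection_nilpotent[OF fin clinear_comp[OF g g] p idem])
    show "p (?g (?g x)) = ?g (?g (p x))" for x by (simp only: gcomm)
    show "\<exists>m. ((\<lambda>x. ?g (?g x)) ^^ m) (p x) = 0" for x
    proof -
      obtain m where m: "(?g ^^ m) (p x) = 0" using nil by blast
      have "(\<lambda>x. ?g (?g x)) = ?g ^^ 2" by (simp add: fun_eq_iff numeral_2_eq_2)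
      then have "(\<lambda>x. ?g (?g x)) ^^ m = ?g ^^ (2 * m)" by (simp only: funpow_mult)
      moreover have "(?g ^^ (2 * m)) (p x) = 0" by (rule funpow_zero_mono[OF g m]) simp
      ultimately have "((\<lambda>x. ?g (?g x)) ^^ m) (p x) = 0" by (simp only:)
      then show ?thesis by (rule exI)
    qed
  qed
  moreover have "?g (?g x) = f (f x) - (2 * c) *\<^sub>C f x + c\<^sup>2 *\<^sub>C x" for x
  proof -
    have "(2 * c) *\<^sub>C f x = c *\<^sub>C f x + c *\<^sub>C f x" by (simp only: mult_2 scaleC_left_distrib)
    then show ?thesis
      by (simp add: clinear_diff[OF f] clinear_scale[OF f] cv.scale_right_diff_distrib scaleC_scaleC power2_eq_square)
  qed
  ultimately have "trace (\<lambda>x. p (f (f x))) - 2 * c * trace (\<lambda>x. p (f x)) + c\<^sup>2 * trace p = 0"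
    by (simp add: clinear_diff[OF p] clinear_add[OF p] clinear_scale[OF p] trace_diff trace_add trace_scale)
  with t1 show "trace (\<lambda>x. p (f (f x))) = c\<^sup>2 * trace p"
    by (simp add: power2_eq_square algebra_simps)
qed

subsection \<open>Finite dimension\<close>

lemma dim_psubset:
  assumes fin: "fin_dim (UNIV :: 'a::complex_vector set)" and "cv.subspace S" "cv.subspace T" "(S :: 'a set) \<subset> T"
  shows "cv.dim S < cv.dim T"
proof -
  interpret fd: finite_dimensional_vector_space "scaleC :: complex \<Rightarrow> 'a \<Rightarrow> 'a" std_basis
    using finite_independent[OF fin std_basis(1)] std_basis by unfold_locales
  show ?thesis using fd.dim_psubset[of S T] assms(2-4) by (simp add: cv.span_eq_iff[THEN iffD2])
qed

lemma nondegenerate_represents: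
  fixes B :: "'a::complex_vector \<Rightarrow> 'a \<Rightarrow> complex"
  assumes fin: "fin_dim (UNIV :: 'a set)"
    and left: "\<And>y. clinear (\<lambda>x. B x y)" and right: "\<And>x. clinear (B x)"
    and nondeg: "\<And>x. (\<And>y. B x y = 0) \<Longrightarrow> x = 0" and l: "clinear l"
  obtains d where "\<And>y. B d y = l y"
proof -
  note finB = finite_independent[OF fin std_basis(1)]
  interpret fd: finite_dimensional_vector_space "scaleC :: complex \<Rightarrow> 'a \<Rightarrow> 'a" std_basis
    using finB std_basis by unfold_locales
  let ?r = "cv.representation (std_basis :: 'a set)"
  define \<Psi> where "\<Psi> d = (\<Sum>b\<in>std_basis. B d b *\<^sub>C b)" for d
  have lin: "clinear \<Psi>" unfolding \<Psi>_def by (intro clinear_sum_map clinear_fun left)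
  have coord: "?r (\<Sum>b\<in>std_basis. u b *\<^sub>C b) c = u c" if "c \<in> std_basis" for u c
  proof -
    have "?r (\<Sum>b\<in>std_basis. u b *\<^sub>C b) c = (\<Sum>b\<in>std_basis. u b * (if c = b then 1 else 0))"
      unfolding clinear_sum[OF clinear_coordinate] clinear_scale[OF clinear_coordinate]
      by (intro sum.cong) (simp_all add: cv.representation_basis[OF std_basis(1)] scaleC_complex_def)
    then show ?thesis using that finB by (simp add: if_distrib cong: if_cong)
  qed
  have ext: "B d y = l y" if "\<And>b. b \<in> std_basis \<Longrightarrow> B d b = l b" "clinear l" for d y and l :: "'a \<Rightarrow> complex"
    by (rule clinear_eq_on_span[OF right that(2), of std_basis]) (auto simp: that(1) std_basis(2))
  have "inj \<Psi>"
  proof -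
    have "d = 0" if "\<Psi> d = 0" for d
    proof (rule nondeg)
      have "B d b = 0" if "b \<in> std_basis" for b
        using coord[OF that, of "B d"] \<open>\<Psi> d = 0\<close> by (simp add: \<Psi>_def cv.representation_zero)
      then show "B d y = 0" for y using ext[of d "\<lambda>_. 0"] clinear_zero_map by blast
    qed
    then show ?thesis using cvp.linear_inj_iff_eq_0[OF lin] by blast
  qed
  then have "surj \<Psi>" by (rule fd.linear_inj_imp_surj[OF lin])
  then obtain d where d: "\<Psi> d = (\<Sum>b\<in>std_basis. l b *\<^sub>C b)" by (metis surjD)
  have "B d b = l b" if "b \<in> std_basis" for b
    using coord[OF that, of "B d"] coord[OF that, of l] d by (simp add: \<Psi>_def)
  from ext[OF this l] show ?thesis by (rule that)
qed

subsection \<open>Direct sums\<close>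

lemma direct_sum_components:
  fixes U :: "'i \<Rightarrow> 'a::complex_vector set"
  assumes "direct_sum_on I UNIV U"
  obtains cmp where "\<And>i. clinear (cmp i)" "\<And>i x. i \<in> I \<Longrightarrow> cmp i x \<in> U i"
    "\<And>i j x. i \<in> I \<Longrightarrow> x \<in> U i \<Longrightarrow> cmp j x = (if j = i then x else 0)"
    "\<And>x. finite {i. cmp i x \<noteq> 0}" "\<And>x. {i. cmp i x \<noteq> 0} \<subseteq> I" "\<And>x. (\<Sum>i | cmp i x \<noteq> 0. cmp i x) = x"
proof -
  let ?P = "\<lambda>x f. {i. f i \<noteq> 0} \<subseteq> I \<and> finite {i. f i \<noteq> 0} \<and> (\<forall>i\<in>I. f i \<in> U i) \<and> x = (\<Sum>i | f i \<noteq> 0. f i)"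
  have sub: "cv.subspace (U i)" if "i \<in> I" for i using assms that by (simp add: direct_sum_on_def)
  have ex: "\<exists>!f. ?P x f" for x using assms by (simp add: direct_sum_on_def)
  define c where "c x = (THE f. ?P x f)" for x
  have P: "?P x (c x)" for x unfolding c_def by (rule theI'[OF ex])
  have uniq: "c x = f" if "?P x f" for x f unfolding c_def by (rule the1_equality[OF ex[of x]], rule that)
  have eqI: "c x = f" if "finite F" "F \<subseteq> I" "\<And>i. i \<notin> F \<Longrightarrow> f i = 0" "\<And>i. i \<in> F \<Longrightarrow> f i \<in> U i" "x = (\<Sum>i\<in>F. f i)" for x f F
  proof (rule uniq)
    have sup: "{i. f i \<noteq> 0} \<subseteq> F" using that(3) by blast
    have "(\<Sum>i | f i \<noteq> 0. f i) = (\<Sum>i\<in>F. f i)" by (rule sum.mono_neutral_left[OF that(1) sup]) auto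
    moreover have "f i \<in> U i" if "i \<in> I" for i using that \<open>\<And>i. i \<notin> F \<Longrightarrow> f i = 0\<close> \<open>\<And>i. i \<in> F \<Longrightarrow> f i \<in> U i\<close> cv.subspace_0[OF sub] by metis
    ultimately show "?P x f" using sup that(1,2,5) finite_subset by auto
  qed
  have sum: "x = (\<Sum>i\<in>F. c x i)" if "finite F" "{i. c x i \<noteq> 0} \<subseteq> F" for x F
  proof -
    have "(\<Sum>i | c x i \<noteq> 0. c x i) = (\<Sum>i\<in>F. c x i)" by (rule sum.mono_neutral_left[OF that]) auto
    then show ?thesis using P by metis
  qed
  have cadd: "c (x + y) = (\<lambda>i. c x i + c y i)" for x y
  proof (rule eqI)
    let ?F = "{i. c x i \<noteq> 0} \<union> {i. c y i \<noteq> 0}"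
    show "finite ?F" "?F \<subseteq> I" using P by auto
    then show "c x i + c y i \<in> U i" if "i \<in> ?F" for i using that P sub cv.subspace_add by (metis subsetD)
    show "x + y = (\<Sum>i\<in>?F. c x i + c y i)"
      using sum[of ?F x] sum[of ?F y] \<open>finite ?F\<close> by (simp add: sum.distrib)
  qed auto
  have cscale: "c (a *\<^sub>C x) = (\<lambda>i. a *\<^sub>C c x i)" for a x
  proof (rule eqI)
    let ?F = "{i. c x i \<noteq> 0}"
    show "finite ?F" "?F \<subseteq> I" using P by auto
    then show "a *\<^sub>C c x i \<in> U i" if "i \<in> ?F" for i using that P sub cv.subspace_scale by (metis subsetD)
    show "a *\<^sub>C x = (\<Sum>i\<in>?F. a *\<^sub>C c x i)"
      using sum[of ?F x] \<open>finite ?F\<close> by (simp flip: cv.scale_sum_right)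
  qed auto
  have "clinear (\<lambda>x. c x i)" for i by (rule clinearI) (simp_all add: cadd cscale)
  moreover have "c x = (\<lambda>j. if j = i then x else 0)" if "i \<in> I" "x \<in> U i" for i x
    by (rule eqI[of "{i}"]) (use that in auto)
  moreover have "c x i \<in> U i" if "i \<in> I" for i x using P[of x] that by blast
  moreover have "finite {i. c x i \<noteq> 0}" "{i. c x i \<noteq> 0} \<subseteq> I" "(\<Sum>i | c x i \<noteq> 0. c x i) = x" for x
    using P[of x] by simp_all
  ultimately show ?thesis by (intro that[of "\<lambda>i x. c x i"]) simp_all
qed

text \<open>This is how a subspace is recognised as graded: it is stable under the projections onto the components.\<close>

lemma direct_sum_on_subspace:
  assumes "cv.subspace N" "\<And>i. i \<in> I \<Longrightarrow> cv.subspace (U i)"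
    and cmp: "\<And>i x. i \<in> I \<Longrightarrow> x \<in> N \<Longrightarrow> cmp i x \<in> N" "\<And>i x. i \<in> I \<Longrightarrow> cmp i x \<in> U i" "\<And>i. clinear (cmp i)"
      "\<And>i j x. i \<in> I \<Longrightarrow> x \<in> U i \<Longrightarrow> cmp j x = (if j = i then x else 0)"
      "\<And>x. finite {i. cmp i x \<noteq> 0}" "\<And>x. {i. cmp i x \<noteq> 0} \<subseteq> I" "\<And>x. (\<Sum>i | cmp i x \<noteq> 0. cmp i x) = x"
  shows "direct_sum_on I N (\<lambda>i. N \<inter> U i)"
  unfolding direct_sum_on_def
proof (intro conjI ballI)
  show "cv.subspace (N \<inter> U i)" if "i \<in> I" for i using assms(1,2) that by (auto intro: cv.subspace_inter)
  show "N \<inter> U i \<subseteq> N" for i by blast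
  show "\<exists>!f. {i. f i \<noteq> 0} \<subseteq> I \<and> finite {i. f i \<noteq> 0} \<and> (\<forall>i\<in>I. f i \<in> N \<inter> U i) \<and> x = (\<Sum>i | f i \<noteq> 0. f i)" if x: "x \<in> N" for x
  proof (rule ex1I[of _ "\<lambda>i. cmp i x"])
    show "{i. cmp i x \<noteq> 0} \<subseteq> I \<and> finite {i. cmp i x \<noteq> 0} \<and> (\<forall>i\<in>I. cmp i x \<in> N \<inter> U i) \<and> x = (\<Sum>i | cmp i x \<noteq> 0. cmp i x)"
      using cmp x by auto
    fix f assume f: "{i. f i \<noteq> 0} \<subseteq> I \<and> finite {i. f i \<noteq> 0} \<and> (\<forall>i\<in>I. f i \<in> N \<inter> U i) \<and> x = (\<Sum>i | f i \<noteq> 0. f i)"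
    show "f = (\<lambda>i. cmp i x)"
    proof
      fix j
      have "cmp j x = (\<Sum>i | f i \<noteq> 0. cmp j (f i))" using f clinear_sum[OF cmp(3)] by metis
      also have "\<dots> = (\<Sum>i | f i \<noteq> 0. if j = i then f i else 0)" by (rule sum.cong[OF refl]) (use f cmp(4) in blast)
      also have "\<dots> = f j" using f by simp
      finally show "f j = cmp j x" by simp
    qed
  qed
qed

section \<open>Weights of the Cartan subalgebra on the Lie algebra\<close>

text \<open>One power suffices for a finite basis of the span of \<open>M\<close>.\<close>

lemma uniformly_nilpotent_on:
  fixes f :: "'a::complex_vector \<Rightarrow> 'a"
  assumes fin: "fin_dim (UNIV :: 'a set)" and f: "clinear f" and nil: "\<And>x. x \<in> M \<Longrightarrow> \<exists>m. (f ^^ m) x = 0"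
  obtains m where "\<And>x. x \<in> M \<Longrightarrow> (f ^^ m) x = 0"
proof -
  obtain B where B: "B \<subseteq> M" "cv.independent B" "M \<subseteq> cv.span B" using cv.basis_exists by metis
  note finB = finite_independent[OF fin B(2)]
  have "\<forall>x\<in>M. \<exists>m. (f ^^ m) x = 0" using nil by blast
  from bchoice[OF this] obtain m where m: "\<forall>x\<in>M. (f ^^ m x) x = 0" by (rule exE)
  define n where "n = Max (insert 0 (m ` B))"
  have "(f ^^ n) b = 0" if "b \<in> B" for b
    by (rule funpow_zero_mono[OF f m[rule_format]]) (use finB that B(1) in \<open>auto simp: n_def\<close>)
  then have "(f ^^ n) x = 0" if "x \<in> M" for x
    by (rule clinear_eq_on_span[OF clinear_funpow[OF f] clinear_zero_map, of B]) (use B(3) that in auto)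
  then show ?thesis by (rule that)
qed

locale toroidal =
  fixes A :: "('g::complex_vector, 'n::finite) toroidal_data" and lmin :: nat
  assumes multiloop: "multiloop_data A" and standing: "standing_assumptions lmin A"
begin

abbreviation br where "br \<equiv> lie A"
abbreviation H where "H \<equiv> cart0 A"

lemmas multiloop_unfolded = multiloop[unfolded multiloop_data_def clinear_on_UNIV]

lemma fin: "fin_dim (UNIV :: 'g set)"
  by (rule multiloop_unfolded[THEN conjunct1])

lemma simple: "simple_lie_algebra_on br UNIV"
  by (rule multiloop_unfolded[THEN conjunct2, THEN conjunct1])

lemma form_bilinear: "bilinear_map (form A)"
  by (rule multiloop_unfolded[THEN conjunct2, THEN conjunct2, THEN conjunct1])

lemma form_invariant: "form A (br x y) z = form A x (br y z)"
  by (rule multiloop_unfolded[THEN conjunct2, THEN conjunct2, THEN conjunct2, THEN conjunct2, THEN conjunct1, THEN spec, THEN spec, THEN spec])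

lemma form_linear: "clinear (form A x)" "clinear (\<lambda>x. form A x y)"
  using form_bilinear unfolding bilinear_map_def clinear_on_UNIV by blast+

lemma br_linear: "clinear (br x)" "clinear (\<lambda>x. br x y)"
  using simple unfolding simple_lie_algebra_on_def lie_algebra_on_def clinear_on_UNIV by blast+

lemmas br_simps = clinear_add[OF br_linear(1)] clinear_add[OF br_linear(2)] clinear_diff[OF br_linear(1)]
  clinear_diff[OF br_linear(2)] clinear_scale[OF br_linear(1)] clinear_scale[OF br_linear(2)]
  clinear_0[OF br_linear(1)] clinear_0[OF br_linear(2)] clinear_neg[OF br_linear(1)] clinear_neg[OF br_linear(2)]

lemma br_self: "br x x = 0"
  using simple unfolding simple_lie_algebra_on_def lie_algebra_on_def by blast

lemma br_skew: "br x y = - br y x"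
proof -
  have "br (x + y) (x + y) = br x x + br x y + (br y x + br y y)"
    by (simp only: clinear_add[OF br_linear(1)] clinear_add[OF br_linear(2)] add_ac)
  then have "br x y + br y x = 0" unfolding br_self by simp
  then show ?thesis by (simp add: eq_neg_iff_add_eq_0)
qed

lemma br_jacobi: "br (br x y) z = br x (br y z) - br y (br x z)"
proof -
  have "br x (br y z) + br y (br z x) + br z (br x y) = 0"
    using simple unfolding simple_lie_algebra_on_def lie_algebra_on_def by blast
  then have "br x (br y z) - br y (br x z) - br (br x y) z = 0"
    using br_skew[of z x] br_skew[of z "br x y"] by (simp add: br_simps)
  then show ?thesis by simp
qed

lemma ideal_trivial:
  assumes "cv.subspace I" "\<And>x y. y \<in> I \<Longrightarrow> br x y \<in> I"
  shows "I = {0} \<or> I = UNIV"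
  using simple assms unfolding simple_lie_algebra_on_def by blast

lemma aut_linear: "clinear (aut A i)"
  and aut_bij: "bij (aut A i)"
  and aut_br: "aut A i (br x y) = br (aut A i x) (aut A i y)"
  using multiloop_unfolded[THEN conjunct2, THEN conjunct2, THEN conjunct2, THEN conjunct2, THEN conjunct2, THEN conjunct2, THEN conjunct1] by blast+

lemma aut_comm: "aut A i (aut A j x) = aut A j (aut A i x)"
proof -
  have "aut A i \<circ> aut A j = aut A j \<circ> aut A i"
    using multiloop_unfolded[THEN conjunct2, THEN conjunct2, THEN conjunct2, THEN conjunct2, THEN conjunct2, THEN conjunct2, THEN conjunct2, THEN conjunct1] by blast
  then have "(aut A i \<circ> aut A j) x = (aut A j \<circ> aut A i) x" by simp
  then show ?thesis by simp
qed

lemma ord_pos: "ord A i > 0"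
  using multiloop_unfolded[THEN conjunct2, THEN conjunct2, THEN conjunct2, THEN conjunct2, THEN conjunct2, THEN conjunct2, THEN conjunct2, THEN conjunct2, THEN conjunct1] by blast

lemma aut_ord: "(aut A i ^^ ord A i) x = x"
proof -
  have "aut A i ^^ ord A i = id"
    using multiloop_unfolded[THEN conjunct2, THEN conjunct2, THEN conjunct2, THEN conjunct2, THEN conjunct2, THEN conjunct2, THEN conjunct2, THEN conjunct2, THEN conjunct1] by blast
  then show ?thesis by simp
qed

lemma root1_ord: "root1 A i ^ ord A i = 1"
  and root1_primitive: "0 < q \<Longrightarrow> q < ord A i \<Longrightarrow> root1 A i ^ q \<noteq> 1"
  using multiloop_unfolded[THEN conjunct2, THEN conjunct2, THEN conjunct2, THEN conjunct2, THEN conjunct2, THEN conjunct2, THEN conjunct2, THEN conjunct2, THEN conjunct2] by blast+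

lemma root1_nz: "root1 A i \<noteq> 0"
  using root1_ord[of i] ord_pos[of i] by (metis power_eq_0_iff zero_neq_one)

lemma eig0: "x \<in> eig A 0 \<longleftrightarrow> (\<forall>i. aut A i x = x)"
  by (simp add: eig_def scaleC_one)

lemma eig_subspace: "cv.subspace (eig A k)"
  unfolding cv.subspace_def eig_def
  by (simp add: clinear_0[OF aut_linear] clinear_add[OF aut_linear] clinear_scale[OF aut_linear] scaleC_right_distrib scaleC_scaleC mult.commute)

lemma simple0: "simple_lie_algebra_on br (eig A 0)"
  and cartan0: "cartan_subalgebra_of br (eig A 0) H"
  and weights_eq: "weights A UNIV \<union> {0} = Delta_en_nz lmin A \<union> {0}"
  and pos_sys: "positive_system (Delta_en_nz lmin A) (positive A)"
  using standing unfolding standing_assumptions_def by blast+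

lemma H_eig0: "h \<in> H \<Longrightarrow> h \<in> eig A 0"
  using cartan0 unfolding cartan_subalgebra_of_def by blast

lemma aut_H: "h \<in> H \<Longrightarrow> aut A i h = h"
  using H_eig0 eig0 by blast

lemma H_subspace: "cv.subspace H"
  and H_br: "x \<in> H \<Longrightarrow> y \<in> H \<Longrightarrow> br x y \<in> H"
  using cartan0 unfolding cartan_subalgebra_of_def lie_algebra_on_def by blast+

lemma H_nilpotent: obtains n where "lower_central_series br H n = {0}"
  using cartan0 unfolding cartan_subalgebra_of_def by blast

lemma H_normalizer: "x \<in> eig A 0 \<Longrightarrow> (\<And>h. h \<in> H \<Longrightarrow> br x h \<in> H) \<Longrightarrow> x \<in> H"
  using cartan0 unfolding cartan_subalgebra_of_def by blast

lemma lower_central_series_H: "lower_central_series br H i \<subseteq> H"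
proof (induction i)
  case (Suc i)
  have "{br x y |x y. x \<in> H \<and> y \<in> lower_central_series br H i} \<subseteq> H" using Suc H_br by blast
  then show ?case by (simp add: cv.span_minimal H_subspace)
qed simp

subsection \<open>Generalised weight spaces\<close>

text \<open>By the Leibniz rule \<open>D - (a + b)\<close> sends \<open>[x, y]\<close> to \<open>[(D - a) x, y] + [x, (D - b) y]\<close>, and in each
  of the two terms the order of nilpotency of one argument has dropped.\<close>

lemma derivation_generalised_eigenspace:
  assumes D: "clinear D" "\<And>x y. D (br x y) = br (D x) y + br x (D y)"
    and "x \<in> generalised_eigenspace D a" "y \<in> generalised_eigenspace D b"
  shows "br x y \<in> generalised_eigenspace D (a + b)"
proof -
  let ?s = "\<lambda>c y. D y - c *\<^sub>C y"
  have "br x y \<in> generalised_eigenspace D (a + b)" if "(?s a ^^ m) x = 0" "(?s b ^^ n) y = 0" for m n x y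
    using that
  proof (induction "m + n" arbitrary: m n x y)
    case 0
    then show ?case by (simp add: br_simps cv.subspace_0[OF subspace_generalised_eigenspace[OF D(1)]])
  next
    case (Suc k)
    consider "m = 0" | "n = 0" | m' n' where "m = Suc m'" "n = Suc n'" by (cases m; cases n) auto
    then show ?case
    proof cases
      case 3
      have "br (?s a x) y \<in> generalised_eigenspace D (a + b)"
      proof (rule Suc.hyps(1))
        show "k = m' + n" using 3 Suc.hyps(2) by simp
        show "(?s a ^^ m') (?s a x) = 0" using Suc.prems(1) unfolding 3 by (simp only: funpow_Suc_right o_apply)
      qed (rule Suc.prems)
      moreover have "br x (?s b y) \<in> generalised_eigenspace D (a + b)"
      proof (rule Suc.hyps(1))
        show "k = m + n'" using 3 Suc.hyps(2) by simp
        show "(?s b ^^ n') (?s b y) = 0" using Suc.prems(2) unfolding 3 by (simp only: funpow_Suc_right o_apply)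
      qed (rule Suc.prems)
      moreover have "?s (a + b) (br x y) = br (?s a x) y + br x (?s b y)"
        by (simp add: D(2) br_simps scaleC_left_distrib)
      ultimately have "?s (a + b) (br x y) \<in> generalised_eigenspace D (a + b)"
        using cv.subspace_add[OF subspace_generalised_eigenspace[OF D(1)]] by simp
      then show ?thesis using generalised_eigenspace_shift_iff[OF D(1)] by blast
    qed (use Suc.prems in \<open>simp_all add: br_simps cv.subspace_0[OF subspace_generalised_eigenspace[OF D(1)]]\<close>)
  qed
  then show ?thesis using assms(3,4) by (auto simp: generalised_eigenspace_def)
qed

lemma br_derivation: "br h (br x y) = br (br h x) y + br x (br h y)"
  by (simp add: br_jacobi)

text \<open>The Cartan subalgebra is only known to be nilpotent and self-normalising in the fixed algebra, so its
  weight spaces on \<open>\<gg>\<close> have to be generalised ones; that it acts by scalars on them is \<open>H_diagonal\<close> below.\<close>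

definition wspace :: "('g \<Rightarrow> complex) \<Rightarrow> 'g set" where
  "wspace \<eta> = {x. \<forall>h\<in>H. x \<in> generalised_eigenspace (br h) (\<eta> h)}"

lemma wspace_subspace: "cv.subspace (wspace \<eta>)"
  using subspace_generalised_eigenspace[OF br_linear(1)]
  unfolding wspace_def cv.subspace_def by blast

lemma wspace_br: "x \<in> wspace \<eta> \<Longrightarrow> y \<in> wspace \<mu> \<Longrightarrow> br x y \<in> wspace (\<eta> + \<mu>)"
  unfolding wspace_def
  by (auto intro!: derivation_generalised_eigenspace br_linear br_derivation)

lemma H_wspace0: "h \<in> H \<Longrightarrow> h \<in> wspace 0"
  unfolding wspace_def
proof (intro CollectI ballI)
  fix g assume hg: "h \<in> H" "g \<in> H"
  obtain n where n: "lower_central_series br H n = {0}" by (rule H_nilpotent)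
  have "(br g ^^ i) h \<in> lower_central_series br H i" for i
  proof (induction i)
    case (Suc i)
    then show ?case using hg(2) by (auto intro!: cv.span_base)
  qed (simp add: hg)
  with n have "(br g ^^ n) h = 0" by blast
  then show "h \<in> generalised_eigenspace (br g) (0 g)" by (auto simp: generalised_eigenspace_def)
qed

lemma wspace_H: "h \<in> H \<Longrightarrow> x \<in> wspace \<eta> \<Longrightarrow> br h x \<in> wspace \<eta>"
  using wspace_br[OF H_wspace0] by simp

lemma wspace_aut: "x \<in> wspace \<eta> \<Longrightarrow> aut A i x \<in> wspace \<eta>"
  unfolding wspace_def
proof (intro CollectI ballI)
  fix h assume x: "x \<in> {x. \<forall>h\<in>H. x \<in> generalised_eigenspace (br h) (\<eta> h)}" and h: "h \<in> H"
  let ?s = "\<lambda>y. br h y - \<eta> h *\<^sub>C y"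
  obtain m where m: "(?s ^^ m) x = 0" using x h by (auto simp: generalised_eigenspace_def)
  have "(?s ^^ k) (aut A i x) = aut A i ((?s ^^ k) x)" for k
    by (induction k) (simp_all add: clinear_diff[OF aut_linear] clinear_scale[OF aut_linear] aut_br aut_H[OF h])
  then have "(?s ^^ m) (aut A i x) = 0" using m clinear_0[OF aut_linear] by simp
  then show "aut A i x \<in> generalised_eigenspace (br h) (\<eta> h)" unfolding generalised_eigenspace_def by blast
qed

lemma cart0_dual_subspace: "cv.subspace (cart0_dual A)"
  unfolding cv.subspace_def cart0_dual_def clinear_on_def
  by (auto simp: scaleC_fun_def scaleC_complex_def algebra_simps)

lemma cart0_dual_eqI:
  assumes "\<eta> \<in> cart0_dual A" "\<mu> \<in> cart0_dual A" "\<And>h. h \<in> H \<Longrightarrow> \<eta> h = \<mu> h"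
  shows "\<eta> = \<mu>"
proof
  fix h show "\<eta> h = \<mu> h" using assms unfolding cart0_dual_def by (cases "h \<in> H") simp_all
qed

lemma weight_linear:
  assumes "\<eta> \<in> cart0_dual A" "h \<in> H" "k \<in> H"
  shows "\<eta> (h + k) = \<eta> h + \<eta> k" "\<eta> (c *\<^sub>C h) = c * \<eta> h"
  using assms unfolding cart0_dual_def clinear_on_def by (auto simp: scaleC_complex_def)

lemma weight_sum:
  assumes "\<eta> \<in> cart0_dual A" "finite I" "\<And>i. i \<in> I \<Longrightarrow> f i \<in> H"
  shows "\<eta> (\<Sum>i\<in>I. f i) = (\<Sum>i\<in>I. \<eta> (f i))"
  using assms(2,3)
proof (induction I)
  case empty
  show ?case using weight_linear(2)[OF assms(1), of 0 0 0] cv.subspace_0[OF H_subspace] by simp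
next
  case (insert i I)
  then show ?case using weight_linear(1)[OF assms(1)] cv.subspace_sum[OF H_subspace, of I f] by simp
qed

text \<open>For some \<open>h\<close> separating two of the weights, a power of \<open>h - \<mu> h\<close> removes the component of weight \<open>\<mu>\<close> and
  is injective on that of weight \<open>\<eta>\<close>.\<close>

lemma wspace_independent:
  assumes "finite F" "F \<subseteq> cart0_dual A" "\<And>\<eta>. \<eta> \<in> F \<Longrightarrow> y \<eta> \<in> wspace \<eta>" "(\<Sum>\<eta>\<in>F. y \<eta>) = 0" "\<eta> \<in> F"
  shows "y \<eta> = 0"
  using assms
proof (induction "card F" arbitrary: F y \<eta>)
  case 0
  then show ?case by simp
next
  case (Suc n)
  show ?case
  proof (cases "F = {\<eta>}")
    case True
    then show ?thesis using Suc.prems(4) by simp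
  next
    case False
    with Suc.prems(5) obtain \<mu> where \<mu>: "\<mu> \<in> F" "\<mu> \<noteq> \<eta>" by blast
    then obtain h where h: "h \<in> H" "\<eta> h \<noteq> \<mu> h" using cart0_dual_eqI Suc.prems(2,5) by blast
    let ?s = "\<lambda>y. br h y - \<mu> h *\<^sub>C y"
    have lin: "clinear (?s ^^ m)" for m by (rule clinear_funpow[OF clinear_shift[OF br_linear(1)]])
    obtain m where m: "(?s ^^ m) (y \<mu>) = 0"
      using Suc.prems(3)[OF \<mu>(1)] h(1) by (auto simp: wspace_def generalised_eigenspace_def)
    have stable: "(?s ^^ k) x \<in> wspace \<nu>" if "x \<in> wspace \<nu>" for k x \<nu>
      by (induction k) (use that h(1) in \<open>auto intro!: cv.subspace_diff[OF wspace_subspace] cv.subspace_scale[OF wspace_subspace] wspace_H\<close>)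
    have "(\<Sum>\<eta>\<in>F. (?s ^^ m) (y \<eta>)) = (?s ^^ m) (\<Sum>\<eta>\<in>F. y \<eta>)" by (rule clinear_sum[OF lin, symmetric])
    also have "\<dots> = 0" using Suc.prems(4) clinear_0[OF lin] by simp
    finally have sum: "(\<Sum>\<eta>\<in>F - {\<mu>}. (?s ^^ m) (y \<eta>)) = 0"
      using m Suc.prems(1) \<mu>(1) by (simp add: sum.remove)
    have "(?s ^^ m) (y \<eta>) = 0"
    proof (rule Suc.hyps(1))
      show "n = card (F - {\<mu>})" using Suc.hyps(2) \<mu>(1) Suc.prems(1) by simp
      show "(\<Sum>\<eta>\<in>F - {\<mu>}. (?s ^^ m) (y \<eta>)) = 0" by (rule sum)
      show "(?s ^^ m) (y \<nu>) \<in> wspace \<nu>" if "\<nu> \<in> F - {\<mu>}" for \<nu> using that Suc.prems(3) by (intro stable) blast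
    qed (use Suc.prems(1,2,5) \<mu>(2) in auto)
    then have "y \<eta> \<in> generalised_eigenspace (br h) (\<mu> h)" unfolding generalised_eigenspace_def by blast
    moreover have "y \<eta> \<in> generalised_eigenspace (br h) (\<eta> h)" using Suc.prems(3,5) h(1) by (auto simp: wspace_def)
    ultimately show ?thesis using shift_inj_generalised_eigenspace[OF br_linear(1)] h(2) by blast
  qed
qed

text \<open>A subspace is split by some \<open>h \<in> H\<close> with two generalised eigenvalues, or every \<open>h\<close> has only one
  generalised eigenvalue \<open>\<eta> h\<close> on it; in the latter case \<open>\<eta>\<close> is linear, being the trace divided by
  the dimension.\<close>

lemma wspaces_span_invariant:
  assumes "cv.subspace M" "\<And>h x. h \<in> H \<Longrightarrow> x \<in> M \<Longrightarrow> br h x \<in> M"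
  shows "M \<subseteq> cv.span (\<Union>\<eta>\<in>cart0_dual A. wspace \<eta> \<inter> M)"
  using assms
proof (induction "cv.dim M" arbitrary: M rule: less_induct)
  case less
  show ?case
  proof (cases "\<forall>h\<in>H. \<exists>c. M \<subseteq> generalised_eigenspace (br h) c")
    case True
    then obtain c where c: "\<And>h. h \<in> H \<Longrightarrow> M \<subseteq> generalised_eigenspace (br h) (c h)" by metis
    show ?thesis
    proof (cases "M = {0}")
      case True
      then show ?thesis by (simp add: cv.span_zero)
    next
      case False
      obtain p where p: "clinear p" "\<And>x. p x \<in> M" "\<And>x. x \<in> M \<Longrightarrow> p x = x"
        by (rule projection_exists[OF less.prems(1)]) blast
      obtain n where n: "trace p = of_nat n" "n = 0 \<Longrightarrow> p = (\<lambda>x. 0)"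
        by (rule trace_idempotent[OF fin p(1)]) (use p in auto)
      have "n \<noteq> 0"
      proof
        assume "n = 0"
        then have "x = 0" if "x \<in> M" for x using p(3)[OF that] n(2) by simp
        with False cv.subspace_0[OF less.prems(1)] show False by blast
      qed
      define \<eta> where "\<eta> h = (if h \<in> H then c h else 0)" for h
      have tr: "\<eta> h = trace (\<lambda>x. p (br h (p x))) / of_nat n" if h: "h \<in> H" for h
      proof -
        have "trace (\<lambda>x. p (br h (p x))) - c h * trace p = 0"
        proof -
          let ?s = "\<lambda>y. br h y - c h *\<^sub>C y"
          let ?g = "\<lambda>x. p (br h (p x)) - c h *\<^sub>C p x"
          have g: "?g x = ?s (p x)" for x using p(2,3) less.prems(2)[OF h] by simp
          have "trace ?g = 0"
          proof (rule trace_locally_nilpotent[OF fin])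
            show "clinear ?g" by (intro clinear_intros clinear_comp[OF p(1)] clinear_comp[OF br_linear(1)] p(1))
            fix x
            have pow: "(?g ^^ Suc k) x = (?s ^^ Suc k) (p x) \<and> (?s ^^ Suc k) (p x) \<in> M" for k
            proof (induction k)
              case 0
              have "?s (p x) \<in> M"
                using less.prems(1,2) h p(2) by (intro cv.subspace_diff cv.subspace_scale) auto
              then show ?case unfolding funpow.simps o_apply id_apply g by simp
            next
              case (Suc k)
              let ?y = "(?s ^^ Suc k) (p x)"
              have "(?g ^^ Suc (Suc k)) x = ?g ?y" using Suc by simp
              also have "\<dots> = ?s ?y" using p(3)[of ?y] Suc unfolding g by (simp only:)
              finally have "(?g ^^ Suc (Suc k)) x = (?s ^^ Suc (Suc k)) (p x)" by simp
              moreover have "?s ?y \<in> M"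
                using Suc less.prems(1,2) h by (intro cv.subspace_diff cv.subspace_scale) auto
              ultimately show ?case by simp
            qed
            obtain m where m: "(?s ^^ m) (p x) = 0" using c[OF h] p(2)[of x] by (auto simp: generalised_eigenspace_def)
            have "(?s ^^ Suc m) (p x) = 0"
              by (rule funpow_zero_mono[OF clinear_shift[OF br_linear(1)] m]) simp
            then show "\<exists>m. (?g ^^ m) x = 0" using pow[of m] by metis
          qed
          then show ?thesis by (simp add: trace_diff trace_scale)
        qed
        then show ?thesis using n(1) \<open>n \<noteq> 0\<close> h by (simp add: \<eta>_def field_simps)
      qed
      have "\<eta> \<in> cart0_dual A"
        unfolding cart0_dual_def clinear_on_def
      proof (intro CollectI conjI ballI allI impI)
        show "\<eta> (h + k) = \<eta> h + \<eta> k" if "h \<in> H" "k \<in> H" for h k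
          using that cv.subspace_add[OF H_subspace that]
          by (simp add: tr br_simps clinear_add[OF p(1)] trace_add add_divide_distrib)
        show "\<eta> (a *\<^sub>C h) = a *\<^sub>C \<eta> h" if "h \<in> H" for a h
          using that cv.subspace_scale[OF H_subspace that]
          by (simp add: tr br_simps clinear_scale[OF p(1)] trace_scale scaleC_complex_def)
      qed (simp add: \<eta>_def)
      moreover have "M \<subseteq> wspace \<eta>" using c by (auto simp: wspace_def \<eta>_def)
      ultimately show ?thesis by (auto intro!: cv.span_base)
    qed
  next
    case False
    then obtain h where h: "h \<in> H" "\<And>c. \<not> M \<subseteq> generalised_eigenspace (br h) c" by blast
    let ?M = "\<lambda>c. generalised_eigenspace (br h) c \<inter> M"
    have sub: "cv.subspace (?M c)" for c
      using subspace_generalised_eigenspace[OF br_linear(1)] less.prems(1) by (rule cv.subspace_inter)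
    have "?M c \<subseteq> cv.span (\<Union>\<eta>\<in>cart0_dual A. wspace \<eta> \<inter> M)" for c
    proof -
      have "?M c \<subseteq> cv.span (\<Union>\<eta>\<in>cart0_dual A. wspace \<eta> \<inter> ?M c)"
      proof (rule less.hyps)
        show "cv.dim (?M c) < cv.dim M"
          by (rule dim_psubset[OF fin sub less.prems(1)]) (use h(2)[of c] in blast)
        show "br k x \<in> ?M c" if "k \<in> H" "x \<in> ?M c" for k x
        proof -
          have "k \<in> generalised_eigenspace (br h) 0" using H_wspace0[OF that(1)] h(1) by (auto simp: wspace_def)
          then have "br k x \<in> generalised_eigenspace (br h) (0 + c)"
            using that(2) by (intro derivation_generalised_eigenspace br_linear br_derivation) auto
          then show ?thesis using that less.prems(2) by simp
        qed
      qed (rule sub)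
      also have "\<dots> \<subseteq> cv.span (\<Union>\<eta>\<in>cart0_dual A. wspace \<eta> \<inter> M)" by (rule cv.span_mono) blast
      finally show ?thesis .
    qed
    then have "cv.span (\<Union>c. ?M c) \<subseteq> cv.span (\<Union>\<eta>\<in>cart0_dual A. wspace \<eta> \<inter> M)"
      by (intro cv.span_minimal cv.subspace_span) blast
    then show ?thesis
      using generalised_eigenspaces_span[OF fin br_linear(1) less.prems(1)] less.prems(2)[OF h(1)] by blast
  qed
qed

definition W :: "('g \<Rightarrow> complex) set" where
  "W = {\<eta>\<in>cart0_dual A. wspace \<eta> \<noteq> {0}}"

lemma W_dual: "\<eta> \<in> W \<Longrightarrow> \<eta> \<in> cart0_dual A"
  by (simp add: W_def)

lemma wspaces_span: "cv.span (\<Union>\<eta>\<in>W. wspace \<eta>) = UNIV"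
proof -
  have "(\<Union>\<eta>\<in>cart0_dual A. wspace \<eta> \<inter> UNIV) \<subseteq> cv.span (\<Union>\<eta>\<in>W. wspace \<eta>)"
  proof
    fix x assume "x \<in> (\<Union>\<eta>\<in>cart0_dual A. wspace \<eta> \<inter> UNIV)"
    then obtain \<eta> where l: "\<eta> \<in> cart0_dual A" "x \<in> wspace \<eta>" by blast
    show "x \<in> cv.span (\<Union>\<eta>\<in>W. wspace \<eta>)"
    proof (cases "x = 0")
      case False
      then have "\<eta> \<in> W" using l by (auto simp: W_def)
      then show ?thesis using l(2) by (intro cv.span_base) blast
    qed (simp add: cv.span_zero)
  qed
  then have "cv.span (\<Union>\<eta>\<in>cart0_dual A. wspace \<eta> \<inter> UNIV) \<subseteq> cv.span (\<Union>\<eta>\<in>W. wspace \<eta>)"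
    by (intro cv.span_minimal cv.subspace_span)
  then show ?thesis using wspaces_span_invariant[OF cv.subspace_UNIV] by blast
qed

text \<open>Finitely many weight spaces contain a basis in their span, and a further weight would contradict
  independence.\<close>

lemma W_finite: "finite W"
proof -
  have "\<exists>F. finite F \<and> F \<subseteq> W \<and> b \<in> cv.span (\<Union>\<eta>\<in>F. wspace \<eta>)" for b
  proof -
    have b: "b \<in> cv.span (\<Union>\<eta>\<in>W. wspace \<eta>)" by (simp add: wspaces_span)
    obtain F y where F: "finite F" "F \<subseteq> W" "\<And>\<eta>. \<eta> \<in> F \<Longrightarrow> y \<eta> \<in> wspace \<eta>" "b = (\<Sum>\<eta>\<in>F. y \<eta>)"
      by (rule span_UN_decomposition[OF b wspace_subspace]) blast
    have "b \<in> cv.span (\<Union>\<eta>\<in>F. wspace \<eta>)" unfolding F(4) using F(3) by (intro cv.span_sum cv.span_base) blast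
    with F(1,2) show ?thesis by blast
  qed
  then obtain F where F: "\<And>b. finite (F b)" "\<And>b. F b \<subseteq> W" "\<And>b. b \<in> cv.span (\<Union>\<eta>\<in>F b. wspace \<eta>)" by metis
  let ?F = "\<Union>b\<in>std_basis. F b"
  have "finite ?F" using F(1) finite_independent[OF fin std_basis(1)] by blast
  moreover have "W \<subseteq> ?F"
  proof (rule ccontr)
    assume "\<not> W \<subseteq> ?F"
    then obtain \<mu> where \<mu>: "\<mu> \<in> W" "\<mu> \<notin> ?F" by blast
    then obtain v where v: "v \<in> wspace \<mu>" "v \<noteq> 0" using cv.subspace_0[OF wspace_subspace] by (auto simp: W_def)
    have "std_basis \<subseteq> cv.span (\<Union>\<eta>\<in>?F. wspace \<eta>)"
    proof
      fix b :: 'g assume "b \<in> std_basis"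
      then have "cv.span (\<Union>\<eta>\<in>F b. wspace \<eta>) \<subseteq> cv.span (\<Union>\<eta>\<in>?F. wspace \<eta>)" by (intro cv.span_mono) blast
      with F(3) show "b \<in> cv.span (\<Union>\<eta>\<in>?F. wspace \<eta>)" by blast
    qed
    then have "cv.span std_basis \<subseteq> cv.span (\<Union>\<eta>\<in>?F. wspace \<eta>)" by (intro cv.span_minimal cv.subspace_span)
    then have "v \<in> cv.span (\<Union>\<eta>\<in>?F. wspace \<eta>)" using std_basis(2) by blast
    then obtain E y where E: "finite E" "E \<subseteq> ?F" "\<And>\<eta>. \<eta> \<in> E \<Longrightarrow> y \<eta> \<in> wspace \<eta>" "v = (\<Sum>\<eta>\<in>E. y \<eta>)"
      by (rule span_UN_decomposition[OF _ wspace_subspace]) blast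
    let ?y = "y(\<mu> := - v)"
    have "\<mu> \<notin> E" using E(2) \<mu>(2) by blast
    have "?y \<mu> = 0"
    proof (rule wspace_independent[of "insert \<mu> E" ?y])
      show "insert \<mu> E \<subseteq> cart0_dual A" using E(2) F(2) \<mu>(1) by (auto simp: W_def)
      show "?y \<eta> \<in> wspace \<eta>" if "\<eta> \<in> insert \<mu> E" for \<eta>
        using that E(3) v(1) cv.subspace_neg[OF wspace_subspace] by auto
      have "(\<Sum>\<eta>\<in>E. ?y \<eta>) = v" unfolding E(4) by (rule sum.cong) (use \<open>\<mu> \<notin> E\<close> in auto)
      then show "(\<Sum>\<eta>\<in>insert \<mu> E. ?y \<eta>) = 0" using \<open>\<mu> \<notin> E\<close> E(1) by simp
    qed (use E(1) in auto)
    with v(2) show False by simp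
  qed
  ultimately show ?thesis by (rule finite_subset[rotated])
qed

lemma wspaces_direct_sum: "direct_sum_on W UNIV wspace"
  unfolding direct_sum_on_def
proof (intro conjI ballI)
  fix x :: 'g
  let ?P = "\<lambda>f. {i. f i \<noteq> 0} \<subseteq> W \<and> finite {i. f i \<noteq> 0} \<and> (\<forall>i\<in>W. f i \<in> wspace i) \<and> x = (\<Sum>i | f i \<noteq> 0. f i)"
  have sup: "(\<Sum>i | f i \<noteq> 0. f i) = (\<Sum>i\<in>W. f i)" if "{i. f i \<noteq> 0} \<subseteq> W" for f :: "('g \<Rightarrow> complex) \<Rightarrow> 'g"
    by (rule sum.mono_neutral_left[OF W_finite that]) auto
  have x: "x \<in> cv.span (\<Union>\<eta>\<in>W. wspace \<eta>)" by (simp add: wspaces_span)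
  obtain F y where F: "finite F" "F \<subseteq> W" "\<And>\<eta>. \<eta> \<in> F \<Longrightarrow> y \<eta> \<in> wspace \<eta>" "x = (\<Sum>\<eta>\<in>F. y \<eta>)"
    by (rule span_UN_decomposition[OF x wspace_subspace]) blast
  let ?f = "\<lambda>\<eta>. if \<eta> \<in> F then y \<eta> else 0"
  have fW: "{i. ?f i \<noteq> 0} \<subseteq> W" using F(2) by auto
  have "(\<Sum>i\<in>W. ?f i) = x"
    unfolding F(4) using F(1,2) W_finite by (simp add: sum.If_cases Int_absorb1 Collect_mem_eq)
  then have ex: "?P ?f"
    using sup[OF fW] fW finite_subset[OF fW W_finite] F(3) cv.subspace_0[OF wspace_subspace] by auto
  have uniq: "f = g" if f: "?P f" and g: "?P g" for f g
  proof
    fix i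
    show "f i = g i"
    proof (cases "i \<in> W")
      case True
      have "f i - g i = 0"
      proof (rule wspace_independent[OF W_finite _ _ _ True, of "\<lambda>i. f i - g i"])
        show "f \<eta> - g \<eta> \<in> wspace \<eta>" if "\<eta> \<in> W" for \<eta>
          using f g that by (auto intro!: cv.subspace_diff[OF wspace_subspace])
        have "(\<Sum>i\<in>W. f i) = (\<Sum>i\<in>W. g i)" using sup[of f] sup[of g] f g by simp
        then show "(\<Sum>\<eta>\<in>W. f \<eta> - g \<eta>) = 0" by (simp add: sum_subtractf)
      qed (simp add: W_def)
      then show ?thesis by simp
    next
      case False
      then have "f i = 0" "g i = 0" using f g by blast+
      then show ?thesis by simp
    qed
  qed
  show "\<exists>!f. ?P f" by (rule ex1I[of ?P, OF ex uniq[OF _ ex]])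
qed (auto simp: wspace_subspace)

definition wproj :: "('g \<Rightarrow> complex) \<Rightarrow> 'g \<Rightarrow> 'g" where
  "wproj = (SOME p. (\<forall>\<eta>. clinear (p \<eta>)) \<and> (\<forall>\<eta> x. \<eta> \<in> W \<longrightarrow> p \<eta> x \<in> wspace \<eta>) \<and>
     (\<forall>\<eta> \<mu> x. \<eta> \<in> W \<longrightarrow> x \<in> wspace \<eta> \<longrightarrow> p \<mu> x = (if \<mu> = \<eta> then x else 0)) \<and>
     (\<forall>x. {\<eta>. p \<eta> x \<noteq> 0} \<subseteq> W) \<and> (\<forall>x. (\<Sum>\<eta> | p \<eta> x \<noteq> 0. p \<eta> x) = x))"

lemma wproj_props: "(\<forall>\<eta>. clinear (wproj \<eta>)) \<and> (\<forall>\<eta> x. \<eta> \<in> W \<longrightarrow> wproj \<eta> x \<in> wspace \<eta>) \<and>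
     (\<forall>\<eta> \<mu> x. \<eta> \<in> W \<longrightarrow> x \<in> wspace \<eta> \<longrightarrow> wproj \<mu> x = (if \<mu> = \<eta> then x else 0)) \<and>
     (\<forall>x. {\<eta>. wproj \<eta> x \<noteq> 0} \<subseteq> W) \<and> (\<forall>x. (\<Sum>\<eta> | wproj \<eta> x \<noteq> 0. wproj \<eta> x) = x)"
proof -
  obtain p where p: "\<And>\<eta>. clinear (p \<eta>)" "\<And>\<eta> x. \<eta> \<in> W \<Longrightarrow> p \<eta> x \<in> wspace \<eta>"
    "\<And>\<eta> \<mu> x. \<eta> \<in> W \<Longrightarrow> x \<in> wspace \<eta> \<Longrightarrow> p \<mu> x = (if \<mu> = \<eta> then x else 0)"
    "\<And>x. {\<eta>. p \<eta> x \<noteq> 0} \<subseteq> W" "\<And>x. (\<Sum>\<eta> | p \<eta> x \<noteq> 0. p \<eta> x) = x"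
    by (rule direct_sum_components[OF wspaces_direct_sum]) blast
  show ?thesis
    unfolding wproj_def
    by (rule someI[where x = p], intro conjI allI impI) (erule p p(3)[rotated] | rule p | assumption)+
qed

lemma wproj_linear: "clinear (wproj \<eta>)" using wproj_props by blast

lemma wproj_outside: "\<eta> \<notin> W \<Longrightarrow> wproj \<eta> x = 0" using wproj_props by blast

lemma wproj_in: "wproj \<eta> x \<in> wspace \<eta>"
  using wproj_props wproj_outside cv.subspace_0[OF wspace_subspace] by (cases "\<eta> \<in> W") auto

lemma wproj_wspace:
  assumes "\<eta> \<in> cart0_dual A" "x \<in> wspace \<eta>"
  shows "wproj \<mu> x = (if \<mu> = \<eta> then x else 0)"
proof (cases "\<eta> \<in> W")
  case True
  then show ?thesis using wproj_props assms(2) by blast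
next
  case False
  then have "x = 0" using assms by (auto simp: W_def)
  then show ?thesis by (simp add: clinear_0[OF wproj_linear])
qed

lemma wproj_sum: "(\<Sum>\<eta>\<in>W. wproj \<eta> x) = x"
proof -
  have "{\<eta>. wproj \<eta> x \<noteq> 0} \<subseteq> W" "(\<Sum>\<eta> | wproj \<eta> x \<noteq> 0. wproj \<eta> x) = x" using wproj_props by blast+
  moreover have "(\<Sum>\<eta> | wproj \<eta> x \<noteq> 0. wproj \<eta> x) = (\<Sum>\<eta>\<in>W. wproj \<eta> x)"
    by (rule sum.mono_neutral_left[OF W_finite calculation(1)]) auto
  ultimately show ?thesis by simp
qed

lemma wproj_idem: "wproj \<eta> (wproj \<eta> x) = wproj \<eta> x"
proof (cases "\<eta> \<in> W")
  case True
  then show ?thesis using wproj_wspace[OF W_dual wproj_in] by simp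
qed (simp add: wproj_outside)

lemma wproj_shift:
  assumes T: "clinear T" "\<alpha> \<in> cart0_dual A" "\<And>\<eta> x. \<eta> \<in> cart0_dual A \<Longrightarrow> x \<in> wspace \<eta> \<Longrightarrow> T x \<in> wspace (\<eta> + \<alpha>)"
  shows "wproj (\<gamma> + \<alpha>) (T x) = T (wproj \<gamma> x)"
proof -
  have "wproj (\<gamma> + \<alpha>) (T x) = wproj (\<gamma> + \<alpha>) (T (\<Sum>\<eta>\<in>W. wproj \<eta> x))" by (simp only: wproj_sum)
  also have "\<dots> = (\<Sum>\<eta>\<in>W. wproj (\<gamma> + \<alpha>) (T (wproj \<eta> x)))"
    by (simp add: clinear_sum[OF T(1)] clinear_sum[OF wproj_linear])
  also have "\<dots> = (\<Sum>\<eta>\<in>W. if \<eta> = \<gamma> then T (wproj \<gamma> x) else 0)"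
  proof (rule sum.cong[OF refl])
    fix \<eta> assume l: "\<eta> \<in> W"
    have "\<eta> + \<alpha> \<in> cart0_dual A" using W_dual[OF l] T(2) cv.subspace_add[OF cart0_dual_subspace] by blast
    from wproj_wspace[OF this T(3)[OF W_dual[OF l] wproj_in]]
    show "wproj (\<gamma> + \<alpha>) (T (wproj \<eta> x)) = (if \<eta> = \<gamma> then T (wproj \<gamma> x) else 0)" by auto
  qed
  also have "\<dots> = T (wproj \<gamma> x)" using W_finite by (simp add: wproj_outside clinear_0[OF T(1)])
  finally show ?thesis .
qed

lemma zero_dual: "0 \<in> cart0_dual A" by (rule cv.subspace_0[OF cart0_dual_subspace])

lemma wproj_aut: "wproj \<eta> (aut A i x) = aut A i (wproj \<eta> x)"
  using wproj_shift[OF aut_linear zero_dual, of i \<eta> x] wspace_aut by simp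

lemma wproj_br:
  assumes "\<alpha> \<in> cart0_dual A" "y \<in> wspace \<alpha>"
  shows "wproj (\<gamma> + \<alpha>) (br y x) = br y (wproj \<gamma> x)"
  by (rule wproj_shift[OF br_linear(1) assms(1)]) (use wspace_br[OF assms(2)] in \<open>simp add: add.commute\<close>)

lemma wproj_br0:
  assumes "y \<in> wspace 0"
  shows "wproj \<gamma> (br y x) = br y (wproj \<gamma> x)"
  using wproj_br[OF zero_dual assms, of \<gamma> x] by simp

subsection \<open>The weight zero part\<close>

lemma eig0_br: "x \<in> eig A 0 \<Longrightarrow> y \<in> eig A 0 \<Longrightarrow> br x y \<in> eig A 0"
  by (simp add: eig0 aut_br)

text \<open>An Engel argument. Let \<open>Q\<close> be a minimal \<open>H\<close>-stable space that properly contains \<open>H\<close> and on which \<open>H\<close> is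
  nilpotent. Descending along the lower central series of \<open>H\<close>, its terms map \<open>Q\<close> into \<open>H\<close>: if the next term
  does, then \<open>H + [l, Q]\<close> is \<open>H\<close>-stable for \<open>l\<close> in the current term, and it is properly smaller than \<open>Q\<close> as
  \<open>l\<close> is nilpotent, so it equals \<open>H\<close> by minimality. Hence \<open>Q\<close> normalises \<open>H\<close>, which is self-normalising.\<close>

lemma wspace0_eig0: "wspace 0 \<inter> eig A 0 = H"
proof
  show "H \<subseteq> wspace 0 \<inter> eig A 0" using H_wspace0 H_eig0 by blast
  show "wspace 0 \<inter> eig A 0 \<subseteq> H"
  proof (rule ccontr)
    let ?M = "wspace 0 \<inter> eig A 0"
    assume not: "\<not> ?M \<subseteq> H"
    let ?P = "\<lambda>Q. cv.subspace Q \<and> H \<subset> Q \<and> Q \<subseteq> ?M \<and> (\<forall>h\<in>H. \<forall>q\<in>Q. br h q \<in> Q)"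
    have "?P ?M"
      using not H_wspace0 H_eig0 wspace_H eig0_br cv.subspace_inter[OF wspace_subspace eig_subspace] by auto
    then obtain Q where Q: "?P Q" "\<And>Q'. ?P Q' \<Longrightarrow> cv.dim Q \<le> cv.dim Q'"
      using ex_has_least_nat[of ?P ?M cv.dim] by blast
    have subQ: "cv.subspace Q" and HQ: "H \<subset> Q" and QM: "Q \<subseteq> ?M" and stab: "\<And>h q. h \<in> H \<Longrightarrow> q \<in> Q \<Longrightarrow> br h q \<in> Q"
      using Q(1) by blast+
    obtain n where n: "lower_central_series br H n = {0}" by (rule H_nilpotent)
    have step: "br l q \<in> H" if l: "l \<in> lower_central_series br H i" and q: "q \<in> Q"
      and next_in: "\<And>l q. l \<in> lower_central_series br H (Suc i) \<Longrightarrow> q \<in> Q \<Longrightarrow> br l q \<in> H" for i l q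
    proof -
      have lH: "l \<in> H" using l lower_central_series_H by blast
      define Q' where "Q' = {a + br l q |a q. a \<in> H \<and> q \<in> Q}"
      have HQ': "H \<subseteq> Q'"
      proof
        fix h assume "h \<in> H"
        then have "h = h + br l 0" "0 \<in> Q" using cv.subspace_0[OF subQ] by (simp_all add: br_simps)
        with \<open>h \<in> H\<close> show "h \<in> Q'" unfolding Q'_def by blast
      qed
      have lQ': "br l q \<in> Q'" if "q \<in> Q" for q
      proof -
        have "br l q = 0 + br l q" "0 \<in> H" using cv.subspace_0[OF H_subspace] by simp_all
        with that show ?thesis unfolding Q'_def by blast
      qed
      have Q'Q: "Q' \<subseteq> Q" unfolding Q'_def using HQ stab lH cv.subspace_add[OF subQ] by blast
      have subQ': "cv.subspace Q'"
        unfolding cv.subspace_def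
      proof (intro conjI ballI allI)
        show "0 \<in> Q'" using HQ' cv.subspace_0[OF H_subspace] by blast
        fix x y assume "x \<in> Q'" "y \<in> Q'"
        then obtain a q b r where xy: "x = a + br l q" "a \<in> H" "q \<in> Q" "y = b + br l r" "b \<in> H" "r \<in> Q"
          unfolding Q'_def by blast
        then have "x + y = (a + b) + br l (q + r)" by (simp add: br_simps)
        moreover have "a + b \<in> H" "q + r \<in> Q" using xy cv.subspace_add[OF H_subspace] cv.subspace_add[OF subQ] by auto
        ultimately show "x + y \<in> Q'" unfolding Q'_def by blast
        fix c
        have "c *\<^sub>C x = c *\<^sub>C a + br l (c *\<^sub>C q)" unfolding xy(1) by (simp add: br_simps scaleC_right_distrib)
        moreover have "c *\<^sub>C a \<in> H" "c *\<^sub>C q \<in> Q" using xy cv.subspace_scale[OF H_subspace] cv.subspace_scale[OF subQ] by auto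
        ultimately show "c *\<^sub>C x \<in> Q'" unfolding Q'_def by blast
      qed
      have stab': "br h x \<in> Q'" if hx: "h \<in> H" "x \<in> Q'" for h x
      proof -
        obtain a q where x: "x = a + br l q" "a \<in> H" "q \<in> Q" using hx(2) unfolding Q'_def by blast
        have "br h l \<in> lower_central_series br H (Suc i)" using hx(1) l by (auto intro!: cv.span_base)
        then have "br (br h l) q \<in> H" using next_in x(3) by blast
        then have "br h a + br (br h l) q \<in> H" using H_br[OF hx(1) x(2)] cv.subspace_add[OF H_subspace] by blast
        moreover have "br h x = (br h a + br (br h l) q) + br l (br h q)"
          unfolding x(1) by (simp add: br_simps br_jacobi)
        ultimately show ?thesis unfolding Q'_def using stab[OF hx(1) x(3)] by blast
      qed
      have "Q' = H"
      proof (rule ccontr)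
        assume "Q' \<noteq> H"
        then have "?P Q'" using subQ' HQ' Q'Q QM stab' by blast
        then have "\<not> Q' \<subset> Q" using Q(2) dim_psubset[OF fin subQ' subQ] by (meson leD)
        then have "Q' = Q" using Q'Q by blast
        have nil: "\<exists>m. (br l ^^ m) x = 0" if "x \<in> Q" for x
        proof -
          have "x \<in> generalised_eigenspace (br l) 0" using QM that lH by (auto simp: wspace_def)
          then show ?thesis by (simp add: generalised_eigenspace_def)
        qed
        obtain m where m: "\<forall>x\<in>Q. (br l ^^ m) x = 0"
          by (rule uniformly_nilpotent_on[where M = Q, OF fin br_linear(1) nil]) (assumption, rule that, rule ballI)
        have "\<exists>a q'. a \<in> H \<and> q' \<in> Q \<and> q = a + (br l ^^ k) q'" if "q \<in> Q" for k q
          using that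
        proof (induction k arbitrary: q)
          case 0
          have "0 \<in> H" by (rule cv.subspace_0[OF H_subspace])
          moreover have "q = 0 + (br l ^^ 0) q" by simp
          ultimately show ?case using 0 by blast
        next
          case (Suc k)
          then obtain a q' where 1: "a \<in> H" "q' \<in> Q" "q = a + br l q'" using \<open>Q' = Q\<close> unfolding Q'_def by blast
          obtain b q'' where 2: "b \<in> H" "q'' \<in> Q" "q' = b + (br l ^^ k) q''" using Suc.IH[OF 1(2)] by blast
          have "q = (a + br l b) + (br l ^^ Suc k) q''" unfolding 1(3) 2(3) by (simp add: br_simps)
          moreover have "a + br l b \<in> H" using 1(1) 2(1) lH H_br cv.subspace_add[OF H_subspace] by blast
          ultimately show ?case using 2(2) by blast
        qed
        then have "Q \<subseteq> H" using m by (metis add.right_neutral subsetI)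
        with HQ show False by blast
      qed
      with lQ'[OF q] show ?thesis by simp
    qed
    have "\<forall>l q. l \<in> lower_central_series br H (n - i) \<longrightarrow> q \<in> Q \<longrightarrow> br l q \<in> H" if "i \<le> n" for i
      using that
    proof (induction i)
      case 0
      then show ?case using n cv.subspace_0[OF H_subspace] by (simp add: br_simps)
    next
      case (Suc i)
      then have "Suc (n - Suc i) = n - i" by simp
      then show ?case using step[of _ "n - Suc i"] Suc by (metis Suc_leD)
    qed
    from this[of n] have "br h q \<in> H" if "h \<in> H" "q \<in> Q" for h q using that by simp
    then have "br q h \<in> H" if "h \<in> H" "q \<in> Q" for h q
      using that br_skew[of q h] cv.subspace_neg[OF H_subspace] by simp
    then have "Q \<subseteq> H" using H_normalizer QM by blast
    with HQ show False by blast
  qed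
qed

text \<open>Here \<open>y\<close> is the average of \<open>x\<close> over the finite group generated by the commuting automorphisms, formed by
  averaging over one of them after the other.\<close>

lemma average_exists:
  assumes "cv.subspace U" "\<And>i x. x \<in> U \<Longrightarrow> aut A i x \<in> U" "x \<in> U"
  obtains y where "y \<in> U" "y \<in> eig A 0"
    "\<And>\<phi> :: 'g \<Rightarrow> complex. clinear \<phi> \<Longrightarrow> (\<And>i x. \<phi> (aut A i x) = \<phi> x) \<Longrightarrow> \<phi> y = \<phi> x"
proof -
  have "\<exists>y\<in>U. (\<forall>i\<in>I. aut A i y = y) \<and>
      (\<forall>\<phi> :: 'g \<Rightarrow> complex. clinear \<phi> \<longrightarrow> (\<forall>i x. \<phi> (aut A i x) = \<phi> x) \<longrightarrow> \<phi> y = \<phi> x)" if "finite I" for I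
    using that
  proof (induction I rule: finite_induct)
    case empty
    then show ?case using assms(3) by auto
  next
    case (insert i I)
    then obtain y where y: "y \<in> U" "\<And>j. j \<in> I \<Longrightarrow> aut A j y = y"
      "\<And>\<phi> :: 'g \<Rightarrow> complex. clinear \<phi> \<Longrightarrow> (\<forall>i x. \<phi> (aut A i x) = \<phi> x) \<Longrightarrow> \<phi> y = \<phi> x" by blast
    let ?m = "ord A i"
    let ?s = "\<Sum>j<?m. (aut A i ^^ j) y"
    let ?z = "inverse (of_nat ?m) *\<^sub>C ?s"
    have iter: "(aut A i ^^ j) y \<in> U" for j by (induction j) (use assms(2) y(1) in auto)
    have "aut A i ?s = (\<Sum>j<?m. (aut A i ^^ Suc j) y)" by (simp add: clinear_sum[OF aut_linear])
    also have "\<dots> = ?s + ((aut A i ^^ ?m) y - (aut A i ^^ 0) y)"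
      using sum_lessThan_telescope[of "\<lambda>j. (aut A i ^^ j) y" ?m] unfolding sum_subtractf
      by (simp add: algebra_simps)
    finally have si: "aut A i ?z = ?z" by (simp add: aut_ord clinear_scale[OF aut_linear])
    have "aut A j ((aut A i ^^ k) y) = (aut A i ^^ k) y" if "j \<in> I" for j k
      by (induction k) (simp_all add: y(2)[OF that] aut_comm[of j i])
    then have sj: "aut A j ?z = ?z" if "j \<in> I" for j
      using that by (simp add: clinear_sum[OF aut_linear] clinear_scale[OF aut_linear])
    have "\<phi> ?z = \<phi> x" if \<phi>: "clinear \<phi>" "\<forall>i x. \<phi> (aut A i x) = \<phi> x" for \<phi> :: "'g \<Rightarrow> complex"
    proof -
      have "\<phi> ((aut A i ^^ j) y) = \<phi> y" for j by (induction j) (simp_all add: \<phi>(2))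
      then have "\<phi> ?s = of_nat ?m * \<phi> y" by (simp add: clinear_sum[OF \<phi>(1)])
      then show ?thesis using ord_pos[of i] y(3)[OF \<phi>] by (simp add: clinear_scale[OF \<phi>(1)] scaleC_complex_def)
    qed
    moreover have "?z \<in> U" using iter assms(1) by (intro cv.subspace_scale cv.subspace_sum) auto
    ultimately show ?case using si sj by (intro bexI[of _ ?z]) auto
  qed
  from this[OF finite_class.finite_UNIV] obtain y where "y \<in> U" "\<forall>i. aut A i y = y"
    "\<forall>\<phi> :: 'g \<Rightarrow> complex. clinear \<phi> \<longrightarrow> (\<forall>i x. \<phi> (aut A i x) = \<phi> x) \<longrightarrow> \<phi> y = \<phi> x" by auto
  then show ?thesis by (intro that[of y]) (simp_all add: eig0)
qed

text \<open>Brackets of opposite weight vectors need not lie in \<open>H\<close>; their averages do, and the traces used below do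
  not see the difference.\<close>

lemma average_in_H:
  assumes "z \<in> wspace 0"
  obtains h where "h \<in> H" "\<And>\<phi> :: 'g \<Rightarrow> complex. clinear \<phi> \<Longrightarrow> (\<And>i x. \<phi> (aut A i x) = \<phi> x) \<Longrightarrow> \<phi> h = \<phi> z"
  using average_exists[OF wspace_subspace wspace_aut assms] wspace0_eig0 by (metis IntI)

subsection \<open>Traces on weight spaces\<close>

text \<open>The dimension of the weight space, in the form in which it enters traces.\<close>

definition wdim :: "('g \<Rightarrow> complex) \<Rightarrow> nat" where
  "wdim \<eta> = (SOME n. trace (wproj \<eta>) = of_nat n)"

lemma wdim: "trace (wproj \<eta>) = of_nat (wdim \<eta>)"
proof -
  have "\<exists>n. trace (wproj \<eta>) = of_nat n"
    by (rule trace_idempotent[OF fin wproj_linear wproj_idem]) blast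
  then show ?thesis unfolding wdim_def by (rule someI_ex)
qed

lemma wdim_pos: assumes "\<eta> \<in> W" shows "wdim \<eta> > 0"
proof -
  obtain n where n: "trace (wproj \<eta>) = of_nat n" "n = 0 \<Longrightarrow> wproj \<eta> = (\<lambda>x. 0)"
    by (rule trace_idempotent[OF fin wproj_linear wproj_idem]) blast
  obtain v where v: "v \<in> wspace \<eta>" "v \<noteq> 0" using assms cv.subspace_0[OF wspace_subspace] by (auto simp: W_def)
  then have "wproj \<eta> v \<noteq> 0" using wproj_wspace[OF W_dual[OF assms] v(1)] by simp
  then have "n \<noteq> 0" using n(2) by metis
  moreover have "wdim \<eta> = n" using n(1) wdim by simp
  ultimately show ?thesis by simp
qed

lemma wdim_outside: "\<eta> \<notin> W \<Longrightarrow> wdim \<eta> = 0"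
proof -
  assume "\<eta> \<notin> W"
  then have "wproj \<eta> = (\<lambda>x. 0)" using wproj_outside by auto
  then have "(of_nat (wdim \<eta>) :: complex) = 0" using wdim[of \<eta>] by simp
  then show ?thesis by simp
qed

definition wtrace :: "('g \<Rightarrow> complex) \<Rightarrow> 'g \<Rightarrow> complex" where
  "wtrace \<eta> y = trace (\<lambda>x. wproj \<eta> (br y x))"

lemma wtrace_linear: "clinear (wtrace \<eta>)"
  by (rule clinearI)
    (simp_all add: wtrace_def br_simps clinear_add[OF wproj_linear] clinear_scale[OF wproj_linear] trace_add trace_scale scaleC_complex_def)

lemma trace_split: "trace f = (\<Sum>\<eta>\<in>W. trace (\<lambda>x. wproj \<eta> (f x)))"
  by (simp add: wproj_sum flip: trace_sum)

lemma trace_wproj_move: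
  assumes "clinear f" "\<And>x. wproj \<eta> (f (wproj \<eta> x)) = 0"
  shows "trace (\<lambda>x. wproj \<eta> (f x)) = 0"
proof -
  have "trace (\<lambda>x. wproj \<eta> (f x)) = trace (\<lambda>x. wproj \<eta> (wproj \<eta> (f x)))" by (simp add: wproj_idem)
  also have "\<dots> = trace (\<lambda>x. wproj \<eta> (f (wproj \<eta> x)))"
    by (rule trace_comp[OF fin wproj_linear clinear_comp[OF wproj_linear assms(1)]])
  finally show ?thesis by (simp add: assms(2))
qed

lemma trace_aut_conj:
  assumes "clinear f" "\<And>x. g (aut A i x) = aut A i (f x)" "clinear g"
  shows "trace g = trace f"
proof -
  obtain k where k: "ord A i = Suc k" using ord_pos[of i] by (cases "ord A i") auto
  let ?\<tau> = "aut A i ^^ k"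
  have inverse: "aut A i (?\<tau> x) = x" "?\<tau> (aut A i x) = x" for x
    using aut_ord[of i x] unfolding k by (simp_all add: funpow_swap1)
  have "trace g = trace (\<lambda>x. aut A i (?\<tau> (g x)))" by (simp add: inverse)
  also have "\<dots> = trace (\<lambda>x. ?\<tau> (g (aut A i x)))"
    by (rule trace_comp[OF fin aut_linear clinear_comp[OF clinear_funpow[OF aut_linear] assms(3)]])
  also have "\<dots> = trace f" by (simp add: assms(2) inverse)
  finally show ?thesis .
qed

lemma wtrace_aut: "wtrace \<eta> (aut A i y) = wtrace \<eta> y"
  unfolding wtrace_def
  by (rule trace_aut_conj[of _ _ i]) (simp_all add: clinear_comp[OF wproj_linear br_linear(1)] wproj_aut flip: aut_br)

lemma wproj_H: "h \<in> H \<Longrightarrow> wproj \<eta> (br h x) = br h (wproj \<eta> x)"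
  by (rule wproj_br0[OF H_wspace0])

lemma wtrace_H:
  assumes "h \<in> H"
  shows "wtrace \<eta> h = of_nat (wdim \<eta>) * \<eta> h"
    and "trace (\<lambda>x. wproj \<eta> (br h (br h x))) = of_nat (wdim \<eta>) * (\<eta> h)\<^sup>2"
proof -
  have gen: "wproj \<eta> x \<in> generalised_eigenspace (br h) (\<eta> h)" for x
    using wproj_in[of \<eta> x] assms by (simp add: wspace_def)
  note * = trace_generalised_eigenspace[OF fin br_linear(1) wproj_linear wproj_idem wproj_H[OF assms] gen]
  show "wtrace \<eta> h = of_nat (wdim \<eta>) * \<eta> h" unfolding wtrace_def using *(1) wdim by simp
  show "trace (\<lambda>x. wproj \<eta> (br h (br h x))) = of_nat (wdim \<eta>) * (\<eta> h)\<^sup>2" using *(2) wdim by simp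
qed

lemma wtrace_br_other:
  assumes "x \<in> wspace \<alpha>" "y \<in> wspace \<beta>" "\<alpha> \<in> cart0_dual A" "\<beta> \<in> cart0_dual A" "\<alpha> + \<beta> \<noteq> 0"
  shows "wtrace \<eta> (br x y) = 0"
  unfolding wtrace_def
proof (rule trace_wproj_move[OF br_linear(1)])
  fix z
  have ab: "\<alpha> + \<beta> \<in> cart0_dual A" using assms(3,4) cv.subspace_add[OF cart0_dual_subspace] by blast
  have "br (br x y) (wproj \<eta> z) = wproj (\<eta> + (\<alpha> + \<beta>)) (br (br x y) z)"
    by (rule wproj_br[OF ab wspace_br[OF assms(1,2)], symmetric])
  also have "wproj \<eta> \<dots> = 0"
  proof (cases "\<eta> + (\<alpha> + \<beta>) \<in> W")
    case True
    then show ?thesis using wproj_wspace[OF W_dual wproj_in] assms(5) by simp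
  qed (simp add: wproj_outside clinear_0[OF wproj_linear])
  finally show "wproj \<eta> (br (br x y) (wproj \<eta> z)) = 0" .
qed

text \<open>With \<open>E = ad e\<close> and \<open>F = ad f\<close> this is the trace of \<open>F E\<close> on the weight space of \<open>\<gamma>\<close>; the trace of
  \<open>[E, F]\<close> is the difference of two consecutive values along the \<open>\<alpha>\<close>-string.\<close>

definition string_trace :: "'g \<Rightarrow> 'g \<Rightarrow> ('g \<Rightarrow> complex) \<Rightarrow> complex" where
  "string_trace e f \<gamma> = trace (\<lambda>x. wproj \<gamma> (br f (br e x)))"

lemma string_trace_outside: "\<gamma> \<notin> W \<Longrightarrow> string_trace e f \<gamma> = 0"
  by (simp add: string_trace_def wproj_outside)

lemma string_trace_step:
  assumes "\<alpha> \<in> cart0_dual A" "e \<in> wspace \<alpha>" "f \<in> wspace (- \<alpha>)"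
  shows "wtrace \<gamma> (br e f) = string_trace e f (\<gamma> - \<alpha>) - string_trace e f \<gamma>"
proof -
  have "trace (\<lambda>x. wproj \<gamma> (br e (br f x))) = trace (\<lambda>x. br e (wproj (\<gamma> - \<alpha>) (br f x)))"
    using wproj_br[OF assms(1,2), of "\<gamma> - \<alpha>"] by simp
  also have "\<dots> = trace (\<lambda>x. wproj (\<gamma> - \<alpha>) (br f (br e x)))"
    by (rule trace_comp[OF fin br_linear(1) clinear_comp[OF wproj_linear br_linear(1)]])
  finally have "trace (\<lambda>x. wproj \<gamma> (br e (br f x))) = string_trace e f (\<gamma> - \<alpha>)" by (simp add: string_trace_def)
  then show ?thesis
    by (simp add: wtrace_def br_jacobi clinear_diff[OF wproj_linear] trace_diff string_trace_def)
qed

text \<open>At the upper end of a string, \<open>e\<close> maps the weight space to zero.\<close>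

lemma string_trace_top:
  assumes "\<alpha> \<in> cart0_dual A" "e \<in> wspace \<alpha>" "f \<in> wspace (- \<alpha>)" "\<gamma> + \<alpha> \<notin> W"
  shows "string_trace e f \<gamma> = 0"
proof -
  have "- \<alpha> \<in> cart0_dual A" using assms(1) cv.subspace_neg[OF cart0_dual_subspace] by blast
  then have "wproj \<gamma> (br f (br e x)) = br f (wproj (\<gamma> + \<alpha>) (br e x))" for x
    using wproj_br[of "- \<alpha>" f "\<gamma> + \<alpha>"] assms(3) by simp
  then show ?thesis by (simp add: string_trace_def wproj_outside[OF assms(4)] br_simps)
qed

lemma string_leaves_W:
  assumes "\<alpha> \<noteq> 0"
  obtains N :: nat where "\<And>j::int. \<bar>j\<bar> \<ge> int N \<Longrightarrow> \<gamma> + of_int j *\<^sub>C \<alpha> \<notin> W"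
proof -
  let ?f = "\<lambda>j::int. \<gamma> + of_int j *\<^sub>C \<alpha>"
  have "inj ?f"
    using assms by (auto intro!: injI simp: cv.scale_right_imp_eq)
  then have fin_f: "finite (?f -` W)" by (rule finite_vimageI[OF W_finite])
  define N where "N = (\<Sum>j\<in>?f -` W. \<bar>j\<bar>) + 1"
  have N: "\<bar>j\<bar> < N" if "j \<in> ?f -` W" for j
    using member_le_sum[OF that, of abs] fin_f by (simp add: N_def)
  show ?thesis
  proof (rule that[of "nat N"])
    fix j :: int assume "\<bar>j\<bar> \<ge> int (nat N)"
    then have "\<not> \<bar>j\<bar> < N" by linarith
    then show "?f j \<notin> W" using N by blast
  qed
qed

lemma string_shift: "\<gamma> + of_int j *\<^sub>C \<alpha> - \<alpha> = \<gamma> + of_int (j - 1) *\<^sub>C (\<alpha> :: 'g \<Rightarrow> complex)"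
  by (simp add: cv.scale_left_diff_distrib scaleC_one)

text \<open>The traces of \<open>[e, f]\<close> on the weight spaces of the \<open>\<alpha>\<close>-string through \<open>\<gamma>\<close> telescope to zero. They are
  \<open>(\<gamma> + j \<alpha>)(h)\<close> times a dimension, so a positive multiple of \<open>\<gamma> h\<close> is an integral multiple of \<open>\<alpha> h\<close>.\<close>

lemma string_rational:
  assumes \<alpha>: "\<alpha> \<in> cart0_dual A" "\<alpha> \<noteq> 0" and \<gamma>: "\<gamma> \<in> W" and ef: "e \<in> wspace \<alpha>" "f \<in> wspace (- \<alpha>)"
    and h: "\<And>\<eta>. wtrace \<eta> (br e f) = of_nat (wdim \<eta>) * \<eta> h"
  obtains q :: real where "\<gamma> h = of_real q * \<alpha> h"
proof -
  obtain N where N: "\<And>j::int. \<bar>j\<bar> \<ge> int N \<Longrightarrow> \<gamma> + of_int j *\<^sub>C \<alpha> \<notin> W"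
    by (rule string_leaves_W[OF \<alpha>(2), of \<gamma>]) blast
  let ?d = "\<lambda>j::int. wdim (\<gamma> + of_int j *\<^sub>C \<alpha>)"
  let ?s = "\<lambda>j::int. string_trace e f (\<gamma> + of_int j *\<^sub>C \<alpha>)"
  let ?k = "\<lambda>i::nat. int i - int N"
  have val: "(\<gamma> + of_int j *\<^sub>C \<alpha>) h = \<gamma> h + of_int j * \<alpha> h" for j
    by (simp add: scaleC_fun_def scaleC_complex_def)
  have step: "of_nat (?d j) * (\<gamma> h + of_int j * \<alpha> h) = ?s (j - 1) - ?s j" for j
    using string_trace_step[OF \<alpha>(1) ef, of "\<gamma> + of_int j *\<^sub>C \<alpha>"] h[of "\<gamma> + of_int j *\<^sub>C \<alpha>"]
    unfolding string_shift by (simp only: val)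
  have "(\<Sum>i<2 * N + 1. of_nat (?d (?k i)) * (\<gamma> h + of_int (?k i) * \<alpha> h)) = (\<Sum>i<2 * N + 1. ?s (?k i - 1) - ?s (?k i))"
    by (simp only: step)
  also have "\<dots> = (\<Sum>i<2 * N + 1. ?s (int i - int N - 1) - ?s (int (Suc i) - int N - 1))"
    by (intro sum.cong refl) (simp add: algebra_simps)
  also have "\<dots> = ?s (- int N - 1) - ?s (int (2 * N + 1) - int N - 1)"
    by (subst sum_lessThan_telescope') simp
  also have "\<dots> = 0" using N[of "- int N - 1"] N[of "int (2 * N + 1) - int N - 1"] by (simp add: string_trace_outside)
  also have "(\<Sum>i<2 * N + 1. of_nat (?d (?k i)) * (\<gamma> h + of_int (?k i) * \<alpha> h)) =
      (\<Sum>i<2 * N + 1. \<gamma> h * of_real (real (?d (?k i))) + \<alpha> h * of_real (real (?d (?k i)) * of_int (?k i)))"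
    by (intro sum.cong refl) (simp add: algebra_simps)
  finally have eq: "\<gamma> h * of_real (\<Sum>i<2 * N + 1. real (?d (?k i))) + \<alpha> h * of_real (\<Sum>i<2 * N + 1. real (?d (?k i)) * of_int (?k i)) = 0"
    by (simp only: sum.distrib sum_distrib_left of_real_sum)
  let ?m = "\<Sum>i<2 * N + 1. real (?d (?k i))"
  have "?d (?k N) \<le> ?m" by (rule member_le_sum) auto
  then have "?m > 0" using wdim_pos[OF \<gamma>] by simp
  have solve: "a = of_real (- y / x) * b" if "a * of_real x + b * of_real y = 0" "x > 0" for a b :: complex and x y :: real
  proof -
    have "a * of_real x = - (b * of_real y)" using that(1) by (simp only: eq_neg_iff_add_eq_0)
    then have "a = - (b * of_real y) / of_real x" by (subst nonzero_eq_divide_eq) (use that(2) in simp_all)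
    then show ?thesis by simp
  qed
  show ?thesis by (rule that[OF solve[OF eq \<open>?m > 0\<close>]])
qed

subsection \<open>The Killing form\<close>

definition killing :: "'g \<Rightarrow> 'g \<Rightarrow> complex" where
  "killing x y = trace (\<lambda>z. br x (br y z))"

lemma killing_sym: "killing x y = killing y x"
  unfolding killing_def by (rule trace_comp[OF fin br_linear(1) br_linear(1)])

lemma killing_linear: "clinear (\<lambda>x. killing x y)" "clinear (killing x)"
  by (rule clinearI; simp add: killing_def br_simps trace_add trace_scale scaleC_complex_def)+

lemma killing_invariant: "killing (br x y) z = killing x (br y z)"
proof -
  have "trace (\<lambda>w. br y (br x (br z w))) = trace (\<lambda>w. br x (br z (br y w)))"
    by (rule trace_comp[OF fin br_linear(1) clinear_comp[OF br_linear(1) br_linear(1)]])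
  then show ?thesis by (simp add: killing_def br_jacobi br_simps trace_diff)
qed

lemma killing_aut: "killing (aut A i x) (aut A i y) = killing x y"
  unfolding killing_def
  by (rule trace_aut_conj[of _ _ i]) (simp_all add: clinear_comp[OF br_linear(1) br_linear(1)] flip: aut_br)

text \<open>The product of the two operators shifts every weight space to another one.\<close>

lemma killing_wspaces:
  assumes "x \<in> wspace \<alpha>" "y \<in> wspace \<beta>" "\<alpha> \<in> cart0_dual A" "\<beta> \<in> cart0_dual A" "\<alpha> + \<beta> \<noteq> 0"
  shows "killing x y = 0"
  unfolding killing_def
proof (subst trace_split, rule sum.neutral, intro ballI)
  fix \<eta>
  show "trace (\<lambda>z. wproj \<eta> (br x (br y z))) = 0"
  proof (rule trace_wproj_move[OF clinear_comp[OF br_linear(1) br_linear(1)]])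
    fix z
    have "br x (br y (wproj \<eta> z)) = wproj (\<eta> + \<beta> + \<alpha>) (br x (br y z))"
      by (simp add: wproj_br[OF assms(3,1)] wproj_br[OF assms(4,2)])
    also have "wproj \<eta> \<dots> = 0"
    proof (cases "\<eta> + \<beta> + \<alpha> \<in> W")
      case True
      have "\<eta> \<noteq> \<eta> + \<beta> + \<alpha>" using assms(5) by (simp add: add.assoc add.commute)
      with True show ?thesis using wproj_wspace[OF W_dual wproj_in] by simp
    qed (simp add: wproj_outside clinear_0[OF wproj_linear])
    finally show "wproj \<eta> (br x (br y (wproj \<eta> z))) = 0" .
  qed
qed

lemma killing_H_square: "h \<in> H \<Longrightarrow> killing h h = (\<Sum>\<eta>\<in>W. of_nat (wdim \<eta>) * (\<eta> h)\<^sup>2)"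
  unfolding killing_def by (subst trace_split) (simp add: wtrace_H(2))

lemma killing_H:
  assumes "h \<in> H" "k \<in> H"
  shows "killing h k = (\<Sum>\<eta>\<in>W. of_nat (wdim \<eta>) * \<eta> h * \<eta> k)"
proof -
  have "killing (h + k) (h + k) = killing h h + 2 * killing h k + killing k k"
    by (simp add: clinear_add[OF killing_linear(1)] clinear_add[OF killing_linear(2)] killing_sym[of k h])
  moreover have "killing (h + k) (h + k) = (\<Sum>\<eta>\<in>W. of_nat (wdim \<eta>) * (\<eta> h + \<eta> k)\<^sup>2)"
    using killing_H_square[OF cv.subspace_add[OF H_subspace assms]] weight_linear(1)[OF W_dual assms] by simp
  moreover have "\<dots> = killing h h + 2 * (\<Sum>\<eta>\<in>W. of_nat (wdim \<eta>) * \<eta> h * \<eta> k) + killing k k"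
    unfolding killing_H_square[OF assms(1)] killing_H_square[OF assms(2)] sum_distrib_left sum.distrib[symmetric]
    by (intro sum.cong refl) (simp add: power2_eq_square algebra_simps)
  ultimately show ?thesis by simp
qed

lemma derived_algebra: "cv.span {br x y |x y. True} = UNIV"
proof -
  let ?D = "cv.span {br x y |x y. True}"
  have "?D = {0} \<or> ?D = UNIV"
  proof (rule ideal_trivial)
    show "br x y \<in> ?D" for x y by (rule cv.span_base) blast
  qed simp
  moreover have "?D \<noteq> {0}"
  proof
    assume "?D = {0}"
    then have "br x y = 0" for x y using cv.span_base[of "br x y" "{br x y |x y. True}"] by blast
    then show False using simple unfolding simple_lie_algebra_on_def by blast
  qed
  ultimately show ?thesis by blast
qed

text \<open>A simple Lie algebra equals its derived algebra and so is not nilpotent, while \<open>H\<close> is.\<close>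

lemma eig0_not_nilpotent: "H \<noteq> eig A 0"
proof
  assume eq: "H = eig A 0"
  let ?S = "{br x y |x y. x \<in> eig A 0 \<and> y \<in> eig A 0}"
  have sub: "cv.span ?S \<subseteq> eig A 0" by (rule cv.span_minimal[OF _ eig_subspace]) (use eig0_br in blast)
  have "cv.span ?S = {0} \<or> cv.span ?S = eig A 0"
  proof -
    have "br x y \<in> cv.span ?S" if "x \<in> eig A 0" "y \<in> cv.span ?S" for x y
      using that sub by (intro cv.span_base) blast
    then show ?thesis using simple0 sub cv.subspace_span unfolding simple_lie_algebra_on_def by blast
  qed
  moreover obtain x y where xy: "x \<in> eig A 0" "y \<in> eig A 0" "br x y \<noteq> 0"
    using simple0 unfolding simple_lie_algebra_on_def by blast
  moreover from xy have "br x y \<in> cv.span ?S" by (intro cv.span_base) blast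
  ultimately have S: "cv.span ?S = eig A 0" by blast
  have "lower_central_series br H n = eig A 0" for n
    by (induction n) (simp_all add: eq S)
  then have "eig A 0 = {0}" using H_nilpotent by metis
  then show False using xy by (simp add: br_simps)
qed

text \<open>If the Killing form vanished, all weights would vanish on the averages of the brackets \<open>[e, f]\<close>
  of opposite weight vectors, by rationality. All traces of weight spaces would then vanish on the
  brackets, which span \<open>\<gg>\<close>. So zero would be the only weight, and the fixed algebra would be the nilpotent
  algebra \<open>H\<close>.\<close>

lemma killing_nonzero: "\<exists>x y. killing x y \<noteq> 0"
proof (rule ccontr)
  assume "\<nexists>x y. killing x y \<noteq> 0"
  then have zero: "killing x y = 0" for x y by blast
  have opp: "wtrace \<gamma> (br e f) = 0" if \<alpha>: "\<alpha> \<in> W" and ef: "e \<in> wspace \<alpha>" "f \<in> wspace (- \<alpha>)" for \<alpha> \<gamma> e f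
  proof (cases "\<alpha> = 0")
    case True
    have e0: "e \<in> wspace 0" and f0: "f \<in> wspace 0" using ef True by simp_all
    have "trace (\<lambda>x. wproj \<gamma> (br e (br f x))) = trace (\<lambda>x. br e (wproj \<gamma> (br f x)))"
      by (simp add: wproj_br0[OF e0])
    also have "\<dots> = trace (\<lambda>x. wproj \<gamma> (br f (br e x)))"
      by (rule trace_comp[OF fin br_linear(1) clinear_comp[OF wproj_linear br_linear(1)]])
    finally show ?thesis by (simp add: wtrace_def br_jacobi clinear_diff[OF wproj_linear] trace_diff)
  next
    case False
    have "br e f \<in> wspace 0" using wspace_br[OF ef] by simp
    then obtain h where h: "h \<in> H" "\<And>\<phi> :: 'g \<Rightarrow> complex. clinear \<phi> \<Longrightarrow> (\<And>i x. \<phi> (aut A i x) = \<phi> x) \<Longrightarrow> \<phi> h = \<phi> (br e f)"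
      by (rule average_in_H) blast
    have wt: "wtrace \<eta> (br e f) = of_nat (wdim \<eta>) * \<eta> h" for \<eta>
      using h(2)[OF wtrace_linear wtrace_aut] wtrace_H(1)[OF h(1)] by simp
    have "\<exists>q::real. \<eta> h = of_real q * \<alpha> h" if "\<eta> \<in> W" for \<eta>
      by (rule string_rational[OF W_dual[OF \<alpha>] False that ef wt]) blast
    then obtain q :: "_ \<Rightarrow> real" where q: "\<And>\<eta>. \<eta> \<in> W \<Longrightarrow> \<eta> h = of_real (q \<eta>) * \<alpha> h" by metis
    have "0 = (\<Sum>\<eta>\<in>W. of_nat (wdim \<eta>) * (\<eta> h)\<^sup>2)" using killing_H_square[OF h(1)] zero by simp
    also have "\<dots> = (\<Sum>\<eta>\<in>W. of_real (real (wdim \<eta>) * (q \<eta>)\<^sup>2) * (\<alpha> h)\<^sup>2)"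
      by (rule sum.cong[OF refl]) (simp add: q power_mult_distrib)
    also have "\<dots> = of_real (\<Sum>\<eta>\<in>W. real (wdim \<eta>) * (q \<eta>)\<^sup>2) * (\<alpha> h)\<^sup>2"
      by (simp add: sum_distrib_right)
    finally have "of_real (\<Sum>\<eta>\<in>W. real (wdim \<eta>) * (q \<eta>)\<^sup>2) * (\<alpha> h)\<^sup>2 = 0" by (rule sym)
    then have "(\<Sum>\<eta>\<in>W. real (wdim \<eta>) * (q \<eta>)\<^sup>2) = 0 \<or> \<alpha> h = 0"
      unfolding mult_eq_0_iff of_real_eq_0_iff power_eq_0_iff by blast
    then have "\<eta> h = 0" if "\<eta> \<in> W" for \<eta>
    proof
      assume "(\<Sum>\<eta>\<in>W. real (wdim \<eta>) * (q \<eta>)\<^sup>2) = 0"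
      then have "real (wdim \<eta>) * (q \<eta>)\<^sup>2 = 0" using sum_nonneg_eq_0_iff[OF W_finite, of "\<lambda>\<eta>. real (wdim \<eta>) * (q \<eta>)\<^sup>2"] that by simp
      then show ?thesis using q[OF that] wdim_pos[OF that] by simp
    qed (simp add: q[OF that])
    then have "of_nat (wdim \<gamma>) * \<gamma> h = 0" by (cases "\<gamma> \<in> W") (simp_all add: wdim_outside)
    then show ?thesis by (simp add: wt)
  qed
  have all_zero: "wtrace \<gamma> z \<in> {0}" for \<gamma> z
  proof (rule span_map_into[OF wtrace_linear cv.subspace_single_0])
    show "z \<in> cv.span {br x y |x y. True}" unfolding derived_algebra by (rule UNIV_I)
    fix s assume "s \<in> {br x y |x y. True}"
    then obtain x y where s: "s = br x y" by blast
    have "wtrace \<gamma> (br (wproj \<alpha> x) (wproj \<beta> y)) = 0" if "\<alpha> \<in> W" "\<beta> \<in> W" for \<alpha> \<beta>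
    proof (cases "\<alpha> + \<beta> = 0")
      case True
      then have "\<beta> = - \<alpha>" by (simp add: eq_neg_iff_add_eq_0 add.commute)
      then show ?thesis using opp[OF that(1) wproj_in] wproj_in by metis
    qed (rule wtrace_br_other[OF wproj_in wproj_in W_dual[OF that(1)] W_dual[OF that(2)]])
    moreover have "s = (\<Sum>\<alpha>\<in>W. \<Sum>\<beta>\<in>W. br (wproj \<alpha> x) (wproj \<beta> y))"
      unfolding s by (simp add: wproj_sum flip: clinear_sum[OF br_linear(1)] clinear_sum[OF br_linear(2)])
    ultimately show "wtrace \<gamma> s \<in> {0}" by (simp add: clinear_sum[OF wtrace_linear])
  qed
  have "\<gamma> h = 0" if "h \<in> H" "\<gamma> \<in> W" for \<gamma> h
    using all_zero[of \<gamma> h] wtrace_H(1)[OF that(1), of \<gamma>] wdim_pos[OF that(2)] by simp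
  then have "\<gamma> = 0" if "\<gamma> \<in> W" for \<gamma> using that cart0_dual_eqI[OF W_dual[OF that] zero_dual] by simp
  then have "(\<Union>\<eta>\<in>W. wspace \<eta>) \<subseteq> wspace 0" by blast
  then have "wspace 0 = UNIV" using cv.span_minimal[OF _ wspace_subspace] wspaces_span by blast
  then have "H = eig A 0" using wspace0_eig0 by blast
  with eig0_not_nilpotent show False by blast
qed

text \<open>The radical of the form is an ideal.\<close>

lemma killing_nondeg:
  assumes "\<And>y. killing x y = 0"
  shows "x = 0"
proof -
  let ?R = "{x. \<forall>y. killing x y = 0}"
  have "?R = {0} \<or> ?R = UNIV"
  proof (rule ideal_trivial)
    show "cv.subspace ?R"
      unfolding cv.subspace_def
      by (simp add: clinear_0[OF killing_linear(1)] clinear_add[OF killing_linear(1)] clinear_scale[OF killing_linear(1)] scaleC_complex_def)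
    show "br x y \<in> ?R" if "y \<in> ?R" for x y
    proof -
      have "killing (br y x) z = 0" for z using that by (simp add: killing_invariant)
      then show ?thesis using br_skew[of x y] by (simp add: clinear_neg[OF killing_linear(1)])
    qed
  qed
  moreover have "?R \<noteq> UNIV" using killing_nonzero by blast
  ultimately show ?thesis using assms by blast
qed

text \<open>Averaging reduces the pairing of \<open>h\<close> with the zero weight space to its pairing with \<open>H\<close>.\<close>

lemma killing_nondeg_H:
  assumes "h \<in> H" "\<And>k. k \<in> H \<Longrightarrow> killing h k = 0"
  shows "h = 0"
proof (rule killing_nondeg)
  fix y
  have "killing h (wproj \<eta> y) = 0" if \<eta>: "\<eta> \<in> W" for \<eta>
  proof (cases "\<eta> = 0")
    case True
    then have "wproj \<eta> y \<in> wspace 0" using wproj_in[of \<eta> y] by simp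
    then obtain k where k: "k \<in> H" "\<And>\<phi> :: 'g \<Rightarrow> complex. clinear \<phi> \<Longrightarrow> (\<And>i x. \<phi> (aut A i x) = \<phi> x) \<Longrightarrow> \<phi> k = \<phi> (wproj \<eta> y)"
      by (rule average_in_H) blast
    have "killing h (aut A i x) = killing h x" for i x using killing_aut[of i h x] aut_H[OF assms(1)] by simp
    then have "killing h k = killing h (wproj \<eta> y)" by (rule k(2)[OF killing_linear(2)])
    then show ?thesis using assms(2) k(1) by simp
  next
    case False
    then show ?thesis using killing_wspaces[OF H_wspace0[OF assms(1)] wproj_in zero_dual W_dual[OF \<eta>]] by simp
  qed
  moreover have "killing h y = (\<Sum>\<eta>\<in>W. killing h (wproj \<eta> y))" by (simp add: wproj_sum flip: clinear_sum[OF killing_linear(2)])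
  ultimately show "killing h y = 0" by simp
qed

subsection \<open>The Cartan subalgebra acts diagonalisably\<close>

text \<open>By non-degeneracy the linear form \<open>x \<mapsto> tr (D \<circ> ad x)\<close> is the pairing with some \<open>d\<close>. The derivation
  \<open>E = D - ad d\<close> then satisfies \<open>tr (E \<circ> ad x) = 0\<close> for all \<open>x\<close>, and the Killing form of \<open>E x\<close> and \<open>y\<close> is
  \<open>tr (E \<circ> ad [x, y])\<close>.\<close>

lemma derivation_inner:
  assumes D: "clinear D" "\<And>x y. D (br x y) = br (D x) y + br x (D y)"
  obtains d where "\<And>x. D x = br d x"
proof -
  have lin: "clinear (\<lambda>x. trace (\<lambda>z. D (br x z)))"
    by (rule clinearI) (simp_all add: br_simps clinear_add[OF D(1)] clinear_scale[OF D(1)] trace_add trace_scale scaleC_complex_def)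
  obtain d where d: "\<And>x. killing d x = trace (\<lambda>z. D (br x z))"
    by (rule nondegenerate_represents[OF fin killing_linear killing_nondeg lin]) (assumption, rule that)
  define E where "E x = D x - br d x" for x
  have E_lin: "clinear E" unfolding E_def by (intro clinear_minus D(1) br_linear)
  have E_der: "E (br x y) = br (E x) y + br x (E y)" for x y
    by (simp add: E_def D(2) br_simps br_jacobi algebra_simps)
  have E_trace: "trace (\<lambda>z. E (br x z)) = 0" for x
    using d[of x] by (simp add: E_def trace_diff killing_def)
  have "E x = 0" for x
  proof (rule killing_nondeg)
    fix y
    have "trace (\<lambda>z. br x (E (br y z))) = trace (\<lambda>z. E (br y (br x z)))"
      by (rule trace_comp[OF fin br_linear(1) clinear_comp[OF E_lin br_linear(1)]])
    then have "killing (E x) y = trace (\<lambda>z. E (br x (br y z))) - trace (\<lambda>z. E (br y (br x z)))"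
      by (simp add: killing_def E_der trace_add)
    also have "\<dots> = trace (\<lambda>z. E (br (br x y) z))"
      by (simp add: br_jacobi clinear_diff[OF E_lin] trace_diff)
    finally show "killing (E x) y = 0" by (simp add: E_trace)
  qed
  then have "D x = br d x" for x by (simp add: E_def)
  then show ?thesis by (rule that)
qed

text \<open>The semisimple part of \<open>ad h\<close> is a derivation, hence inner, and the element that induces it lies in
  \<open>H\<close> and has the same weights as \<open>h\<close>.\<close>

lemma H_diagonal:
  assumes h: "h \<in> H" and x: "x \<in> wspace \<eta>" and \<eta>: "\<eta> \<in> cart0_dual A"
  shows "br h x = \<eta> h *\<^sub>C x"
proof -
  define D where "D x = (\<Sum>\<eta>\<in>W. \<eta> h *\<^sub>C wproj \<eta> x)" for x
  have D_lin: "clinear D" unfolding D_def by (intro clinear_sum_map clinear_scaled wproj_linear)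
  have D_wt: "D x = \<eta> h *\<^sub>C x" if "x \<in> wspace \<eta>" "\<eta> \<in> cart0_dual A" for x \<eta>
  proof (cases "\<eta> \<in> W")
    case True
    have "D x = (\<Sum>\<mu>\<in>W. if \<mu> = \<eta> then \<eta> h *\<^sub>C x else 0)"
      unfolding D_def by (rule sum.cong[OF refl]) (simp add: wproj_wspace[OF that(2,1)])
    then show ?thesis using True W_finite by simp
  next
    case False
    then have "x = 0" using that by (auto simp: W_def)
    then show ?thesis by (simp add: clinear_0[OF D_lin])
  qed
  have D_der: "D (br x y) = br (D x) y + br x (D y)" for x y
  proof -
    have 1: "D (br (wproj \<alpha> x) (wproj \<beta> y)) = br (D (wproj \<alpha> x)) (wproj \<beta> y) + br (wproj \<alpha> x) (D (wproj \<beta> y))"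
      if "\<alpha> \<in> W" "\<beta> \<in> W" for \<alpha> \<beta>
      using D_wt[OF wspace_br[OF wproj_in wproj_in] cv.subspace_add[OF cart0_dual_subspace W_dual[OF that(1)] W_dual[OF that(2)]]]
      by (simp add: D_wt[OF wproj_in W_dual[OF that(1)]] D_wt[OF wproj_in W_dual[OF that(2)]] br_simps scaleC_left_distrib)
    have "D (br x y) = D (br (\<Sum>\<alpha>\<in>W. wproj \<alpha> x) (\<Sum>\<beta>\<in>W. wproj \<beta> y))" by (simp only: wproj_sum)
    also have "\<dots> = (\<Sum>\<alpha>\<in>W. \<Sum>\<beta>\<in>W. D (br (wproj \<alpha> x) (wproj \<beta> y)))"
      by (simp only: clinear_sum[OF br_linear(1)] clinear_sum[OF br_linear(2)] clinear_sum[OF D_lin]) (rule sum.swap)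
    also have "\<dots> = (\<Sum>\<alpha>\<in>W. \<Sum>\<beta>\<in>W. br (D (wproj \<alpha> x)) (wproj \<beta> y) + br (wproj \<alpha> x) (D (wproj \<beta> y)))"
      by (intro sum.cong refl 1)
    also have "\<dots> = (\<Sum>\<alpha>\<in>W. br (D (wproj \<alpha> x)) y + br (wproj \<alpha> x) (D y))"
      by (simp add: sum.distrib wproj_sum flip: clinear_sum[OF br_linear(1)] clinear_sum[OF D_lin])
    also have "\<dots> = br (D x) y + br x (D y)"
      by (simp add: sum.distrib wproj_sum flip: clinear_sum[OF br_linear(2)] clinear_sum[OF D_lin])
    finally show ?thesis .
  qed
  obtain d where d: "\<And>x. D x = br d x" by (rule derivation_inner[OF D_lin D_der]) blast
  have D_aut: "D (aut A i x) = aut A i (D x)" for i x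
    by (simp add: D_def wproj_aut clinear_sum[OF aut_linear] clinear_scale[OF aut_linear])
  have "aut A i d = d" for i
  proof -
    have "br (aut A i d) x = br d x" for x
    proof -
      obtain y where y: "x = aut A i y" using bij_is_surj[OF aut_bij] by (rule surjE)
      show ?thesis unfolding y using D_aut[of i y] by (simp add: d flip: aut_br)
    qed
    then have "killing (aut A i d - d) y = 0" for y by (simp add: killing_def br_simps)
    then have "aut A i d - d = 0" by (rule killing_nondeg)
    then show ?thesis by simp
  qed
  then have "d \<in> eig A 0" by (simp add: eig0)
  moreover have "br d k \<in> H" if "k \<in> H" for k
    using D_wt[OF H_wspace0[OF that] zero_dual] cv.subspace_0[OF H_subspace] by (simp add: d)
  ultimately have dH: "d \<in> H" by (rule H_normalizer)
  have wt: "\<mu> d = \<mu> h" if "\<mu> \<in> W" for \<mu>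
  proof -
    have "wproj \<mu> (br d x) = \<mu> h *\<^sub>C wproj \<mu> x" for x
      using wproj_H[OF dH, of \<mu> x] D_wt[OF wproj_in W_dual[OF that]] by (simp add: d)
    then have "wtrace \<mu> d = \<mu> h * of_nat (wdim \<mu>)" by (simp add: wtrace_def trace_scale wdim)
    then show ?thesis using wtrace_H(1)[OF dH] wdim_pos[OF that] by simp
  qed
  have "h - d = 0"
  proof (rule killing_nondeg_H)
    show "h - d \<in> H" using h dH cv.subspace_diff[OF H_subspace] by blast
    fix k assume k: "k \<in> H"
    have "killing h k = killing d k" unfolding killing_H[OF h k] killing_H[OF dH k] by (simp add: wt)
    then show "killing (h - d) k = 0" by (simp add: clinear_diff[OF killing_linear(1)])
  qed
  then show ?thesis using d[of x] D_wt[OF x \<eta>] by simp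
qed

lemma wspace_eq_weight_space: "\<eta> \<in> cart0_dual A \<Longrightarrow> wspace \<eta> = weight_space A UNIV \<eta>"
proof (intro equalityI subsetI)
  assume \<eta>: "\<eta> \<in> cart0_dual A"
  fix x
  show "x \<in> weight_space A UNIV \<eta>" if "x \<in> wspace \<eta>" using H_diagonal[OF _ that \<eta>] by (simp add: weight_space_def)
  assume "x \<in> weight_space A UNIV \<eta>"
  then have "((\<lambda>y. br h y - \<eta> h *\<^sub>C y) ^^ 1) x = 0" if "h \<in> H" for h using that by (simp add: weight_space_def)
  then show "x \<in> wspace \<eta>" unfolding wspace_def generalised_eigenspace_def by blast
qed

lemma W_weights: "W = weights A UNIV"
  unfolding W_def weights_def
  by (rule Collect_cong, rule conj_cong[OF refl], drule wspace_eq_weight_space, simp only:)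

lemma H_abelian: "h \<in> H \<Longrightarrow> k \<in> H \<Longrightarrow> br h k = 0"
  using H_diagonal[OF _ H_wspace0 zero_dual] by simp

subsection \<open>A positive element of the Cartan subalgebra\<close>

text \<open>The vectors \<open>e\<close> and \<open>f\<close> are paired to \<open>1\<close> by the Killing form, and \<open>t\<close> is the average of \<open>[e, f]\<close> over
  the automorphisms.\<close>

lemma coroot_exists:
  assumes "\<alpha> \<in> W" "\<alpha> \<noteq> 0"
  obtains t e f where "t \<in> H" "e \<in> wspace \<alpha>" "f \<in> wspace (- \<alpha>)" "\<And>h. h \<in> H \<Longrightarrow> killing t h = \<alpha> h"
    "\<And>\<eta>. wtrace \<eta> (br e f) = of_nat (wdim \<eta>) * \<eta> t"
proof -
  obtain e where e: "e \<in> wspace \<alpha>" "e \<noteq> 0" using assms(1) cv.subspace_0[OF wspace_subspace] by (auto simp: W_def)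
  obtain y where y: "killing e y \<noteq> 0" using killing_nondeg[of e] e(2) by blast
  have "(\<Sum>\<mu>\<in>W. killing e (wproj \<mu> y)) \<noteq> 0" using y by (simp add: wproj_sum flip: clinear_sum[OF killing_linear(2)])
  then obtain \<mu> where \<mu>: "\<mu> \<in> W" "killing e (wproj \<mu> y) \<noteq> 0" by (rule sum.not_neutral_contains_not_neutral)
  then have "\<alpha> + \<mu> = 0" using killing_wspaces[OF e(1) wproj_in W_dual[OF assms(1)] W_dual[OF \<mu>(1)]] by blast
  then have \<mu>': "\<mu> = - \<alpha>" by (simp add: eq_neg_iff_add_eq_0 add.commute)
  define f where "f = inverse (killing e (wproj \<mu> y)) *\<^sub>C wproj \<mu> y"
  have f: "f \<in> wspace (- \<alpha>)" unfolding f_def \<mu>'[symmetric] by (intro cv.subspace_scale[OF wspace_subspace] wproj_in)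
  have ef: "killing e f = 1" using \<mu>(2) by (simp add: f_def clinear_scale[OF killing_linear(2)] scaleC_complex_def)
  have "br e f \<in> wspace 0" using wspace_br[OF e(1) f] by simp
  then obtain t where t: "t \<in> H" "\<And>\<phi> :: 'g \<Rightarrow> complex. clinear \<phi> \<Longrightarrow> (\<And>i x. \<phi> (aut A i x) = \<phi> x) \<Longrightarrow> \<phi> t = \<phi> (br e f)"
    by (rule average_in_H) blast
  have dual: "- \<alpha> \<in> cart0_dual A" using W_dual[OF assms(1)] cv.subspace_neg[OF cart0_dual_subspace] by blast
  have "killing t h = \<alpha> h" if h: "h \<in> H" for h
  proof -
    have "killing (aut A i x) h = killing x h" for i x using killing_aut[of i x h] aut_H[OF h] by simp
    then have "killing t h = killing (br e f) h" by (rule t(2)[OF killing_linear(1)])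
    also have "\<dots> = killing e (br f h)" by (rule killing_invariant)
    also have "br f h = \<alpha> h *\<^sub>C f" using br_skew[of f h] H_diagonal[OF h f dual] by simp
    finally show ?thesis using ef by (simp add: clinear_scale[OF killing_linear(2)] scaleC_complex_def)
  qed
  moreover have "wtrace \<eta> (br e f) = of_nat (wdim \<eta>) * \<eta> t" for \<eta>
    using t(2)[OF wtrace_linear wtrace_aut] wtrace_H(1)[OF t(1)] by simp
  ultimately show ?thesis by (rule that[OF t(1) e(1) f])
qed

context
  fixes \<alpha> t e f
  assumes \<alpha>: "\<alpha> \<in> W" "\<alpha> \<noteq> 0" and t: "t \<in> H" and ef: "e \<in> wspace \<alpha>" "f \<in> wspace (- \<alpha>)"
    and tk: "\<And>h. h \<in> H \<Longrightarrow> killing t h = \<alpha> h"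
    and wt: "\<And>\<eta>. wtrace \<eta> (br e f) = of_nat (wdim \<eta>) * \<eta> t"
begin

lemma weight_real_multiple: "\<gamma> \<in> W \<Longrightarrow> \<exists>q::real. \<gamma> t = of_real q * \<alpha> t"
  by (rule string_rational[OF W_dual[OF \<alpha>(1)] \<alpha>(2) _ ef wt]) (assumption, rule exI)

text \<open>As \<open>\<alpha> t\<close> is the value of the Killing form at \<open>(t, t)\<close>, it is a sum of squares of real multiples of \<open>\<alpha> t\<close> itself, that
  is \<open>\<alpha> t = Q (\<alpha> t)\<^sup>2\<close> with \<open>Q \<ge> 0\<close>.\<close>

lemma coroot_positive: "\<exists>c>0. \<alpha> t = of_real c"
proof -
  obtain q :: "_ \<Rightarrow> real" where q: "\<And>\<eta>. \<eta> \<in> W \<Longrightarrow> \<eta> t = of_real (q \<eta>) * \<alpha> t" using weight_real_multiple by metis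
  define Q where "Q = (\<Sum>\<eta>\<in>W. real (wdim \<eta>) * (q \<eta>)\<^sup>2)"
  have "\<alpha> t = (\<Sum>\<eta>\<in>W. of_nat (wdim \<eta>) * (\<eta> t)\<^sup>2)" using tk[OF t] killing_H_square[OF t] by simp
  also have "\<dots> = (\<Sum>\<eta>\<in>W. of_real (real (wdim \<eta>) * (q \<eta>)\<^sup>2) * (\<alpha> t)\<^sup>2)"
    by (rule sum.cong[OF refl]) (simp add: q power_mult_distrib)
  also have "\<dots> = of_real Q * (\<alpha> t)\<^sup>2" unfolding Q_def of_real_sum by (rule sum_distrib_right[symmetric])
  finally have eq: "\<alpha> t = of_real Q * (\<alpha> t)\<^sup>2" .
  have nz: "\<alpha> t \<noteq> 0"
  proof
    assume "\<alpha> t = 0"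
    then have "\<eta> t = 0" if "\<eta> \<in> W" for \<eta> using q[OF that] by simp
    then have "(\<Sum>\<eta>\<in>W. of_nat (wdim \<eta>) * \<eta> t * \<eta> h) = 0" for h by (intro sum.neutral) simp
    then have "\<alpha> h = 0" if "h \<in> H" for h using tk[OF that] killing_H[OF t that] by simp
    then have "\<alpha> = 0" using cart0_dual_eqI[OF W_dual[OF \<alpha>(1)] zero_dual] by simp
    with \<alpha>(2) show False by simp
  qed
  have "Q \<ge> 0" unfolding Q_def by (intro sum_nonneg) simp
  moreover have "Q \<noteq> 0" using eq nz by auto
  moreover have "\<alpha> t = of_real (1 / Q)"
  proof -
    have "\<alpha> t * 1 = \<alpha> t * (of_real Q * \<alpha> t)" using eq by (simp add: power2_eq_square mult_ac)
    then have "of_real Q * \<alpha> t = 1" using nz by simp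
    then show ?thesis using \<open>Q \<noteq> 0\<close> by (simp add: field_simps)
  qed
  ultimately show ?thesis by (intro exI[of _ "1 / Q"]) auto
qed

lemma string_step:
  "string_trace e f (\<gamma> + of_int (j - 1) *\<^sub>C \<alpha>) - string_trace e f (\<gamma> + of_int j *\<^sub>C \<alpha>) =
    of_nat (wdim (\<gamma> + of_int j *\<^sub>C \<alpha>)) * (\<gamma> t + of_int j * \<alpha> t)"
proof -
  have val: "(\<gamma> + of_int j *\<^sub>C \<alpha>) t = \<gamma> t + of_int j * \<alpha> t"
    by (simp add: scaleC_fun_def scaleC_complex_def)
  show ?thesis
    using string_trace_step[OF W_dual[OF \<alpha>(1)] ef, of "\<gamma> + of_int j *\<^sub>C \<alpha>"] wt[of "\<gamma> + of_int j *\<^sub>C \<alpha>"]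
    unfolding string_shift by (simp only: val)
qed

lemma string_trace_up:
  "string_trace e f \<gamma> = string_trace e f (\<gamma> + of_int (int N) *\<^sub>C \<alpha>) +
    (\<Sum>j<N. of_nat (wdim (\<gamma> + of_int (int (Suc j)) *\<^sub>C \<alpha>)) * (\<gamma> t + of_int (int (Suc j)) * \<alpha> t))"
proof (induction N)
  case (Suc N)
  have eq: "int (Suc N) - 1 = int N" by simp
  have "string_trace e f (\<gamma> + of_int (int N) *\<^sub>C \<alpha>) = string_trace e f (\<gamma> + of_int (int (Suc N)) *\<^sub>C \<alpha>) +
      of_nat (wdim (\<gamma> + of_int (int (Suc N)) *\<^sub>C \<alpha>)) * (\<gamma> t + of_int (int (Suc N)) * \<alpha> t)"
    using string_step[of \<gamma> "int (Suc N)", unfolded eq] by (simp only: diff_eq_eq add.commute)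
  then show ?case using Suc by (simp only: sum.lessThan_Suc add_ac)
qed simp

lemma string_trace_down:
  "string_trace e f \<gamma> = string_trace e f (\<gamma> + of_int (- int N) *\<^sub>C \<alpha>) -
    (\<Sum>j<N. of_nat (wdim (\<gamma> + of_int (- int j) *\<^sub>C \<alpha>)) * (\<gamma> t + of_int (- int j) * \<alpha> t))"
proof (induction N)
  case (Suc N)
  have eq: "- int N - 1 = - int (Suc N)" by simp
  have move: "b = a - c" if "a - b = c" for a b c :: complex using that by auto
  have "string_trace e f (\<gamma> + of_int (- int N) *\<^sub>C \<alpha>) = string_trace e f (\<gamma> + of_int (- int (Suc N)) *\<^sub>C \<alpha>) -
      of_nat (wdim (\<gamma> + of_int (- int N) *\<^sub>C \<alpha>)) * (\<gamma> t + of_int (- int N) * \<alpha> t)"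
    by (rule move[OF string_step[of \<gamma> "- int N", unfolded eq]])
  then show ?case using Suc by (simp only: sum.lessThan_Suc diff_diff_eq add.commute)
qed simp

text \<open>Along the string the values increase while \<open>\<gamma>(t)\<close> is negative and decrease while it is positive, and
  they vanish at both ends.\<close>

lemma string_trace_nonneg: "\<exists>r\<ge>0. string_trace e f \<gamma> = of_real r"
proof (cases "\<gamma> \<in> W")
  case True
  obtain c where c: "c > 0" "\<alpha> t = of_real c" using coroot_positive by blast
  obtain q :: real where "\<gamma> t = of_real q * \<alpha> t" using weight_real_multiple[OF True] by blast
  then have r: "\<gamma> t = of_real (q * c)" using c(2) by simp
  obtain N where N: "\<And>j::int. \<bar>j\<bar> \<ge> int N \<Longrightarrow> \<gamma> + of_int j *\<^sub>C \<alpha> \<notin> W"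
    by (rule string_leaves_W[OF \<alpha>(2), of \<gamma>]) blast
  show ?thesis
  proof (cases "q \<ge> 0")
    case True
    let ?r = "\<Sum>j<N. real (wdim (\<gamma> + of_int (int (Suc j)) *\<^sub>C \<alpha>)) * (q * c + real (Suc j) * c)"
    have "string_trace e f \<gamma> = of_real ?r"
      using string_trace_up[of \<gamma> N] string_trace_outside[OF N[of "int N"], of e f] by (simp add: r c(2))
    moreover have "?r \<ge> 0" using True c(1) by (intro sum_nonneg mult_nonneg_nonneg add_nonneg_nonneg) auto
    ultimately show ?thesis by blast
  next
    case False
    let ?r = "\<Sum>j<N. real (wdim (\<gamma> + of_int (- int j) *\<^sub>C \<alpha>)) * (real j * c - q * c)"
    have "string_trace e f \<gamma> = - (\<Sum>j<N. of_nat (wdim (\<gamma> + of_int (- int j) *\<^sub>C \<alpha>)) * (\<gamma> t + of_int (- int j) * \<alpha> t))"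
      using string_trace_down[of \<gamma> N] string_trace_outside[OF N[of "- int N"], of e f] by simp
    also have "\<dots> = of_real ?r"
      unfolding of_real_sum sum_negf[symmetric] by (rule sum.cong[OF refl]) (simp add: r c(2) algebra_simps)
    finally have "string_trace e f \<gamma> = of_real ?r" .
    moreover have "q * c \<le> real j * c" for j using False c(1) by (intro mult_right_mono) auto
    then have "?r \<ge> 0" by (intro sum_nonneg mult_nonneg_nonneg) auto
    ultimately show ?thesis by blast
  qed
qed (auto simp: string_trace_outside)

text \<open>The weight \<open>\<alpha>\<close> itself contributes a positive term to the sum over the upper half of its string through \<open>0\<close>.\<close>

lemma string_trace_zero_pos: "\<exists>r>0. string_trace e f 0 = of_real r"
proof -
  obtain c where c: "c > 0" "\<alpha> t = of_real c" using coroot_positive by blast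
  obtain N where N: "\<And>j::int. \<bar>j\<bar> \<ge> int N \<Longrightarrow> 0 + of_int j *\<^sub>C \<alpha> \<notin> W"
    by (rule string_leaves_W[OF \<alpha>(2), of 0]) blast
  let ?r = "\<Sum>j<Suc N. real (wdim (0 + of_int (int (Suc j)) *\<^sub>C \<alpha>)) * (real (Suc j) * c)"
  have "string_trace e f 0 = of_real ?r"
    using string_trace_up[of 0 "Suc N"] string_trace_outside[OF N[of "int (Suc N)"], of e f]
    by (simp only: of_real_sum) (simp add: c(2))
  moreover have "real (wdim (0 + of_int (int (Suc 0)) *\<^sub>C \<alpha>)) * (real (Suc 0) * c) \<le> ?r"
    by (rule member_le_sum[of 0 "{..<Suc N}" "\<lambda>j. real (wdim (0 + of_int (int (Suc j)) *\<^sub>C \<alpha>)) * (real (Suc j) * c)"])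
      (use c(1) in auto)
  then have "?r > 0" using wdim_pos[OF \<alpha>(1)] c(1) by (simp add: scaleC_one) (smt (verit) mult_pos_pos of_nat_0_less_iff)
  ultimately show ?thesis by blast
qed

end

abbreviation P where "P \<equiv> positive A"

lemma positive_system: "Delta_en_nz lmin A = P \<union> uminus ` P" "P \<inter> uminus ` P = {}"
  "\<alpha> \<in> P \<Longrightarrow> \<beta> \<in> P \<Longrightarrow> \<alpha> + \<beta> \<in> Delta_en_nz lmin A \<Longrightarrow> \<alpha> + \<beta> \<in> P"
  using pos_sys unfolding positive_system_def by blast+

lemma zero_not_Delta: "0 \<notin> Delta_en_nz lmin A"
proof
  assume "0 \<in> Delta_en_nz lmin A"
  then have "0 \<in> P" unfolding positive_system(1) by auto
  then have "0 \<in> uminus ` P" by (intro image_eqI[of _ _ 0]) simp_all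
  with \<open>0 \<in> P\<close> show False using positive_system(2) by blast
qed

lemma Delta_W: "Delta_en_nz lmin A = W - {0}"
  using weights_eq zero_not_Delta unfolding W_weights by blast

lemma positive_W: "\<alpha> \<in> P \<Longrightarrow> \<alpha> \<in> W" "\<alpha> \<in> P \<Longrightarrow> \<alpha> \<noteq> 0"
  using positive_system(1) Delta_W by blast+

lemma W_cases: "\<alpha> \<in> W \<Longrightarrow> \<alpha> = 0 \<or> \<alpha> \<in> P \<or> - \<alpha> \<in> P"
proof -
  assume "\<alpha> \<in> W"
  then have "\<alpha> = 0 \<or> \<alpha> \<in> P \<union> uminus ` P" using positive_system(1) Delta_W by blast
  then show ?thesis by auto
qed

lemma positive_closed: "\<alpha> \<in> P \<Longrightarrow> \<beta> \<in> P \<Longrightarrow> \<alpha> + \<beta> \<in> W \<Longrightarrow> \<alpha> + \<beta> \<in> P"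
proof -
  assume ab: "\<alpha> \<in> P" "\<beta> \<in> P" "\<alpha> + \<beta> \<in> W"
  have "\<alpha> + \<beta> \<noteq> 0"
  proof
    assume "\<alpha> + \<beta> = 0"
    then have "\<alpha> = - \<beta>" by (simp add: eq_neg_iff_add_eq_0)
    with ab show False using positive_system(2) by blast
  qed
  with ab show ?thesis using positive_system(3) Delta_W by blast
qed

text \<open>The element is dual to the sum of the positive roots, counted with the dimensions of their weight
  spaces. Its value on a positive root \<open>\<alpha>\<close> is the trace of \<open>[e, f]\<close> on the sum of the positive weight
  spaces, which \<open>e\<close> preserves; it is a sum of string traces over the weights from which \<open>\<alpha>\<close> leads into
  the positive ones, and \<open>0\<close> is such a weight.\<close>

lemma positive_element_exists:
  obtains h0 where "h0 \<in> H" "\<And>\<alpha>. \<alpha> \<in> P \<Longrightarrow> \<exists>r>0. \<alpha> h0 = of_real r"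
proof -
  define R where "R \<alpha> t e f \<longleftrightarrow> t \<in> H \<and> e \<in> wspace \<alpha> \<and> f \<in> wspace (- \<alpha>) \<and> (\<forall>h\<in>H. killing t h = \<alpha> h) \<and>
    (\<forall>\<eta>. wtrace \<eta> (br e f) = of_nat (wdim \<eta>) * \<eta> t)" for \<alpha> t e f
  have "\<exists>t e f. R \<alpha> t e f" if "\<alpha> \<in> P" for \<alpha>
    unfolding R_def by (rule coroot_exists[OF positive_W[OF that]]) blast
  then obtain t e f where R: "\<And>\<alpha>. \<alpha> \<in> P \<Longrightarrow> R \<alpha> (t \<alpha>) (e \<alpha>) (f \<alpha>)" by metis
  have tH: "t \<alpha> \<in> H" and eW: "e \<alpha> \<in> wspace \<alpha>" and fW: "f \<alpha> \<in> wspace (- \<alpha>)"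
    and tk: "\<And>h. h \<in> H \<Longrightarrow> killing (t \<alpha>) h = \<alpha> h"
    and wt: "\<And>\<eta>. wtrace \<eta> (br (e \<alpha>) (f \<alpha>)) = of_nat (wdim \<eta>) * \<eta> (t \<alpha>)" if "\<alpha> \<in> P" for \<alpha>
    using R[OF that] unfolding R_def by blast+
  have "P \<subseteq> W" using positive_W by blast
  then have finP: "finite P" using W_finite finite_subset by blast
  define h0 where "h0 = (\<Sum>\<beta>\<in>P. of_nat (wdim \<beta>) *\<^sub>C t \<beta>)"
  have "h0 \<in> H" unfolding h0_def by (intro cv.subspace_sum[OF H_subspace] cv.subspace_scale[OF H_subspace] tH)
  moreover have "\<exists>r>0. \<alpha> h0 = of_real r" if \<alpha>: "\<alpha> \<in> P" for \<alpha>
  proof -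
    note dual = W_dual[OF positive_W(1)[OF \<alpha>]]
    let ?st = "string_trace (e \<alpha>) (f \<alpha>)"
    let ?I = "(\<lambda>\<beta>. \<beta> - \<alpha>) ` P"
    note hyps = positive_W[OF \<alpha>] tH[OF \<alpha>] eW[OF \<alpha>] fW[OF \<alpha>] tk[OF \<alpha>] wt[OF \<alpha>]
    have "\<alpha> h0 = (\<Sum>\<beta>\<in>P. \<alpha> (of_nat (wdim \<beta>) *\<^sub>C t \<beta>))"
      unfolding h0_def by (rule weight_sum[OF dual finP]) (intro cv.subspace_scale[OF H_subspace] tH)
    also have "\<dots> = (\<Sum>\<beta>\<in>P. ?st (\<beta> - \<alpha>) - ?st \<beta>)"
    proof (rule sum.cong[OF refl])
      fix \<beta> assume \<beta>: "\<beta> \<in> P"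
      have "\<alpha> (of_nat (wdim \<beta>) *\<^sub>C t \<beta>) = of_nat (wdim \<beta>) * \<alpha> (t \<beta>)" by (rule weight_linear(2)[OF dual tH[OF \<beta>] tH[OF \<beta>]])
      also have "\<alpha> (t \<beta>) = \<beta> (t \<alpha>)" using tk[OF \<alpha> tH[OF \<beta>]] tk[OF \<beta> tH[OF \<alpha>]] killing_sym by metis
      also have "of_nat (wdim \<beta>) * \<beta> (t \<alpha>) = ?st (\<beta> - \<alpha>) - ?st \<beta>"
        using string_trace_step[OF dual eW[OF \<alpha>] fW[OF \<alpha>]] wt[OF \<alpha>] by simp
      finally show "\<alpha> (of_nat (wdim \<beta>) *\<^sub>C t \<beta>) = ?st (\<beta> - \<alpha>) - ?st \<beta>" .
    qed
    also have "\<dots> = (\<Sum>\<gamma>\<in>?I. ?st \<gamma>) - (\<Sum>\<beta>\<in>P. ?st \<beta>)"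
      by (simp add: sum_subtractf sum.reindex inj_on_def)
    also have "(\<Sum>\<beta>\<in>P. ?st \<beta>) = (\<Sum>\<beta>\<in>P \<inter> ?I. ?st \<beta>)"
    proof (rule sum.mono_neutral_right[OF finP])
      show "\<forall>\<beta>\<in>P - P \<inter> ?I. ?st \<beta> = 0"
      proof
        fix \<beta> assume \<beta>: "\<beta> \<in> P - P \<inter> ?I"
        have "\<beta> + \<alpha> \<notin> P"
        proof
          assume "\<beta> + \<alpha> \<in> P"
          then have "\<beta> \<in> ?I" by (intro image_eqI[of _ _ "\<beta> + \<alpha>"]) simp_all
          with \<beta> show False by blast
        qed
        then have "\<beta> + \<alpha> \<notin> W" using positive_closed[OF _ \<alpha>] \<beta> by blast
        then show "?st \<beta> = 0" by (rule string_trace_top[OF dual eW[OF \<alpha>] fW[OF \<alpha>]])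
      qed
    qed blast
    also have "(\<Sum>\<gamma>\<in>?I. ?st \<gamma>) - (\<Sum>\<beta>\<in>P \<inter> ?I. ?st \<beta>) = (\<Sum>\<gamma>\<in>?I - P. ?st \<gamma>)"
      using sum.Int_Diff[of ?I ?st P] finP by (simp add: Int_commute)
    finally have sum: "\<alpha> h0 = (\<Sum>\<gamma>\<in>?I - P. ?st \<gamma>)" .
    have "\<forall>\<gamma>. \<exists>r\<ge>0. ?st \<gamma> = of_real r" using string_trace_nonneg[OF hyps] by blast
    then obtain r where r: "\<And>\<gamma>. r \<gamma> \<ge> 0" "\<And>\<gamma>. ?st \<gamma> = of_real (r \<gamma>)" by metis
    have "r 0 > 0" using string_trace_zero_pos[OF hyps] r(2)[of 0] by auto
    have "0 \<in> ?I" using \<alpha> by (intro image_eqI[of _ _ \<alpha>]) simp_all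
    then have "0 \<in> ?I - P" using positive_W(2) by blast
    then have "(\<Sum>\<gamma>\<in>?I - P. r \<gamma>) \<ge> r 0" using member_le_sum[of 0 "?I - P" r] finP r(1) by simp
    then show ?thesis using sum r(2) \<open>r 0 > 0\<close> by (intro exI[of _ "\<Sum>\<gamma>\<in>?I - P. r \<gamma>"]) simp
  qed
  ultimately show ?thesis by (rule that)
qed

subsection \<open>The invariant form and the automorphisms\<close>

text \<open>Schur's lemma: relative to the non-degenerate Killing form, the invariant form is given by an operator
  that commutes with \<open>ad \<gg>\<close>, and an eigenspace of it is an ideal. In particular the invariant form is
  preserved by the automorphisms.\<close>

lemma form_eq_killing: "\<exists>c. \<forall>x y. form A x y = c * killing x y"
proof -
  have "\<exists>d. \<forall>y. killing d y = form A x y" for x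
    by (rule nondegenerate_represents[OF fin killing_linear killing_nondeg form_linear(1)]) (assumption, blast)
  then obtain \<phi> where \<phi>: "\<And>x y. killing (\<phi> x) y = form A x y" by metis
  have eqI: "u = v" if "\<And>y. killing u y = killing v y" for u v
    using killing_nondeg[of "u - v"] that by (simp add: clinear_diff[OF killing_linear(1)])
  have lin: "clinear \<phi>"
    by (rule clinearI; rule eqI)
      (simp_all add: \<phi> clinear_add[OF killing_linear(1)] clinear_scale[OF killing_linear(1)] clinear_add[OF form_linear(2)] clinear_scale[OF form_linear(2)])
  have comm: "\<phi> (br z x) = br z (\<phi> x)" for x z
  proof (rule eqI)
    fix y
    have "killing (\<phi> (br z x)) y = - form A (br x z) y"
      using br_skew[of z x] by (simp add: \<phi> clinear_neg[OF form_linear(2)])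
    also have "\<dots> = - killing (br (\<phi> x) z) y" by (simp add: form_invariant killing_invariant \<phi>)
    also have "\<dots> = killing (br z (\<phi> x)) y" using br_skew[of z "\<phi> x"] by (simp add: clinear_neg[OF killing_linear(1)])
    finally show "killing (\<phi> (br z x)) y = killing (br z (\<phi> x)) y" .
  qed
  have "(UNIV :: 'g set) \<noteq> {0}" using derived_algebra simple0
    unfolding simple_lie_algebra_on_def by (metis UNIV_I br_simps(7) singletonD)
  then obtain c v where cv: "v \<noteq> 0" "\<phi> v = c *\<^sub>C v" by (rule eigenvector_exists[OF fin lin])
  let ?I = "{x. \<phi> x = c *\<^sub>C x}"
  have "?I = {0} \<or> ?I = UNIV"
    by (rule ideal_trivial[OF subspace_eigenspace[OF lin]]) (simp add: comm br_simps)
  then have "\<phi> x = c *\<^sub>C x" for x using cv by blast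
  then have "form A x y = c * killing x y" for x y
    using \<phi>[of x y] by (simp add: clinear_scale[OF killing_linear(1)] scaleC_complex_def)
  then show ?thesis by blast
qed

lemma form_aut: "form A (aut A i x) (aut A i y) = form A x y"
  using form_eq_killing killing_aut by metis

lemma root1_powi_eq_1: "root1 A i powi k = 1 \<longleftrightarrow> int (ord A i) dvd k"
proof -
  let ?m = "int (ord A i)"
  have m: "root1 A i powi (?m * q) = 1" for q
    by (simp add: power_int_mult root1_ord)
  have "root1 A i powi k = root1 A i powi (?m * (k div ?m) + k mod ?m)" by simp
  also have "\<dots> = root1 A i powi (k mod ?m)"
    using root1_nz[of i] m[of "k div ?m"] by (subst power_int_add) simp_all
  also have "\<dots> = root1 A i ^ nat (k mod ?m)" using ord_pos[of i] by (simp add: power_int_def)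
  finally have eq: "root1 A i powi k = root1 A i ^ nat (k mod ?m)" .
  have "nat (k mod ?m) < ord A i" using ord_pos[of i] by (simp add: nat_less_iff)
  then have "root1 A i ^ nat (k mod ?m) = 1 \<longleftrightarrow> nat (k mod ?m) = 0"
    using root1_primitive[of "nat (k mod ?m)" i] by (metis gr0I power_0)
  also have "\<dots> \<longleftrightarrow> ?m dvd k"
  proof -
    have "0 \<le> k mod ?m" using ord_pos[of i] by simp
    then show ?thesis unfolding dvd_eq_mod_eq_0 nat_eq_iff by auto
  qed
  finally show ?thesis using eq by simp
qed

lemma eig_br: "x \<in> eig A k \<Longrightarrow> y \<in> eig A l \<Longrightarrow> br x y \<in> eig A (k + l)"
  using root1_nz by (simp add: eig_def aut_br br_simps scaleC_scaleC power_int_add mult.commute)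

lemma eig_shift_Gam: "r \<in> Gam A \<Longrightarrow> eig A (k + r) = eig A k"
proof -
  assume "r \<in> Gam A"
  then have "root1 A i powi (r $ i) = 1" for i using root1_powi_eq_1 by (simp add: Gam_def)
  then show ?thesis using root1_nz by (simp add: eig_def power_int_add)
qed

text \<open>The central term of the bracket of two loop elements thus only occurs with exponents in the lattice of
  the central part, which makes the toroidal algebra closed under its bracket.\<close>

lemma form_eig: "x \<in> eig A k \<Longrightarrow> y \<in> eig A l \<Longrightarrow> form A x y \<noteq> 0 \<Longrightarrow> k + l \<in> Gam A"
proof -
  assume xy: "x \<in> eig A k" "y \<in> eig A l" and nz: "form A x y \<noteq> 0"
  have "int (ord A i) dvd (k + l) $ i" for i
  proof -
    have "form A x y = form A (root1 A i powi (k $ i) *\<^sub>C x) (root1 A i powi (l $ i) *\<^sub>C y)"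
      using form_aut[of i x y] xy by (simp add: eig_def)
    then have "form A x y = root1 A i powi ((k + l) $ i) * form A x y"
      using root1_nz by (simp add: clinear_scale[OF form_linear(1)] clinear_scale[OF form_linear(2)] scaleC_complex_def power_int_add mult.commute)
    then have "root1 A i powi ((k + l) $ i) = 1" using nz by simp
    then show ?thesis using root1_powi_eq_1 by blast
  qed
  then show ?thesis by (simp add: Gam_def)
qed

text \<open>One automorphism at a time, \<open>y\<close> is the sum of its discrete Fourier components \<open>E a\<close> with respect to the
  powers of the root of unity.\<close>

lemma eigenspace_decomposition:
  assumes "cv.subspace U" "\<And>i x. x \<in> U \<Longrightarrow> aut A i x \<in> U" "x \<in> U"
  shows "x \<in> cv.span (\<Union>k. U \<inter> eig A k)"
proof -
  let ?S = "\<lambda>I. {y\<in>U. \<exists>k :: int ^ 'n option. \<forall>i\<in>I. aut A i y = (root1 A i powi (k $ i)) *\<^sub>C y}"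
  have "U \<subseteq> cv.span (?S I)" if "finite I" for I
    using that
  proof (induction I rule: finite_induct)
    case empty
    show ?case by (auto intro: cv.span_base)
  next
    case (insert i I)
    have "?S I \<subseteq> cv.span (?S (insert i I))"
    proof
      fix y assume "y \<in> ?S I"
      then obtain k where y: "y \<in> U" "\<And>j. j \<in> I \<Longrightarrow> aut A j y = (root1 A j powi (k $ j)) *\<^sub>C y" by blast
      let ?m = "ord A i" and ?\<sigma> = "aut A i" and ?x = "root1 A i"
      define E where "E a = inverse (of_nat ?m) *\<^sub>C (\<Sum>j<?m. (inverse ?x ^ (a * j)) *\<^sub>C (?\<sigma> ^^ j) y)" for a
      have iterU: "(?\<sigma> ^^ j) y \<in> U" for j by (induction j) (use y(1) assms(2) in auto)
      have E_in: "E a \<in> ?S (insert i I)" for a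
      proof -
        have "E a \<in> U" unfolding E_def by (intro cv.subspace_scale[OF assms(1)] cv.subspace_sum[OF assms(1)] iterU)
        moreover have "aut A j (E a) = (root1 A j powi (k $ j)) *\<^sub>C E a" if "j \<in> I" for j
        proof -
          have "aut A j ((?\<sigma> ^^ b) y) = (root1 A j powi (k $ j)) *\<^sub>C (?\<sigma> ^^ b) y" for b
            by (induction b) (simp_all add: y(2)[OF that] aut_comm[of j i] clinear_scale[OF aut_linear])
          then show ?thesis
            by (simp add: E_def clinear_scale[OF aut_linear] clinear_sum[OF aut_linear] cv.scale_sum_right scaleC_scaleC mult_ac)
        qed
        moreover have "?\<sigma> (E a) = (?x powi int a) *\<^sub>C E a"
        proof -
          let ?u = "\<lambda>j. (inverse ?x ^ (a * j)) *\<^sub>C (?\<sigma> ^^ j) y"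
          have "?\<sigma> (?u j) = (?x ^ a) *\<^sub>C ?u (Suc j)" for j
          proof -
            have "?x ^ a * inverse ?x ^ (a * Suc j) = inverse ?x ^ (a * j)"
              using root1_nz[of i] by (simp add: power_add flip: power_mult_distrib)
            then show ?thesis by (simp add: clinear_scale[OF aut_linear] scaleC_scaleC)
          qed
          then have "?\<sigma> (\<Sum>j<?m. ?u j) = (?x ^ a) *\<^sub>C (\<Sum>j<?m. ?u (Suc j))"
            by (simp add: clinear_sum[OF aut_linear] cv.scale_sum_right)
          also have "(\<Sum>j<?m. ?u (Suc j)) = (\<Sum>j<?m. ?u j) + (?u ?m - ?u 0)"
            using sum_lessThan_telescope[of ?u ?m] unfolding sum_subtractf by (simp add: algebra_simps)
          also have "?u ?m = ?u 0"
          proof -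
            have "inverse ?x ^ (a * ?m) = 1"
              using root1_ord[of i] by (metis inverse_1 power_inverse power_mult power_one mult.commute)
            then show ?thesis by (simp add: aut_ord)
          qed
          finally show ?thesis by (simp add: E_def clinear_scale[OF aut_linear] scaleC_scaleC mult.commute)
        qed
        ultimately have "\<forall>j\<in>insert i I. aut A j (E a) = (root1 A j powi ((\<chi> j. if j = i then int a else k $ j) $ j)) *\<^sub>C E a" "E a \<in> U"
          using insert.hyps(2) by auto
        then show ?thesis by blast
      qed
      have "(\<Sum>a<?m. E a) = inverse (of_nat ?m) *\<^sub>C (\<Sum>j<?m. (\<Sum>a<?m. inverse ?x ^ (a * j)) *\<^sub>C (?\<sigma> ^^ j) y)"
        unfolding E_def cv.scale_sum_right[symmetric] by (subst sum.swap) (simp add: cv.scale_sum_left)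
      also have "(\<Sum>j<?m. (\<Sum>a<?m. inverse ?x ^ (a * j)) *\<^sub>C (?\<sigma> ^^ j) y) = (\<Sum>j<?m. if j = 0 then of_nat ?m *\<^sub>C y else 0)"
      proof (rule sum.cong[OF refl])
        fix j assume j: "j \<in> {..<?m}"
        show "(\<Sum>a<?m. inverse ?x ^ (a * j)) *\<^sub>C (?\<sigma> ^^ j) y = (if j = 0 then of_nat ?m *\<^sub>C y else 0)"
        proof (cases "j = 0")
          case False
          let ?w = "inverse ?x ^ j"
          have "?x ^ j \<noteq> 1" using root1_primitive[of j i] False j by simp
          then have "?w \<noteq> 1" by (simp add: power_inverse)
          have "?w ^ ?m = (inverse ?x ^ ?m) ^ j" by (simp add: mult.commute flip: power_mult)
          then have "?w ^ ?m = 1" using root1_ord[of i] by (simp add: power_inverse)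
          have "(\<Sum>a<?m. inverse ?x ^ (a * j)) = (\<Sum>a<?m. ?w ^ a)" by (simp add: mult.commute flip: power_mult)
          also have "\<dots> = 0" using geometric_sum[OF \<open>?w \<noteq> 1\<close>, of ?m] \<open>?w ^ ?m = 1\<close> by simp
          finally show ?thesis using False by simp
        qed simp
      qed
      also have "\<dots> = of_nat ?m *\<^sub>C y" using ord_pos[of i] by simp
      finally have "(\<Sum>a<?m. E a) = y" using ord_pos[of i] by (simp add: scaleC_scaleC scaleC_one)
      moreover have "(\<Sum>a<?m. E a) \<in> cv.span (?S (insert i I))" using E_in by (intro cv.span_sum cv.span_base)
      ultimately show "y \<in> cv.span (?S (insert i I))" by simp
    qed
    then have "cv.span (?S I) \<subseteq> cv.span (?S (insert i I))" by (rule cv.span_minimal[OF _ cv.subspace_span])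
    with insert.IH show ?case by blast
  qed
  from this[OF finite_class.finite_UNIV] have "x \<in> cv.span (?S UNIV)" using assms(3) by blast
  moreover have "?S UNIV = (\<Union>k. U \<inter> eig A k)" by (auto simp: eig_def)
  ultimately show ?thesis by simp
qed

end

section \<open>The bracket of the toroidal algebra on homogeneous elements\<close>

lemma pm_sum2_swap: "pm_sum2 B f g = pm_sum2 (\<lambda>l k b a. B k l a b) g f"
  unfolding pm_sum2_def by (rule sum.swap)

lemma pm_sum2_linear_right:
  fixes B :: "'k \<Rightarrow> 'l \<Rightarrow> 'a::zero \<Rightarrow> 'b::complex_vector \<Rightarrow> 'c::complex_vector"
  assumes "\<And>k l a. clinear (B k l a)"
  shows "clinear (pm_sum2 B f)"
  by (rule clinearI)
    (simp_all add: pm_sum2_add_right pm_sum2_scale_right clinear_0[OF assms] clinear_add[OF assms] clinear_scale[OF assms])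

lemma pm_sum2_linear_left:
  fixes B :: "'k \<Rightarrow> 'l \<Rightarrow> 'a::complex_vector \<Rightarrow> 'b::zero \<Rightarrow> 'c::complex_vector"
  assumes "\<And>k l b. clinear (\<lambda>a. B k l a b)"
  shows "clinear (\<lambda>f. pm_sum2 B f g)"
  unfolding pm_sum2_swap[of B] by (rule pm_sum2_linear_right) (rule assms)

lemma clinear_single: "clinear (\<lambda>x. single k (f x))" if "clinear f" for f :: "'a::complex_vector \<Rightarrow> 'b::complex_vector"
  by (rule clinearI) (simp_all add: clinear_add[OF that] clinear_scale[OF that] single_add scaleC_single)

lemma cdot_commute: "cdot u v = cdot v u"
  by (simp add: cdot_def mult.commute)

lemma cdot_linear: "clinear (cdot u)" "clinear (\<lambda>u. cdot u v)"
  by (rule clinearI; simp add: cdot_right scaleC_complex_def cdot_commute[of _ v])+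

lemma pm_sum_singles: "(\<Sum>k\<in>keys f. single k (lookup f k)) = f"
  by (rule poly_mapping_eqI) (simp add: lookup_sum lookup_single when_def in_keys_iff)

lemma Kmono_linear: "clinear (Kmono r)"
  by (rule clinearI) (simp_all add: Kmono_add Kmono_scale)

lemma abs_K_space_linear: "clinear abs_K_space"
  by (rule clinearI) (simp_all add: plus_K_space.abs_eq scaleC_K_space.abs_eq)

lemma K_space_cases: obtains f where "z = abs_K_space f"
  by (induction z) blast

lemma der_K_raw_linear: "clinear (\<lambda>D. der_K_raw D z)" "clinear (der_K_raw D)"
  unfolding der_K_raw_def
  by (intro pm_sum2_linear_left pm_sum2_linear_right clinear_single clinear_plus clinear_fun clinear_scaled clinear_ident cdot_linear)+

lemma der_K_linear: "clinear (\<lambda>D. der_K D z)" "clinear (der_K D)"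
proof -
  obtain f where f: "z = abs_K_space f" by (rule K_space_cases)
  show "clinear (\<lambda>D. der_K D z)"
    unfolding f der_K.abs_eq by (rule clinear_comp[OF abs_K_space_linear der_K_raw_linear(1)])
  have "der_K D (u + v) = der_K D u + der_K D v" for u v
  proof -
    obtain g h where "u = abs_K_space g" "v = abs_K_space h" by (metis K_space_cases)
    then show ?thesis by (simp add: plus_K_space.abs_eq der_K.abs_eq clinear_add[OF der_K_raw_linear(2)])
  qed
  moreover have "der_K D (c *\<^sub>C u) = c *\<^sub>C der_K D u" for c u
  proof -
    obtain g where "u = abs_K_space g" by (rule K_space_cases)
    then show ?thesis by (simp add: scaleC_K_space.abs_eq der_K.abs_eq clinear_scale[OF der_K_raw_linear(2)])
  qed
  ultimately show "clinear (der_K D)" by (rule clinearI)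
qed

lemma der_loop_linear: "clinear (der_loop D)" "clinear (\<lambda>D. der_loop D x)"
  unfolding der_loop_def
  by (intro pm_sum2_linear_left pm_sum2_linear_right clinear_single clinear_fun clinear_scaled clinear_ident cdot_linear)+

lemma der_bracket_linear: "clinear (der_bracket D)" "clinear (\<lambda>D. der_bracket D E)"
  unfolding der_bracket_def
  by (intro pm_sum2_linear_left pm_sum2_linear_right clinear_single clinear_minus clinear_fun clinear_scaled clinear_ident cdot_linear)+

lemma clinear_times: "clinear f \<Longrightarrow> clinear (\<lambda>x. c * f x)" "clinear f \<Longrightarrow> clinear (\<lambda>x. f x * c)"
  "clinear f \<Longrightarrow> clinear (\<lambda>x. - f x)" for f :: "'a::complex_vector \<Rightarrow> complex"
  by (simp_all add: clinear_iff scaleC_complex_def algebra_simps)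

lemma phi_linear: "clinear (phi1 D)" "clinear (\<lambda>D. phi1 D E)" "clinear (phi2 D)" "clinear (\<lambda>D. phi2 D E)"
  unfolding phi1_def phi2_def
  by (intro pm_sum2_linear_left pm_sum2_linear_right clinear_fun clinear_times cdot_linear)+

definition K_mono :: "int ^ 'n option \<Rightarrow> complex ^ 'n option \<Rightarrow> ('g::complex_vector, 'n::finite) toroidal" where
  "K_mono r c = (0, Kmono r c, 0)"

definition D_mono :: "int ^ 'n option \<Rightarrow> complex ^ 'n option \<Rightarrow> ('g::complex_vector, 'n::finite) toroidal" where
  "D_mono r c = (0, 0, single r c)"

lemma d_elt_mono: "d_elt r i = D_mono r (axis i 1)" by (simp add: d_elt_def D_mono_def)

lemma mono_linear: "clinear (\<lambda>X. loop_elt X k)" "clinear (K_mono r)" "clinear (D_mono r)"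
  by (rule clinearI; simp add: loop_elt_def K_mono_def D_mono_def toroidal_scale single_add scaleC_single Kmono_add Kmono_scale)+

lemmas mono_simps = clinear_0[OF mono_linear(1)] clinear_0[OF mono_linear(2)] clinear_0[OF mono_linear(3)]
  clinear_neg[OF mono_linear(1)] clinear_neg[OF mono_linear(2)] clinear_neg[OF mono_linear(3)]
  clinear_scale[OF mono_linear(1)] clinear_scale[OF mono_linear(2)] clinear_scale[OF mono_linear(3)]
  clinear_add[OF mono_linear(1)] clinear_add[OF mono_linear(2)] clinear_add[OF mono_linear(3)]

context toroidal
begin

lemma loop_bracket_linear: "clinear (loop_bracket A x)" "clinear (\<lambda>x. loop_bracket A x y)"
  unfolding loop_bracket_def
  by (intro pm_sum2_linear_left pm_sum2_linear_right clinear_single br_linear)+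

lemma loop_cocycle_linear: "clinear (loop_cocycle A x)" "clinear (\<lambda>x. loop_cocycle A x y)"
  unfolding loop_cocycle_def
  by (intro pm_sum2_linear_left pm_sum2_linear_right clinear_comp[OF Kmono_linear] clinear_fun form_linear)+

lemma bracket_linear: "clinear (bracket A X)" "clinear (\<lambda>X. bracket A X Y)"
proof -
  obtain x z D where X: "X = (x, z, D)" by (cases X)
  obtain x' z' D' where Y: "Y = (x', z', D')" by (cases Y)
  show "clinear (bracket A X)"
    unfolding X
    by (rule clinearI; clarsimp simp: toroidal_scale clinear_add[OF loop_bracket_linear(1)] clinear_add[OF loop_cocycle_linear(1)]
        clinear_add[OF der_loop_linear(1)] clinear_add[OF der_loop_linear(2)] clinear_add[OF der_K_linear(1)] clinear_add[OF der_K_linear(2)]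
        clinear_add[OF phi_linear(1)] clinear_add[OF phi_linear(3)] clinear_add[OF der_bracket_linear(1)]
        clinear_scale[OF loop_bracket_linear(1)] clinear_scale[OF loop_cocycle_linear(1)]
        clinear_scale[OF der_loop_linear(1)] clinear_scale[OF der_loop_linear(2)] clinear_scale[OF der_K_linear(1)] clinear_scale[OF der_K_linear(2)]
        clinear_scale[OF phi_linear(1)] clinear_scale[OF phi_linear(3)] clinear_scale[OF der_bracket_linear(1)]
        scaleC_right_distrib cv.scale_right_diff_distrib scaleC_scaleC mult.commute)
  show "clinear (\<lambda>X. bracket A X Y)"
    unfolding Y
    by (rule clinearI; clarsimp simp: toroidal_scale clinear_add[OF loop_bracket_linear(2)] clinear_add[OF loop_cocycle_linear(2)]
        clinear_add[OF der_loop_linear(1)] clinear_add[OF der_loop_linear(2)] clinear_add[OF der_K_linear(1)] clinear_add[OF der_K_linear(2)]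
        clinear_add[OF phi_linear(2)] clinear_add[OF phi_linear(4)] clinear_add[OF der_bracket_linear(2)]
        clinear_scale[OF loop_bracket_linear(2)] clinear_scale[OF loop_cocycle_linear(2)]
        clinear_scale[OF der_loop_linear(1)] clinear_scale[OF der_loop_linear(2)] clinear_scale[OF der_K_linear(1)] clinear_scale[OF der_K_linear(2)]
        clinear_scale[OF phi_linear(2)] clinear_scale[OF phi_linear(4)] clinear_scale[OF der_bracket_linear(2)]
        scaleC_right_distrib cv.scale_right_diff_distrib scaleC_scaleC mult.commute)
qed

lemma bracket_LL: "bracket A (loop_elt X k) (loop_elt Y l) = loop_elt (br X Y) (k + l) + K_mono (k + l) (form A X Y *\<^sub>C cvec k)"
  by (simp add: loop_elt_def K_mono_def loop_bracket_def loop_cocycle_def pm_sum2_single br_simps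
      clinear_0[OF form_linear(1)] clinear_0[OF form_linear(2)])

lemma bracket_LK: "bracket A (loop_elt X k) (K_mono r c) = 0" "bracket A (K_mono r c) (loop_elt X k) = 0"
  "bracket A (K_mono r c) (K_mono s e) = 0"
  by (simp_all add: loop_elt_def K_mono_def zero_prod_def)

lemma bracket_DL: "bracket A (D_mono r c) (loop_elt X k) = cdot c (cvec k) *\<^sub>C loop_elt X (k + r)"
  "bracket A (loop_elt X k) (D_mono r c) = - cdot c (cvec k) *\<^sub>C loop_elt X (k + r)"
  by (simp_all add: loop_elt_def D_mono_def der_loop_def pm_sum2_single toroidal_scale scaleC_single single_uminus)

lemma bracket_DK: "bracket A (D_mono r c) (K_mono s e) = K_mono (r + s) (cdot c (cvec s) *\<^sub>C e + cdot c e *\<^sub>C cvec r)"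
  "bracket A (K_mono s e) (D_mono r c) = - K_mono (r + s) (cdot c (cvec s) *\<^sub>C e + cdot c e *\<^sub>C cvec r)"
proof -
  have "der_K_raw (single r c) (single s e) = single (r + s) (cdot c (cvec s) *\<^sub>C e + cdot c e *\<^sub>C cvec r)"
    unfolding der_K_raw_def by (rule pm_sum2_single) simp_all
  then have "der_K (single r c) (Kmono s e) = Kmono (r + s) (cdot c (cvec s) *\<^sub>C e + cdot c e *\<^sub>C cvec r)"
    by (simp only: Kmono.abs_eq der_K.abs_eq)
  then show "bracket A (D_mono r c) (K_mono s e) = K_mono (r + s) (cdot c (cvec s) *\<^sub>C e + cdot c e *\<^sub>C cvec r)"
    "bracket A (K_mono s e) (D_mono r c) = - K_mono (r + s) (cdot c (cvec s) *\<^sub>C e + cdot c e *\<^sub>C cvec r)"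
    by (simp_all add: D_mono_def K_mono_def)
qed

lemma bracket_DD: "bracket A (D_mono r c) (D_mono s e) = D_mono (r + s) (cdot c (cvec s) *\<^sub>C e - cdot e (cvec r) *\<^sub>C c) +
   K_mono (r + s) ((mu2 A * (cdot c (cvec r) * cdot e (cvec s)) - mu1 A * (cdot c (cvec s) * cdot e (cvec r))) *\<^sub>C cvec r)"
proof -
  have "phi1 (single r c) (single s e) = - (cdot c (cvec s) * cdot e (cvec r)) *\<^sub>C Kmono (r + s) (cvec r)"
    "phi2 (single r c) (single s e) = (cdot c (cvec r) * cdot e (cvec s)) *\<^sub>C Kmono (r + s) (cvec r)"
    unfolding phi1_def phi2_def by (subst pm_sum2_single; simp)+
  then show ?thesis
    by (simp add: D_mono_def K_mono_def der_bracket_def pm_sum2_single Kmono_scale cv.scale_left_diff_distrib clinear_diff[OF Kmono_linear])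
qed

text \<open>The homogeneous elements of \<open>d\<^sub>0\<close>-degree \<open>q\<close>. The coefficients of \<open>K\<close> and \<open>D\<close> range over all vectors
  instead of a basis, so that the bracket of two such elements is a sum of at most two others.\<close>

definition monos_deg :: "int \<Rightarrow> ('g, 'n) toroidal set" where
  "monos_deg q = {loop_elt X k |X k. X \<in> eig A k \<and> k $ None = q} \<union> {K_mono r c |r c. r \<in> Gam A \<and> r $ None = q} \<union>
     {D_mono r c |r c. r \<in> Gam A \<and> r $ None = q}"

lemma monos_degI:
  "X \<in> eig A k \<Longrightarrow> loop_elt X k \<in> monos_deg (k $ None)"
  "r \<in> Gam A \<Longrightarrow> K_mono r c \<in> monos_deg (r $ None)"
  "r \<in> Gam A \<Longrightarrow> D_mono r c \<in> monos_deg (r $ None)"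
  unfolding monos_deg_def by blast+

lemma Gam_add: "r \<in> Gam A \<Longrightarrow> s \<in> Gam A \<Longrightarrow> r + s \<in> Gam A"
  by (simp add: Gam_def)

lemma Gam_zero: "0 \<in> Gam A" by (simp add: Gam_def)

lemma K_part_subspace: "cv.subspace (K_part A)"
  unfolding K_part_def
proof (rule cvp.linear_subspace_image[OF abs_K_space_linear])
  have "keys (c *\<^sub>C f) \<subseteq> keys f" for c and f :: "(int ^ 'n option) \<Rightarrow>\<^sub>0 (complex ^ 'n option)"
    by (auto simp: in_keys_iff lookup_scaleC)
  note k = this
  show "cv.subspace {z :: (int ^ 'n option) \<Rightarrow>\<^sub>0 (complex ^ 'n option). keys z \<subseteq> Gam A}"
    unfolding cv.subspace_def
  proof (intro conjI ballI allI)
    fix f g :: "(int ^ 'n option) \<Rightarrow>\<^sub>0 (complex ^ 'n option)"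
    assume fg: "f \<in> {z. keys z \<subseteq> Gam A}" "g \<in> {z. keys z \<subseteq> Gam A}"
    show "f + g \<in> {z. keys z \<subseteq> Gam A}" using fg keys_add[of f g] by blast
    show "c *\<^sub>C f \<in> {z. keys z \<subseteq> Gam A}" for c using fg(1) k[of c f] by blast
  qed simp
qed

lemma tau_subspace: "cv.subspace (tau A)"
proof -
  have k: "keys (c *\<^sub>C f) \<subseteq> keys f" for c and f :: "(int ^ 'n option) \<Rightarrow>\<^sub>0 (complex ^ 'n option)"
    by (auto simp: in_keys_iff lookup_scaleC)
  show ?thesis
    unfolding cv.subspace_def
  proof (intro conjI ballI allI)
    show "0 \<in> tau A"
      using cv.subspace_0[OF eig_subspace] cv.subspace_0[OF K_part_subspace] by (simp add: tau_def zero_prod_def)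
    fix X Y assume "X \<in> tau A" "Y \<in> tau A"
    then obtain x z D x' z' D' where X: "X = (x, z, D)" "\<And>k. lookup x k \<in> eig A k" "z \<in> K_part A" "keys D \<subseteq> Gam A"
      and Y: "Y = (x', z', D')" "\<And>k. lookup x' k \<in> eig A k" "z' \<in> K_part A" "keys D' \<subseteq> Gam A"
      by (auto simp: tau_def)
    have "keys (D + D') \<subseteq> Gam A" using keys_add[of D D'] X(4) Y(4) by blast
    moreover have "z + z' \<in> K_part A" by (rule cv.subspace_add[OF K_part_subspace X(3) Y(3)])
    ultimately show "X + Y \<in> tau A"
      by (simp add: X(1) Y(1) tau_def lookup_add cv.subspace_add[OF eig_subspace X(2) Y(2)])
    fix c
    have "keys (c *\<^sub>C D) \<subseteq> Gam A" using k[of c D] X(4) by blast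
    moreover have "c *\<^sub>C z \<in> K_part A" by (rule cv.subspace_scale[OF K_part_subspace X(3)])
    ultimately show "c *\<^sub>C X \<in> tau A"
      by (simp add: X(1) tau_def toroidal_scale lookup_scaleC cv.subspace_scale[OF eig_subspace X(2)])
  qed
qed

lemma monos_tau: "monos_deg q \<subseteq> tau A"
proof -
  note zero = cv.subspace_0[OF eig_subspace] cv.subspace_0[OF K_part_subspace]
  have "loop_elt X k \<in> tau A" if "X \<in> eig A k" for X k
    using that by (simp add: loop_elt_def tau_def lookup_single when_def zero)
  moreover have "K_mono r c \<in> tau A" if "r \<in> Gam A" for r c
  proof -
    have "Kmono r c \<in> K_part A" unfolding K_part_def Kmono.abs_eq by (rule imageI) (use that in auto)
    then show ?thesis by (simp add: K_mono_def tau_def zero)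
  qed
  moreover have "D_mono r c \<in> tau A" if "r \<in> Gam A" for r c
    using that by (simp add: D_mono_def tau_def zero)
  ultimately show ?thesis unfolding monos_deg_def by blast
qed

lemma tau_span: "tau A = cv.span (\<Union>q. monos_deg q)"
proof
  show "cv.span (\<Union>q. monos_deg q) \<subseteq> tau A" by (rule cv.span_minimal[OF _ tau_subspace]) (use monos_tau in blast)
  show "tau A \<subseteq> cv.span (\<Union>q. monos_deg q)"
  proof
    fix X assume X: "X \<in> tau A"
    obtain x z D where xzD: "X = (x, z, D)" by (cases X)
    with X have x: "\<And>k. lookup x k \<in> eig A k" and z: "z \<in> K_part A" and D: "keys D \<subseteq> Gam A" by (auto simp: tau_def)
    from z obtain f where f: "z = abs_K_space f" "keys f \<subseteq> Gam A" by (auto simp: K_part_def)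
    have sum_first: "(\<Sum>k\<in>I. (g k, 0, 0)) = (\<Sum>k\<in>I. g k, 0, 0)"
      and sum_second: "(\<Sum>k\<in>I. (0, g' k, 0)) = (0, \<Sum>k\<in>I. g' k, 0)"
      and sum_third: "(\<Sum>k\<in>I. (0, 0, g'' k)) = (0, 0, \<Sum>k\<in>I. g'' k)"
      for I :: "(int ^ 'n option) set" and g :: "_ \<Rightarrow> (int ^ 'n option) \<Rightarrow>\<^sub>0 'g" and g' :: "_ \<Rightarrow> 'n K_space"
      and g'' :: "_ \<Rightarrow> (int ^ 'n option) \<Rightarrow>\<^sub>0 (complex ^ 'n option)"
      by (induction I rule: infinite_finite_induct) (simp_all add: zero_prod_def)
    have "(\<Sum>k\<in>keys x. loop_elt (lookup x k) k) = (x, 0, 0)"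
      by (simp add: loop_elt_def sum_first pm_sum_singles)
    moreover have "(\<Sum>r\<in>keys f. K_mono r (lookup f r)) = (0 :: (int ^ 'n option) \<Rightarrow>\<^sub>0 'g, z, 0)"
      by (simp add: K_mono_def sum_second Kmono.abs_eq f(1) pm_sum_singles flip: clinear_sum[OF abs_K_space_linear])
    moreover have "(\<Sum>r\<in>keys D. D_mono r (lookup D r)) = (0 :: (int ^ 'n option) \<Rightarrow>\<^sub>0 'g, 0, D)"
      by (simp add: D_mono_def sum_third pm_sum_singles)
    ultimately have "X = (\<Sum>k\<in>keys x. loop_elt (lookup x k) k) + (\<Sum>r\<in>keys f. K_mono r (lookup f r)) + (\<Sum>r\<in>keys D. D_mono r (lookup D r))"
      by (simp add: xzD)
    also have "\<dots> \<in> cv.span (\<Union>q. monos_deg q)"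
    proof (intro cv.span_add cv.span_sum cv.span_base)
      show "loop_elt (lookup x k) k \<in> (\<Union>q. monos_deg q)" for k using monos_degI(1)[OF x] by blast
      show "K_mono r (lookup f r) \<in> (\<Union>q. monos_deg q)" if "r \<in> keys f" for r using monos_degI(2)[of r] that f(2) by blast
      show "D_mono r (lookup D r) \<in> (\<Union>q. monos_deg q)" if "r \<in> keys D" for r using monos_degI(3)[of r] that D by blast
    qed
    finally show "X \<in> cv.span (\<Union>q. monos_deg q)" .
  qed
qed

lemma bracket_monos:
  assumes "X \<in> monos_deg p" "Y \<in> monos_deg q"
  shows "bracket A X Y \<in> cv.span (monos_deg (p + q))"
proof -
  let ?S = "cv.span (monos_deg (p + q))"
  have L: "loop_elt X k \<in> ?S" if "X \<in> eig A k" "k $ None = p + q" for X k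
    using that unfolding monos_deg_def by (intro cv.span_base) blast
  have K: "K_mono r c \<in> ?S" if "r \<in> Gam A" "r $ None = p + q" for r c
    using that unfolding monos_deg_def by (intro cv.span_base) blast
  have D: "D_mono r c \<in> ?S" if "r \<in> Gam A" "r $ None = p + q" for r c
    using that unfolding monos_deg_def by (intro cv.span_base) blast
  consider X' k where "X = loop_elt X' k" "X' \<in> eig A k" "k $ None = p" | r c where "X = K_mono r c" "r \<in> Gam A" "r $ None = p"
    | r c where "X = D_mono r c" "r \<in> Gam A" "r $ None = p" using assms(1) unfolding monos_deg_def by blast
  note X = this
  consider Y' k where "Y = loop_elt Y' k" "Y' \<in> eig A k" "k $ None = q" | r c where "Y = K_mono r c" "r \<in> Gam A" "r $ None = q"
    | r c where "Y = D_mono r c" "r \<in> Gam A" "r $ None = q" using assms(2) unfolding monos_deg_def by blast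
  note Y = this
  show ?thesis
  proof (cases rule: X)
    case x: (1 X' k)
    show ?thesis
    proof (cases rule: Y)
      case y: (1 Y' l)
      have "K_mono (k + l) (form A X' Y' *\<^sub>C cvec k) \<in> ?S"
      proof (cases "form A X' Y' = 0")
        case True
        then show ?thesis by (simp add: mono_simps cv.span_zero)
      next
        case False
        then show ?thesis using form_eig[OF x(2) y(2)] x(3) y(3) by (intro K) simp_all
      qed
      then show ?thesis unfolding x(1) y(1) bracket_LL
        using eig_br[OF x(2) y(2)] x(3) y(3) by (intro cv.span_add L) simp_all
    next
      case 2
      then show ?thesis by (simp add: x(1) bracket_LK cv.span_zero)
    next
      case y: (3 r c)
      show ?thesis unfolding x(1) y(1) bracket_DL
        using eig_shift_Gam[OF y(2)] x(2,3) y(3) by (intro cv.span_scale L) simp_all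
    qed
  next
    case x: (2 r c)
    show ?thesis
    proof (cases rule: Y)
      case y: (3 s e)
      show ?thesis unfolding x(1) y(1) bracket_DK
        using Gam_add[OF x(2) y(2)] x(3) y(3) by (intro cv.span_neg K) (simp_all add: add.commute)
    qed (simp_all add: x(1) bracket_LK cv.span_zero)
  next
    case x: (3 r c)
    show ?thesis
    proof (cases rule: Y)
      case y: (1 Y' l)
      show ?thesis unfolding x(1) y(1) bracket_DL
        using eig_shift_Gam[OF x(2)] x(3) y(2,3) by (intro cv.span_scale L) simp_all
    next
      case y: (2 s e)
      show ?thesis unfolding x(1) y(1) bracket_DK
        using Gam_add[OF x(2) y(2)] x(3) y(3) by (intro K) simp_all
    next
      case y: (3 s e)
      show ?thesis unfolding x(1) y(1) bracket_DD
        using Gam_add[OF x(2) y(2)] x(3) y(3) by (intro cv.span_add D K) simp_all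
    qed
  qed
qed

lemma bracket_span_deg:
  assumes "X \<in> cv.span (monos_deg p)" "Y \<in> cv.span (monos_deg q)"
  shows "bracket A X Y \<in> cv.span (monos_deg (p + q))"
proof (rule span_map_into[OF bracket_linear(2) cv.subspace_span _ assms(1)])
  fix X assume X: "X \<in> monos_deg p"
  show "bracket A X Y \<in> cv.span (monos_deg (p + q))"
    by (rule span_map_into[OF bracket_linear(1) cv.subspace_span _ assms(2)]) (rule bracket_monos[OF X])
qed

lemma tau_bracket: "X \<in> tau A \<Longrightarrow> Y \<in> tau A \<Longrightarrow> bracket A X Y \<in> tau A"
  unfolding tau_span
proof (rule span_map_into[OF bracket_linear(2) cv.subspace_span])
  fix X assume X: "X \<in> (\<Union>q. monos_deg q)" and Y: "Y \<in> cv.span (\<Union>q. monos_deg q)"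
  show "bracket A X Y \<in> cv.span (\<Union>q. monos_deg q)"
  proof (rule span_map_into[OF bracket_linear(1) cv.subspace_span _ Y])
    fix Y assume Y: "Y \<in> (\<Union>q. monos_deg q)"
    from X Y obtain p q where "X \<in> monos_deg p" "Y \<in> monos_deg q" by blast
    then have "bracket A X Y \<in> cv.span (monos_deg (p + q))" by (rule bracket_monos)
    also have "\<dots> \<subseteq> cv.span (\<Union>q. monos_deg q)" by (rule cv.span_mono) blast
    finally show "bracket A X Y \<in> cv.span (\<Union>q. monos_deg q)" .
  qed
qed

lemma bracket_d:
  "bracket A (d_elt 0 i) (loop_elt X k) = of_int (k $ i) *\<^sub>C loop_elt X k"
  "bracket A (d_elt 0 i) (K_mono k c) = of_int (k $ i) *\<^sub>C K_mono k c"
  "bracket A (d_elt 0 i) (D_mono k c) = of_int (k $ i) *\<^sub>C D_mono k c"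
  by (simp_all add: d_elt_mono bracket_DL bracket_DK bracket_DD mono_simps)

lemma bracket_d0:
  assumes "X \<in> cv.span (monos_deg q)"
  shows "bracket A (d_elt 0 None) X = of_int q *\<^sub>C X"
proof -
  have "bracket A (d_elt 0 None) X = (\<lambda>X. of_int q *\<^sub>C X) X"
    by (rule clinear_eq_on_span[OF bracket_linear(1) clinear_scaled[OF clinear_ident] _ assms])
      (auto simp: monos_deg_def bracket_d)
  then show ?thesis by simp
qed

text \<open>The components in the other degrees are eigenvectors of \<open>d\<^sub>0\<close> with other eigenvalues, so they vanish.\<close>

lemma tau_deg_span: "tau_deg A q = cv.span (monos_deg q)"
proof
  have "cv.span (monos_deg q) \<subseteq> tau A" unfolding tau_span by (rule cv.span_mono) blast
  then show "cv.span (monos_deg q) \<subseteq> tau_deg A q" using bracket_d0 by (auto simp: tau_deg_def)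
  show "tau_deg A q \<subseteq> cv.span (monos_deg q)"
  proof
    fix X assume "X \<in> tau_deg A q"
    then have X: "X \<in> tau A" "bracket A (d_elt 0 None) X = of_int q *\<^sub>C X" by (auto simp: tau_deg_def)
    have "(\<Union>q. monos_deg q) \<subseteq> (\<Union>p. cv.span (monos_deg p))" using cv.span_base by blast
    then have "X \<in> cv.span (\<Union>p\<in>UNIV. cv.span (monos_deg p))" using X(1) cv.span_mono unfolding tau_span by blast
    then obtain F Y where F: "finite F" "F \<subseteq> UNIV" "\<And>p. p \<in> F \<Longrightarrow> Y p \<in> cv.span (monos_deg p)" "X = (\<Sum>p\<in>F. Y p)"
      by (rule span_UN_decomposition) auto
    let ?f = "bracket A (d_elt 0 None)"
    define Z where "Z = (\<Sum>p\<in>F - {q}. Y p)"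
    have "X - Z = (if q \<in> F then Y q else 0)" using F(1) by (simp add: F(4) Z_def sum.remove)
    then have XZ: "X - Z \<in> cv.span (monos_deg q)" using F(3) cv.span_zero by auto
    have "Z = 0"
    proof (rule eigenvector_in_span_eigenvectors[OF bracket_linear(1)])
      show "Z \<in> cv.span {v. \<exists>d\<in>of_int ` (- {q}). ?f v = d *\<^sub>C v}"
        unfolding Z_def by (intro cv.span_sum cv.span_base) (use F(3) bracket_d0 in blast)
      have "?f (X - Z) = of_int q *\<^sub>C (X - Z)" by (rule bracket_d0[OF XZ])
      then show "?f Z = of_int q *\<^sub>C Z"
        using X(2) by (simp add: clinear_diff[OF bracket_linear(1)] cv.scale_right_diff_distrib)
      show "(of_int q :: complex) \<notin> of_int ` (- {q})" by auto
    qed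
    with XZ show "X \<in> cv.span (monos_deg q)" by simp
  qed
qed

lemma tau_zero_span: "tau_zero A = cv.span (monos_deg 0)"
  by (simp add: tau_zero_def tau_deg_span)

lemma d0_tau_zero: "d_elt 0 None \<in> tau_zero A"
  unfolding tau_zero_span d_elt_mono using Gam_zero by (intro cv.span_base) (auto simp: monos_deg_def)

lemma tau_zero_subspace: "cv.subspace (tau_zero A)"
  by (simp add: tau_zero_span)

lemma tau_zero_bracket: "X \<in> tau_zero A \<Longrightarrow> Y \<in> tau_zero A \<Longrightarrow> bracket A X Y \<in> tau_zero A"
  using bracket_span_deg[of X 0 Y 0] by (simp add: tau_zero_span)

lemma tau_zero_tau: "tau_zero A \<subseteq> tau A"
  by (auto simp: tau_zero_def tau_deg_def)

lemma emb_rest: "k $ None = 0 \<Longrightarrow> emb (rest k) = k"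
  by (auto simp: vec_eq_iff emb_def rest_def split: option.split)

lemma monos0_cases:
  assumes "X \<in> monos_deg 0"
  obtains Y l where "X = loop_elt Y (emb l)" "Y \<in> eig A (emb l)" | r c where "X = K_mono (emb r) c" "emb r \<in> Gam A"
    | r c where "X = D_mono (emb r) c" "emb r \<in> Gam A"
proof -
  consider Y k where "X = loop_elt Y k" "Y \<in> eig A k" "k $ None = 0" | r c where "X = K_mono r c" "r \<in> Gam A" "r $ None = 0"
    | r c where "X = D_mono r c" "r \<in> Gam A" "r $ None = 0" using assms unfolding monos_deg_def by blast
  then show ?thesis
  proof cases
    case (1 Y k)
    then show ?thesis using that(1)[of Y "rest k"] emb_rest[of k] by simp
  next
    case (2 r c)
    then show ?thesis using that(2)[of "rest r" c] emb_rest[of r] by simp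
  next
    case (3 r c)
    then show ?thesis using that(3)[of "rest r" c] emb_rest[of r] by simp
  qed
qed

lemma loop_tau_zero: "X \<in> eig A (emb l) \<Longrightarrow> loop_elt X (emb l) \<in> tau_zero A"
proof -
  assume "X \<in> eig A (emb l)"
  then have "loop_elt X (emb l) \<in> monos_deg 0" using monos_degI(1)[of X "emb l"] by simp
  then show ?thesis unfolding tau_zero_span by (rule cv.span_base)
qed

lemma zero_emb: "(0 :: int ^ 'n option) = emb 0"
  by (auto simp: vec_eq_iff emb_def split: option.split)

lemma bracket_H:
  "bracket A (loop_elt h 0) (loop_elt X k) = loop_elt (br h X) k"
  "bracket A (loop_elt h 0) (K_mono r c) = 0"
  "bracket A (loop_elt h 0) (D_mono r c) = 0"
  by (simp_all add: bracket_LL bracket_LK bracket_DL mono_simps)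

subsection \<open>The triangular decompositions\<close>

lemma eig_wproj: "X \<in> eig A k \<Longrightarrow> wproj \<eta> X \<in> eig A k"
  by (simp add: eig_def clinear_scale[OF wproj_linear] flip: wproj_aut)

lemma loop_elt_root_space:
  assumes "X \<in> eig A k" "X \<in> wspace \<eta>" "\<eta> \<in> cart0_dual A"
  shows "loop_elt X k \<in> root_space A \<eta> k"
proof -
  have "loop_elt X k \<in> tau A" using assms(1) monos_tau[of "k $ None"] by (auto simp: monos_deg_def)
  then show ?thesis
    using H_diagonal[OF _ assms(2,3)] by (simp add: root_space_def bracket_H bracket_d mono_simps)
qed

lemma root_space_upper_plus:
  assumes "X \<in> root_space A \<eta> k" "\<eta> \<in> cart0_dual A" "k $ None > 0 \<or> k $ None = 0 \<and> \<eta> \<in> P"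
  shows "X \<in> tau_upper_plus A"
  unfolding tau_upper_plus_def using assms by (intro cv.span_base) blast

lemma monos_deg_upper_plus:
  assumes "q > 0"
  shows "monos_deg q \<subseteq> tau_upper_plus A"
proof
  fix X assume X: "X \<in> monos_deg q"
  then consider Y k where "X = loop_elt Y k" "Y \<in> eig A k" "k $ None = q" | r c where "X = K_mono r c" "r \<in> Gam A" "r $ None = q"
    | r c where "X = D_mono r c" "r \<in> Gam A" "r $ None = q" unfolding monos_deg_def by blast
  then show "X \<in> tau_upper_plus A"
  proof cases
    case (1 Y k)
    have "X = loop_elt (\<Sum>\<eta>\<in>W. wproj \<eta> Y) k" by (simp add: 1(1) wproj_sum)
    also have "\<dots> = (\<Sum>\<eta>\<in>W. loop_elt (wproj \<eta> Y) k)" by (rule clinear_sum[OF mono_linear(1)])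
    also have "\<dots> \<in> tau_upper_plus A"
      unfolding tau_upper_plus_def
    proof (rule cv.span_sum, fold tau_upper_plus_def)
      fix \<eta> assume \<eta>: "\<eta> \<in> W"
      show "loop_elt (wproj \<eta> Y) k \<in> tau_upper_plus A"
        by (rule root_space_upper_plus[OF loop_elt_root_space[OF eig_wproj[OF 1(2)] wproj_in W_dual[OF \<eta>]] W_dual[OF \<eta>]])
          (use assms 1(3) in simp)
    qed
    finally show ?thesis .
  next
    case (2 r c)
    have "X \<in> root_space A 0 r" using X monos_tau by (auto simp: root_space_def 2(1) bracket_H bracket_d)
    then show ?thesis by (rule root_space_upper_plus[OF _ zero_dual]) (use assms 2 in simp)
  next
    case (3 r c)
    have "X \<in> root_space A 0 r" using X monos_tau by (auto simp: root_space_def 3(1) bracket_H bracket_d)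
    then show ?thesis by (rule root_space_upper_plus[OF _ zero_dual]) (use assms 3 in simp)
  qed
qed

lemma tau_plus_upper_plus: "tau_plus A \<subseteq> tau_upper_plus A"
  unfolding tau_plus_def
proof (rule cv.span_minimal)
  show "cv.subspace (tau_upper_plus A)" by (simp add: tau_upper_plus_def)
  then show "(\<Union>q\<in>{0<..}. tau_deg A q) \<subseteq> tau_upper_plus A"
    using cv.span_minimal[OF monos_deg_upper_plus] by (auto simp: tau_deg_span)
qed

definition lowering :: "('g, 'n) toroidal set" where
  "lowering = {loop_elt X (emb l) |X l \<eta>. X \<in> eig A (emb l) \<and> X \<in> wspace \<eta> \<and> \<eta> \<in> W \<and> - \<eta> \<in> P}"

definition raising :: "('g, 'n) toroidal set" where
  "raising = {loop_elt X (emb l) |X l \<eta>. X \<in> eig A (emb l) \<and> X \<in> wspace \<eta> \<and> \<eta> \<in> P}"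

lemma raising_upper_plus: "raising \<subseteq> tau_upper_plus A"
  unfolding raising_def
  using root_space_upper_plus[OF loop_elt_root_space] W_dual[OF positive_W(1)] emb_nth(1) by blast

lemma lowering_tau_zero: "lowering \<subseteq> tau_zero A" and raising_tau_zero: "raising \<subseteq> tau_zero A"
  unfolding lowering_def raising_def using loop_tau_zero by blast+

lemma tau_upper_zero_subspace: "cv.subspace (tau_upper_zero A)"
proof -
  have "tau_upper_zero A = tau_zero A \<inter> (\<Inter>h\<in>H. {X. bracket A (loop_elt h 0) X = 0})"
    by (auto simp: tau_upper_zero_def)
  moreover have "cv.subspace (\<Inter>h\<in>H. {X. bracket A (loop_elt h 0) X = 0})"
    using subspace_kernel[OF bracket_linear(1)] by (intro cv.subspace_Inter) blast
  ultimately show ?thesis using cv.subspace_inter[OF tau_zero_subspace] by simp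
qed

text \<open>Each loop element is split along the weights of its coefficient, which are zero, positive or negative.\<close>

lemma tau_zero_triangular: "tau_zero A \<subseteq> cv.span (lowering \<union> tau_upper_zero A \<union> raising)"
  unfolding tau_zero_span
proof (rule cv.span_minimal[OF _ cv.subspace_span], rule subsetI)
  let ?S = "cv.span (lowering \<union> tau_upper_zero A \<union> raising)"
  fix X assume X: "X \<in> monos_deg 0"
  then have X0: "X \<in> tau_zero A" by (simp add: tau_zero_span cv.span_base)
  from X show "X \<in> ?S"
  proof (cases rule: monos0_cases)
    case (1 Y l)
    have "X = (\<Sum>\<eta>\<in>W. loop_elt (wproj \<eta> Y) (emb l))"
      by (simp add: 1(1) wproj_sum flip: clinear_sum[OF mono_linear(1)])
    also have "\<dots> \<in> ?S"
    proof (intro cv.span_sum cv.span_base)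
      fix \<eta> assume \<eta>: "\<eta> \<in> W"
      note e = eig_wproj[OF 1(2), of \<eta>]
      from W_cases[OF \<eta>] show "loop_elt (wproj \<eta> Y) (emb l) \<in> lowering \<union> tau_upper_zero A \<union> raising"
      proof (elim disjE)
        assume "\<eta> = 0"
        then have "br h (wproj \<eta> Y) = 0" if "h \<in> H" for h using H_diagonal[OF that wproj_in zero_dual] by simp
        then show ?thesis using loop_tau_zero[OF e] by (simp add: tau_upper_zero_def bracket_H mono_simps)
      next
        assume "\<eta> \<in> P"
        then show ?thesis using e wproj_in by (auto simp: raising_def)
      next
        assume "- \<eta> \<in> P"
        then show ?thesis using e wproj_in \<eta> by (auto simp: lowering_def)
      qed
    qed
    finally show ?thesis .
  next
    case (2 r c)
    then have "X \<in> tau_upper_zero A" using X0 by (simp add: tau_upper_zero_def bracket_H)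
    then show ?thesis by (intro cv.span_base) blast
  next
    case (3 r c)
    then have "X \<in> tau_upper_zero A" using X0 by (simp add: tau_upper_zero_def bracket_H)
    then show ?thesis by (intro cv.span_base) blast
  qed
qed

lemma tau_upper_zero_span:
  "tau_upper_zero A \<subseteq> cv.span ({loop_elt Y (emb l) |Y l. Y \<in> eig A (emb l) \<and> (\<forall>h\<in>H. br h Y = 0)} \<union>
     {K_mono (emb r) c |r c. emb r \<in> Gam A} \<union> {D_mono (emb r) c |r c. emb r \<in> Gam A})"
    (is "_ \<subseteq> cv.span ?S")
proof
  fix X assume X: "X \<in> tau_upper_zero A"
  \<comment> \<open>The projection of the loop part onto the weight space of weight zero fixes \<open>X\<close>.\<close>
  define p :: "('g, 'n) toroidal \<Rightarrow> ('g, 'n) toroidal" where "p Z = (\<Sum>k\<in>keys (fst Z). loop_elt (wproj 0 (lookup (fst Z) k)) k) + (0, snd Z)" for Z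
  have p_eq: "p Z = (\<Sum>k\<in>F. loop_elt (wproj 0 (lookup (fst Z) k)) k) + (0, snd Z)" if "finite F" "keys (fst Z) \<subseteq> F" for Z F
    unfolding p_def using that
    by (intro arg_cong2[where f = "(+)"] refl sum.mono_neutral_left) (auto simp: in_keys_iff clinear_0[OF wproj_linear] mono_simps)
  have p_add: "p (Y + Z) = p Y + p Z" for Y Z
  proof -
    let ?F = "keys (fst Y) \<union> keys (fst Z)"
    have "keys (fst (Y + Z)) \<subseteq> ?F" by (simp add: keys_add)
    then show ?thesis
      using p_eq[of ?F "Y + Z"] p_eq[of ?F Y] p_eq[of ?F Z]
      by (simp add: lookup_add clinear_add[OF wproj_linear] mono_simps sum.distrib)
  qed
  have p_scale: "p (c *\<^sub>C Z) = c *\<^sub>C p Z" for c Z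
  proof -
    have fs: "fst (c *\<^sub>C Z) = c *\<^sub>C fst Z" "snd (c *\<^sub>C Z) = c *\<^sub>C snd Z" "(0, c *\<^sub>C snd Z) = c *\<^sub>C (0 :: (int ^ 'n option) \<Rightarrow>\<^sub>0 'g, snd Z)"
      by (simp_all add: scaleC_prod_def)
    have "keys (fst (c *\<^sub>C Z)) \<subseteq> keys (fst Z)" by (auto simp: fs in_keys_iff lookup_scaleC)
    then show ?thesis
      using p_eq[of "keys (fst Z)" "c *\<^sub>C Z"] p_eq[of "keys (fst Z)" Z]
      by (simp add: fs lookup_scaleC clinear_scale[OF wproj_linear] mono_simps scaleC_right_distrib cv.scale_sum_right)
  qed
  note p_lin = clinearI[OF p_add p_scale]
  have "\<forall>k. br h (lookup (fst X) k) = 0" if h: "h \<in> H" for h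
  proof -
    obtain x z D where xzD: "X = (x, z, D)" by (cases X)
    have "bracket A (loop_elt h 0) X = 0" using X h by (simp add: tau_upper_zero_def)
    moreover have "der_loop D (single 0 h) = 0" by (simp add: der_loop_def pm_sum2_def)
    ultimately have "loop_bracket A (single 0 h) x = 0" by (simp add: xzD loop_elt_def zero_prod_def)
    moreover have "loop_bracket A (single 0 h) x = (\<Sum>k\<in>keys x. single k (br h (lookup x k)))"
      by (cases "h = 0") (simp_all add: loop_bracket_def pm_sum2_def br_simps)
    ultimately have zero: "lookup (\<Sum>k\<in>keys x. single k (br h (lookup x k))) k = 0" for k by simp
    have "br h (lookup x k) = 0" for k
      using zero[of k] by (cases "k \<in> keys x") (simp_all add: lookup_sum lookup_single when_def in_keys_iff br_simps)
    then show ?thesis by (simp add: xzD)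
  qed
  then have "lookup (fst X) k \<in> wspace 0" for k
    by (simp add: wspace_eq_weight_space[OF zero_dual] weight_space_def)
  then have "wproj 0 (lookup (fst X) k) = lookup (fst X) k" for k using wproj_wspace[OF zero_dual] by simp
  moreover have "(\<Sum>k\<in>I. loop_elt (g k) k) = (\<Sum>k\<in>I. single k (g k), 0, 0)" for I and g :: "int ^ 'n option \<Rightarrow> 'g"
    by (induction I rule: infinite_finite_induct) (simp_all add: loop_elt_def zero_prod_def)
  ultimately have "p X = X" by (cases X) (simp add: p_def pm_sum_singles)
  moreover have "p X \<in> cv.span ?S"
  proof (rule span_map_into[OF p_lin cv.subspace_span])
    show "X \<in> cv.span (monos_deg 0)" using X by (simp add: tau_upper_zero_def tau_zero_span)
    fix s assume "s \<in> monos_deg 0"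
    then show "p s \<in> cv.span ?S"
    proof (cases rule: monos0_cases)
      case (1 Y l)
      have "p s = loop_elt (wproj 0 Y) (emb l)"
        using p_eq[of "{emb l}" s] by (simp add: 1(1) loop_elt_def lookup_single)
      moreover have "br h (wproj 0 Y) = 0" if "h \<in> H" for h using H_diagonal[OF that wproj_in zero_dual] by simp
      ultimately show ?thesis using eig_wproj[OF 1(2)] by (intro cv.span_base) blast
    next
      case (2 r c)
      have "p s = s" by (simp add: p_def 2(1) K_mono_def)
      then show ?thesis using 2 by (intro cv.span_base) auto
    next
      case (3 r c)
      have "p s = s" by (simp add: p_def 3(1) D_mono_def)
      then show ?thesis using 3 by (intro cv.span_base) auto
    qed
  qed
  ultimately show "X \<in> cv.span ?S" by simp
qed

end

section \<open>The tensor modules\<close>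

lemma abs_tensor_linear: "clinear abs_tensor"
  by (rule clinearI) (simp_all add: plus_tensor.abs_eq scaleC_tensor.abs_eq)

lemma tensor_span: "(t :: ('a::complex_vector, 'b::complex_vector) tensor) \<in> cv.span {x \<otimes>\<^sub>t y |x y. True}"
proof (induction t)
  case (1 f)
  have "abs_tensor f = (\<Sum>p\<in>keys f. abs_tensor (single p (lookup f p)))"
    by (simp add: pm_sum_singles flip: clinear_sum[OF abs_tensor_linear])
  also have "\<dots> = (\<Sum>p\<in>keys f. lookup f p *\<^sub>C (fst p \<otimes>\<^sub>t snd p))"
  proof (rule sum.cong[OF refl])
    fix p
    have "single p (lookup f p) = lookup f p *\<^sub>C single p 1" by (simp add: scaleC_single scaleC_complex_def)
    then show "abs_tensor (single p (lookup f p)) = lookup f p *\<^sub>C (fst p \<otimes>\<^sub>t snd p)"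
      by (simp add: tensor.abs_eq clinear_scale[OF abs_tensor_linear])
  qed
  also have "\<dots> \<in> cv.span {x \<otimes>\<^sub>t y |x y. True}" by (intro cv.span_sum cv.span_scale cv.span_base) blast
  finally show ?case .
qed

lemma tensor_linear_eqI:
  assumes "clinear f" "clinear g" "\<And>x y. f (x \<otimes>\<^sub>t y) = g (x \<otimes>\<^sub>t y)"
  shows "f t = g t"
  by (rule clinear_eq_on_span[OF assms(1,2) _ tensor_span]) (use assms(3) in blast)

definition tmap :: "('a::complex_vector \<Rightarrow> 'c::complex_vector) \<Rightarrow> ('b::complex_vector \<Rightarrow> 'd::complex_vector) \<Rightarrow>
    ('a, 'b) tensor \<Rightarrow> ('c, 'd) tensor" where
  "tmap f g = tensor_lift (\<lambda>x y. f x \<otimes>\<^sub>t g y)"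

lemma tensor_clinear: "clinear (\<lambda>x. x \<otimes>\<^sub>t y)" "clinear (\<lambda>y. x \<otimes>\<^sub>t y)"
  by (rule clinearI; simp add: tensor_linear)+

lemma bilinear_map_iff: "bilinear_map B \<longleftrightarrow> (\<forall>x. clinear (B x)) \<and> (\<forall>y. clinear (\<lambda>x. B x y))"
  by (simp add: bilinear_map_def clinear_on_UNIV)

lemma tmap_tensor: "clinear f \<Longrightarrow> clinear g \<Longrightarrow> tmap f g (x \<otimes>\<^sub>t y) = f x \<otimes>\<^sub>t g y"
  unfolding tmap_def by (rule tensor_lift_tensor, rule bilinear_tensor_map) (simp_all add: clinear_on_UNIV)

lemma tmap_linear: "clinear f \<Longrightarrow> clinear g \<Longrightarrow> clinear (tmap f g)"
  unfolding tmap_def clinear_on_UNIV[symmetric] by (intro tensor_lift_linear bilinear_tensor_map)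

lemma tmap_comp:
  assumes "clinear f" "clinear g" "clinear f'" "clinear g'"
  shows "tmap f g (tmap f' g' t) = tmap (\<lambda>x. f (f' x)) (\<lambda>x. g (g' x)) t"
  by (rule tensor_linear_eqI[of _ _ t])
    (simp_all add: assms tmap_linear clinear_comp tmap_tensor)

lemma tmap_linear_left:
  assumes "\<And>Y. clinear (F Y)" "\<And>x. clinear (\<lambda>Y. F Y x)" "clinear g"
  shows "clinear (\<lambda>Y. tmap (F Y) g t)"
proof (rule clinearI)
  note lin = tmap_linear[OF assms(1,3)]
  show "tmap (F (Y + Z)) g t = tmap (F Y) g t + tmap (F Z) g t" for Y Z
    by (rule tensor_linear_eqI[OF lin clinear_plus[OF lin lin]])
      (simp add: tmap_tensor[OF assms(1,3)] clinear_add[OF assms(2)] tensor_linear)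
  show "tmap (F (c *\<^sub>C Y)) g t = c *\<^sub>C tmap (F Y) g t" for c Y
    by (rule tensor_linear_eqI[OF lin clinear_scaled[OF lin]])
      (simp add: tmap_tensor[OF assms(1,3)] clinear_scale[OF assms(2)] tensor_linear)
qed

lemma tmap_linear_right:
  assumes "\<And>Y. clinear (F Y)" "\<And>x. clinear (\<lambda>Y. F Y x)" "clinear g"
  shows "clinear (\<lambda>Y. tmap g (F Y) t)"
proof (rule clinearI)
  note lin = tmap_linear[OF assms(3,1)]
  show "tmap g (F (Y + Z)) t = tmap g (F Y) t + tmap g (F Z) t" for Y Z
    by (rule tensor_linear_eqI[OF lin clinear_plus[OF lin lin]])
      (simp add: tmap_tensor[OF assms(3,1)] clinear_add[OF assms(2)] tensor_linear)
  show "tmap g (F (c *\<^sub>C Y)) t = c *\<^sub>C tmap g (F Y) t" for c Y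
    by (rule tensor_linear_eqI[OF lin clinear_scaled[OF lin]])
      (simp add: tmap_tensor[OF assms(3,1)] clinear_scale[OF assms(2)] tensor_linear)
qed

lemma sum_option: "(\<Sum>i\<in>UNIV. f i) = f None + (\<Sum>i\<in>UNIV. f (Some i))" for f :: "'i::finite option \<Rightarrow> 'a::comm_monoid_add"
  by (simp add: UNIV_option_conv sum.reindex)

lemma clinear_coord: "clinear (\<lambda>u :: complex ^ 'i. u $ i)"
  by (rule clinearI) (simp_all add: scaleC_vec_def scaleC_complex_def)

lemma K0_part_linear: "clinear (K0_part :: 'n::finite K_space \<Rightarrow> _)"
proof -
  have look: "lookup (K0_part (abs_K_space f)) r = (if r $ None = 0 then lookup f r $ None else 0)"
    for f :: "(int ^ 'n option) \<Rightarrow>\<^sub>0 (complex ^ 'n option)" and r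
    by (simp add: K0_part.abs_eq Poly_Mapping.mapp.rep_eq in_keys_iff when_def)
  show ?thesis
  proof (rule clinearI)
    fix u v :: "'n K_space" and c
    obtain f g where "u = abs_K_space f" "v = abs_K_space g" by (metis K_space_cases)
    then show "K0_part (u + v) = K0_part u + K0_part v" "K0_part (c *\<^sub>C u) = c *\<^sub>C K0_part u"
      by (auto intro!: poly_mapping_eqI simp: plus_K_space.abs_eq scaleC_K_space.abs_eq look lookup_add lookup_scaleC
          scaleC_vec_def scaleC_complex_def)
  qed
qed

lemma tensor_act_cong:
  assumes "\<And>k. k \<in> keys x \<Longrightarrow> act2 (lookup x k) = act2' (lookup x k)"
  shows "tensor_act act1 act2 \<alpha> d C0 (x, z, D) f = tensor_act act1 act2' \<alpha> d C0 (x, z, D) f"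
proof -
  have "pm_sum2 (\<lambda>l k X v. single (k + rest l) (tensor_lift (\<lambda>v1 v2. v1 \<otimes>\<^sub>t act2 X v2) v)) x f =
      pm_sum2 (\<lambda>l k X v. single (k + rest l) (tensor_lift (\<lambda>v1 v2. v1 \<otimes>\<^sub>t act2' X v2) v)) x f"
    unfolding pm_sum2_def by (intro sum.cong refl) (simp only: assms)
  then show ?thesis by simp
qed

lemma tensor_act_linear:
  assumes "\<And>Y. clinear (act1 Y)" "\<And>k. k \<in> keys x \<Longrightarrow> clinear (act2 (lookup x k))"
  shows "clinear (tensor_act act1 act2 \<alpha> d C0 (x, z, D))"
proof -
  define act2' where "act2' Y = (if clinear (act2 Y) then act2 Y else (\<lambda>_. 0))" for Y
  have lin: "clinear (act2' Y)" for Y by (simp add: act2'_def clinear_zero_map)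
  have "clinear (tensor_act act1 act2' \<alpha> d C0 (x, z, D))"
    unfolding tensor_act.simps tmap_def[symmetric]
    by (intro clinear_plus pm_sum2_linear_right clinear_single clinear_sum_map clinear_scaled clinear_ident
        tmap_linear[OF assms(1) clinear_ident] tmap_linear[OF clinear_ident lin])
  moreover have "tensor_act act1 act2 \<alpha> d C0 (x, z, D) = tensor_act act1 act2' \<alpha> d C0 (x, z, D)"
    by (rule ext, rule tensor_act_cong) (simp add: act2'_def assms(2))
  ultimately show ?thesis by simp
qed

lemma poly_mapping_span: "(f :: 'k \<Rightarrow>\<^sub>0 'a::complex_vector) \<in> cv.span {single k v |k v. True}"
proof -
  have "(\<Sum>k\<in>keys f. single k (lookup f k)) \<in> cv.span {single k v |k v. True}"
    by (intro cv.span_sum cv.span_base) blast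
  then show ?thesis by (simp add: pm_sum_singles)
qed

lemma lie_module_on_subset:
  assumes "lie_module_on br L act M" "L' \<subseteq> L"
  shows "lie_module_on br L' act M"
  using assms(1) subsetD[OF assms(2)] unfolding lie_module_on_def clinear_on_def by blast

lemma lie_module_on_subspace:
  assumes "lie_module_on br L act UNIV" "cv.subspace M" "\<And>x v. x \<in> L \<Longrightarrow> v \<in> M \<Longrightarrow> act x v \<in> M"
  shows "lie_module_on br L act M"
  using assms unfolding lie_module_on_def clinear_on_def by blast

lemma span_lookup_subset:
  assumes "cv.subspace U" "X \<in> cv.span S" "\<And>s. s \<in> S \<Longrightarrow> lookup (fst s) k \<in> U"
  shows "lookup (fst X) k \<in> U"
  by (rule span_map_into[of "\<lambda>X. lookup (fst X) k", OF _ assms(1,3,2)])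
    (auto intro!: clinearI simp: lookup_add lookup_scaleC scaleC_prod_def)

context toroidal
begin

lemma g_sigma0_subspace: "cv.subspace (g_sigma0 A)"
  unfolding cv.subspace_def g_sigma0_def
  by (simp add: clinear_0[OF aut_linear] clinear_add[OF aut_linear] clinear_scale[OF aut_linear])

lemma g_sigma0_br: "x \<in> g_sigma0 A \<Longrightarrow> y \<in> g_sigma0 A \<Longrightarrow> br x y \<in> g_sigma0 A"
  by (simp add: g_sigma0_def aut_br)

lemma eig_g_sigma0: "x \<in> eig A k \<Longrightarrow> k $ None = 0 \<Longrightarrow> x \<in> g_sigma0 A"
  unfolding eig_def g_sigma0_def by (auto simp: scaleC_one dest!: spec[of _ None])

lemma eig_emb_homog: "x \<in> eig A (emb l) \<longleftrightarrow> x \<in> homog A (g_sigma0 A) l"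
proof -
  have "x \<in> eig A (emb l) \<longleftrightarrow> (\<forall>i. aut A i x = (root1 A i powi (emb l $ i)) *\<^sub>C x)" by (simp add: eig_def)
  also have "\<dots> \<longleftrightarrow> aut A None x = x \<and> (\<forall>i. aut A (Some i) x = (root1 A (Some i) powi (l $ i)) *\<^sub>C x)"
    unfolding split_option_all[of "\<lambda>i. aut A i x = (root1 A i powi (emb l $ i)) *\<^sub>C x"] by (simp add: scaleC_one)
  finally show ?thesis by (simp add: homog_def g_sigma0_def)
qed

lemma tau_zero_lookup: "X \<in> tau_zero A \<Longrightarrow> lookup (fst X) k \<in> g_sigma0 A"
  unfolding tau_zero_span
proof (erule span_lookup_subset[OF g_sigma0_subspace])
  fix s assume "s \<in> monos_deg 0"
  then show "lookup (fst s) k \<in> g_sigma0 A"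
    by (cases rule: monos0_cases)
      (auto simp: loop_elt_def K_mono_def D_mono_def lookup_single when_def cv.subspace_0[OF g_sigma0_subspace] eig_g_sigma0)
qed

end

text \<open>\<open>Bmat r c\<close> is the matrix \<open>\<Sum>\<^sub>i\<^sub>j c\<^sub>i r\<^sub>j E\<^sub>j\<^sub>i\<close> by which the derivation \<open>t\<^sup>r \<Sum>\<^sub>i c\<^sub>i d\<^sub>i\<close> acts on \<open>W\<^sub>1\<close>.\<close>

definition Bmat :: "int ^ 'n \<Rightarrow> complex ^ 'n option \<Rightarrow> complex ^ 'n ^ ('n::finite)" where
  "Bmat r c = (\<chi> j i. of_int (r $ j) * c $ Some i)"

lemma Bmat_add: "Bmat (r + s) c = Bmat r c + Bmat s c" "Bmat r (c + e) = Bmat r c + Bmat r e"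
  "Bmat r (a *\<^sub>C c) = a *\<^sub>C Bmat r c" "Bmat r (c - e) = Bmat r c - Bmat r e"
  by (simp_all add: Bmat_def vec_eq_iff scaleC_vec_def scaleC_complex_def algebra_simps)

lemma cdot_emb: "cdot c (cvec (emb r)) = (\<Sum>i\<in>UNIV. c $ Some i * of_int (r $ i))"
  by (simp add: cdot_def sum_option)

lemma Bmat_bracket: "gl_bracket (Bmat r c) (Bmat s e) = cdot c (cvec (emb s)) *\<^sub>C Bmat r e - cdot e (cvec (emb r)) *\<^sub>C Bmat s c"
  unfolding gl_bracket_def vec_eq_iff
  by (simp add: Bmat_def matrix_matrix_mult_def cdot_emb scaleC_vec_def scaleC_complex_def sum_distrib_left sum_distrib_right mult_ac)

lemma Bmat_sum: "(\<Sum>i\<in>UNIV. \<Sum>j\<in>UNIV. (c $ Some i * of_int (r $ j)) *\<^sub>C gl_unit j i) = Bmat r c"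
proof -
  have "(\<Sum>i\<in>UNIV. \<Sum>j\<in>UNIV. (c $ Some i * of_int (r $ j)) *\<^sub>C gl_unit j i) $ a $ b = Bmat r c $ a $ b" for a b
  proof -
    have "(\<Sum>i\<in>UNIV. \<Sum>j\<in>UNIV. (c $ Some i * of_int (r $ j)) *\<^sub>C gl_unit j i) $ a $ b =
        (\<Sum>i\<in>UNIV. \<Sum>j\<in>UNIV. if j = a then (if i = b then c $ Some i * of_int (r $ j) else 0) else 0)"
      unfolding sum_component
      by (intro sum.cong refl) (simp add: gl_unit_def scaleC_vec_def scaleC_complex_def)
    also have "\<dots> = Bmat r c $ a $ b" by (simp add: Bmat_def mult.commute)
    finally show ?thesis .
  qed
  then show ?thesis by (simp add: vec_eq_iff)
qed

text \<open>The scalar by which the derivation \<open>t\<^sup>r \<Sum>\<^sub>i c\<^sub>i d\<^sub>i\<close> acts on the component of exponent \<open>k\<close>, next to the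
  matrix \<open>Bmat\<close>.\<close>

definition scal :: "complex ^ 'n \<Rightarrow> complex \<Rightarrow> complex ^ 'n option \<Rightarrow> int ^ ('n::finite) \<Rightarrow> complex" where
  "scal \<alpha> d c k = (\<Sum>i\<in>UNIV. c $ Some i * (of_int (k $ i) + \<alpha> $ i)) + c $ None * d"

lemma scal_add: "scal \<alpha> d (c - e) k = scal \<alpha> d c k - scal \<alpha> d e k" "scal \<alpha> d (a *\<^sub>C c) k = a * scal \<alpha> d c k"
  "scal \<alpha> d c (k + r) = scal \<alpha> d c k + cdot c (cvec (emb r))"
  by (simp_all add: scal_def cdot_emb scaleC_vec_def scaleC_complex_def algebra_simps sum.distrib sum_subtractf sum_distrib_left)

lemma tensor_act_loop_single:
  assumes "clinear (act2 X)" "X = 0 \<Longrightarrow> act2 X = (\<lambda>v. 0)"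
  shows "tensor_act act1 act2 \<alpha> d C0 (loop_elt X (emb l)) (single k v) = single (k + l) (tmap (\<lambda>v. v) (act2 X) v)"
proof (cases "X = 0 \<or> v = 0")
  case True
  note lin = tmap_linear[OF clinear_ident assms(1)]
  have "tmap (\<lambda>v. v) (act2 X) v = 0"
  proof (cases "X = 0")
    case True
    show ?thesis
      by (rule tensor_linear_eqI[OF lin clinear_zero_map]) (subst tmap_tensor[OF clinear_ident assms(1)], simp add: assms(2)[OF True])
  next
    case False
    with \<open>X = 0 \<or> v = 0\<close> show ?thesis by (simp add: clinear_0[OF lin])
  qed
  with True show ?thesis by (auto simp: loop_elt_def)
next
  case False
  then show ?thesis by (simp add: loop_elt_def pm_sum2_def tmap_def)
qed

lemma tensor_act_K_mono: "tensor_act act1 act2 \<alpha> d C0 (K_mono (emb r) c) (single k v) = single (k + r) ((C0 * c $ None) *\<^sub>C v)"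
  unfolding K_mono_def tensor_act.simps pm_sum2_zero K0_part_emb
  by (subst pm_sum2_single) simp_all

lemma tensor_act_D_mono:
  assumes "\<And>Y. clinear (act1 Y)" "\<And>v. clinear (\<lambda>Y. act1 Y v)"
  shows "tensor_act act1 act2 \<alpha> d C0 (D_mono (emb r) c) (single k v) =
    single (k + r) (scal \<alpha> d c k *\<^sub>C v + tmap (act1 (Bmat r c)) (\<lambda>v. v) v)"
proof -
  note lin = tmap_linear[OF assms(1) clinear_ident] tmap_linear_left[OF assms clinear_ident]
  have "(\<Sum>i\<in>UNIV. \<Sum>j\<in>UNIV. (c $ Some i * of_int (r $ j)) *\<^sub>C tmap (act1 (gl_unit j i)) (\<lambda>v. v) v) = tmap (act1 (Bmat r c)) (\<lambda>v. v) v"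
    unfolding Bmat_sum[symmetric] by (simp add: clinear_sum[OF lin(2)] clinear_scale[OF lin(2)])
  then show ?thesis
    unfolding D_mono_def tensor_act.simps pm_sum2_zero K0_part_zero tmap_def[symmetric]
    by (subst pm_sum2_single) (simp_all add: clinear_0[OF lin(1)] scal_def scaleC_left_distrib add_ac)
qed

locale tensor_module = toroidal A lmin for A :: "('g::complex_vector, 'n::finite) toroidal_data" and lmin +
  fixes act1 :: "complex ^ 'n ^ 'n \<Rightarrow> 'w1 \<Rightarrow> 'w1::complex_vector" and act2 :: "'g \<Rightarrow> 'm \<Rightarrow> 'm::complex_vector"
    and \<alpha> :: "complex ^ 'n" and d C0 :: complex
  assumes gl_module: "lie_module_on gl_bracket UNIV act1 UNIV"
    and sigma_module: "lie_module_on (lie A) (g_sigma0 A) act2 UNIV"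
begin

lemma act1_linear: "clinear (act1 Y)" "clinear (\<lambda>Y. act1 Y v)"
  and act1_bracket: "act1 (gl_bracket X Y) v = act1 X (act1 Y v) - act1 Y (act1 X v)"
  using gl_module unfolding lie_module_on_def clinear_on_UNIV by simp_all

lemma act2_linear: "X \<in> g_sigma0 A \<Longrightarrow> clinear (act2 X)"
  and act2_bracket: "X \<in> g_sigma0 A \<Longrightarrow> Y \<in> g_sigma0 A \<Longrightarrow> act2 (br X Y) v = act2 X (act2 Y v) - act2 Y (act2 X v)"
  using sigma_module unfolding lie_module_on_def clinear_on_UNIV by simp_all

lemma act2_linear_left: "clinear_on (g_sigma0 A) (\<lambda>X. act2 X v)"
  using sigma_module unfolding lie_module_on_def by simp

definition sigma0_proj :: "'g \<Rightarrow> 'g" where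
  "sigma0_proj = (SOME p. clinear p \<and> (\<forall>x. p x \<in> g_sigma0 A) \<and> (\<forall>x\<in>g_sigma0 A. p x = x))"

lemma sigma0_proj: "clinear sigma0_proj" "sigma0_proj x \<in> g_sigma0 A" "x \<in> g_sigma0 A \<Longrightarrow> sigma0_proj x = x"
proof -
  have "\<exists>p. clinear p \<and> (\<forall>x. p x \<in> g_sigma0 A) \<and> (\<forall>x\<in>g_sigma0 A. p x = x)"
    by (rule projection_exists[OF g_sigma0_subspace]) blast
  then have "clinear sigma0_proj \<and> (\<forall>x. sigma0_proj x \<in> g_sigma0 A) \<and> (\<forall>x\<in>g_sigma0 A. sigma0_proj x = x)"
    unfolding sigma0_proj_def by (rule someI_ex)
  then show "clinear sigma0_proj" "sigma0_proj x \<in> g_sigma0 A" "x \<in> g_sigma0 A \<Longrightarrow> sigma0_proj x = x" by blast+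
qed

text \<open>Extending the action of \<open>\<gg>(\<sigma>\<^sub>0)\<close> linearly to all of \<open>\<gg>\<close> makes the formulas for the action of the
  toroidal algebra bilinear without side conditions.\<close>

definition ext :: "'g \<Rightarrow> 'm \<Rightarrow> 'm" where "ext X = act2 (sigma0_proj X)"

lemma ext_linear: "clinear (ext X)" "clinear (\<lambda>X. ext X v)"
proof -
  show "clinear (ext X)" unfolding ext_def by (rule act2_linear[OF sigma0_proj(2)])
  show "clinear (\<lambda>X. ext X v)"
    using act2_linear_left[of v] sigma0_proj(2) unfolding ext_def clinear_on_def
    by (intro clinearI) (simp_all add: clinear_add[OF sigma0_proj(1)] clinear_scale[OF sigma0_proj(1)])
qed

lemma ext_eq: "X \<in> g_sigma0 A \<Longrightarrow> ext X = act2 X" by (simp add: ext_def sigma0_proj(3))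

abbreviation te where "te \<equiv> tensor_act act1 ext \<alpha> d C0"
abbreviation ta where "ta \<equiv> tensor_act act1 act2 \<alpha> d C0"

lemma ta_te: "X \<in> tau_zero A \<Longrightarrow> ta X f = te X f"
proof -
  assume X: "X \<in> tau_zero A"
  obtain x z D where xzD: "X = (x, z, D)" by (cases X)
  have "ext (lookup x k) = act2 (lookup x k)" for k using tau_zero_lookup[OF X, of k] by (simp add: xzD ext_eq)
  then show ?thesis unfolding xzD by (rule tensor_act_cong[symmetric])
qed

abbreviation T1 where "T1 Y \<equiv> tmap (act1 Y) (\<lambda>v. v)"
abbreviation T2 where "T2 X \<equiv> tmap (\<lambda>v. v) (ext X)"

lemmas T1_linear = tmap_linear[OF act1_linear(1) clinear_ident] tmap_linear_left[OF act1_linear clinear_ident]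
lemmas T2_linear = tmap_linear[OF clinear_ident ext_linear(1)] tmap_linear_right[OF ext_linear clinear_ident]

lemma te_linear: "clinear (te X)" "clinear (\<lambda>X. te X f)"
proof -
  have "clinear (te (x, z, D))" for x z D
    unfolding tensor_act.simps tmap_def[symmetric]
    by (intro clinear_plus pm_sum2_linear_right clinear_single clinear_sum_map clinear_scaled clinear_ident T1_linear T2_linear)
  then show "clinear (te X)" by (cases X) simp
  define a where "a x = pm_sum2 (\<lambda>l k X v. single (k + rest l) (T2 X v)) x f" for x
  define b where "b D = pm_sum2 (\<lambda>r k u v. single (k + rest r)
       ((\<Sum>i\<in>UNIV. u $ Some i * (of_int (k $ i) + \<alpha> $ i)) *\<^sub>C v +
        (\<Sum>i\<in>UNIV. \<Sum>j\<in>UNIV. (u $ Some i * of_int (r $ Some j)) *\<^sub>C T1 (gl_unit j i) v) + (u $ None * d) *\<^sub>C v)) D f" for D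
  define c where "c z = pm_sum2 (\<lambda>r k c v. single (k + rest r) ((C0 * c) *\<^sub>C v)) z f" for z
  have te: "te X f = a (fst X) + b (snd (snd X)) + c (K0_part (fst (snd X)))" for X
    by (cases X) (simp only: tensor_act.simps a_def b_def c_def tmap_def fst_conv snd_conv)
  have a: "clinear a" unfolding a_def by (intro pm_sum2_linear_left clinear_single T2_linear)
  have b: "clinear b"
    unfolding b_def
    by (intro pm_sum2_linear_left clinear_single clinear_plus clinear_sum_map clinear_fun clinear_times clinear_coord)
  have c: "clinear c" unfolding c_def by (intro pm_sum2_linear_left clinear_single clinear_fun clinear_times clinear_ident)
  have components: "clinear (fst :: ('g, 'n) toroidal \<Rightarrow> _)" "clinear (\<lambda>X :: ('g, 'n) toroidal. fst (snd X))"
    "clinear (\<lambda>X :: ('g, 'n) toroidal. snd (snd X))"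
    by (rule clinearI; simp add: scaleC_prod_def)+
  show "clinear (\<lambda>X. te X f)"
    unfolding te
    by (rule clinear_plus[OF clinear_plus[OF clinear_comp[OF a components(1)] clinear_comp[OF b components(3)]]
          clinear_comp[OF c clinear_comp[OF K0_part_linear components(2)]]])
qed

abbreviation sc where "sc \<equiv> scal \<alpha> d"

lemma te_loop: "te (loop_elt X (emb l)) (single k v) = single (k + l) (T2 X v)"
  by (rule tensor_act_loop_single[OF ext_linear(1)]) (use clinear_0[OF ext_linear(2)] in \<open>simp add: fun_eq_iff\<close>)

lemmas te_K = tensor_act_K_mono[of act1 ext \<alpha> d C0]
lemmas te_D = tensor_act_D_mono[OF act1_linear, of ext \<alpha> d C0]

lemma T1_T1: "T1 Y (T1 Z v) - T1 Z (T1 Y v) = T1 (gl_bracket Y Z) v"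
proof (rule tensor_linear_eqI[of "\<lambda>v. T1 Y (T1 Z v) - T1 Z (T1 Y v)" "T1 (gl_bracket Y Z)"])
  show "clinear (\<lambda>v. T1 Y (T1 Z v) - T1 Z (T1 Y v))"
    by (rule clinear_minus[OF clinear_comp[OF T1_linear(1) T1_linear(1)] clinear_comp[OF T1_linear(1) T1_linear(1)]])
  show "clinear (T1 (gl_bracket Y Z))" by (rule T1_linear(1))
  show "T1 Y (T1 Z (x \<otimes>\<^sub>t y)) - T1 Z (T1 Y (x \<otimes>\<^sub>t y)) = T1 (gl_bracket Y Z) (x \<otimes>\<^sub>t y)" for x y
    unfolding tmap_tensor[OF act1_linear(1) clinear_ident] act1_bracket clinear_diff[OF tensor_clinear(1)] ..
qed

lemma T2_T2:
  assumes "X \<in> g_sigma0 A" "Y \<in> g_sigma0 A"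
  shows "T2 X (T2 Y v) - T2 Y (T2 X v) = T2 (br X Y) v"
proof (rule tensor_linear_eqI[of "\<lambda>v. T2 X (T2 Y v) - T2 Y (T2 X v)" "T2 (br X Y)"])
  show "clinear (\<lambda>v. T2 X (T2 Y v) - T2 Y (T2 X v))"
    by (rule clinear_minus[OF clinear_comp[OF T2_linear(1) T2_linear(1)] clinear_comp[OF T2_linear(1) T2_linear(1)]])
  show "clinear (T2 (br X Y))" by (rule T2_linear(1))
  show "T2 X (T2 Y (x \<otimes>\<^sub>t y)) - T2 Y (T2 X (x \<otimes>\<^sub>t y)) = T2 (br X Y) (x \<otimes>\<^sub>t y)" for x y
    unfolding tmap_tensor[OF clinear_ident ext_linear(1)]
    unfolding ext_eq[OF assms(1)] ext_eq[OF assms(2)] ext_eq[OF g_sigma0_br[OF assms]]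
      act2_bracket[OF assms] clinear_diff[OF tensor_clinear(2)] ..
qed

lemma T1_T2: "T1 Y (T2 X v) = T2 X (T1 Y v)"
  by (rule tensor_linear_eqI[of _ _ v])
    (simp_all add: clinear_comp T1_linear T2_linear tmap_tensor ext_linear act1_linear clinear_ident)

lemma emb_add: "emb r + emb s = (emb (r + s) :: int ^ 'n option)"
  by (simp add: vec_eq_iff emb_def split: option.split)

text \<open>On elements of \<open>d\<^sub>0\<close>-degree zero, the central terms of the brackets of two loop elements and of two
  derivations are multiples of \<open>t\<^sup>r \<Sum>\<^sub>p k\<^sub>p K\<^sub>p\<close> with \<open>k\<^sub>0 = 0\<close>. Only \<open>K\<^sub>0\<close> acts non-trivially, so these
  terms act by zero, for every choice of the cocycle. The matrices \<open>Bmat\<close> of two derivations obey the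
  commutator rule of \<open>\<gg>\<ll>\<^sub>n\<close>.\<close>

lemma te_bracket_monos:
  assumes X: "X \<in> monos_deg 0" and Y: "Y \<in> monos_deg 0"
  shows "te (bracket A X Y) (single k v) = te X (te Y (single k v)) - te Y (te X (single k v))"
proof -
  note lin = clinear_add[OF te_linear(2)] clinear_diff[OF te_linear(2)] clinear_scale[OF te_linear(2)] clinear_neg[OF te_linear(2)]
    clinear_0[OF te_linear(2)] clinear_scale[OF T1_linear(1)] clinear_scale[OF T2_linear(1)] clinear_add[OF T1_linear(1)] clinear_add[OF T2_linear(1)]
    scaleC_single[symmetric]
  show ?thesis
    using X
  proof (cases rule: monos0_cases)
    case x: (1 X' l)
    show ?thesis using Y
    proof (cases rule: monos0_cases)
      case y: (1 Y' m)
      have sig: "X' \<in> g_sigma0 A" "Y' \<in> g_sigma0 A" using x(2) y(2) eig_g_sigma0 by auto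
      show ?thesis
        by (simp add: x(1) y(1) bracket_LL clinear_add[OF te_linear(2)] emb_add te_loop te_K scaleC_vec_def scaleC_complex_def
            T2_T2[OF sig, symmetric] single_diff add_ac)
    next
      case y: (2 r c)
      show ?thesis
        by (simp add: x(1) y(1) bracket_LK clinear_0[OF te_linear(2)] te_loop te_K clinear_scale[OF T2_linear(1)] add_ac)
    next
      case y: (3 r c)
      have "te (bracket A X Y) (single k v) = - cdot c (cvec (emb l)) *\<^sub>C single (k + l + r) (T2 X' v)"
        by (simp only: x(1) y(1) bracket_DL clinear_scale[OF te_linear(2)] emb_add te_loop add.assoc)
      moreover have "te X (te Y (single k v)) = single (k + l + r) (sc c k *\<^sub>C T2 X' v + T2 X' (T1 (Bmat r c) v))"
        by (simp add: x(1) y(1) te_loop te_D clinear_add[OF T2_linear(1)] clinear_scale[OF T2_linear(1)] add_ac)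
      moreover have "te Y (te X (single k v)) = single (k + l + r) ((sc c k + cdot c (cvec (emb l))) *\<^sub>C T2 X' v + T2 X' (T1 (Bmat r c) v))"
        by (simp add: x(1) y(1) te_loop te_D scal_add T1_T2)
      ultimately show ?thesis by (simp add: scaleC_single scaleC_left_distrib flip: single_diff)
    qed
  next
    case x: (2 r c)
    show ?thesis using Y
    proof (cases rule: monos0_cases)
      case y: (1 Y' m)
      show ?thesis
        by (simp add: x(1) y(1) bracket_LK clinear_0[OF te_linear(2)] te_loop te_K clinear_scale[OF T2_linear(1)] add_ac)
    next
      case y: (2 s e)
      show ?thesis
        by (simp add: x(1) y(1) bracket_LK clinear_0[OF te_linear(2)] te_K scaleC_scaleC mult_ac add_ac)
    next
      case y: (3 s e)
      have "te (bracket A X Y) (single k v) = - single (k + r + s) ((cdot e (cvec (emb r)) * (C0 * c $ None)) *\<^sub>C v)"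
        by (simp add: x(1) y(1) bracket_DK clinear_neg[OF te_linear(2)] emb_add te_K scaleC_vec_def scaleC_complex_def cdot_def mult_ac add_ac)
      moreover have "te X (te Y (single k v)) = single (k + r + s) ((C0 * c $ None) *\<^sub>C (sc e k *\<^sub>C v + T1 (Bmat s e) v))"
        by (simp add: x(1) y(1) te_K te_D add_ac)
      moreover have "te Y (te X (single k v)) = single (k + r + s) ((sc e k + cdot e (cvec (emb r))) *\<^sub>C (C0 * c $ None) *\<^sub>C v + (C0 * c $ None) *\<^sub>C T1 (Bmat s e) v)"
        by (simp add: x(1) y(1) te_K te_D scal_add clinear_scale[OF T1_linear(1)])
      ultimately show ?thesis
        by (simp add: scaleC_scaleC scaleC_right_distrib scaleC_left_distrib mult_ac distrib_left flip: single_diff single_uminus)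
    qed
  next
    case x: (3 r c)
    show ?thesis using Y
    proof (cases rule: monos0_cases)
      case y: (1 Y' l)
      have "te (bracket A X Y) (single k v) = cdot c (cvec (emb l)) *\<^sub>C single (k + l + r) (T2 Y' v)"
        by (simp only: x(1) y(1) bracket_DL clinear_scale[OF te_linear(2)] emb_add te_loop add.assoc)
      moreover have "te Y (te X (single k v)) = single (k + l + r) (sc c k *\<^sub>C T2 Y' v + T2 Y' (T1 (Bmat r c) v))"
        by (simp add: x(1) y(1) te_loop te_D clinear_add[OF T2_linear(1)] clinear_scale[OF T2_linear(1)] add_ac)
      moreover have "te X (te Y (single k v)) = single (k + l + r) ((sc c k + cdot c (cvec (emb l))) *\<^sub>C T2 Y' v + T2 Y' (T1 (Bmat r c) v))"
        by (simp add: x(1) y(1) te_loop te_D scal_add T1_T2)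
      ultimately show ?thesis by (simp add: scaleC_single scaleC_left_distrib flip: single_diff)
    next
      case y: (2 s e)
      have "te (bracket A X Y) (single k v) = single (k + r + s) ((cdot c (cvec (emb s)) * (C0 * e $ None)) *\<^sub>C v)"
        by (simp add: x(1) y(1) bracket_DK emb_add te_K scaleC_vec_def scaleC_complex_def cdot_def mult_ac add_ac)
      moreover have "te Y (te X (single k v)) = single (k + r + s) ((C0 * e $ None) *\<^sub>C (sc c k *\<^sub>C v + T1 (Bmat r c) v))"
        by (simp add: x(1) y(1) te_K te_D add_ac)
      moreover have "te X (te Y (single k v)) = single (k + r + s) ((sc c k + cdot c (cvec (emb s))) *\<^sub>C (C0 * e $ None) *\<^sub>C v + (C0 * e $ None) *\<^sub>C T1 (Bmat r c) v)"
        by (simp add: x(1) y(1) te_K te_D scal_add clinear_scale[OF T1_linear(1)] add_ac)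
      ultimately show ?thesis
        by (simp add: scaleC_scaleC scaleC_right_distrib scaleC_left_distrib mult_ac distrib_left flip: single_diff)
    next
      case y: (3 s e)
      define p q a b where "p = cdot c (cvec (emb s))" "q = cdot e (cvec (emb r))" "a = sc c k" "b = sc e k"
      let ?R = "T1 (Bmat r c)" and ?S = "T1 (Bmat s e)"
      have com: "te (bracket A X Y) (single k v) = single (k + r + s)
          ((p * b - q * a) *\<^sub>C v + (p *\<^sub>C (T1 (Bmat r e) v + ?S v) - q *\<^sub>C (?R v + T1 (Bmat s c) v)))"
      proof -
        have K: "te (K_mono (emb (r + s)) (\<kappa> *\<^sub>C cvec (emb r))) (single k v) = 0" for \<kappa>
          by (simp add: te_K scaleC_vec_def scaleC_complex_def)
        have "T1 (Bmat (r + s) (p *\<^sub>C e - q *\<^sub>C c)) v = p *\<^sub>C (T1 (Bmat r e) v + ?S v) - q *\<^sub>C (?R v + T1 (Bmat s c) v)"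
          by (simp only: Bmat_add clinear_add[OF T1_linear(2)] clinear_diff[OF T1_linear(2)] clinear_scale[OF T1_linear(2)] scaleC_right_distrib)
        then have "te (D_mono (emb (r + s)) (p *\<^sub>C e - q *\<^sub>C c)) (single k v) = single (k + r + s)
            ((p * b - q * a) *\<^sub>C v + (p *\<^sub>C (T1 (Bmat r e) v + ?S v) - q *\<^sub>C (?R v + T1 (Bmat s c) v)))"
          by (simp only: te_D scal_add p_q_a_b_def(3,4) add.assoc)
        then show ?thesis
          by (simp only: x(1) y(1) bracket_DD clinear_add[OF te_linear(2)] emb_add K p_q_a_b_def(1,2) add_0_right)
      qed
      have XY: "te X (te Y (single k v)) = single (k + r + s) ((a + p) *\<^sub>C (b *\<^sub>C v + ?S v) + (b *\<^sub>C ?R v + ?R (?S v)))"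
        by (simp add: x(1) y(1) te_D scal_add clinear_add[OF T1_linear(1)] clinear_scale[OF T1_linear(1)] add_ac p_q_a_b_def)
      have YX: "te Y (te X (single k v)) = single (k + r + s) ((b + q) *\<^sub>C (a *\<^sub>C v + ?R v) + (a *\<^sub>C ?S v + ?S (?R v)))"
        by (simp add: x(1) y(1) te_D scal_add clinear_add[OF T1_linear(1)] clinear_scale[OF T1_linear(1)] add_ac p_q_a_b_def)
      have RS: "?R (?S v) = ?S (?R v) + (p *\<^sub>C T1 (Bmat r e) v - q *\<^sub>C T1 (Bmat s c) v)"
        using T1_T1[of "Bmat r c" "Bmat s e" v]
        by (simp add: Bmat_bracket clinear_diff[OF T1_linear(2)] clinear_scale[OF T1_linear(2)] p_q_a_b_def algebra_simps)
      have "(p * b - q * a) *\<^sub>C v + (p *\<^sub>C (T1 (Bmat r e) v + ?S v) - q *\<^sub>C (?R v + T1 (Bmat s c) v)) =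
          ((a + p) *\<^sub>C (b *\<^sub>C v + ?S v) + (b *\<^sub>C ?R v + ?R (?S v))) - ((b + q) *\<^sub>C (a *\<^sub>C v + ?R v) + (a *\<^sub>C ?S v + ?S (?R v)))"
        by (simp add: RS scaleC_scaleC scaleC_right_distrib scaleC_left_distrib cv.scale_left_diff_distrib algebra_simps)
      then show ?thesis by (simp only: com XY YX single_diff)
    qed
  qed
qed

lemma te_bracket:
  assumes X: "X \<in> tau_zero A" and Y: "Y \<in> tau_zero A"
  shows "te (bracket A X Y) f = te X (te Y f) - te Y (te X f)"
proof (rule clinear_eq_on_span[of "\<lambda>X. te (bracket A X Y) f" "\<lambda>X. te X (te Y f) - te Y (te X f)"])
  show "clinear (\<lambda>X. te (bracket A X Y) f)" by (rule clinear_comp[OF te_linear(2) bracket_linear(2)])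
  show "clinear (\<lambda>X. te X (te Y f) - te Y (te X f))"
    by (rule clinear_minus[OF te_linear(2) clinear_comp[OF te_linear(1) te_linear(2)]])
  show "X \<in> cv.span (monos_deg 0)" using X by (simp add: tau_zero_span)
  fix X assume X: "X \<in> monos_deg 0"
  show "te (bracket A X Y) f = te X (te Y f) - te Y (te X f)"
  proof (rule clinear_eq_on_span[of "\<lambda>Y. te (bracket A X Y) f" "\<lambda>Y. te X (te Y f) - te Y (te X f)"])
    show "clinear (\<lambda>Y. te (bracket A X Y) f)" by (rule clinear_comp[OF te_linear(2) bracket_linear(1)])
    show "clinear (\<lambda>Y. te X (te Y f) - te Y (te X f))"
      by (rule clinear_minus[OF clinear_comp[OF te_linear(1) te_linear(2)] te_linear(2)])
    show "Y \<in> cv.span (monos_deg 0)" using Y by (simp add: tau_zero_span)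
    fix Y assume Y: "Y \<in> monos_deg 0"
    show "te (bracket A X Y) f = te X (te Y f) - te Y (te X f)"
    proof (rule clinear_eq_on_span[of "te (bracket A X Y)" "\<lambda>f. te X (te Y f) - te Y (te X f)", OF te_linear(1) _ _ poly_mapping_span])
      show "clinear (\<lambda>f. te X (te Y f) - te Y (te X f))"
        by (rule clinear_minus[OF clinear_comp[OF te_linear(1) te_linear(1)] clinear_comp[OF te_linear(1) te_linear(1)]])
      show "te (bracket A X Y) s = te X (te Y s) - te Y (te X s)" if s: "s \<in> {single k v |k v. True}" for s
      proof -
        from s obtain k v where "s = single k v" by blast
        then show ?thesis using te_bracket_monos[OF X Y] by simp
      qed
    qed
  qed
qed

lemma ta_linear: "X \<in> tau_zero A \<Longrightarrow> clinear (ta X)"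
  using te_linear(1)[of X] ta_te[of X] by (simp add: clinear_iff)

lemma ta_module: "lie_module_on (bracket A) (tau_zero A) ta UNIV"
  unfolding lie_module_on_def
proof (intro conjI ballI)
  show "clinear_on UNIV (ta X)" if "X \<in> tau_zero A" for X
    unfolding clinear_on_UNIV by (rule ta_linear[OF that])
  show "clinear_on (tau_zero A) (\<lambda>X. ta X f)" for f
    unfolding clinear_on_def
    by (auto simp: ta_te cv.subspace_add[OF tau_zero_subspace] cv.subspace_scale[OF tau_zero_subspace]
        clinear_add[OF te_linear(2)] clinear_scale[OF te_linear(2)])
  show "ta (bracket A X Y) f = ta X (ta Y f) - ta Y (ta X f)" if "X \<in> tau_zero A" "Y \<in> tau_zero A" for X Y f
    using te_bracket[OF that] that by (simp add: ta_te tau_zero_bracket)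
qed simp_all

lemma ta_loop:
  assumes "X \<in> g_sigma0 A"
  shows "ta (loop_elt X (emb l)) (single k v) = single (k + l) (tmap (\<lambda>v. v) (act2 X) v)"
proof (rule tensor_act_loop_single[of act2 X, OF act2_linear[OF assms]])
  assume "X = 0"
  moreover have "act2 X = ext X" by (rule ext_eq[OF assms, symmetric])
  ultimately show "act2 X = (\<lambda>v. 0)" using clinear_0[OF ext_linear(2)] by (simp add: fun_eq_iff)
qed

end

lemma tensor_space_subspace: "cv.subspace (tensor_space A gr)"
  unfolding tensor_space_def Collect_all_eq
proof (rule cv.subspace_Inter, safe)
  show "cv.subspace {f. lookup f k \<in> cv.span {v1 \<otimes>\<^sub>t v2 |v1 v2. v2 \<in> gr (lam A k)}}" for k
    by (rule subspace_Collect_linear) (auto intro!: clinearI simp: lookup_add lookup_scaleC)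
qed

lemma tensor_space_span: "tensor_space A gr = cv.span {single k (v1 \<otimes>\<^sub>t v2) |k v1 v2. v2 \<in> gr (lam A k)}"
proof
  show "tensor_space A gr \<subseteq> cv.span {single k (v1 \<otimes>\<^sub>t v2) |k v1 v2. v2 \<in> gr (lam A k)}"
  proof
    fix f assume f: "f \<in> tensor_space A gr"
    have "single k (lookup f k) \<in> cv.span {single k (v1 \<otimes>\<^sub>t v2) |k v1 v2. v2 \<in> gr (lam A k)}" for k
    proof (rule span_map_into[OF clinear_single[OF clinear_ident] cv.subspace_span])
      show "lookup f k \<in> cv.span {v1 \<otimes>\<^sub>t v2 |v1 v2. v2 \<in> gr (lam A k)}" using f by (simp add: tensor_space_def)
      show "single k s \<in> cv.span {single k (v1 \<otimes>\<^sub>t v2) |k v1 v2. v2 \<in> gr (lam A k)}"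
        if "s \<in> {v1 \<otimes>\<^sub>t v2 |v1 v2. v2 \<in> gr (lam A k)}" for s using that by (intro cv.span_base) blast
    qed
    then have "(\<Sum>k\<in>keys f. single k (lookup f k)) \<in> cv.span {single k (v1 \<otimes>\<^sub>t v2) |k v1 v2. v2 \<in> gr (lam A k)}"
      by (intro cv.span_sum)
    then show "f \<in> cv.span {single k (v1 \<otimes>\<^sub>t v2) |k v1 v2. v2 \<in> gr (lam A k)}" by (simp add: pm_sum_singles)
  qed
  have "single k (v1 \<otimes>\<^sub>t v2) \<in> tensor_space A gr" if "v2 \<in> gr (lam A k)" for k v1 v2
    unfolding tensor_space_def using that by (auto simp: lookup_single when_def cv.span_zero intro!: cv.span_base)
  then show "cv.span {single k (v1 \<otimes>\<^sub>t v2) |k v1 v2. v2 \<in> gr (lam A k)} \<subseteq> tensor_space A gr"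
    by (intro cv.span_minimal tensor_space_subspace) blast
qed

lemma lam_shift: "emb r \<in> Gam A \<Longrightarrow> lam A (k + r) = lam A k"
proof -
  assume r: "emb r \<in> Gam A"
  have dr: "int (ord A (Some i)) dvd r $ i" for i using r by (auto simp: Gam_def dest: spec[of _ "Some i"])
  have "int (ord A (Some i)) dvd l $ i - (k + r) $ i \<longleftrightarrow> int (ord A (Some i)) dvd l $ i - k $ i" for l i
    using dvd_add_left_iff[of "int (ord A (Some i))" "- r $ i" "l $ i - k $ i"] dr[of i] by (simp add: algebra_simps)
  then show ?thesis by (simp add: lam_def)
qed

context tensor_module
begin

lemma ta_tensor_space:
  assumes gr: "graded_module A (g_sigma0 A) act2 gr" and X: "X \<in> tau_zero A" and f: "f \<in> tensor_space A gr"
  shows "ta X f \<in> tensor_space A gr"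
proof -
  note sub = tensor_space_subspace[of A gr]
  have grk: "cv.subspace (gr (lam A k))" for k using gr by (auto simp: graded_module_def direct_sum_on_def)
  have base: "single k (v1 \<otimes>\<^sub>t v2) \<in> tensor_space A gr" if "v2 \<in> gr (lam A k)" for k v1 v2
    unfolding tensor_space_span using that by (intro cv.span_base) blast
  have "te X f \<in> tensor_space A gr"
  proof (rule span_map_into[of "\<lambda>X. te X f", OF te_linear(2) sub])
    show "X \<in> cv.span (monos_deg 0)" using X by (simp add: tau_zero_span)
    fix Y assume Y: "Y \<in> monos_deg 0"
    show "te Y f \<in> tensor_space A gr"
    proof (rule span_map_into[OF te_linear(1) sub])
      show "f \<in> cv.span {single k (v1 \<otimes>\<^sub>t v2) |k v1 v2. v2 \<in> gr (lam A k)}" using f by (simp add: tensor_space_span)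
      fix s assume "s \<in> {single k ((v1 :: 'w1) \<otimes>\<^sub>t v2) |k v1 v2. v2 \<in> gr (lam A k)}"
      then obtain k v1 v2 where s: "s = single k (v1 \<otimes>\<^sub>t v2)" "v2 \<in> gr (lam A k)" by blast
      from Y show "te Y s \<in> tensor_space A gr"
      proof (cases rule: monos0_cases)
        case (1 X' l)
        have sig: "X' \<in> g_sigma0 A" using 1(2) eig_g_sigma0 by simp
        have "act2 X' v2 \<in> gr (lam A (l + k))"
          using gr 1(2) s(2) by (auto simp: graded_module_def eig_emb_homog)
        then have "act2 X' v2 \<in> gr (lam A (k + l))" by (simp only: add.commute)
        then show ?thesis
          by (simp add: 1(1) s(1) te_loop tmap_tensor clinear_ident ext_linear ext_eq[OF sig] act2_linear[OF sig] base)
      next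
        case (2 r c)
        then show ?thesis
          using s(2) by (auto simp: s(1) te_K lam_shift scaleC_single[symmetric] intro!: cv.subspace_scale[OF sub] base)
      next
        case (3 r c)
        then show ?thesis
          using s(2) by (auto simp: s(1) te_D lam_shift tmap_tensor act1_linear clinear_ident single_add scaleC_single[symmetric]
              intro!: cv.subspace_add[OF sub] cv.subspace_scale[OF sub] base)
      qed
    qed
  qed
  then show ?thesis by (simp add: ta_te[OF X])
qed

lemma ta_tensor_space_module:
  assumes "graded_module A (g_sigma0 A) act2 gr"
  shows "lie_module_on (bracket A) (tau_zero A) ta (tensor_space A gr)"
  by (rule lie_module_on_subspace[OF ta_module tensor_space_subspace ta_tensor_space[OF assms]])

end

section \<open>Modules generated by highest weight spaces\<close>

text \<open>The span of this set is the submodule over the subalgebra generated by \<open>Lm\<close>. Arguing with products of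
  operators applied to vectors of \<open>N\<close> replaces the enveloping algebra and its triangular decomposition.\<close>

inductive_set lowered :: "'l set \<Rightarrow> ('l \<Rightarrow> 'v \<Rightarrow> 'v) \<Rightarrow> 'v set \<Rightarrow> 'v set" for Lm act N where
  base: "v \<in> N \<Longrightarrow> v \<in> lowered Lm act N"
| step: "y \<in> Lm \<Longrightarrow> v \<in> lowered Lm act N \<Longrightarrow> act y v \<in> lowered Lm act N"

lemma act_span_into:
  assumes lin: "clinear_on L (\<lambda>x. act x v)" and L: "cv.subspace L" "S \<subseteq> L" and U: "cv.subspace U"
    and S: "\<And>s. s \<in> S \<Longrightarrow> act s v \<in> U" and x: "x \<in> cv.span S"
  shows "act x v \<in> U"
proof -
  have "x \<in> L \<and> act x v \<in> U"
    using x
  proof (induction rule: cv.span_induct_alt)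
    case base
    show ?case using clinear_zero[OF lin] cv.subspace_0[OF L(1)] cv.subspace_0[OF U] by simp
  next
    case (step c s y)
    have s: "s \<in> L" using step.hyps L(2) by blast
    have "c *\<^sub>C s \<in> L" by (rule cv.subspace_scale[OF L(1) s])
    then have "act (c *\<^sub>C s + y) v = c *\<^sub>C act s v + act y v"
      using lin s step.IH unfolding clinear_on_def by simp
    then show ?case
      using cv.subspace_add[OF L(1) \<open>c *\<^sub>C s \<in> L\<close>] step.IH cv.subspace_add[OF U cv.subspace_scale[OF U S[OF step.hyps]]] by auto
  qed
  then show ?thesis by simp
qed

lemma span_lowered_subset:
  assumes "\<And>y. y \<in> Lm \<Longrightarrow> clinear (act y)" "cv.subspace U" "N \<subseteq> U" "\<And>y v. y \<in> Lm \<Longrightarrow> v \<in> U \<Longrightarrow> act y v \<in> U"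
  shows "cv.span (lowered Lm act N) \<subseteq> U"
proof (rule cv.span_minimal[OF _ assms(2)], rule subsetI)
  fix v assume "v \<in> lowered Lm act N"
  then show "v \<in> U" by induction (use assms(3,4) in auto)
qed

lemma span_lowered_stable:
  assumes "\<And>y. y \<in> Lm \<Longrightarrow> clinear (act y)" "y \<in> Lm" "v \<in> cv.span (lowered Lm act N)"
  shows "act y v \<in> cv.span (lowered Lm act N)"
  by (rule span_map_into[OF assms(1)[OF assms(2)] cv.subspace_span _ assms(3)])
    (intro cv.span_base lowered.step assms(2))

text \<open>As \<open>L\<close> is spanned by its lowering part, its weight zero part and its raising part, a subspace that is
  stable under weight zero and killed by raising operators generates an \<open>L\<close>-module by lowering
  operators alone: the other operators are moved to the right past them.\<close>

lemma lowered_submodule: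
  assumes mod: "lie_module_on br L act UNIV" and L: "cv.subspace L" "\<And>x y. x \<in> L \<Longrightarrow> y \<in> L \<Longrightarrow> br x y \<in> L"
    and tri: "L \<subseteq> cv.span (Lm \<union> L0 \<union> Lp)" "Lm \<subseteq> L" "L0 \<subseteq> L" "Lp \<subseteq> L"
    and N: "\<And>x v. x \<in> L0 \<Longrightarrow> v \<in> N \<Longrightarrow> act x v \<in> N" "\<And>x v. x \<in> Lp \<Longrightarrow> v \<in> N \<Longrightarrow> act x v = 0"
    and x: "x \<in> L" and v: "v \<in> cv.span (lowered Lm act N)"
  shows "act x v \<in> cv.span (lowered Lm act N)"
proof -
  let ?G = "cv.span (lowered Lm act N)"
  have lin: "clinear (act x)" if "x \<in> L" for x using mod that unfolding lie_module_on_def clinear_on_UNIV by blast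
  have lin_left: "clinear_on L (\<lambda>x. act x v)" for v using mod unfolding lie_module_on_def by blast
  have bracket: "act (br x y) v = act x (act y v) - act y (act x v)" if "x \<in> L" "y \<in> L" for x y v
    using mod that unfolding lie_module_on_def by blast
  have "\<forall>x\<in>L. act x v \<in> ?G" if "v \<in> lowered Lm act N" for v
    using that
  proof induction
    case (base v)
    show ?case
    proof
      fix x assume "x \<in> L"
      then have "x \<in> cv.span (Lm \<union> L0 \<union> Lp)" using tri(1) by blast
      then show "act x v \<in> ?G"
      proof (rule act_span_into[where L = L and act = act and v = v, OF lin_left L(1) _ cv.subspace_span, rotated 2])
        show "Lm \<union> L0 \<union> Lp \<subseteq> L" using tri(2-4) by blast
        fix s assume "s \<in> Lm \<union> L0 \<union> Lp"
        then consider "s \<in> Lm" | "s \<in> L0" | "s \<in> Lp" by blast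
        then show "act s v \<in> ?G"
        proof cases
          case 1
          then show ?thesis using base by (intro cv.span_base lowered.step lowered.base)
        next
          case 2
          then show ?thesis using base N(1) by (intro cv.span_base lowered.base)
        next
          case 3
          then show ?thesis using base N(2) by (simp add: cv.span_zero)
        qed
      qed
    qed
  next
    case (step y v)
    show ?case
    proof
      fix x assume x: "x \<in> L"
      have y: "y \<in> L" using step.hyps tri(2) by blast
      have "act y (act x v) \<in> ?G"
        by (rule span_lowered_stable[OF _ step.hyps(1)]) (use lin tri(2) step.IH x in auto)
      moreover have "act (br x y) v \<in> ?G" using step.IH L(2)[OF x y] by blast
      moreover have "act x (act y v) = act (br x y) v + act y (act x v)" using bracket[OF x y] by simp
      ultimately show "act x (act y v) \<in> ?G" by (simp add: cv.span_add)
    qed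
  qed
  then show ?thesis by (intro span_map_into[OF lin[OF x] cv.subspace_span _ v]) (use x in blast)
qed

text \<open>Each lowering operator decreases the eigenvalue of \<open>e\<close> by a positive real number.\<close>

lemma lowered_eigenvectors:
  assumes mod: "lie_module_on br L act UNIV" and Lm: "Lm \<subseteq> L" and e: "e \<in> L"
    and N: "\<And>v. v \<in> N \<Longrightarrow> act e v = c *\<^sub>C v"
    and low: "\<And>y. y \<in> Lm \<Longrightarrow> \<exists>r::real. r > 0 \<and> br e y = - of_real r *\<^sub>C y"
    and v: "v \<in> lowered Lm act N"
  shows "v \<in> N \<or> (\<exists>r::real. r > 0 \<and> act e v = (c - of_real r) *\<^sub>C v)"
  using v
proof induction
  case (step y v)
  have lin: "clinear (act y)" and lin_left: "clinear_on L (\<lambda>x. act x v)"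
    and bracket: "act (br e y) v = act e (act y v) - act y (act e v)"
    using mod step.hyps(1) Lm e unfolding lie_module_on_def clinear_on_UNIV by blast+
  obtain r :: real where r: "r > 0" "br e y = - of_real r *\<^sub>C y" using low[OF step.hyps(1)] by blast
  obtain s :: real where s: "s \<ge> 0" "act e v = (c - of_real s) *\<^sub>C v"
  proof (cases "v \<in> N")
    case True
    then show ?thesis using that[of 0] N by simp
  next
    case False
    then show ?thesis using step.IH that by (meson less_imp_le)
  qed
  have "act (- of_real r *\<^sub>C y) v = - of_real r *\<^sub>C act y v"
    using lin_left step.hyps(1) Lm unfolding clinear_on_def by blast
  then have "act e (act y v) = - of_real r *\<^sub>C act y v + (c - of_real s) *\<^sub>C act y v"
    using bracket by (simp add: r(2) s(2) clinear_scale[OF lin] clinear_diff[OF lin] algebra_simps)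
  also have "\<dots> = (c - of_real (r + s)) *\<^sub>C act y v" by (simp add: scaleC_left_distrib cv.scale_left_diff_distrib algebra_simps)
  finally show ?case using r(1) s(1) by (intro disjI2 exI[of _ "r + s"]) simp
qed simp

text \<open>All vectors obtained from \<open>N\<close> by at least one lowering operator have eigenvalues of \<open>e\<close> strictly below \<open>c\<close>.
  So \<open>N\<close> is the full eigenspace of \<open>c\<close> in the module that it generates.\<close>

lemma lowered_top:
  assumes mod: "lie_module_on br L act UNIV" and Lm: "Lm \<subseteq> L" and e: "e \<in> L" and sub: "cv.subspace N"
    and N: "\<And>v. v \<in> N \<Longrightarrow> act e v = c *\<^sub>C v"
    and low: "\<And>y. y \<in> Lm \<Longrightarrow> \<exists>r::real. r > 0 \<and> br e y = - of_real r *\<^sub>C y"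
    and x: "x \<in> cv.span (lowered Lm act N)"
  shows "act e x = c *\<^sub>C x \<Longrightarrow> x \<in> N" and "x \<in> cv.span {v. \<exists>d\<in>{c - of_real r |r::real. r \<ge> 0}. act e v = d *\<^sub>C v}"
proof -
  let ?B = "{v. \<exists>d\<in>{c - of_real r |r::real. r > 0}. act e v = d *\<^sub>C v}"
  have lin: "clinear (act e)" using mod e unfolding lie_module_on_def clinear_on_UNIV by blast
  have sub_low: "lowered Lm act N \<subseteq> N \<union> ?B"
    using lowered_eigenvectors[OF mod Lm e N low] by blast
  then have span_low: "cv.span (lowered Lm act N) \<subseteq> cv.span (N \<union> ?B)" by (rule cv.span_mono)
  with x have "x \<in> cv.span (N \<union> ?B)" by blast
  then obtain n b where nb: "x = n + b" "n \<in> N" "b \<in> cv.span ?B"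
    unfolding cv.span_Un cv.span_eq_iff[THEN iffD2, OF sub] by blast
  show "x \<in> N" if "act e x = c *\<^sub>C x"
  proof -
    have "act e b = c *\<^sub>C b"
      using that N[OF nb(2)] by (simp add: nb(1) clinear_add[OF lin] scaleC_right_distrib)
    moreover have "c \<notin> {c - of_real r |r::real. r > 0}" by auto
    ultimately have "b = 0" using eigenvector_in_span_eigenvectors[OF lin nb(3)] by blast
    with nb show ?thesis by simp
  qed
  have incl: "N \<union> ?B \<subseteq> {v. \<exists>d\<in>{c - of_real r |r::real. r \<ge> 0}. act e v = d *\<^sub>C v}"
  proof
    fix v assume "v \<in> N \<union> ?B"
    then consider "v \<in> N" | r :: real where "r > 0" "act e v = (c - of_real r) *\<^sub>C v" by blast
    then show "v \<in> {v. \<exists>d\<in>{c - of_real r |r::real. r \<ge> 0}. act e v = d *\<^sub>C v}"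
    proof cases
      case 1
      then have "act e v = (c - of_real 0) *\<^sub>C v" using N by simp
      then show ?thesis by (intro CollectI bexI[of _ "c - of_real 0"]) auto
    next
      case 2
      then show ?thesis by (intro CollectI bexI[of _ "c - of_real r"]) auto
    qed
  qed
  show "x \<in> cv.span {v. \<exists>d\<in>{c - of_real r |r::real. r \<ge> 0}. act e v = d *\<^sub>C v}"
    using x span_low cv.span_mono[OF incl] by blast
qed

section \<open>The vectors killed by the positive part\<close>

locale irreducible_module = toroidal A lmin for A :: "('g::complex_vector, 'n::finite) toroidal_data" and lmin +
  fixes actV :: "('g, 'n) toroidal \<Rightarrow> 'v \<Rightarrow> 'v::complex_vector"
  assumes irreducible: "irreducible_lie_module_on (bracket A) (tau A) actV UNIV"
begin

abbreviation d0 where "d0 \<equiv> d_elt 0 None :: ('g, 'n) toroidal"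

definition S where "S = {v. \<forall>X\<in>tau_plus A. actV X v = 0}"

lemma V_module: "lie_module_on (bracket A) (tau A) actV UNIV"
  using irreducible by (simp add: irreducible_lie_module_on_def)

lemma actV_linear: "X \<in> tau A \<Longrightarrow> clinear (actV X)"
  and actV_linear_left: "clinear_on (tau A) (\<lambda>X. actV X v)"
  and actV_bracket: "X \<in> tau A \<Longrightarrow> Y \<in> tau A \<Longrightarrow> actV (bracket A X Y) v = actV X (actV Y v) - actV Y (actV X v)"
  using V_module unfolding lie_module_on_def clinear_on_UNIV by simp_all

lemma d0_tau: "d0 \<in> tau A" using d0_tau_zero tau_zero_tau by blast

lemma tau_deg_tau: "tau_deg A q \<subseteq> tau A" by (auto simp: tau_deg_def)

lemma tau_plus_tau: "tau_plus A \<subseteq> tau A"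
  unfolding tau_plus_def by (rule cv.span_minimal[OF _ tau_subspace]) (use tau_deg_tau in blast)

lemma S_iff: "v \<in> S \<longleftrightarrow> (\<forall>q>0. \<forall>X\<in>tau_deg A q. actV X v = 0)"
proof
  assume "v \<in> S"
  then show "\<forall>q>0. \<forall>X\<in>tau_deg A q. actV X v = 0"
    unfolding S_def tau_plus_def using cv.span_base[of _ "\<Union>q\<in>{0<..}. tau_deg A q"] by blast
next
  assume v: "\<forall>q>0. \<forall>X\<in>tau_deg A q. actV X v = 0"
  show "v \<in> S"
    unfolding S_def
  proof (intro CollectI ballI)
    fix X assume "X \<in> tau_plus A"
    then have "actV X v \<in> {0}"
      unfolding tau_plus_def
      by (rule act_span_into[where L = "tau A" and act = actV and v = v, OF actV_linear_left tau_subspace _ cv.subspace_single_0, rotated 2])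
        (use v tau_deg_tau in auto)
    then show "actV X v = 0" by simp
  qed
qed

lemma S_subspace: "cv.subspace S"
proof -
  have "S = (\<Inter>X\<in>tau_plus A. {v. actV X v = 0})" by (auto simp: S_def)
  moreover have "cv.subspace {v. actV X v = 0}" if "X \<in> tau_plus A" for X
    using subspace_kernel[OF actV_linear] that tau_plus_tau by blast
  ultimately show ?thesis by (simp only:) (rule cv.subspace_Inter, blast)
qed

lemma S_stable: "X \<in> tau_zero A \<Longrightarrow> v \<in> S \<Longrightarrow> actV X v \<in> S"
  unfolding S_iff
proof (intro allI impI ballI)
  fix q Y assume X: "X \<in> tau_zero A" and v: "\<forall>q>0. \<forall>X\<in>tau_deg A q. actV X v = 0" and q: "q > (0::int)" and Y: "Y \<in> tau_deg A q"
  have XY: "X \<in> tau A" "Y \<in> tau A" using X Y tau_zero_tau tau_deg_tau by blast+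
  have "bracket A Y X \<in> tau_deg A q"
    using bracket_span_deg[of Y q X 0] X Y by (simp add: tau_deg_span tau_zero_span)
  then have "actV (bracket A Y X) v = 0" using v q by blast
  then have "actV Y (actV X v) = actV X (actV Y v)" using actV_bracket[OF XY(2,1)] by simp
  also have "actV Y v = 0" using v q Y by blast
  finally show "actV Y (actV X v) = 0" using clinear_0[OF actV_linear[OF XY(1)]] by simp
qed

text \<open>The \<open>\<tau>\<^sub>0\<close>-submodule generated by \<open>s\<close>.\<close>

definition U0 where "U0 s = cv.span (lowered (tau_zero A) actV {s})"

lemma U0_base: "s \<in> U0 s"
  unfolding U0_def by (intro cv.span_base lowered.base) simp

lemma tau_zero_linear: "X \<in> tau_zero A \<Longrightarrow> clinear (actV X)"
  using actV_linear tau_zero_tau by blast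

lemma U0_stable: "X \<in> tau_zero A \<Longrightarrow> v \<in> U0 s \<Longrightarrow> actV X v \<in> U0 s"
  unfolding U0_def by (rule span_lowered_stable[OF tau_zero_linear])

lemma U0_subset:
  assumes "cv.subspace U" "s \<in> U" "\<And>X v. X \<in> tau_zero A \<Longrightarrow> v \<in> U \<Longrightarrow> actV X v \<in> U"
  shows "U0 s \<subseteq> U"
  unfolding U0_def by (rule span_lowered_subset[OF tau_zero_linear assms(1)]) (use assms(2,3) in auto)

lemma U0_eigen:
  assumes "actV d0 s = c *\<^sub>C s" "v \<in> U0 s"
  shows "actV d0 v = c *\<^sub>C v"
proof -
  have "U0 s \<subseteq> {v. actV d0 v = c *\<^sub>C v}"
  proof (rule U0_subset[OF subspace_eigenspace[OF actV_linear[OF d0_tau]]])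
    show "s \<in> {v. actV d0 v = c *\<^sub>C v}" using assms(1) by simp
    fix X v assume X: "X \<in> tau_zero A" and v: "v \<in> {v. actV d0 v = c *\<^sub>C v}"
    have "X \<in> tau A" using X tau_zero_tau by blast
    have "bracket A d0 X = 0" using X by (simp add: tau_zero_def tau_deg_def)
    moreover have "actV 0 v = 0" using clinear_zero[OF actV_linear_left cv.subspace_0[OF tau_subspace]] .
    ultimately have "actV d0 (actV X v) = actV X (actV d0 v)"
      using actV_bracket[OF d0_tau \<open>X \<in> tau A\<close>, of v] by simp
    then show "actV X v \<in> {v. actV d0 v = c *\<^sub>C v}"
      using v clinear_scale[OF actV_linear[OF \<open>X \<in> tau A\<close>]] by simp
  qed
  with assms(2) show ?thesis by blast
qed

text \<open>By irreducibility \<open>V\<close> is generated from \<open>U(\<tau>\<^sub>0) s\<close> by operators that lower the eigenvalue of \<open>d\<^sub>0\<close>.\<close>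

lemma S_eigenvector_generates:
  assumes s: "s \<in> S" "s \<noteq> 0" "actV d0 s = c *\<^sub>C s"
  shows "actV d0 v = c *\<^sub>C v \<Longrightarrow> v \<in> U0 s"
    and "v \<in> cv.span {v. \<exists>d\<in>{c - of_real r |r::real. r \<ge> 0}. actV d0 v = d *\<^sub>C v}"
proof -
  let ?Lm = "\<Union>q\<in>{..<0}. tau_deg A q" and ?Lp = "\<Union>q\<in>{0<..}. tau_deg A q"
  let ?G = "cv.span (lowered ?Lm actV (U0 s))"
  have US: "U0 s \<subseteq> S" by (rule U0_subset[OF S_subspace s(1) S_stable])
  have tri: "tau A \<subseteq> cv.span (?Lm \<union> tau_zero A \<union> ?Lp)"
    unfolding tau_span
  proof (rule cv.span_mono, rule subsetI)
    fix X assume "X \<in> (\<Union>q. monos_deg q)"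
    then obtain q where "X \<in> tau_deg A q" unfolding tau_deg_span using cv.span_base by blast
    then show "X \<in> ?Lm \<union> tau_zero A \<union> ?Lp"
      by (cases "q = 0"; cases "q < 0") (auto simp: tau_zero_def)
  qed
  have Lm: "?Lm \<subseteq> tau A" and Lp: "?Lp \<subseteq> tau A" using tau_deg_tau by blast+
  have low: "\<exists>r::real. r > 0 \<and> bracket A d0 y = - of_real r *\<^sub>C y" if y: "y \<in> ?Lm" for y
  proof -
    obtain q where "q < 0" "bracket A d0 y = of_int q *\<^sub>C y" using y by (auto simp: tau_deg_def)
    then show ?thesis by (intro exI[of _ "- of_int q"]) simp
  qed
  have stable: "actV X v \<in> ?G" if "X \<in> tau A" "v \<in> ?G" for X v
  proof (rule lowered_submodule[OF V_module tau_subspace tau_bracket tri Lm tau_zero_tau Lp U0_stable _ that])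
    show "actV x v = 0" if "x \<in> ?Lp" "v \<in> U0 s" for x v using that US S_iff by blast
  qed
  have "?G = {0} \<or> ?G = UNIV"
    using irreducible stable unfolding irreducible_lie_module_on_def lie_submodule_def by (simp add: Ball_def)
  moreover have "s \<in> ?G" by (intro cv.span_base lowered.base U0_base)
  ultimately have G: "?G = UNIV" using s(2) by blast
  have sub: "cv.subspace (U0 s)" by (simp add: U0_def)
  have v: "v \<in> ?G" by (simp add: G)
  note top = lowered_top[OF V_module Lm d0_tau sub U0_eigen[OF s(3)] low v]
  show "actV d0 v = c *\<^sub>C v \<Longrightarrow> v \<in> U0 s" by (rule top(1))
  show "v \<in> cv.span {v. \<exists>d\<in>{c - of_real r |r::real. r \<ge> 0}. actV d0 v = d *\<^sub>C v}" by (rule top(2))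
qed

text \<open>If \<open>S\<close> had an eigenvector of \<open>d\<^sub>0\<close> of an eigenvalue \<open>c \<noteq> d\<close>, then \<open>c\<close> would lie below \<open>d\<close>, as the
  eigenvalues on \<open>V\<close> lie below \<open>d\<close>, and conversely \<open>d\<close> would lie below \<open>c\<close>.\<close>

lemma S_eigenvalue:
  assumes t: "t \<in> S" "t \<noteq> 0" "actV d0 t = d *\<^sub>C t" and s: "s \<in> S"
  shows "actV d0 s = d *\<^sub>C s"
proof -
  note lin = actV_linear[OF d0_tau]
  obtain F y where F: "finite F" "F \<subseteq> {d - of_real r |r::real. r \<ge> 0}" "\<And>c. c \<in> F \<Longrightarrow> actV d0 (y c) = c *\<^sub>C y c" "s = (\<Sum>c\<in>F. y c)"
    by (rule span_eigenvectors_decomposition[OF lin S_eigenvector_generates(2)[OF t]]) blast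
  have yS: "y c \<in> S" if "c \<in> F" for c
    by (rule eigencomponents_in_invariant_subspace[OF lin S_subspace S_stable[OF d0_tau_zero] F(1,3) _ that])
      (use s F(4) in auto)
  have "y c = 0" if c: "c \<in> F" "c \<noteq> d" for c
  proof (rule ccontr)
    assume nz: "y c \<noteq> 0"
    obtain r :: real where r: "c = d - of_real r" "r \<ge> 0" using F(2) c(1) by blast
    have "d \<notin> {c - of_real r' |r'::real. r' \<ge> 0}"
    proof
      assume "d \<in> {c - of_real r' |r'::real. r' \<ge> 0}"
      then obtain r' :: real where r': "d = c - of_real r'" "r' \<ge> 0" by blast
      have "d = d - of_real r - of_real r'" using r'(1) unfolding r(1) .
      then have "- r = r'" by simp
      then have "r = 0" using r(2) r'(2) by linarith
      with r(1) c(2) show False by simp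
    qed
    then have "t = 0"
      using eigenvector_in_span_eigenvectors[OF lin S_eigenvector_generates(2)[OF yS[OF c(1)] nz F(3)[OF c(1)]] t(3)] by blast
    with t(2) show False by simp
  qed
  then have "actV d0 (y c) = d *\<^sub>C y c" if "c \<in> F" for c using F(3)[OF that] that by (cases "c = d") (auto simp: clinear_0[OF lin])
  then show ?thesis by (simp add: F(4) clinear_sum[OF lin] cv.scale_sum_right)
qed

text \<open>All of \<open>S\<close> lies in a single eigenspace of \<open>d\<^sub>0\<close>, and the vectors of this eigenvalue lie in the
  \<open>\<tau>\<^sub>0\<close>-submodule generated by \<open>s\<close>. So \<open>S\<close> is irreducible as soon as it contains some eigenvector \<open>t\<close> of \<open>d\<^sub>0\<close>.\<close>

lemma S_irreducible:
  assumes t: "t \<in> S" "t \<noteq> 0" "actV d0 t = d *\<^sub>C t" and s: "s \<in> S" "s \<noteq> 0" "s \<in> U"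
    and U: "cv.subspace U" "\<And>X v. X \<in> tau_zero A \<Longrightarrow> v \<in> U \<Longrightarrow> actV X v \<in> U"
  shows "S \<subseteq> U"
proof
  fix v assume "v \<in> S"
  then have "v \<in> U0 s"
    by (rule S_eigenvector_generates(1)[OF s(1,2) S_eigenvalue[OF t s(1)] S_eigenvalue[OF t]])
  then show "v \<in> U" using U0_subset[OF U(1) s(3) U(2)] by blast
qed

end

section \<open>The graded irreducible quotient of the induced module\<close>

lemma lam_eq_iff: "lam A k = lam A k' \<longleftrightarrow> (\<forall>i. int (ord A (Some i)) dvd k $ i - k' $ i)"
proof
  assume "lam A k = lam A k'"
  moreover have "k \<in> lam A k" by (simp add: lam_def)
  ultimately show "\<forall>i. int (ord A (Some i)) dvd k $ i - k' $ i" by (auto simp: lam_def)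
next
  assume dv: "\<forall>i. int (ord A (Some i)) dvd k $ i - k' $ i"
  have "int (ord A (Some i)) dvd l $ i - k $ i \<longleftrightarrow> int (ord A (Some i)) dvd l $ i - k' $ i" for l i
    using dvd_add_left_iff[of "int (ord A (Some i))" "k $ i - k' $ i" "l $ i - k $ i"] dv by (simp add: algebra_simps)
  then show "lam A k = lam A k'" by (simp add: lam_def)
qed

lemma lam_add_cancel: "lam A (K + k) = lam A (K + k') \<longleftrightarrow> lam A k = lam A k'"
  by (simp add: lam_eq_iff)

text \<open>A homogeneous operator of degree \<open>K\<close> permutes the homogeneous components.\<close>

lemma component_shift:
  fixes f :: "'m::complex_vector \<Rightarrow> 'm"
  assumes f: "clinear f" "\<And>l v. v \<in> gr (lam A l) \<Longrightarrow> f v \<in> gr (lam A (K + l))"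
    and cmp: "\<And>i. clinear (cmp i)" "\<And>i x. i \<in> range (lam A) \<Longrightarrow> cmp i x \<in> gr i"
      "\<And>i j x. i \<in> range (lam A) \<Longrightarrow> x \<in> gr i \<Longrightarrow> cmp j x = (if j = i then x else 0)"
      "\<And>x. finite {i. cmp i x \<noteq> 0}" "\<And>x. {i. cmp i x \<noteq> 0} \<subseteq> range (lam A)" "\<And>x. (\<Sum>i | cmp i x \<noteq> 0. cmp i x) = x"
  shows "cmp (lam A (K + l)) (f x) = f (cmp (lam A l) x)"
proof -
  let ?I = "{i. cmp i x \<noteq> 0}"
  have "cmp (lam A (K + l)) (f x) = cmp (lam A (K + l)) (f (\<Sum>i\<in>?I. cmp i x))" by (simp only: cmp(6))
  also have "\<dots> = (\<Sum>i\<in>?I. cmp (lam A (K + l)) (f (cmp i x)))"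
    by (simp only: clinear_sum[OF f(1)] clinear_sum[OF cmp(1)])
  also have "\<dots> = (\<Sum>i\<in>?I. if i = lam A l then f (cmp i x) else 0)"
  proof (rule sum.cong[OF refl])
    fix i assume "i \<in> ?I"
    then obtain k where i: "i = lam A k" using cmp(5) by blast
    have "f (cmp i x) \<in> gr (lam A (K + k))" unfolding i by (intro f(2) cmp(2)) simp
    then show "cmp (lam A (K + l)) (f (cmp i x)) = (if i = lam A l then f (cmp i x) else 0)"
      using cmp(3)[of "lam A (K + k)" "f (cmp i x)" "lam A (K + l)"] lam_add_cancel[of A K l k] by (auto simp: i)
  qed
  also have "\<dots> = f (cmp (lam A l) x)" using cmp(4)[of x] by (simp add: clinear_0[OF f(1)])
  finally show ?thesis .
qed

text \<open>The graded pieces are spanned by the homogeneous elements of any homogeneous spanning set.\<close>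

lemma graded_piece_span:
  assumes ds: "direct_sum_on I UNIV gr" and B: "\<And>b. b \<in> B \<Longrightarrow> \<exists>i\<in>I. b \<in> gr i" "cv.span B = UNIV" and x: "x \<in> gr i" "i \<in> I"
  shows "x \<in> cv.span (B \<inter> gr i)"
proof -
  obtain cmp where cmp: "\<And>i. clinear (cmp i)" "\<And>i x. i \<in> I \<Longrightarrow> cmp i x \<in> gr i"
      "\<And>i j x. i \<in> I \<Longrightarrow> x \<in> gr i \<Longrightarrow> cmp j x = (if j = i then x else 0)"
    by (rule direct_sum_components[OF ds]) (rule that)
  have "cmp i x \<in> cv.span (B \<inter> gr i)"
  proof (rule span_map_into[OF cmp(1) cv.subspace_span])
    show "x \<in> cv.span B" by (simp add: B(2))
    fix b assume b: "b \<in> B"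
    then obtain j where "j \<in> I" "b \<in> gr j" using B(1) by blast
    then show "cmp i b \<in> cv.span (B \<inter> gr i)"
      using cmp(3)[of j b i] b by (auto simp: cv.span_zero intro: cv.span_base)
  qed
  then show ?thesis using cmp(3)[OF x(2,1), of i] by simp
qed

locale induced_quotient = toroidal A lmin for A :: "('g::complex_vector, 'n::finite) toroidal_data" and lmin +
  fixes act2 :: "'g \<Rightarrow> 'w2 \<Rightarrow> 'w2::complex_vector" and gr2 :: "(int ^ 'n) set \<Rightarrow> 'w2 set"
    and act2s :: "'g \<Rightarrow> 'm \<Rightarrow> 'm::complex_vector" and gr2s :: "(int ^ 'n) set \<Rightarrow> 'm set"
  assumes fin2: "fin_dim (UNIV :: 'w2 set)"
    and circ_irreducible: "graded_irreducible A (g_circ A) act2 gr2"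
    and quotient: "graded_irreducible_quotient A act2 gr2 act2s gr2s"
begin

lemma sigma_irreducible: "graded_irreducible A (g_sigma0 A) act2s gr2s"
  using quotient by (simp add: graded_irreducible_quotient_def)

lemma circ_graded: "graded_module A (g_circ A) act2 gr2" and sigma_graded: "graded_module A (g_sigma0 A) act2s gr2s"
  using circ_irreducible sigma_irreducible by (simp_all add: graded_irreducible_def)

lemma circ_module: "lie_module_on br (g_circ A) act2 UNIV" and sigma_mod: "lie_module_on br (g_sigma0 A) act2s UNIV"
  using circ_graded sigma_graded by (simp_all add: graded_module_def)

lemma circ_direct: "direct_sum_on (range (lam A)) UNIV gr2" and sigma_direct: "direct_sum_on (range (lam A)) UNIV gr2s"
  using circ_graded sigma_graded by (simp_all add: graded_module_def)

lemma circ_gr: "x \<in> homog A (g_circ A) k \<Longrightarrow> w \<in> gr2 (lam A l) \<Longrightarrow> act2 x w \<in> gr2 (lam A (k + l))"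
  and sigma_gr: "x \<in> homog A (g_sigma0 A) k \<Longrightarrow> m \<in> gr2s (lam A l) \<Longrightarrow> act2s x m \<in> gr2s (lam A (k + l))"
  using circ_graded sigma_graded unfolding graded_module_def by blast+

lemma act2_linear: "x \<in> g_circ A \<Longrightarrow> clinear (act2 x)"
  and act2_bracket: "x \<in> g_circ A \<Longrightarrow> y \<in> g_circ A \<Longrightarrow> act2 (br x y) v = act2 x (act2 y v) - act2 y (act2 x v)"
  and act2_linear_left: "clinear_on (g_circ A) (\<lambda>x. act2 x v)"
  using circ_module unfolding lie_module_on_def clinear_on_UNIV by simp_all

lemma act2s_linear: "x \<in> g_sigma0 A \<Longrightarrow> clinear (act2s x)"
  and act2s_linear_left: "clinear_on (g_sigma0 A) (\<lambda>x. act2s x m)"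
  using sigma_mod unfolding lie_module_on_def clinear_on_UNIV by simp_all

text \<open>The quotient map onto \<open>W\<^sub>2(\<sigma>\<^sub>0)\<close>, defined on the free module that covers the induced module.\<close>

definition qmap :: "('g list \<Rightarrow>\<^sub>0 'w2) \<Rightarrow> 'm" where
  "qmap = (SOME \<pi>. clinear_on (induced_free A) \<pi> \<and> (\<forall>f\<in>induced_relations A act2. \<pi> f = 0) \<and>
        \<pi> ` induced_free A = UNIV \<and>
        (\<forall>x\<in>g_sigma0 A. \<forall>p\<in>lists (g_sigma0 A). \<forall>w. \<pi> (single (x # p) w) = act2s x (\<pi> (single p w))) \<and>
        (\<forall>ks p l w. list_all2 (\<lambda>k x. x \<in> homog A (g_sigma0 A) k) ks p \<and> w \<in> gr2 (lam A l) \<longrightarrow>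
           \<pi> (single p w) \<in> gr2s (lam A (sum_list ks + l))))"

lemma qmap_props: "clinear_on (induced_free A) qmap \<and> (\<forall>f\<in>induced_relations A act2. qmap f = 0) \<and>
        qmap ` induced_free A = UNIV \<and>
        (\<forall>x\<in>g_sigma0 A. \<forall>p\<in>lists (g_sigma0 A). \<forall>w. qmap (single (x # p) w) = act2s x (qmap (single p w))) \<and>
        (\<forall>ks p l w. list_all2 (\<lambda>k x. x \<in> homog A (g_sigma0 A) k) ks p \<and> w \<in> gr2 (lam A l) \<longrightarrow>
           qmap (single p w) \<in> gr2s (lam A (sum_list ks + l)))"
  using someI_ex[OF conjunct2[OF quotient[unfolded graded_irreducible_quotient_def]]] unfolding qmap_def .

text \<open>The map from the highest weight space \<open>W\<^sub>2\<close> to the quotient of the induced module.\<close>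

definition \<iota> :: "'w2 \<Rightarrow> 'm" where "\<iota> w = qmap (single [] w)"

lemma single_induced_free: "p \<in> lists (g_sigma0 A) \<Longrightarrow> single p (w :: 'w2) \<in> induced_free A"
  by (auto simp: induced_free_def)

lemma \<iota>_linear: "clinear \<iota>"
proof (rule clinearI)
  have lin: "clinear_on (induced_free A) qmap" using qmap_props by blast
  show "\<iota> (v + w) = \<iota> v + \<iota> w" for v w
    using lin single_induced_free[of "[]"] unfolding \<iota>_def clinear_on_def by (simp add: single_add)
  show "\<iota> (c *\<^sub>C w) = c *\<^sub>C \<iota> w" for c w
    using lin single_induced_free[of "[]"] unfolding \<iota>_def clinear_on_def by (simp flip: scaleC_single)
qed

lemma qmap_foldr: "p \<in> lists (g_sigma0 A) \<Longrightarrow> qmap (single p w) = foldr act2s p (\<iota> w)"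
proof (induction p)
  case (Cons x p)
  then have "qmap (single (x # p) w) = act2s x (qmap (single p w))" using qmap_props by auto
  with Cons show ?case by simp
qed (simp add: \<iota>_def)

lemma g_circ_sigma0: "g_circ A \<subseteq> g_sigma0 A" by (auto simp: g_circ_def)

lemma \<iota>_circ:
  assumes "x \<in> g_circ A"
  shows "act2s x (\<iota> w) = \<iota> (act2 x w)"
proof -
  have "single ([] @ [x]) w - single [] (act2 x w) \<in> induced_relations A act2"
    unfolding induced_relations_def using assms by (intro cv.span_base) blast
  then have "qmap (single [x] w - single [] (act2 x w)) = 0" using qmap_props by simp
  moreover have "single [x] w \<in> induced_free A" "single [] (act2 x w) \<in> induced_free A"
    using assms g_circ_sigma0 by (auto intro!: single_induced_free)
  moreover have "qmap (u - v) = qmap u - qmap v" if "u \<in> induced_free A" "v \<in> induced_free A" for u v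
  proof -
    have lin: "\<forall>x\<in>induced_free A. \<forall>y\<in>induced_free A. qmap (x + y) = qmap x + qmap y"
      "\<forall>c. \<forall>x\<in>induced_free A. qmap (c *\<^sub>C x) = c *\<^sub>C qmap x"
      using qmap_props unfolding clinear_on_def by blast+
    have "keys ((- 1) *\<^sub>C v) \<subseteq> keys v" by (auto simp: in_keys_iff lookup_scaleC)
    then have "(- 1) *\<^sub>C v \<in> induced_free A" using that(2) by (auto simp: induced_free_def)
    then have "qmap (u + (- 1) *\<^sub>C v) = qmap u + qmap ((- 1) *\<^sub>C v)" using lin(1) that(1) by blast
    moreover have "qmap ((- 1) *\<^sub>C v) = (- 1) *\<^sub>C qmap v" using lin(2) that(2) by blast
    ultimately show ?thesis by (simp add: scaleC_one)
  qed
  ultimately have "qmap (single [x] w) = \<iota> (act2 x w)" by (simp add: \<iota>_def)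
  then show ?thesis using qmap_foldr[of "[x]"] assms g_circ_sigma0 by auto
qed

lemma \<iota>_plus:
  assumes "x \<in> g_sigma0_plus A" "x \<in> g_sigma0 A"
  shows "act2s x (\<iota> w) = 0"
proof -
  have "single ([] @ [x]) w \<in> induced_relations A act2"
    unfolding induced_relations_def using assms(1) by (intro cv.span_base) blast
  then have "qmap (single [x] w) = 0" using qmap_props by simp
  then show ?thesis using qmap_foldr[of "[x]"] assms(2) by simp
qed

lemma products_graded:
  assumes "list_all2 (\<lambda>k x. x \<in> homog A (g_sigma0 A) k) ks p" "m \<in> gr2s (lam A l)"
  shows "foldr act2s p m \<in> gr2s (lam A (sum_list ks + l))"
  using assms(1)
proof (induction rule: list_all2_induct)
  case (Cons k ks x p)
  then show ?case using sigma_gr[of x k "foldr act2s p m" "sum_list ks + l"] by (simp add: add.assoc)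
qed (simp add: assms(2))

lemma \<iota>_gr: "w \<in> gr2 (lam A l) \<Longrightarrow> \<iota> w \<in> gr2s (lam A l)"
proof -
  assume "w \<in> gr2 (lam A l)"
  moreover have "list_all2 (\<lambda>k x. x \<in> homog A (g_sigma0 A) k) [] []" by simp
  ultimately have "qmap (single [] w) \<in> gr2s (lam A (sum_list [] + l))" using qmap_props by blast
  then show ?thesis by (simp add: \<iota>_def)
qed

lemma homog_sigma0: "x \<in> homog A L k \<Longrightarrow> x \<in> L"
  by (simp add: homog_def)

lemma sigma0_homog_span: "x \<in> g_sigma0 A \<Longrightarrow> x \<in> cv.span (\<Union>k. homog A (g_sigma0 A) k)"
proof -
  assume x: "x \<in> g_sigma0 A"
  have "aut A i y \<in> g_sigma0 A" if "y \<in> g_sigma0 A" for i y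
    using that aut_comm[of None i y] by (simp add: g_sigma0_def)
  then have "x \<in> cv.span (\<Union>k. g_sigma0 A \<inter> eig A k)" by (rule eigenspace_decomposition[OF g_sigma0_subspace _ x])
  also have "\<dots> \<subseteq> cv.span (\<Union>k. homog A (g_sigma0 A) k)"
  proof (rule cv.span_mono, rule subsetI)
    fix y assume "y \<in> (\<Union>k. g_sigma0 A \<inter> eig A k)"
    then obtain k where "y \<in> g_sigma0 A" "y \<in> eig A k" by blast
    then have "y \<in> homog A (g_sigma0 A) (rest k)" by (simp add: homog_def eig_def rest_def)
    then show "y \<in> (\<Union>k. homog A (g_sigma0 A) k)" by blast
  qed
  finally show ?thesis .
qed

lemma sigma_span_into:
  assumes "cv.subspace U" "\<And>k x. x \<in> homog A (g_sigma0 A) k \<Longrightarrow> act2s x m \<in> U" "x \<in> g_sigma0 A"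
  shows "act2s x m \<in> U"
proof (rule act_span_into[where L = "g_sigma0 A" and act = act2s and v = m, OF act2s_linear_left g_sigma0_subspace _ assms(1) _ sigma0_homog_span[OF assms(3)]])
  show "(\<Union>k. homog A (g_sigma0 A) k) \<subseteq> g_sigma0 A" by (auto simp: homog_def)
  fix s assume "s \<in> (\<Union>k. homog A (g_sigma0 A) k)"
  then obtain k where "s \<in> homog A (g_sigma0 A) k" by blast
  then show "act2s s m \<in> U" by (rule assms(2))
qed

text \<open>Products of homogeneous elements are enough to span, and unlike arbitrary products they are homogeneous.\<close>

definition products :: "'m set" where
  "products = {foldr act2s p (\<iota> w) |p ks l w. list_all2 (\<lambda>k x. x \<in> homog A (g_sigma0 A) k) ks p \<and> w \<in> gr2 (lam A l)}"

lemma gr2_span: "w \<in> cv.span (\<Union>l. gr2 (lam A l))"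
proof -
  obtain cmp where "\<And>i x. i \<in> range (lam A) \<Longrightarrow> cmp i x \<in> gr2 i" "\<And>x. {i. cmp i x \<noteq> 0} \<subseteq> range (lam A)"
    "\<And>x. (\<Sum>i | cmp i x \<noteq> 0. cmp i x) = x"
    by (rule direct_sum_components[OF circ_direct]) (rule that)
  note cmp = this
  have "(\<Sum>i | cmp i w \<noteq> 0. cmp i w) \<in> cv.span (\<Union>l. gr2 (lam A l))"
  proof (rule cv.span_sum)
    fix i assume "i \<in> {i. cmp i w \<noteq> 0}"
    then obtain l where l: "i = lam A l" using cmp(2) by blast
    then have "cmp i w \<in> gr2 (lam A l)" using cmp(1)[of i w] by simp
    then show "cmp i w \<in> cv.span (\<Union>l. gr2 (lam A l))" by (intro cv.span_base) blast
  qed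
  then show ?thesis by (simp only: cmp(3))
qed

text \<open>The quotient of the induced module is generated by the image of \<open>W\<^sub>2\<close>.\<close>

lemma stable_generated:
  assumes U: "cv.subspace U" "range \<iota> \<subseteq> U" "\<And>k x m. x \<in> homog A (g_sigma0 A) k \<Longrightarrow> m \<in> U \<Longrightarrow> act2s x m \<in> U"
  shows "U = UNIV"
proof -
  have "foldr act2s p (\<iota> w) \<in> U" if "p \<in> lists (g_sigma0 A)" for p w
    using that
  proof (induction p)
    case (Cons x p)
    then show ?case using sigma_span_into[OF U(1), of "foldr act2s p (\<iota> w)" x] U(3) by auto
  qed (use U(2) in auto)
  then have q: "qmap (single p w) \<in> U" if "p \<in> lists (g_sigma0 A)" for p w using qmap_foldr that by simp
  have "qmap f \<in> U" if f: "f \<in> induced_free A" for f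
  proof -
    have lin: "\<forall>x\<in>induced_free A. \<forall>y\<in>induced_free A. qmap (x + y) = qmap x + qmap y"
      using qmap_props unfolding clinear_on_def by blast
    have z: "qmap 0 = 0" using qmap_props cv.subspace_0[of "induced_relations A act2"] by (simp add: induced_relations_def)
    have "(\<Sum>p\<in>F. single p (lookup f p)) \<in> induced_free A \<and> qmap (\<Sum>p\<in>F. single p (lookup f p)) \<in> U"
      if "finite F" "F \<subseteq> keys f" for F
      using that
    proof (induction F)
      case empty
      show ?case using z cv.subspace_0[OF U(1)] by (simp add: induced_free_def)
    next
      case (insert p F)
      let ?s = "\<Sum>p\<in>F. single p (lookup f p)"
      have p: "p \<in> lists (g_sigma0 A)" using insert.prems f by (auto simp: induced_free_def)
      have IH: "?s \<in> induced_free A" "qmap ?s \<in> U" using insert.IH insert.prems by blast+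
      have "keys (single p (lookup f p) + ?s) \<subseteq> lists (g_sigma0 A)"
        using keys_add[of "single p (lookup f p)" ?s] IH(1) single_induced_free[OF p, of "lookup f p"]
        unfolding induced_free_def by blast
      then have "single p (lookup f p) + ?s \<in> induced_free A" by (simp add: induced_free_def)
      moreover have "qmap (single p (lookup f p) + ?s) = qmap (single p (lookup f p)) + qmap ?s"
        by (rule lin[rule_format, OF single_induced_free[OF p] IH(1)])
      then have "qmap (single p (lookup f p) + ?s) \<in> U"
        using cv.subspace_add[OF U(1) q[OF p] IH(2)] by simp
      ultimately show ?case by (simp only: sum.insert[OF insert.hyps])
    qed
    from this[of "keys f"] show ?thesis by (simp add: pm_sum_singles)
  qed
  then have "qmap ` induced_free A \<subseteq> U" by blast
  moreover have "qmap ` induced_free A = UNIV" using qmap_props by (elim conjE)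
  ultimately show ?thesis by blast
qed

lemma products_span: "cv.span products = UNIV"
proof (rule stable_generated[OF cv.subspace_span])
  show "range \<iota> \<subseteq> cv.span products"
  proof
    fix m assume "m \<in> range \<iota>"
    then obtain w where w: "m = \<iota> w" by blast
    show "m \<in> cv.span products"
      unfolding w
    proof (rule span_map_into[OF \<iota>_linear cv.subspace_span _ gr2_span])
      fix s assume "s \<in> (\<Union>l. gr2 (lam A l))"
      then obtain l where "s \<in> gr2 (lam A l)" by blast
      then have "foldr act2s [] (\<iota> s) \<in> products" unfolding products_def by blast
      then show "\<iota> s \<in> cv.span products" by (simp add: cv.span_base)
    qed
  qed
  fix k x m assume x: "x \<in> homog A (g_sigma0 A) k" and m: "m \<in> cv.span products"
  show "act2s x m \<in> cv.span products"
  proof (rule span_map_into[OF act2s_linear[OF homog_sigma0[OF x]] cv.subspace_span _ m])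
    fix s assume "s \<in> products"
    then obtain p ks l w where s: "s = foldr act2s p (\<iota> w)" "list_all2 (\<lambda>k x. x \<in> homog A (g_sigma0 A) k) ks p" "w \<in> gr2 (lam A l)"
      unfolding products_def by blast
    have "list_all2 (\<lambda>k x. x \<in> homog A (g_sigma0 A) k) (k # ks) (x # p)" using s(2) x by simp
    then have "foldr act2s (x # p) (\<iota> w) \<in> products" unfolding products_def using s(3) by blast
    then show "act2s x s \<in> cv.span products" by (simp add: s(1) cv.span_base)
  qed
qed

lemma gr2s_products: "m \<in> gr2s (lam A k) \<Longrightarrow> m \<in> cv.span (products \<inter> gr2s (lam A k))"
proof (rule graded_piece_span[OF sigma_direct _ products_span])
  fix b assume "b \<in> products"
  then show "\<exists>i\<in>range (lam A). b \<in> gr2s i" unfolding products_def using products_graded \<iota>_gr by blast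
qed auto

lemma gr_zero: "lam A k \<noteq> lam A l \<Longrightarrow> m \<in> gr2s (lam A k) \<Longrightarrow> m \<in> gr2s (lam A l) \<Longrightarrow> m = 0"
proof -
  assume a: "lam A k \<noteq> lam A l" "m \<in> gr2s (lam A k)" "m \<in> gr2s (lam A l)"
  obtain cmp where "\<And>i j x. i \<in> range (lam A) \<Longrightarrow> x \<in> gr2s i \<Longrightarrow> cmp j x = (if j = i then x else 0)"
    by (rule direct_sum_components[OF sigma_direct]) (rule that)
  from this[of "lam A k" m "lam A l"] this[of "lam A l" m "lam A l"] a show ?thesis by auto
qed

text \<open>The kernel of \<open>\<iota>\<close> is a graded submodule of \<open>W\<^sub>2\<close>. It is not all of \<open>W\<^sub>2\<close>, since the image of \<open>\<iota>\<close>
  generates a nonzero module.\<close>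

lemma \<iota>_inj: "\<iota> w = 0 \<Longrightarrow> w = 0"
proof -
  let ?N = "{w. \<iota> w = 0}"
  have sub: "cv.subspace ?N" by (rule subspace_kernel[OF \<iota>_linear])
  obtain cmp where cmp: "\<And>i. clinear (cmp i)" "\<And>i x. i \<in> range (lam A) \<Longrightarrow> cmp i x \<in> gr2 i"
    "\<And>i j x. i \<in> range (lam A) \<Longrightarrow> x \<in> gr2 i \<Longrightarrow> cmp j x = (if j = i then x else 0)"
    "\<And>x. finite {i. cmp i x \<noteq> 0}" "\<And>x. {i. cmp i x \<noteq> 0} \<subseteq> range (lam A)" "\<And>x. (\<Sum>i | cmp i x \<noteq> 0. cmp i x) = x"
    by (rule direct_sum_components[OF circ_direct]) (rule that)
  obtain cms where cms: "\<And>i. clinear (cms i)"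
    "\<And>i j x. i \<in> range (lam A) \<Longrightarrow> x \<in> gr2s i \<Longrightarrow> cms j x = (if j = i then x else 0)"
    by (rule direct_sum_components[OF sigma_direct]) (rule that)
  have "cms i (\<iota> x) = \<iota> (cmp i x)" for i x
  proof -
    have "cms i (\<iota> x) = cms i (\<iota> (\<Sum>j | cmp j x \<noteq> 0. cmp j x))" by (simp only: cmp(6))
    also have "\<dots> = (\<Sum>j | cmp j x \<noteq> 0. cms i (\<iota> (cmp j x)))"
      by (simp only: clinear_sum[OF \<iota>_linear] clinear_sum[OF cms(1)])
    also have "\<dots> = (\<Sum>j | cmp j x \<noteq> 0. if j = i then \<iota> (cmp j x) else 0)"
    proof (rule sum.cong[OF refl])
      fix j assume "j \<in> {j. cmp j x \<noteq> 0}"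
      then obtain k where j: "j = lam A k" using cmp(5) by blast
      have "\<iota> (cmp j x) \<in> gr2s j" unfolding j by (intro \<iota>_gr cmp(2)) simp
      then show "cms i (\<iota> (cmp j x)) = (if j = i then \<iota> (cmp j x) else 0)" using cms(2)[of j "\<iota> (cmp j x)" i] by (auto simp: j)
    qed
    also have "\<dots> = \<iota> (cmp i x)" using cmp(4)[of x] by (simp add: clinear_0[OF \<iota>_linear])
    finally show ?thesis .
  qed
  then have "cmp i x \<in> ?N" if "x \<in> ?N" for i x using that clinear_0[OF cms(1)] by (metis mem_Collect_eq)
  then have "direct_sum_on (range (lam A)) ?N (\<lambda>\<mu>. ?N \<inter> gr2 \<mu>)"
    using circ_direct cmp by (intro direct_sum_on_subspace[OF sub, where cmp = cmp]) (auto simp: direct_sum_on_def)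
  moreover have "lie_submodule (g_circ A) act2 UNIV ?N"
    unfolding lie_submodule_def
  proof (intro conjI ballI sub)
    show "act2 x v \<in> ?N" if x: "x \<in> g_circ A" and v: "v \<in> ?N" for x v
    proof -
      have "x \<in> g_sigma0 A" using x g_circ_sigma0 by blast
      then have "act2s x (\<iota> v) = 0" using v clinear_0[OF act2s_linear] by simp
      then show ?thesis using \<iota>_circ[OF x] by simp
    qed
  qed simp
  ultimately have "?N = {0} \<or> ?N = UNIV" using circ_irreducible unfolding graded_irreducible_def by blast
  moreover have "?N \<noteq> UNIV"
  proof
    assume "?N = UNIV"
    then have "range \<iota> \<subseteq> {0}" by auto
    then have "{0} = (UNIV :: 'm set)"
      by (rule stable_generated[OF cv.subspace_single_0]) (use act2s_linear homog_sigma0 clinear_0 in fastforce)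
    then show False using sigma_irreducible unfolding graded_irreducible_def by simp
  qed
  ultimately show "\<iota> w = 0 \<Longrightarrow> w = 0" by blast
qed

definition h0 :: 'g where
  "h0 = (SOME h. h \<in> H \<and> (\<forall>\<alpha>\<in>P. \<exists>r>0. \<alpha> h = of_real r))"

lemma h0: "h0 \<in> H" "\<alpha> \<in> P \<Longrightarrow> \<exists>r>0. \<alpha> h0 = of_real r"
proof -
  have "\<exists>h. h \<in> H \<and> (\<forall>\<alpha>\<in>P. \<exists>r>0. \<alpha> h = of_real r)"
    by (rule positive_element_exists) blast
  then have "h0 \<in> H \<and> (\<forall>\<alpha>\<in>P. \<exists>r>0. \<alpha> h0 = of_real r)" unfolding h0_def by (rule someI_ex)
  then show "h0 \<in> H" "\<alpha> \<in> P \<Longrightarrow> \<exists>r>0. \<alpha> h0 = of_real r" by blast+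
qed

lemma h0_homog: "h0 \<in> homog A (g_sigma0 A) 0"
  using H_eig0[OF h0(1)] eig_emb_homog[of h0 0] by (simp flip: zero_emb)

lemma h0_sigma0: "h0 \<in> g_sigma0 A" by (rule homog_sigma0[OF h0_homog])

lemma h0_circ: "h0 \<in> g_circ A"
  using h0_sigma0 H_abelian[OF _ h0(1)] by (simp add: g_circ_def)

text \<open>A graded form of Schur's lemma: an eigenspace of the central element \<open>h0\<close> of degree zero is a graded
  submodule.\<close>

lemma h0_scalar: "\<exists>c. \<forall>w. act2 h0 w = c *\<^sub>C w"
proof -
  have "(UNIV :: 'w2 set) \<noteq> {0}" using circ_irreducible by (simp add: graded_irreducible_def)
  then obtain c v where v: "v \<noteq> 0" "act2 h0 v = c *\<^sub>C v" by (rule eigenvector_exists[OF fin2 act2_linear[OF h0_circ]])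
  let ?N = "{w. act2 h0 w = c *\<^sub>C w}"
  have sub: "cv.subspace ?N" by (rule subspace_eigenspace[OF act2_linear[OF h0_circ]])
  obtain cmp where cmp: "\<And>i. clinear (cmp i)" "\<And>i x. i \<in> range (lam A) \<Longrightarrow> cmp i x \<in> gr2 i"
    "\<And>i j x. i \<in> range (lam A) \<Longrightarrow> x \<in> gr2 i \<Longrightarrow> cmp j x = (if j = i then x else 0)"
    "\<And>x. finite {i. cmp i x \<noteq> 0}" "\<And>x. {i. cmp i x \<noteq> 0} \<subseteq> range (lam A)" "\<And>x. (\<Sum>i | cmp i x \<noteq> 0. cmp i x) = x"
    by (rule direct_sum_components[OF circ_direct]) (rule that)
  have hom: "h0 \<in> homog A (g_circ A) 0" using h0_homog h0_circ by (simp add: homog_def)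
  have "cmp i x \<in> ?N" if x: "x \<in> ?N" and i: "i \<in> range (lam A)" for i x
  proof -
    obtain l where l: "i = lam A l" using i by blast
    have "cmp (lam A (0 + l)) (act2 h0 x) = act2 h0 (cmp (lam A l) x)"
      by (rule component_shift[OF act2_linear[OF h0_circ] circ_gr[OF hom] cmp])
    then show ?thesis using x by (simp add: l clinear_scale[OF cmp(1)])
  qed
  then have "direct_sum_on (range (lam A)) ?N (\<lambda>\<mu>. ?N \<inter> gr2 \<mu>)"
    using circ_direct cmp by (intro direct_sum_on_subspace[OF sub, where cmp = cmp]) (auto simp: direct_sum_on_def)
  moreover have "lie_submodule (g_circ A) act2 UNIV ?N"
    unfolding lie_submodule_def
  proof (intro conjI ballI sub)
    fix x w assume x: "x \<in> g_circ A" and w: "w \<in> ?N"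
    have "br h0 x = 0" using x h0(1) by (simp add: g_circ_def)
    moreover have "0 \<in> g_circ A" by (simp add: g_circ_def br_simps cv.subspace_0[OF g_sigma0_subspace])
    then have "act2 0 w = 0" by (rule clinear_zero[OF act2_linear_left])
    ultimately have "act2 h0 (act2 x w) = act2 x (act2 h0 w)" using act2_bracket[OF h0_circ x, of w] by simp
    then show "act2 x w \<in> ?N" using w clinear_scale[OF act2_linear[OF x]] by simp
  qed simp
  ultimately have "?N = {0} \<or> ?N = UNIV" using circ_irreducible unfolding graded_irreducible_def by blast
  then have "?N = UNIV" using v by blast
  then show ?thesis by blast
qed

text \<open>This is the top eigenvalue of \<open>h0\<close> on the quotient of the induced module.\<close>

definition wt0 :: complex where "wt0 = (SOME c. \<forall>w. act2 h0 w = c *\<^sub>C w)"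

lemma wt0: "act2 h0 w = wt0 *\<^sub>C w"
  using someI_ex[OF h0_scalar] unfolding wt0_def by blast

lemma weight_vector_plus:
  assumes "x \<in> g_sigma0 A" "x \<in> wspace \<eta>" "\<eta> \<in> P"
  shows "x \<in> g_sigma0_plus A"
proof -
  have "x \<in> weight_space A (g_sigma0 A) \<eta>"
    using assms wspace_eq_weight_space[OF W_dual[OF positive_W(1)[OF assms(3)]]] by (simp add: weight_space_def)
  then show ?thesis unfolding g_sigma0_plus_def using assms(3) by (intro cv.span_base) blast
qed

lemma sigma0_wproj: "x \<in> g_sigma0 A \<Longrightarrow> wproj \<eta> x \<in> g_sigma0 A"
  by (simp add: g_sigma0_def flip: wproj_aut)

text \<open>The quotient of the induced module is generated by lowering operators from the image of \<open>W\<^sub>2\<close>, on which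
  \<open>h0\<close> is a scalar.\<close>

lemma sigma_eigenvectors: "m \<in> cv.span {v. \<exists>d\<in>UNIV. act2s h0 v = d *\<^sub>C v}"
proof -
  let ?Lm = "{x\<in>g_sigma0 A. \<exists>\<eta>. x \<in> wspace \<eta> \<and> \<eta> \<in> W \<and> - \<eta> \<in> P}" and ?Lp = "{x\<in>g_sigma0 A. \<exists>\<eta>. x \<in> wspace \<eta> \<and> \<eta> \<in> P}"
  let ?G = "cv.span (lowered ?Lm act2s (range \<iota>))"
  have tri: "g_sigma0 A \<subseteq> cv.span (?Lm \<union> g_circ A \<union> ?Lp)"
  proof
    fix x assume x: "x \<in> g_sigma0 A"
    have "wproj \<eta> x \<in> ?Lm \<union> g_circ A \<union> ?Lp" if \<eta>: "\<eta> \<in> W" for \<eta>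
    proof -
      note s = sigma0_wproj[OF x, of \<eta>]
      from W_cases[OF \<eta>] show ?thesis
      proof (elim disjE)
        assume "\<eta> = 0"
        then have "br h (wproj \<eta> x) = 0" if "h \<in> H" for h using H_diagonal[OF that wproj_in zero_dual] by simp
        then show ?thesis using s by (simp add: g_circ_def)
      next
        assume "\<eta> \<in> P" then show ?thesis using s wproj_in by blast
      next
        assume "- \<eta> \<in> P" then show ?thesis using s wproj_in \<eta> by blast
      qed
    qed
    then have "(\<Sum>\<eta>\<in>W. wproj \<eta> x) \<in> cv.span (?Lm \<union> g_circ A \<union> ?Lp)" by (intro cv.span_sum cv.span_base)
    then show "x \<in> cv.span (?Lm \<union> g_circ A \<union> ?Lp)" by (simp only: wproj_sum)
  qed
  have sub: "cv.subspace (range \<iota>)" by (rule cvp.linear_subspace_image[OF \<iota>_linear cv.subspace_UNIV])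
  have "?G = UNIV"
  proof (rule stable_generated[OF cv.subspace_span])
    show "range \<iota> \<subseteq> ?G"
    proof
      fix v assume "v \<in> range \<iota>"
      then show "v \<in> ?G" by (intro cv.span_base lowered.base)
    qed
    fix k x m assume x: "x \<in> homog A (g_sigma0 A) k" and m: "m \<in> ?G"
    show "act2s x m \<in> ?G"
    proof (rule lowered_submodule[OF sigma_mod g_sigma0_subspace g_sigma0_br tri _ g_circ_sigma0 _ _ _ homog_sigma0[OF x] m])
      show "act2s x v \<in> range \<iota>" if "x \<in> g_circ A" "v \<in> range \<iota>" for x v using that \<iota>_circ by auto
      show "act2s x v = 0" if "x \<in> ?Lp" "v \<in> range \<iota>" for x v using that \<iota>_plus weight_vector_plus by auto
    qed auto
  qed
  then have m: "m \<in> ?G" by simp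
  have "m \<in> cv.span {v. \<exists>d\<in>{wt0 - of_real r |r::real. r \<ge> 0}. act2s h0 v = d *\<^sub>C v}"
  proof (rule lowered_top(2)[OF sigma_mod _ h0_sigma0 sub _ _ m])
    show "act2s h0 v = wt0 *\<^sub>C v" if "v \<in> range \<iota>" for v
      using that \<iota>_circ[OF h0_circ] by (auto simp: wt0 clinear_scale[OF \<iota>_linear])
    show "\<exists>r::real. r > 0 \<and> br h0 y = - of_real r *\<^sub>C y" if y: "y \<in> ?Lm" for y
    proof -
      obtain \<eta> where \<eta>: "y \<in> wspace \<eta>" "\<eta> \<in> W" "- \<eta> \<in> P" using y by blast
      obtain r :: real where r: "r > 0" "(- \<eta>) h0 = of_real r" using h0(2)[OF \<eta>(3)] by blast
      have "\<eta> h0 = - of_real r" using r(2) by (simp add: minus_equation_iff)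
      then show ?thesis using H_diagonal[OF h0(1) \<eta>(1) W_dual[OF \<eta>(2)]] r(1) by auto
    qed
  qed auto
  then show ?thesis
    using cv.span_mono[of "{v. \<exists>d\<in>{wt0 - of_real r |r::real. r \<ge> 0}. act2s h0 v = d *\<^sub>C v}" "{v. \<exists>d\<in>UNIV. act2s h0 v = d *\<^sub>C v}"] by blast
qed

text \<open>The sum of the eigenspaces of \<open>h0\<close> of eigenvalues other than the top one. Written as a range, it is
  visibly compatible with the grading and with contractions of tensors.\<close>

definition below :: "'m set" where "below = range (\<lambda>m. act2s h0 m - wt0 *\<^sub>C m)"

lemma below_subspace: "cv.subspace below"
  unfolding below_def by (rule cvp.linear_subspace_image[OF clinear_shift[OF act2s_linear[OF h0_sigma0]] cv.subspace_UNIV])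

lemma \<iota>_below: "\<iota> w \<in> below \<Longrightarrow> w = 0"
proof -
  assume "\<iota> w \<in> below"
  then obtain m where m: "\<iota> w = act2s h0 m - wt0 *\<^sub>C m" by (auto simp: below_def)
  note lin = act2s_linear[OF h0_sigma0]
  obtain F y where F: "finite F" "\<And>d. d \<in> F \<Longrightarrow> act2s h0 (y d) = d *\<^sub>C y d" "m = (\<Sum>d\<in>F. y d)"
    by (rule span_eigenvectors_decomposition[OF lin sigma_eigenvectors]) blast
  have "\<iota> w = (\<Sum>d\<in>F. (d - wt0) *\<^sub>C y d)"
    unfolding m F(3) using F(2) by (simp add: clinear_sum[OF lin] cv.scale_sum_right cv.scale_left_diff_distrib sum_subtractf)
  moreover have "(\<Sum>d\<in>F. (d - wt0) *\<^sub>C y d) \<in> cv.span {v. \<exists>d\<in>- {wt0}. act2s h0 v = d *\<^sub>C v}"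
  proof (rule cv.span_sum)
    fix d assume d: "d \<in> F"
    show "(d - wt0) *\<^sub>C y d \<in> cv.span {v. \<exists>d\<in>- {wt0}. act2s h0 v = d *\<^sub>C v}"
    proof (cases "d = wt0")
      case False
      then show ?thesis using F(2)[OF d] by (intro cv.span_scale cv.span_base) blast
    qed (simp add: cv.span_zero)
  qed
  moreover have "act2s h0 (\<iota> w) = wt0 *\<^sub>C \<iota> w" using \<iota>_circ[OF h0_circ] by (simp add: wt0 clinear_scale[OF \<iota>_linear])
  ultimately have "\<iota> w = 0" using eigenvector_in_span_eigenvectors[OF lin, of "\<iota> w" "- {wt0}" wt0] by simp
  then show "w = 0" by (rule \<iota>_inj)
qed

text \<open>The vectors that no product of homogeneous elements moves out of the lower weights form a
  graded submodule without top component, so they vanish.\<close>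

lemma reaches_top:
  assumes "m \<noteq> 0"
  obtains p ks where "list_all2 (\<lambda>k x. x \<in> homog A (g_sigma0 A) k) ks p" "foldr act2s p m \<notin> below"
proof -
  let ?Q = "\<lambda>ks p. list_all2 (\<lambda>k x. x \<in> homog A (g_sigma0 A) k) ks p"
  let ?R = "{m. \<forall>ks p. ?Q ks p \<longrightarrow> foldr act2s p m \<in> below}"
  have lin: "clinear (foldr act2s p)" if "?Q ks p" for ks p
    using that
  proof (induction rule: list_all2_induct)
    case (Cons k ks x p)
    show ?case using clinear_comp[OF act2s_linear[OF homog_sigma0[OF Cons(1)]] Cons(3)] by (simp add: comp_def)
  qed (simp add: clinear_ident id_def)
  have "?R = (\<Inter>(ks, p)\<in>{(ks, p). ?Q ks p}. {m. foldr act2s p m \<in> below})" by auto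
  moreover have "cv.subspace (\<Inter>(ks, p)\<in>{(ks, p). ?Q ks p}. {m. foldr act2s p m \<in> below})"
    by (rule cv.subspace_Inter) (use subspace_Collect_linear[OF lin below_subspace] in auto)
  ultimately have sub: "cv.subspace ?R" by (simp only:)
  obtain cmp where cmp: "\<And>i. clinear (cmp i)" "\<And>i x. i \<in> range (lam A) \<Longrightarrow> cmp i x \<in> gr2s i"
    "\<And>i j x. i \<in> range (lam A) \<Longrightarrow> x \<in> gr2s i \<Longrightarrow> cmp j x = (if j = i then x else 0)"
    "\<And>x. finite {i. cmp i x \<noteq> 0}" "\<And>x. {i. cmp i x \<noteq> 0} \<subseteq> range (lam A)" "\<And>x. (\<Sum>i | cmp i x \<noteq> 0. cmp i x) = x"
    by (rule direct_sum_components[OF sigma_direct]) (rule that)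
  have below_cmp: "cmp (lam A l) v \<in> below" if v: "v \<in> below" for l v
  proof -
    obtain u where u: "v = act2s h0 u - wt0 *\<^sub>C u" using v by (auto simp: below_def)
    have "cmp (lam A (0 + l)) (act2s h0 u) = act2s h0 (cmp (lam A l) u)"
      by (rule component_shift[OF act2s_linear[OF h0_sigma0] sigma_gr[OF h0_homog] cmp])
    then have "cmp (lam A l) v = act2s h0 (cmp (lam A l) u) - wt0 *\<^sub>C cmp (lam A l) u"
      by (simp add: u clinear_diff[OF cmp(1)] clinear_scale[OF cmp(1)])
    then show ?thesis by (auto simp: below_def)
  qed
  have "cmp i v \<in> ?R" if i: "i \<in> range (lam A)" and v: "v \<in> ?R" for i v
  proof (intro CollectI allI impI)
    fix ks p assume Q: "?Q ks p"
    obtain l where l: "i = lam A l" using i by blast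
    have "cmp (lam A (sum_list ks + l)) (foldr act2s p v) = foldr act2s p (cmp (lam A l) v)"
      by (rule component_shift[OF lin[OF Q] products_graded[OF Q] cmp])
    then show "foldr act2s p (cmp i v) \<in> below" using below_cmp[of "foldr act2s p v" "sum_list ks + l"] v Q by (simp add: l)
  qed
  then have "direct_sum_on (range (lam A)) ?R (\<lambda>\<mu>. ?R \<inter> gr2s \<mu>)"
    using sigma_direct cmp by (intro direct_sum_on_subspace[OF sub, where cmp = cmp]) (auto simp: direct_sum_on_def)
  moreover have "lie_submodule (g_sigma0 A) act2s UNIV ?R"
    unfolding lie_submodule_def
  proof (intro conjI ballI sub)
    fix x v assume x: "x \<in> g_sigma0 A" and v: "v \<in> ?R"
    show "act2s x v \<in> ?R"
    proof (rule sigma_span_into[OF sub _ x], intro CollectI allI impI)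
      fix k y ks p assume y: "y \<in> homog A (g_sigma0 A) k" and Q: "?Q ks p"
      have "?Q (ks @ [k]) (p @ [y])" using Q y by (intro list_all2_appendI) simp_all
      then have "foldr act2s (p @ [y]) v \<in> below" using v by blast
      then show "foldr act2s p (act2s y v) \<in> below" by simp
    qed
  qed simp
  ultimately have "?R = {0} \<or> ?R = UNIV" using sigma_irreducible unfolding graded_irreducible_def by blast
  moreover have "?R \<noteq> UNIV"
  proof
    assume R: "?R = UNIV"
    have all_below: "\<iota> w \<in> below" for w
    proof -
      have "\<iota> w \<in> ?R" using R by blast
      then have "?Q [] [] \<longrightarrow> foldr act2s [] (\<iota> w) \<in> below" by blast
      then show ?thesis by simp
    qed
    have "w = 0" for w :: 'w2 by (rule \<iota>_below[OF all_below])
    then have "(UNIV :: 'w2 set) = {0}" by (intro equalityI subsetI) simp_all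
    then show False using circ_irreducible by (simp add: graded_irreducible_def)
  qed
  ultimately have "m \<notin> ?R" using assms by blast
  then have "\<not> (\<forall>ks p. ?Q ks p \<longrightarrow> foldr act2s p m \<in> below)" by simp
  then obtain ks p where "?Q ks p" "foldr act2s p m \<notin> below" by blast
  then show ?thesis by (rule that)
qed

end

section \<open>The isomorphism\<close>

definition pm_map :: "('a \<Rightarrow> 'b) \<Rightarrow> ('k \<Rightarrow>\<^sub>0 'a::complex_vector) \<Rightarrow> ('k \<Rightarrow>\<^sub>0 'b::complex_vector)" where
  "pm_map \<phi> f = (\<Sum>k\<in>keys f. single k (\<phi> (lookup f k)))"

lemma lookup_pm_map: "clinear \<phi> \<Longrightarrow> lookup (pm_map \<phi> f) k = \<phi> (lookup f k)"
  by (simp add: pm_map_def lookup_sum lookup_single when_def in_keys_iff clinear_0)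

lemma pm_map_linear: "clinear \<phi> \<Longrightarrow> clinear (pm_map \<phi>)"
  by (rule clinearI; rule poly_mapping_eqI) (simp_all add: lookup_pm_map lookup_add lookup_scaleC clinear_add clinear_scale)

lemma pm_map_single: "clinear \<phi> \<Longrightarrow> pm_map \<phi> (single k v) = single k (\<phi> v)"
  by (rule poly_mapping_eqI) (simp add: lookup_pm_map lookup_single when_def clinear_0)

text \<open>The contraction of the first tensor factor with a linear form.\<close>

definition contract :: "('a \<Rightarrow> complex) \<Rightarrow> ('a::complex_vector, 'b::complex_vector) tensor \<Rightarrow> 'b" where
  "contract \<phi> = tensor_lift (\<lambda>x y. \<phi> x *\<^sub>C y)"

lemma contract:
  assumes "clinear \<phi>"
  shows "clinear (contract \<phi>)" "contract \<phi> (x \<otimes>\<^sub>t y) = \<phi> x *\<^sub>C y"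
proof -
  have b: "bilinear_map (\<lambda>x y. \<phi> x *\<^sub>C y)"
    unfolding bilinear_map_iff using clinear_scaled[OF clinear_ident] clinear_fun[OF assms] by blast
  show "clinear (contract \<phi>)"
    unfolding contract_def clinear_on_UNIV[symmetric] by (rule tensor_lift_linear[OF b])
  show "contract \<phi> (x \<otimes>\<^sub>t y) = \<phi> x *\<^sub>C y"
    unfolding contract_def by (rule tensor_lift_tensor[OF b])
qed

lemma contract_tmap:
  assumes "clinear \<phi>" "clinear g"
  shows "contract \<phi> (tmap (\<lambda>v. v) g t) = g (contract \<phi> t)"
proof (rule tensor_linear_eqI[of "\<lambda>t. contract \<phi> (tmap (\<lambda>v. v) g t)" "\<lambda>t. g (contract \<phi> t)"])
  show "clinear (\<lambda>t. contract \<phi> (tmap (\<lambda>v. v) g t))"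
    by (rule clinear_comp[OF contract(1)[OF assms(1)] tmap_linear[OF clinear_ident assms(2)]])
  show "clinear (\<lambda>t. g (contract \<phi> t))" by (rule clinear_comp[OF assms(2) contract(1)[OF assms(1)]])
  show "contract \<phi> (tmap (\<lambda>v. v) g (x \<otimes>\<^sub>t y)) = g (contract \<phi> (x \<otimes>\<^sub>t y))" for x y
    by (simp add: tmap_tensor[OF clinear_ident assms(2)] contract(2)[OF assms(1)] clinear_scale[OF assms(2)])
qed

text \<open>A tensor is recovered from its contractions with the coordinate forms of a finite basis.\<close>

lemma contract_nonzero:
  fixes t :: "('a::complex_vector, 'b::complex_vector) tensor"
  assumes fin: "fin_dim (UNIV :: 'a set)" and "t \<noteq> 0"
  obtains \<phi> where "clinear \<phi>" "contract \<phi> t \<noteq> 0"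
proof -
  let ?c = "\<lambda>b (v :: 'a). cv.representation std_basis v b"
  have "t = (\<Sum>b\<in>std_basis. b \<otimes>\<^sub>t contract (?c b) t)"
  proof (rule tensor_linear_eqI[of "\<lambda>t. t" "\<lambda>t. \<Sum>b\<in>std_basis. b \<otimes>\<^sub>t contract (?c b) t", OF clinear_ident])
    show "clinear (\<lambda>t. \<Sum>b\<in>std_basis. b \<otimes>\<^sub>t contract (?c b) t)"
      by (intro clinear_sum_map) (rule clinear_comp[OF tensor_clinear(2) contract(1)[OF clinear_coordinate]])
    fix x :: 'a and y :: 'b
    have "(\<Sum>b\<in>std_basis. b \<otimes>\<^sub>t contract (?c b) (x \<otimes>\<^sub>t y)) = (\<Sum>b\<in>std_basis. ?c b x *\<^sub>C b) \<otimes>\<^sub>t y"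
      by (simp add: contract(2)[OF clinear_coordinate] clinear_sum[OF tensor_clinear(1)] tensor_linear)
    then show "x \<otimes>\<^sub>t y = (\<Sum>b\<in>std_basis. b \<otimes>\<^sub>t contract (?c b) (x \<otimes>\<^sub>t y))"
      by (simp add: coordinate_expansion[OF fin])
  qed
  then have "\<exists>b\<in>std_basis. contract (?c b) t \<noteq> 0" using assms(2) by (metis (mono_tags, lifting) sum.neutral tensor_zero_right)
  then obtain b where "contract (?c b) t \<noteq> 0" by blast
  then show ?thesis by (rule that[OF clinear_coordinate])
qed

locale highest_weight_setting = irreducible_module A lmin actV + induced_quotient A lmin act2 gr2 act2s gr2s +
    tm: tensor_module A lmin act1 act2s \<alpha> d C0
  for A :: "('g::complex_vector, 'n::finite) toroidal_data" and lmin
    and actV :: "('g, 'n) toroidal \<Rightarrow> 'v \<Rightarrow> 'v::complex_vector"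
    and act2 :: "'g \<Rightarrow> 'w2 \<Rightarrow> 'w2::complex_vector" and gr2 :: "(int ^ 'n) set \<Rightarrow> 'w2 set"
    and act2s :: "'g \<Rightarrow> 'm \<Rightarrow> 'm::complex_vector" and gr2s :: "(int ^ 'n) set \<Rightarrow> 'm set"
    and act1 :: "complex ^ 'n ^ 'n \<Rightarrow> 'w1 \<Rightarrow> 'w1::complex_vector" and \<alpha> :: "complex ^ 'n" and d C0 :: complex +
  fixes T :: "'v set" and f :: "'v \<Rightarrow> ((int ^ 'n) \<Rightarrow>\<^sub>0 ('w1, 'w2) tensor)"
  assumes T_def: "T = {v. \<forall>X\<in>tau_upper_plus A. actV X v = 0}"
    and fin1: "fin_dim (UNIV :: 'w1 set)" and nz1: "(UNIV :: 'w1 set) \<noteq> {0}"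
    and T_mod: "lie_module_on (bracket A) (tau_upper_zero A) actV T"
    and T'_mod: "lie_module_on (bracket A) (tau_upper_zero A) (tensor_act act1 act2 \<alpha> d C0) (tensor_space A gr2)"
    and f_bij: "bij_betw f T (tensor_space A gr2)" and f_linear: "clinear_on T f"
    and f_equivariant: "\<And>X v. X \<in> tau_upper_zero A \<Longrightarrow> v \<in> T \<Longrightarrow> f (actV X v) = tensor_act act1 act2 \<alpha> d C0 X (f v)"
begin

abbreviation T' where "T' \<equiv> tensor_space A gr2 :: ((int ^ 'n) \<Rightarrow>\<^sub>0 ('w1, 'w2) tensor) set"
abbreviation S' where "S' \<equiv> tensor_space A gr2s :: ((int ^ 'n) \<Rightarrow>\<^sub>0 ('w1, 'm) tensor) set"
abbreviation taT where "taT \<equiv> tensor_act act1 act2 \<alpha> d C0"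
abbreviation ta where "ta \<equiv> tensor_act act1 act2s \<alpha> d C0"

text \<open>The map of tensor modules induced by \<open>\<iota> : W\<^sub>2 \<rightarrow> W\<^sub>2(\<sigma>\<^sub>0)\<close>.\<close>

definition J :: "((int ^ 'n) \<Rightarrow>\<^sub>0 ('w1, 'w2) tensor) \<Rightarrow> ((int ^ 'n) \<Rightarrow>\<^sub>0 ('w1, 'm) tensor)" where
  "J = pm_map (tmap (\<lambda>v. v) \<iota>)"

lemma J_linear: "clinear J"
  unfolding J_def by (rule pm_map_linear[OF tmap_linear[OF clinear_ident \<iota>_linear]])

lemma J_single: "J (single k v) = single k (tmap (\<lambda>v. v) \<iota> v)"
  unfolding J_def by (rule pm_map_single[OF tmap_linear[OF clinear_ident \<iota>_linear]])

lemma J_inj: "J g = 0 \<Longrightarrow> g = 0"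
proof (rule poly_mapping_eqI)
  fix k assume "J g = 0"
  then have z: "tmap (\<lambda>v. v) \<iota> (lookup g k) = 0"
    using lookup_pm_map[OF tmap_linear[OF clinear_ident \<iota>_linear], of g k] by (simp add: J_def)
  have "inj \<iota>" using cvp.linear_inj_iff_eq_0[OF \<iota>_linear] \<iota>_inj by blast
  then obtain r where r: "clinear r" "r \<circ> \<iota> = id" using cvp.linear_injective_left_inverse[OF \<iota>_linear] by blast
  have "tmap (\<lambda>v. v) r (tmap (\<lambda>v. v) \<iota> (lookup g k)) = tmap (\<lambda>v. v) (\<lambda>x. r (\<iota> x)) (lookup g k)"
    by (rule tmap_comp[OF clinear_ident r(1) clinear_ident \<iota>_linear])
  also have "(\<lambda>x. r (\<iota> x)) = (\<lambda>v. v)" using r(2) by (simp add: fun_eq_iff)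
  also have "tmap (\<lambda>v. v) (\<lambda>v. v) (lookup g k) = lookup g k"
    by (rule tensor_linear_eqI[OF tmap_linear[OF clinear_ident clinear_ident] clinear_ident])
      (simp add: tmap_tensor[OF clinear_ident clinear_ident])
  finally show "lookup g k = lookup 0 k"
    by (simp add: z clinear_0[OF tmap_linear[OF clinear_ident r(1)]])
qed

lemma J_image: "g \<in> T' \<Longrightarrow> J g \<in> S'"
proof -
  assume g: "g \<in> T'"
  show "J g \<in> S'"
  proof (rule span_map_into[OF J_linear tensor_space_subspace])
    show "g \<in> cv.span {single k (v1 \<otimes>\<^sub>t v2) |k v1 v2. v2 \<in> gr2 (lam A k)}" using g by (simp add: tensor_space_span)
    fix s assume "s \<in> {single k ((v1 :: 'w1) \<otimes>\<^sub>t v2) |k v1 v2. v2 \<in> gr2 (lam A k)}"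
    then obtain k and v1 :: 'w1 and v2 where s: "s = single k (v1 \<otimes>\<^sub>t v2)" "v2 \<in> gr2 (lam A k)" by blast
    then have "J s = single k (v1 \<otimes>\<^sub>t \<iota> v2)" by (simp add: J_single tmap_tensor[OF clinear_ident \<iota>_linear])
    then show "J s \<in> S'" unfolding tensor_space_span using \<iota>_gr[OF s(2)] by (intro cv.span_base) blast
  qed
qed

lemma loop_upper_zero: "Y \<in> eig A (emb l) \<Longrightarrow> (\<And>h. h \<in> H \<Longrightarrow> br h Y = 0) \<Longrightarrow> loop_elt Y (emb l) \<in> tau_upper_zero A"
  using loop_tau_zero by (simp add: tau_upper_zero_def bracket_H mono_simps)

lemma KD_upper_zero: "emb r \<in> Gam A \<Longrightarrow> K_mono (emb r) c \<in> tau_upper_zero A"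
  "emb r \<in> Gam A \<Longrightarrow> D_mono (emb r) c \<in> tau_upper_zero A"
proof -
  assume "emb r \<in> Gam A"
  then have "K_mono (emb r) c \<in> tau_zero A" "D_mono (emb r) c \<in> tau_zero A"
    unfolding tau_zero_span using monos_degI(2,3)[of "emb r" c] by (auto intro!: cv.span_base)
  then show "K_mono (emb r) c \<in> tau_upper_zero A" "D_mono (emb r) c \<in> tau_upper_zero A"
    by (simp_all add: tau_upper_zero_def bracket_H)
qed

lemma circI: "Y \<in> eig A (emb l) \<Longrightarrow> (\<And>h. h \<in> H \<Longrightarrow> br h Y = 0) \<Longrightarrow> Y \<in> g_circ A"
  using eig_g_sigma0[of Y "emb l"] by (simp add: g_circ_def)

lemma act2_zero: "act2 0 w = 0"
proof -
  have "0 \<in> g_circ A" by (simp add: g_circ_def br_simps cv.subspace_0[OF g_sigma0_subspace])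
  then show ?thesis by (rule clinear_zero[OF act2_linear_left])
qed

lemma taT_loop: "Y \<in> g_circ A \<Longrightarrow> taT (loop_elt Y (emb l)) (single k v) = single (k + l) (tmap (\<lambda>v. v) (act2 Y) v)"
  by (rule tensor_act_loop_single[of act2 Y, OF act2_linear]) (auto simp: act2_zero)

lemma taT_linear: "clinear (taT (loop_elt Y k))" if "Y \<in> g_circ A"
  unfolding loop_elt_def by (rule tensor_act_linear[OF tm.act1_linear(1)]) (use act2_linear[OF that] in \<open>auto split: if_splits\<close>)

lemma taT_linear_KD: "clinear (taT (K_mono r c))" "clinear (taT (D_mono r c))"
  unfolding K_mono_def D_mono_def by (rule tensor_act_linear[OF tm.act1_linear(1)]; simp)+

lemma J_equivariant:
  assumes X: "X \<in> tau_upper_zero A" and g: "g \<in> T'"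
  shows "J (taT X g) = ta X (J g)"
proof -
  let ?S = "{loop_elt Y (emb l) |Y l. Y \<in> eig A (emb l) \<and> (\<forall>h\<in>H. br h Y = 0)} \<union>
     {K_mono (emb r) c |r c. emb r \<in> Gam A} \<union> {D_mono (emb r) c |r c. emb r \<in> Gam A}"
  have S: "?S \<subseteq> tau_upper_zero A" using loop_upper_zero KD_upper_zero by blast
  have lin: "clinear_on (tau_upper_zero A) (\<lambda>X. J (taT X g) - ta X (J g))"
  proof -
    have "clinear_on (tau_upper_zero A) (\<lambda>X. taT X g)" using T'_mod g by (simp add: lie_module_on_def)
    moreover have "clinear_on (tau_zero A) (\<lambda>X. ta X (J g))" using tm.ta_module by (simp add: lie_module_on_def)
    ultimately show ?thesis
      unfolding clinear_on_def tau_upper_zero_def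
      by (simp add: clinear_add[OF J_linear] clinear_scale[OF J_linear] cv.scale_right_diff_distrib)
  qed
  have "J (taT X g) - ta X (J g) \<in> {0}"
  proof (rule act_span_into[where L = "tau_upper_zero A" and act = "\<lambda>X g. J (taT X g) - ta X (J g)" and v = g,
        OF lin tau_upper_zero_subspace S cv.subspace_single_0])
    show "X \<in> cv.span ?S" using tau_upper_zero_span X by blast
    fix s assume s: "s \<in> ?S"
    then have "s \<in> tau_upper_zero A" using S by (rule subsetD[rotated])
    then have s0: "s \<in> tau_zero A" by (simp add: tau_upper_zero_def)
    have linL: "clinear (taT s)" using s taT_linear taT_linear_KD circI by blast
    have "J (taT s g) = ta s (J g)"
    proof (rule clinear_eq_on_span[OF clinear_comp[OF J_linear linL] clinear_comp[OF tm.ta_linear[OF s0] J_linear] _ poly_mapping_span])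
      fix u assume "u \<in> {single (k :: int ^ 'n) (v :: ('w1, 'w2) tensor) |k v. True}"
      then obtain k :: "int ^ 'n" and v :: "('w1, 'w2) tensor" where u: "u = single k v" by blast
      from s consider Y l where "s = loop_elt Y (emb l)" "Y \<in> eig A (emb l)" "\<forall>h\<in>H. br h Y = 0"
        | r c where "s = K_mono (emb r) c" | r c where "s = D_mono (emb r) c" by blast
      then show "J (taT s u) = ta s (J u)"
      proof cases
        case (1 Y l)
        have Y: "Y \<in> g_circ A" using circI 1 by blast
        then have Y0: "Y \<in> g_sigma0 A" using g_circ_sigma0 by blast
        have "(\<lambda>x. \<iota> (act2 Y x)) = (\<lambda>x. act2s Y (\<iota> x))" using \<iota>_circ[OF Y] by simp
        then show ?thesis
          by (simp add: u 1(1) taT_loop[OF Y] tm.ta_loop[OF Y0] J_single tmap_comp clinear_ident \<iota>_linear act2_linear[OF Y] act2s_linear[OF Y0])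
      next
        case (2 r c)
        then show ?thesis
          by (simp add: u tensor_act_K_mono J_single clinear_scale[OF tmap_linear[OF clinear_ident \<iota>_linear]])
      next
        case (3 r c)
        note l = tmap_linear[OF clinear_ident \<iota>_linear]
        have "tmap (\<lambda>v. v) \<iota> (tmap (act1 (Bmat r c)) (\<lambda>v. v) v) = tmap (act1 (Bmat r c)) (\<lambda>v. v) (tmap (\<lambda>v. v) \<iota> v)"
          by (simp add: tmap_comp clinear_ident \<iota>_linear tm.act1_linear)
        then show ?thesis
          by (simp add: u 3 tensor_act_D_mono[OF tm.act1_linear] J_single clinear_scale[OF l] clinear_add[OF l])
      qed
    qed
    then show "J (taT s g) - ta s (J g) \<in> {0}" by simp
  qed
  then show ?thesis by simp
qed

text \<open>The positive part of \<open>\<gg>(\<sigma>\<^sub>0)\<close> kills the image of \<open>W\<^sub>2\<close>.\<close>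

lemma J_raising:
  assumes "X \<in> raising"
  shows "ta X (J g) = 0"
proof -
  obtain Y l \<eta> where Y: "X = loop_elt Y (emb l)" "Y \<in> eig A (emb l)" "Y \<in> wspace \<eta>" "\<eta> \<in> P"
    using assms by (auto simp: raising_def)
  have Y0: "Y \<in> g_sigma0 A" using eig_g_sigma0[OF Y(2)] by simp
  have X0: "X \<in> tau_zero A" using assms raising_tau_zero by blast
  have z: "(\<lambda>x. act2s Y (\<iota> x)) = (\<lambda>x. 0)" using \<iota>_plus[OF weight_vector_plus[OF Y0 Y(3,4)] Y0] by simp
  show ?thesis
  proof (rule clinear_eq_on_span[OF clinear_comp[OF tm.ta_linear[OF X0] J_linear] clinear_zero_map _ poly_mapping_span])
    fix u assume "u \<in> {single (k :: int ^ 'n) (v :: ('w1, 'w2) tensor) |k v. True}"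
    then obtain k :: "int ^ 'n" and v :: "('w1, 'w2) tensor" where u: "u = single k v" by blast
    have "tmap (\<lambda>v. v) (act2s Y) (tmap (\<lambda>v. v) \<iota> v) = tmap (\<lambda>v. v) (\<lambda>x. 0) v"
      by (simp add: tmap_comp clinear_ident \<iota>_linear act2s_linear[OF Y0] z)
    also have "\<dots> = 0"
      by (rule tensor_linear_eqI[OF tmap_linear[OF clinear_ident clinear_zero_map] clinear_zero_map])
        (simp add: tmap_tensor[OF clinear_ident clinear_zero_map])
    finally show "ta X (J u) = 0" by (simp add: u Y(1) tm.ta_loop[OF Y0] J_single)
  qed
qed

subsection \<open>The vectors of the two modules killed by the positive part\<close>

lemma T_subspace: "cv.subspace T" using T_mod by (simp add: lie_module_on_def)

lemma T_stable: "X \<in> tau_upper_zero A \<Longrightarrow> t \<in> T \<Longrightarrow> actV X t \<in> T"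
  using T_mod by (simp add: lie_module_on_def)

lemma T_S: "T \<subseteq> S"
  unfolding T_def S_def using tau_plus_upper_plus by blast

lemma f_T: "t \<in> T \<Longrightarrow> f t \<in> T'" using f_bij by (auto simp: bij_betw_def)

lemma f_inj: "t \<in> T \<Longrightarrow> u \<in> T \<Longrightarrow> f t = f u \<Longrightarrow> t = u"
  using f_bij by (auto simp: bij_betw_def inj_on_def)

lemma f_scale: "t \<in> T \<Longrightarrow> f (c *\<^sub>C t) = c *\<^sub>C f t" using f_linear by (simp add: clinear_on_def)

lemma f_zero: "f 0 = 0" by (rule clinear_zero[OF f_linear cv.subspace_0[OF T_subspace]])

abbreviation e where "e \<equiv> loop_elt h0 (emb 0) :: ('g, 'n) toroidal"

lemma e_upper_zero: "e \<in> tau_upper_zero A"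
  using loop_upper_zero[of h0 0] H_eig0[OF h0(1)] H_abelian[OF _ h0(1)] by (simp flip: zero_emb)

lemma e_zero: "e \<in> tau_zero A" using e_upper_zero by (simp add: tau_upper_zero_def)

text \<open>As \<open>h0\<close> acts on \<open>W\<^sub>2\<close> by a scalar, \<open>T'\<close> and with it \<open>T\<close> belong to a single eigenvalue of \<open>h0\<close>.\<close>

lemma taT_e: "taT e g = wt0 *\<^sub>C g"
proof (rule clinear_eq_on_span[OF taT_linear[OF h0_circ] clinear_scaled[OF clinear_ident] _ poly_mapping_span])
  fix u assume "u \<in> {single (k :: int ^ 'n) (v :: ('w1, 'w2) tensor) |k v. True}"
  then obtain k :: "int ^ 'n" and v :: "('w1, 'w2) tensor" where u: "u = single k v" by blast
  have "tmap (\<lambda>v. v) (act2 h0) v = wt0 *\<^sub>C v"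
    by (rule tensor_linear_eqI[OF tmap_linear[OF clinear_ident act2_linear[OF h0_circ]] clinear_scaled[OF clinear_ident]])
      (simp add: tmap_tensor[OF clinear_ident act2_linear[OF h0_circ]] wt0 tensor_linear)
  then show "taT e u = wt0 *\<^sub>C u" by (simp add: u taT_loop[OF h0_circ] scaleC_single)
qed

lemma e_T: "t \<in> T \<Longrightarrow> actV e t = wt0 *\<^sub>C t"
  by (rule f_inj) (simp_all add: T_stable e_upper_zero cv.subspace_scale[OF T_subspace] f_equivariant taT_e f_scale)

lemma d0_eq: "d0 = D_mono (emb 0) (axis None 1)"
  by (simp add: d_elt_mono flip: zero_emb)

lemma d0_upper_zero: "d0 \<in> tau_upper_zero A"
  unfolding d0_eq by (rule KD_upper_zero(2)) (simp add: Gam_zero flip: zero_emb)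

lemma taT_d0: "taT d0 g = d *\<^sub>C g"
proof (rule clinear_eq_on_span[OF taT_linear_KD(2)[of "emb 0" "axis None 1", folded d0_eq] clinear_scaled[OF clinear_ident] _ poly_mapping_span])
  fix u assume "u \<in> {single (k :: int ^ 'n) (v :: ('w1, 'w2) tensor) |k v. True}"
  then obtain k :: "int ^ 'n" and v :: "('w1, 'w2) tensor" where u: "u = single k v" by blast
  have ax: "axis (None :: 'n option) (1 :: complex) $ Some i = 0" "axis (None :: 'n option) (1 :: complex) $ None = 1" for i
    by (simp_all add: axis_def)
  have "Bmat 0 (axis (None :: 'n option) 1) = 0" by (simp add: Bmat_def vec_eq_iff)
  then have "tmap (act1 (Bmat 0 (axis None 1))) (\<lambda>v. v) v = 0"
    using clinear_0[OF tmap_linear_left[OF tm.act1_linear clinear_ident]] by simp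
  moreover have "scal \<alpha> d (axis None 1) k = d" by (simp add: scal_def ax)
  ultimately show "taT d0 u = d *\<^sub>C u"
    by (simp add: u d0_eq tensor_act_D_mono[OF tm.act1_linear] scaleC_single)
qed

lemma d0_T: "t \<in> T \<Longrightarrow> actV d0 t = d *\<^sub>C t"
  by (rule f_inj) (simp_all add: T_stable d0_upper_zero cv.subspace_scale[OF T_subspace] f_equivariant taT_d0 f_scale)

lemma T_nonzero: obtains t where "t \<in> T" "t \<noteq> 0"
proof -
  obtain w1 :: 'w1 where w1: "w1 \<noteq> 0" using nz1 by blast
  have "(UNIV :: 'w2 set) \<noteq> {0}" using circ_irreducible by (simp add: graded_irreducible_def)
  then have "\<exists>l. \<exists>w\<in>gr2 (lam A l). w \<noteq> 0"
  proof -
    have False if z: "\<forall>l. \<forall>w\<in>gr2 (lam A l). w = 0"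
    proof -
      have "(\<Union>l. gr2 (lam A l)) \<subseteq> {0}" using z by blast
      then have "cv.span (\<Union>l. gr2 (lam A l)) \<subseteq> {0}" by (rule cv.span_minimal[OF _ cv.subspace_single_0])
      then have "w = 0" for w :: 'w2 using gr2_span[of w] by blast
      then have "(UNIV :: 'w2 set) = {0}" by (intro equalityI subsetI) simp_all
      with \<open>(UNIV :: 'w2 set) \<noteq> {0}\<close> show False by simp
    qed
    then show ?thesis by blast
  qed
  then obtain l w where w: "w \<in> gr2 (lam A l)" "w \<noteq> 0" by blast
  have "w1 \<otimes>\<^sub>t w \<noteq> 0"
  proof
    assume z: "w1 \<otimes>\<^sub>t w = 0"
    have "cv.representation std_basis w1 b = 0" for b
    proof -
      have "contract (\<lambda>v. cv.representation std_basis v b) (w1 \<otimes>\<^sub>t w) = 0"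
        unfolding z by (rule clinear_0[OF contract(1)[OF clinear_coordinate]])
      then show ?thesis using w(2) by (simp add: contract(2)[OF clinear_coordinate])
    qed
    then have "w1 = 0" using coordinate_expansion[OF fin1, of w1] by simp
    with w1 show False by simp
  qed
  then have ne: "single l (w1 \<otimes>\<^sub>t w) \<noteq> (0 :: (int ^ 'n) \<Rightarrow>\<^sub>0 ('w1, 'w2) tensor)"
    by (metis lookup_single_eq lookup_zero)
  have "single l (w1 \<otimes>\<^sub>t w) \<in> T'" unfolding tensor_space_span using w(1) by (intro cv.span_base) blast
  moreover have "f ` T = T'" using f_bij by (simp add: bij_betw_def)
  ultimately have "single l (w1 \<otimes>\<^sub>t w) \<in> f ` T" by simp
  then obtain t where t: "t \<in> T" "single l (w1 \<otimes>\<^sub>t w) = f t" by (rule imageE) (rule that)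
  have "t \<noteq> 0"
  proof
    assume "t = 0"
    then have "f t = 0" using f_zero by simp
    with t(2) ne show False by simp
  qed
  with t(1) show ?thesis by (rule that)
qed

subsection \<open>The submodule generated by the graph\<close>

definition actP :: "('g, 'n) toroidal \<Rightarrow> 'v \<times> ((int ^ 'n) \<Rightarrow>\<^sub>0 ('w1, 'm) tensor) \<Rightarrow> 'v \<times> ((int ^ 'n) \<Rightarrow>\<^sub>0 ('w1, 'm) tensor)" where
  "actP X v = (actV X (fst v), ta X (snd v))"

definition graph where "graph = (\<lambda>t. (t, J (f t))) ` T"

text \<open>By \<open>lowered_submodule\<close> this is the \<open>\<tau>\<^sub>0\<close>-module generated by the graph of \<open>J \<circ> f\<close>. It turns out to be the
  graph of the isomorphism.\<close>

definition G where "G = cv.span (lowered lowering actP graph)"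

lemma scaleC_Pair: "c *\<^sub>C (x, y) = (c *\<^sub>C x, c *\<^sub>C y)" by (simp add: scaleC_prod_def)

lemma actP_module: "lie_module_on (bracket A) (tau_zero A) actP UNIV"
proof -
  have V: "clinear_on (tau_zero A) (\<lambda>X. actV X v)" for v
    using actV_linear_left[of v] tau_zero_tau unfolding clinear_on_def by blast
  have P: "clinear_on (tau_zero A) (\<lambda>X. ta X p)" for p using tm.ta_module by (simp add: lie_module_on_def)
  show ?thesis
    unfolding lie_module_on_def
  proof (intro conjI ballI)
    show "clinear_on UNIV (actP X)" if "X \<in> tau_zero A" for X
      unfolding clinear_on_UNIV
      by (rule clinearI) (simp_all add: actP_def clinear_add[OF tau_zero_linear[OF that]] clinear_add[OF tm.ta_linear[OF that]]
          clinear_scale[OF tau_zero_linear[OF that]] clinear_scale[OF tm.ta_linear[OF that]] scaleC_prod_def)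
    show "clinear_on (tau_zero A) (\<lambda>X. actP X v)" for v
      using V[of "fst v"] P[of "snd v"] unfolding clinear_on_def by (simp add: actP_def scaleC_Pair)
    show "actP (bracket A X Y) v = actP X (actP Y v) - actP Y (actP X v)" if "X \<in> tau_zero A" "Y \<in> tau_zero A" for X Y v
    proof -
      have "X \<in> tau A" "Y \<in> tau A" using that tau_zero_tau by blast+
      moreover have "ta (bracket A X Y) p = ta X (ta Y p) - ta Y (ta X p)" for p
        using tm.ta_module that unfolding lie_module_on_def by blast
      ultimately show ?thesis by (simp add: actP_def actV_bracket)
    qed
  qed simp_all
qed

lemma actP_linear: "X \<in> tau_zero A \<Longrightarrow> clinear (actP X)"
  using actP_module by (simp add: lie_module_on_def clinear_on_UNIV)

lemma graph_subspace: "cv.subspace graph"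
  unfolding cv.subspace_def graph_def
proof (intro conjI ballI allI)
  have "(0, 0) = (\<lambda>t. (t, J (f t))) 0" using f_zero clinear_0[OF J_linear] by simp
  then show "0 \<in> (\<lambda>t. (t, J (f t))) ` T" unfolding zero_prod_def using cv.subspace_0[OF T_subspace] by blast
  fix x y assume "x \<in> (\<lambda>t. (t, J (f t))) ` T" "y \<in> (\<lambda>t. (t, J (f t))) ` T"
  then obtain t u where tu: "x = (t, J (f t))" "t \<in> T" "y = (u, J (f u))" "u \<in> T" by blast
  have "f (t + u) = f t + f u" using f_linear tu by (simp add: clinear_on_def)
  then have "x + y = (\<lambda>t. (t, J (f t))) (t + u)" by (simp add: tu clinear_add[OF J_linear])
  then show "x + y \<in> (\<lambda>t. (t, J (f t))) ` T" using cv.subspace_add[OF T_subspace tu(2,4)] by blast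
  fix c
  have "c *\<^sub>C x = (\<lambda>t. (t, J (f t))) (c *\<^sub>C t)" by (simp add: tu f_scale clinear_scale[OF J_linear] scaleC_Pair)
  then show "c *\<^sub>C x \<in> (\<lambda>t. (t, J (f t))) ` T" using cv.subspace_scale[OF T_subspace tu(2)] by blast
qed

lemma G_subspace: "cv.subspace G" by (simp add: G_def)

lemma graph_G: "t \<in> T \<Longrightarrow> (t, J (f t)) \<in> G"
  unfolding G_def graph_def by (intro cv.span_base lowered.base) blast

lemma upper_zero_zero: "tau_upper_zero A \<subseteq> tau_zero A" by (auto simp: tau_upper_zero_def)

lemma G_stable:
  assumes "X \<in> tau_zero A" "v \<in> G"
  shows "actP X v \<in> G"
  unfolding G_def
proof (rule lowered_submodule[OF actP_module tau_zero_subspace tau_zero_bracket tau_zero_triangular lowering_tau_zero upper_zero_zero raising_tau_zero])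
  show "actP x v \<in> graph" if x: "x \<in> tau_upper_zero A" and v: "v \<in> graph" for x v
  proof -
    obtain t where t: "v = (t, J (f t))" "t \<in> T" using v by (auto simp: graph_def)
    have "actP x v = (actV x t, J (f (actV x t)))"
      by (simp add: actP_def t(1) J_equivariant[OF x f_T[OF t(2)]] f_equivariant[OF x t(2)])
    then show ?thesis using T_stable[OF x t(2)] by (auto simp: graph_def)
  qed
  show "actP x v = 0" if x: "x \<in> raising" and v: "v \<in> graph" for x v
  proof -
    obtain t where t: "v = (t, J (f t))" "t \<in> T" using v by (auto simp: graph_def)
    have "actV x t = 0" using t(2) x raising_upper_plus unfolding T_def by blast
    then show ?thesis using J_raising[OF x] by (simp add: actP_def t(1) zero_prod_def)
  qed
qed (use assms in \<open>simp_all add: G_def\<close>)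

text \<open>No further vector of \<open>G\<close> has the top eigenvalue, as \<open>h0\<close> is positive on the positive roots.\<close>

lemma G_top:
  assumes "v \<in> G" "actP e v = wt0 *\<^sub>C v"
  shows "v \<in> graph"
proof (rule lowered_top(1)[OF actP_module lowering_tau_zero e_zero graph_subspace _ _ assms(1)[unfolded G_def] assms(2)])
  show "actP e v = wt0 *\<^sub>C v" if v: "v \<in> graph" for v
  proof -
    obtain t where t: "v = (t, J (f t))" "t \<in> T" using v by (auto simp: graph_def)
    have "ta e (J (f t)) = wt0 *\<^sub>C J (f t)"
      using J_equivariant[OF e_upper_zero f_T[OF t(2)]] by (simp add: taT_e clinear_scale[OF J_linear])
    then show ?thesis by (simp add: actP_def t(1) e_T[OF t(2)] scaleC_Pair)
  qed
  show "\<exists>r::real. r > 0 \<and> bracket A e y = - of_real r *\<^sub>C y" if y: "y \<in> lowering" for y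
  proof -
    obtain X l \<eta> where X: "y = loop_elt X (emb l)" "X \<in> wspace \<eta>" "\<eta> \<in> W" "- \<eta> \<in> P" using y by (auto simp: lowering_def)
    obtain r :: real where r: "r > 0" "(- \<eta>) h0 = of_real r" using h0(2)[OF X(4)] by blast
    have "\<eta> h0 = - of_real r" using r(2) by (simp add: minus_equation_iff)
    then have "br h0 X = - of_real r *\<^sub>C X" using H_diagonal[OF h0(1) X(2) W_dual[OF X(3)]] by simp
    moreover have "bracket A e y = loop_elt (br h0 X) (emb l)"
      unfolding X(1) zero_emb[symmetric] by (rule bracket_H(1))
    ultimately have "bracket A e y = - of_real r *\<^sub>C y" by (simp only: X(1) clinear_scale[OF mono_linear(1)])
    with r(1) show ?thesis by blast
  qed
qed

lemma G_subset: "G \<subseteq> S \<times> S'"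
  unfolding G_def
proof (rule span_lowered_subset)
  show "clinear (actP y)" if "y \<in> lowering" for y using that lowering_tau_zero actP_linear by blast
  show "cv.subspace (S \<times> S')"
    using S_subspace tensor_space_subspace[of A gr2s] unfolding cv.subspace_def by (auto simp: zero_prod_def scaleC_prod_def)
  show "graph \<subseteq> S \<times> S'" using T_S J_image[OF f_T] by (auto simp: graph_def)
  show "actP y v \<in> S \<times> S'" if y: "y \<in> lowering" and v: "v \<in> S \<times> S'" for y v
  proof -
    have "y \<in> tau_zero A" using y lowering_tau_zero by blast
    then show ?thesis using v S_stable tm.ta_tensor_space[OF sigma_graded] by (simp add: actP_def mem_Times_iff del: tensor_act.simps)
  qed
qed

lemma subspace_fst_image: "cv.subspace (fst ` G)" and subspace_snd_image: "cv.subspace (snd ` G)"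
  by (rule cvp.linear_subspace_image[OF clinearI G_subspace]; simp add: scaleC_prod_def)+

text \<open>The projection is a nonzero submodule of the irreducible module \<open>S\<close>.\<close>

lemma fst_G: "fst ` G = S"
proof
  show "fst ` G \<subseteq> S" using G_subset by auto
  obtain t where t: "t \<in> T" "t \<noteq> 0" by (rule T_nonzero)
  show "S \<subseteq> fst ` G"
  proof (rule S_irreducible[of t d t])
    show "t \<in> S" using t(1) T_S by blast
    then show "t \<in> S" .
    show "t \<in> fst ` G" using graph_G[OF t(1)] by force
    show "actV X v \<in> fst ` G" if X: "X \<in> tau_zero A" and v: "v \<in> fst ` G" for X v
    proof -
      obtain p where "(v, p) \<in> G" using v by auto
      then have "actP X (v, p) \<in> G" by (rule G_stable[OF X])
      then show ?thesis by (force simp: actP_def)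
    qed
  qed (use t d0_T subspace_fst_image in auto)
qed

text \<open>The tensor module is generated by the image of \<open>J\<close>, since \<open>W\<^sub>2(\<sigma>\<^sub>0)\<close> is generated by \<open>W\<^sub>2\<close>
  and \<open>X \<otimes> t\<^sup>l\<close> reaches every exponent in the right coset.\<close>

lemma snd_G: "snd ` G = S'"
proof
  let ?Q = "snd ` G"
  show "?Q \<subseteq> S'" using G_subset by auto
  have Q_stable: "ta X p \<in> ?Q" if X: "X \<in> tau_zero A" and p: "p \<in> ?Q" for X p
  proof -
    obtain v where "(v, p) \<in> G" using p by auto
    then have "actP X (v, p) \<in> G" by (rule G_stable[OF X])
    then show ?thesis by (force simp: actP_def)
  qed
  have J_Q: "J g \<in> ?Q" if "g \<in> T'" for g
  proof -
    have "g \<in> f ` T" using that f_bij by (simp add: bij_betw_def)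
    then obtain t where t: "g = f t" "t \<in> T" by (rule imageE) (rule that)
    show ?thesis unfolding t(1) by (rule image_eqI[OF _ graph_G[OF t(2)]]) simp
  qed
  have prod: "single k (v \<otimes>\<^sub>t foldr act2s p (\<iota> w)) \<in> ?Q"
    if "list_all2 (\<lambda>k x. x \<in> homog A (g_sigma0 A) k) ks p" "w \<in> gr2 (lam A l)" "lam A k = lam A (sum_list ks + l)" for ks p w l k and v :: 'w1
    using that(1,3)
  proof (induction arbitrary: k rule: list_all2_induct)
    case Nil
    have "w \<in> gr2 (lam A k)" using that(2) Nil by simp
    then have "single k (v \<otimes>\<^sub>t w) \<in> T'" unfolding tensor_space_span by (intro cv.span_base) blast
    from J_Q[OF this] show ?case by (simp add: J_single tmap_tensor[OF clinear_ident \<iota>_linear])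
  next
    case (Cons k1 ks x p)
    have "lam A (k1 + (k - k1)) = lam A (k1 + (sum_list ks + l))" using Cons.prems by (simp add: add.assoc)
    then have "lam A (k - k1) = lam A (sum_list ks + l)" using lam_add_cancel by blast
    then have "single (k - k1) (v \<otimes>\<^sub>t foldr act2s p (\<iota> w)) \<in> ?Q" by (rule Cons.IH)
    then have "ta (loop_elt x (emb k1)) (single (k - k1) (v \<otimes>\<^sub>t foldr act2s p (\<iota> w))) \<in> ?Q"
      using Cons.hyps(1) by (intro Q_stable loop_tau_zero) (simp_all add: eig_emb_homog)
    moreover have "x \<in> g_sigma0 A" by (rule homog_sigma0[OF Cons.hyps(1)])
    ultimately show ?case
      by (simp add: tm.ta_loop tmap_tensor[OF clinear_ident act2s_linear])
  qed
  show "S' \<subseteq> ?Q"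
    unfolding tensor_space_span
  proof (rule cv.span_minimal[OF _ subspace_snd_image], rule subsetI)
    fix s assume "s \<in> {single k ((v :: 'w1) \<otimes>\<^sub>t m) |k v m. m \<in> gr2s (lam A k)}"
    then obtain k and v :: 'w1 and m where s: "s = single k (v \<otimes>\<^sub>t m)" "m \<in> gr2s (lam A k)" by blast
    have lin: "clinear (\<lambda>m. single k (v \<otimes>\<^sub>t m))" by (rule clinear_single[OF tensor_clinear(2)])
    show "s \<in> ?Q"
      unfolding s(1)
    proof (rule span_map_into[OF lin subspace_snd_image _ gr2s_products[OF s(2)]])
      fix b assume b: "b \<in> products \<inter> gr2s (lam A k)"
      then obtain p ks l w where p: "b = foldr act2s p (\<iota> w)" "list_all2 (\<lambda>k x. x \<in> homog A (g_sigma0 A) k) ks p" "w \<in> gr2 (lam A l)"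
        unfolding products_def by blast
      show "single k (v \<otimes>\<^sub>t b) \<in> ?Q"
      proof (cases "lam A k = lam A (sum_list ks + l)")
        case True
        then show ?thesis unfolding p(1) by (rule prod[OF p(2,3)])
      next
        case False
        have "b \<in> gr2s (lam A (sum_list ks + l))" unfolding p(1) by (rule products_graded[OF p(2) \<iota>_gr[OF p(3)]])
        then have "b = 0" using gr_zero[OF False] b by blast
        then show ?thesis using cv.subspace_0[OF subspace_snd_image] by simp
      qed
    qed
  qed
qed

text \<open>Otherwise \<open>S \<times> {0} \<subseteq> G\<close> by irreducibility of \<open>S\<close>. But for \<open>0 \<noteq> t \<in> T\<close> the pair \<open>(t, 0)\<close> has the top
  eigenvalue and does not lie on the graph.\<close>

lemma G_left_zero:
  assumes "(v, 0) \<in> G"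
  shows "v = 0"
proof (rule ccontr)
  assume "v \<noteq> 0"
  let ?N = "{v. (v, 0) \<in> G}"
  obtain t where t: "t \<in> T" "t \<noteq> 0" by (rule T_nonzero)
  have tS: "t \<in> S" using t(1) T_S by blast
  have vS: "v \<in> S" using assms G_subset by auto
  have "S \<subseteq> ?N"
  proof (rule S_irreducible[OF tS t(2) d0_T[OF t(1)] vS \<open>v \<noteq> 0\<close>])
    show "v \<in> ?N" using assms by simp
    show "cv.subspace ?N"
    proof (rule subspace_Collect_linear[of "\<lambda>v. (v, 0)", OF _ G_subspace])
      show "clinear (\<lambda>v :: 'v. (v, 0 :: (int ^ 'n) \<Rightarrow>\<^sub>0 ('w1, 'm) tensor))" by (rule clinearI) (simp_all add: scaleC_Pair)
    qed
    show "actV X u \<in> ?N" if "X \<in> tau_zero A" "u \<in> ?N" for X u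
      using G_stable[OF that(1), of "(u, 0)"] that clinear_0[OF tm.ta_linear[OF that(1)]] by (simp add: actP_def)
  qed
  then have "(t, 0) \<in> G" using tS by blast
  moreover have "actP e (t, 0) = wt0 *\<^sub>C (t, 0)"
    using e_T[OF t(1)] clinear_0[OF tm.ta_linear[OF e_zero]] by (simp add: actP_def scaleC_Pair)
  ultimately have "(t, 0) \<in> graph" by (rule G_top)
  then have "J (f t) = 0" by (auto simp: graph_def)
  then have "f t = f 0" using J_inj f_zero by simp
  then have "t = 0" by (rule f_inj[OF t(1) cv.subspace_0[OF T_subspace]])
  with t(2) show False by simp
qed

lemma tensor_eigenvectors: "(p :: (int ^ 'n) \<Rightarrow>\<^sub>0 ('w1, 'm) tensor) \<in> cv.span {v. \<exists>d\<in>UNIV. ta e v = d *\<^sub>C v}"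
proof -
  let ?E = "cv.span {v :: (int ^ 'n) \<Rightarrow>\<^sub>0 ('w1, 'm) tensor. \<exists>d\<in>UNIV. ta e v = d *\<^sub>C v}"
  have pure: "single k (x \<otimes>\<^sub>t y) \<in> ?E" for k and x :: 'w1 and y
  proof (rule span_map_into[of "\<lambda>y. single k (x \<otimes>\<^sub>t y)", OF clinear_single[OF tensor_clinear(2)] cv.subspace_span _ sigma_eigenvectors])
    fix m assume "m \<in> {v. \<exists>d\<in>UNIV. act2s h0 v = d *\<^sub>C v}"
    then obtain c where "act2s h0 m = c *\<^sub>C m" by blast
    then have "ta e (single k (x \<otimes>\<^sub>t m)) = c *\<^sub>C single k (x \<otimes>\<^sub>t m)"
      by (simp add: tm.ta_loop[OF h0_sigma0] tmap_tensor[OF clinear_ident act2s_linear[OF h0_sigma0]] tensor_linear scaleC_single)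
    then show "single k (x \<otimes>\<^sub>t m) \<in> ?E" by (intro cv.span_base) blast
  qed
  have elementary: "single k v \<in> ?E" for k :: "int ^ 'n" and v :: "('w1, 'm) tensor"
  proof (rule span_map_into[OF clinear_single[OF clinear_ident] cv.subspace_span _ tensor_span])
    fix s assume "s \<in> {x \<otimes>\<^sub>t y |(x :: 'w1) (y :: 'm). True}"
    then obtain x :: 'w1 and y :: 'm where "s = x \<otimes>\<^sub>t y" by auto
    then show "single k s \<in> ?E" using pure by simp
  qed
  show ?thesis
  proof (rule span_map_into[OF clinear_ident cv.subspace_span _ poly_mapping_span])
    fix s assume "s \<in> {single (k :: int ^ 'n) (v :: ('w1, 'm) tensor) |k v. True}"
    then obtain k :: "int ^ 'n" and v :: "('w1, 'm) tensor" where "s = single k v" by auto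
    then show "s \<in> ?E" using elementary by simp
  qed
qed

lemma contract_ta:
  assumes "clinear \<phi>" "X \<in> homog A (g_sigma0 A) l"
  shows "contract \<phi> (lookup (ta (loop_elt X (emb l)) p) (k + l)) = act2s X (contract \<phi> (lookup p k))"
proof -
  have X: "X \<in> g_sigma0 A" "loop_elt X (emb l) \<in> tau_zero A"
    using assms(2) loop_tau_zero homog_sigma0 by (auto simp: eig_emb_homog)
  have look: "clinear (\<lambda>p :: (int ^ 'n) \<Rightarrow>\<^sub>0 ('w1, 'm) tensor. lookup p j)" for j
    by (rule clinearI) (simp_all add: lookup_add lookup_scaleC)
  have "lookup (ta (loop_elt X (emb l)) p) (k + l) = tmap (\<lambda>v. v) (act2s X) (lookup p k)"
  proof (rule clinear_eq_on_span[OF clinear_comp[OF look tm.ta_linear[OF X(2)]]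
        clinear_comp[OF tmap_linear[OF clinear_ident act2s_linear[OF X(1)]] look] _ poly_mapping_span])
    fix s assume "s \<in> {single (k :: int ^ 'n) (v :: ('w1, 'm) tensor) |k v. True}"
    then obtain j :: "int ^ 'n" and v :: "('w1, 'm) tensor" where s: "s = single j v" by blast
    show "lookup (ta (loop_elt X (emb l)) s) (k + l) = tmap (\<lambda>v. v) (act2s X) (lookup s k)"
      by (simp add: s tm.ta_loop[OF X(1)] lookup_single when_def clinear_0[OF tmap_linear[OF clinear_ident act2s_linear[OF X(1)]]])
  qed
  then show ?thesis by (simp add: contract_tmap[OF assms(1) act2s_linear[OF X(1)]])
qed

text \<open>The vectors \<open>p\<close> with \<open>(0, p) \<in> G\<close> form a submodule without vectors of the top eigenvalue of \<open>h0\<close>, as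
  \<open>(0, p)\<close> lies on the graph only for \<open>p = 0\<close>. Contracting a nonzero \<open>p\<close> gives a nonzero vector of \<open>W\<^sub>2(\<sigma>\<^sub>0)\<close>.
  By \<open>reaches_top\<close> some product of elements of \<open>\<gg>(\<sigma>\<^sub>0)\<close> moves it out of the lower eigenvalues, so the same
  product of loop elements applied to \<open>p\<close> has a nonzero component of the top eigenvalue.\<close>

lemma G_right_zero:
  assumes p: "(0, p) \<in> G"
  shows "p = 0"
proof (rule ccontr)
  assume "p \<noteq> 0"
  let ?N = "{p. (0, p) \<in> G}"
  have N_sub: "cv.subspace ?N"
  proof (rule subspace_Collect_linear[of "\<lambda>p. (0, p)", OF _ G_subspace])
    show "clinear (\<lambda>p :: (int ^ 'n) \<Rightarrow>\<^sub>0 ('w1, 'm) tensor. (0 :: 'v, p))" by (rule clinearI) (simp_all add: scaleC_Pair)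
  qed
  have N_stable: "ta X u \<in> ?N" if "X \<in> tau_zero A" "u \<in> ?N" for X u
    using G_stable[OF that(1), of "(0, u)"] that clinear_0[OF tau_zero_linear[OF that(1)]] by (simp add: actP_def)
  obtain k where "lookup p k \<noteq> 0" using \<open>p \<noteq> 0\<close> by (auto simp: poly_mapping_eq_iff fun_eq_iff)
  then obtain \<phi> where \<phi>: "clinear \<phi>" "contract \<phi> (lookup p k) \<noteq> 0" by (rule contract_nonzero[OF fin1])
  obtain q ks where q: "list_all2 (\<lambda>k x. x \<in> homog A (g_sigma0 A) k) ks q" "foldr act2s q (contract \<phi> (lookup p k)) \<notin> below"
    by (rule reaches_top[OF \<phi>(2)])
  have "\<exists>u\<in>?N. \<exists>j. contract \<phi> (lookup u j) = foldr act2s q (contract \<phi> (lookup p k))"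
    using q(1)
  proof (induction rule: list_all2_induct)
    case Nil
    show ?case using p by (intro bexI[of _ p] exI[of _ k]) simp_all
  next
    case (Cons l ks x q)
    then obtain u j where u: "u \<in> ?N" "contract \<phi> (lookup u j) = foldr act2s q (contract \<phi> (lookup p k))" by blast
    have "ta (loop_elt x (emb l)) u \<in> ?N"
      by (rule N_stable[OF loop_tau_zero u(1)]) (use Cons.hyps(1) in \<open>simp add: eig_emb_homog\<close>)
    moreover have "contract \<phi> (lookup (ta (loop_elt x (emb l)) u) (j + l)) = foldr act2s (x # q) (contract \<phi> (lookup p k))"
      using contract_ta[OF \<phi>(1) Cons.hyps(1), of u j] u(2) by simp
    ultimately show ?case by blast
  qed
  then obtain u j where u: "u \<in> ?N" "contract \<phi> (lookup u j) = foldr act2s q (contract \<phi> (lookup p k))" by blast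
  have u_top: "contract \<phi> (lookup u j) \<notin> below" unfolding u(2) by (rule q(2))
  note lin = tm.ta_linear[OF e_zero]
  obtain F y where F: "finite F" "\<And>c. c \<in> F \<Longrightarrow> ta e (y c) = c *\<^sub>C y c" "u = (\<Sum>c\<in>F. y c)"
    by (rule span_eigenvectors_decomposition[OF lin tensor_eigenvectors[of u]]) blast
  have "y wt0 = 0" if "wt0 \<in> F"
  proof -
    have "y wt0 \<in> ?N"
      by (rule eigencomponents_in_invariant_subspace[OF lin N_sub N_stable[OF e_zero] F(1,2) _ that])
        (use u(1) F(3) in auto)
    then have "(0, y wt0) \<in> G" by simp
    moreover have "actP e (0, y wt0) = wt0 *\<^sub>C (0, y wt0)"
      using F(2)[OF that] clinear_0[OF tau_zero_linear[OF e_zero]] by (simp add: actP_def scaleC_Pair)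
    ultimately have "(0, y wt0) \<in> graph" by (rule G_top)
    then show ?thesis using f_zero clinear_0[OF J_linear] by (auto simp: graph_def)
  qed
  then obtain w where w: "u = ta e w - wt0 *\<^sub>C w"
    using range_shift_of_eigenvectors[OF lin F(1,2)] F(3) by metis
  have "contract \<phi> (lookup (ta e w) j) = act2s h0 (contract \<phi> (lookup w j))"
    using contract_ta[OF \<phi>(1) h0_homog, of w j] by simp
  then have "contract \<phi> (lookup u j) = act2s h0 (contract \<phi> (lookup w j)) - wt0 *\<^sub>C contract \<phi> (lookup w j)"
    by (simp add: w lookup_minus lookup_scaleC clinear_diff[OF contract(1)[OF \<phi>(1)]] clinear_scale[OF contract(1)[OF \<phi>(1)]])
  then have "contract \<phi> (lookup u j) \<in> below" by (auto simp: below_def)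
  with u_top show False by contradiction
qed

text \<open>So \<open>G\<close> projects bijectively onto both factors, and it is the graph of an isomorphism.\<close>

theorem S_isomorphic: "lie_module_iso (bracket A) (tau_zero A) actV S ta S'"
  unfolding lie_module_iso_def
proof (intro conjI)
  have V0: "lie_module_on (bracket A) (tau_zero A) actV UNIV"
    by (rule lie_module_on_subset[OF V_module tau_zero_tau])
  show "lie_module_on (bracket A) (tau_zero A) actV S"
    by (rule lie_module_on_subspace[OF V0 S_subspace S_stable])
  show "lie_module_on (bracket A) (tau_zero A) ta S'"
    by (rule tm.ta_tensor_space_module[OF sigma_graded])
  have "\<exists>p. (v, p) \<in> G" if "v \<in> S" for v using that fst_G by force
  then obtain F where F: "\<And>v. v \<in> S \<Longrightarrow> (v, F v) \<in> G" by metis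
  have uniq: "p = q" if "(v, p) \<in> G" "(v, q) \<in> G" for v p q
  proof -
    have "(0, p - q) \<in> G" using cv.subspace_diff[OF G_subspace that] by simp
    then show ?thesis using G_right_zero by fastforce
  qed
  have F_eq: "F v = p" if "(v, p) \<in> G" for v p
    using uniq[OF F that] that G_subset by blast
  have "bij_betw F S S'"
    unfolding bij_betw_def
  proof
    show "inj_on F S"
    proof (rule inj_onI)
      fix u v assume uv: "u \<in> S" "v \<in> S" "F u = F v"
      have "(u - v, 0) \<in> G" using cv.subspace_diff[OF G_subspace F[OF uv(1)] F[OF uv(2)]] uv(3) by simp
      then have "u - v = 0" by (rule G_left_zero)
      then show "u = v" by simp
    qed
    show "F ` S = S'"
    proof
      show "F ` S \<subseteq> S'" using F G_subset by auto
      show "S' \<subseteq> F ` S"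
      proof
        fix p assume "p \<in> S'"
        then obtain v where v: "(v, p) \<in> G" using snd_G by force
        then have "v \<in> S" using G_subset by auto
        then show "p \<in> F ` S" using F_eq[OF v] by blast
      qed
    qed
  qed
  moreover have "clinear_on S F"
    unfolding clinear_on_def
  proof (intro conjI ballI allI)
    show "F (u + v) = F u + F v" if "u \<in> S" "v \<in> S" for u v
      using F_eq cv.subspace_add[OF G_subspace F[OF that(1)] F[OF that(2)]] by simp
    show "F (c *\<^sub>C v) = c *\<^sub>C F v" if "v \<in> S" for c v
      using F_eq cv.subspace_scale[OF G_subspace F[OF that], of c] by (simp add: scaleC_Pair)
  qed
  moreover have "F (actV X v) = ta X (F v)" if "X \<in> tau_zero A" "v \<in> S" for X v
    using F_eq G_stable[OF that(1) F[OF that(2)]] by (simp add: actP_def)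
  ultimately show "\<exists>F. bij_betw F S S' \<and> clinear_on S F \<and> (\<forall>X\<in>tau_zero A. \<forall>v\<in>S. F (actV X v) = ta X (F v))"
    by blast
qed

end

theorem theorem5p5:
  fixes A :: "('g::complex_vector, 'n::finite) toroidal_data"
    and lmin :: nat
    and \<psi> :: "('g, 'n) toroidal \<Rightarrow> complex"
    and actV :: "('g, 'n) toroidal \<Rightarrow> 'v \<Rightarrow> 'v::complex_vector"
    and C0 :: complex
    and S T :: "'v set"
    and act1 :: "complex ^ 'n ^ 'n \<Rightarrow> 'w1 \<Rightarrow> 'w1::complex_vector"
    and act2 :: "'g \<Rightarrow> 'w2 \<Rightarrow> 'w2::complex_vector"
    and gr2 :: "(int ^ 'n) set \<Rightarrow> 'w2 set"
    and \<alpha> :: "complex ^ 'n"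
    and d :: complex
    and act2s :: "'g \<Rightarrow> 'm \<Rightarrow> 'm::complex_vector"
    and gr2s :: "(int ^ 'n) set \<Rightarrow> 'm set"
  assumes "multiloop_data A"
    and "lmin \<in> {1, 2}"
    and "standing_assumptions lmin A"
    and "clinear_on (tau_centre A) \<psi>"
    and "in_category_B A \<psi> actV"
    and "irreducible_lie_module_on (bracket A) (tau A) actV UNIV"
    and "\<forall>v. actV (K_elt 0 None) v = C0 *\<^sub>C v"
    and "C0 \<noteq> 0"
    and S_def: "S = {v. \<forall>X\<in>tau_plus A. actV X v = 0}"
    and T_def: "T = {v. \<forall>X\<in>tau_upper_plus A. actV X v = 0}"
    and "fin_dim (UNIV :: 'w1 set)"
    and "irreducible_lie_module_on gl_bracket UNIV act1 UNIV"
    and "fin_dim (UNIV :: 'w2 set)"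
    and "graded_irreducible A (g_circ A) act2 gr2"
    and "lie_module_iso (bracket A) (tau_upper_zero A) actV T
           (tensor_act act1 act2 \<alpha> d C0) (tensor_space A gr2)"
    and "graded_irreducible_quotient A act2 gr2 act2s gr2s"
  shows "lie_module_iso (bracket A) (tau_zero A) actV S
           (tensor_act act1 act2s \<alpha> d C0) (tensor_space A gr2s)"
proof -
  have T_iso: "lie_module_on (bracket A) (tau_upper_zero A) actV T"
    "lie_module_on (bracket A) (tau_upper_zero A) (tensor_act act1 act2 \<alpha> d C0) (tensor_space A gr2)"
    "\<exists>f. bij_betw f T (tensor_space A gr2) \<and> clinear_on T f \<and>
       (\<forall>X\<in>tau_upper_zero A. \<forall>v\<in>T. f (actV X v) = tensor_act act1 act2 \<alpha> d C0 X (f v))"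
    using assms(15) unfolding lie_module_iso_def by blast+
  from T_iso(3) obtain f where f: "bij_betw f T (tensor_space A gr2)" "clinear_on T f"
    "\<And>X v. X \<in> tau_upper_zero A \<Longrightarrow> v \<in> T \<Longrightarrow> f (actV X v) = tensor_act act1 act2 \<alpha> d C0 X (f v)"
    by (elim exE conjE) (rule that, assumption, assumption, simp del: tensor_act.simps)
  have gl: "lie_module_on gl_bracket UNIV act1 UNIV" "(UNIV :: 'w1 set) \<noteq> {0}"
    using assms(12) unfolding irreducible_lie_module_on_def by blast+
  have sigma: "lie_module_on (lie A) (g_sigma0 A) act2s UNIV"
    using assms(16) by (simp add: graded_irreducible_quotient_def graded_irreducible_def graded_module_def)
  interpret highest_weight_setting A lmin actV act2 gr2 act2s gr2s act1 \<alpha> d C0 T f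
    by unfold_locales (rule assms T_iso f gl sigma; assumption?)+
  show ?thesis using S_isomorphic unfolding assms(9) S_def .
qed

end
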